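(* Let $\Bbbk$ be an algebraically closed field of characteristic zero, $(G,\Gamma,\blacktriangleright,\blacktriangleleft)$ a matched pair of finite groups, and $\mathcal{C}$ a fusion category over $\Bbbk$ equipped with a $(G,\Gamma)$-crossed action. Let $\mathcal{B}=\mathrm{vec}_G\bowtie\mathcal{C}$ be the associated bicrossed product, and regard $\mathcal{C}$ as a right $\mathcal{B}$-module category with action $M\bar\otimes(g\bowtie C)=(M\triangleleft g)\otimes C$. Then there is a tensor equivalence $\mathcal{B}^*_{\mathcal{C}}=\operatorname{End}_{\mathcal{B}}(\mathcal{C})\simeq\mathcal{C}^{(G,\Gamma)}$.
   Context: **Conventions.** Categories are $\Bbbk$-linear, abelian, semisimple; functors are $\Bbbk$-linear and exact. $\alpha_{X,Y,Z}:(X\otimes Y)\otimes Z\to X\otimes(Y\otimes Z)$, $\ell_X:\mathbf 1\otimes X\to X$, $r_X:X\otimes\mathbf 1\to X$ are the constraints of a fusion category. $\mathrm{vec}_G$ is the fusion category of finite-dimensional $G$-graded vector spaces with trivial associator, with simple objects $g\in G$ and $g\otimes h=gh$. If $\mathcal{C}$ is graded, $|C|$ is the degree of a homogeneous object $C$; natural maps defined for homogeneous objects are extended additively. **Group actions on categories.** A right action $\triangleleft$ of $G$ on $\mathcal{C}$ consists of functors $-\triangleleft g:\mathcal{C}\to\mathcal{C}$ ($\Bbbk$-linear, exact, not assumed tensor) and natural isomorphisms $(\mathbf R^2_{g,h})_X:(X\triangleleft g)\triangleleft h\to X\triangleleft gh$, $\mathbf R^0_X:X\to X\triangleleft e$ with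 $(\mathbf R^2_{gh,k})_X((\mathbf R^2_{g,h})_X\triangleleft k)=(\mathbf R^2_{g,hk})_X(\mathbf R^2_{h,k})_{X\triangleleft g}$ and $(\mathbf R^2_{g,e})_X\mathbf R^0_{X\triangleleft g}=\mathrm{id}=(\mathbf R^2_{e,g})_X(\mathbf R^0_X\triangleleft g)$. An equivariant object of $(\mathcal{C},\triangleleft)$ is a pair $(X,\{u_g\}_{g\in G})$ of an object and isomorphisms $u_g:X\triangleleft g\to X$ with $u_{gh}(\mathbf R^2_{g,h})_X=u_h(u_g\triangleleft h)$; a morphism $(X,u)\to(Y,v)$ is $f:X\to Y$ with $v_g(f\triangleleft g)=fu_g$ for all $g$. **Matched pair of groups** $(G,\Gamma,\blacktriangleright,\blacktriangleleft)$: a left action $\blacktriangleright$ of $\Gamma$ on the set $G$ and a right action $\blacktriangleleft$ of $G$ on the set $\Gamma$ with $(kt)\blacktriangleleft g=(k\blacktriangleleft(t\blacktriangleright g))(t\blacktriangleleft g)$ and $k\blacktriangleright(gh)=(k\blacktriangleright g)((k\blacktriangleleft g)\blacktriangleright h)$. **$(G,\Gamma)$-crossed action on $\mathcal{C}$**: a faithful grading $\mathcal{C}=\bigoplus_{k\in\Gamma}\mathcal{C}_k$; a right action $\triangleleft$ of $G$ on the category $\mathcal{C}$ with $\mathcal{C}_k\triangleleft g=\mathcal{C}_{k\blacktriangleleft g}$; natural isomorphisms $\eta^g_{C,C'}:(C\otimes C')\triangleleft g\to (C\triangleleft(|C'|\blacktriangleright g))\otimes(C'\triangleleft g)$ ($C'$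 homogeneous); isomorphisms $\eta_0^g:\mathbf 1\triangleleft g\to\mathbf 1$; such that (C1) $\alpha\,(\eta^{|C''|\blacktriangleright g}_{C,C'}\otimes\mathrm{id})\,\eta^g_{C\otimes C',C''}=(\mathrm{id}\otimes\eta^g_{C',C''})\,\eta^g_{C,C'\otimes C''}\,(\alpha_{C,C',C''}\triangleleft g)$; (C2) $\ell_{C\triangleleft g}(\eta_0^{|C|\blacktriangleright g}\otimes\mathrm{id})\eta^g_{\mathbf 1,C}=\ell_C\triangleleft g$ and $r_{C\triangleleft g}(\mathrm{id}\otimes\eta_0^g)\eta^g_{C,\mathbf 1}=r_C\triangleleft g$; (C3) $\eta^{gh}_{C,C'}(\mathbf R^2_{g,h})_{C\otimes C'}=\big((\mathbf R^2_{|C'|\blacktriangleright g,(|C'|\blacktriangleleft g)\blacktriangleright h})_C\otimes(\mathbf R^2_{g,h})_{C'}\big)\,\eta^h_{C\triangleleft(|C'|\blacktriangleright g),\,C'\triangleleft g}\,(\eta^g_{C,C'}\triangleleft h)$; (C4) $\eta_0^{gh}(\mathbf R^2_{g,h})_{\mathbf 1}=\eta_0^h(\eta_0^g\triangleleft h)$; (C5) $\eta^e_{C,C'}\mathbf R^0_{C\otimes C'}=\mathbf R^0_C\otimes\mathbf R^0_{C'}$ and $\eta_0^e\mathbf R^0_{\mathbf 1}=\mathrm{id}$. **The bicrossed product $\mathcal{B}=\mathrm{vec}_G\bowtie\mathcal{C}$** associated with the crossed action: the fusion category equal to $\mathrm{vec}_G\boxtimes\mathcal{C}$ as an abelian category (object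 $g\boxtimes C$ written $g\bowtie C$; one may pass to a skeleton, which does not change it up to tensor equivalence), with $(g\bowtie C)\otimes(g'\bowtie C')=g(|C|\blacktriangleright g')\bowtie\big((C\triangleleft g')\otimes C'\big)$ for $C$ homogeneous, unit $e\bowtie\mathbf 1$, and associativity $((g\bowtie C)(g'\bowtie C'))(g''\bowtie C'')\to(g\bowtie C)((g'\bowtie C')(g''\bowtie C''))$ that is the identity on the $\mathrm{vec}_G$-component and on the $\mathcal{C}$-component is $\eta^{g''}_{C\triangleleft g',C'}\otimes\mathrm{id}$, followed by $(\mathbf R^2_{g',|C'|\blacktriangleright g''})_C\otimes\mathrm{id}\otimes\mathrm{id}$, followed by $\alpha$; the unit constraints are built from $\ell,r,(\mathbf R^0)^{-1},\eta_0$. **Module structure of $\mathcal{C}$ over $\mathcal{B}$.** The action is $M\bar\otimes(g\bowtie C)=(M\triangleleft g)\otimes C$, with module associativity $m_{M,X,Y}:M\bar\otimes(X\otimes Y)\to(M\bar\otimes X)\bar\otimes Y$ given by $$m_{M,g\bowtie C,g'\bowtie C'}=\big((\eta^{g'}_{M\triangleleft g,C})^{-1}\otimes\mathrm{id}_{C'}\big)\big((\mathbf R^2_{g,|C|\blacktriangleright g'})_M^{-1}\otimes\mathrm{id}_{C\triangleleft g'}\otimes\mathrm{id}_{C'}\big)\,\alpha^{-1}_{M\triangleleft g(|C|\blacktriangleright g'),\,C\triangleleft g',\,C'}$$ and unit constraint $m^0_M=r_M((\mathbf R^0_M)^{-1}\otimes\mathrm{id}_{\mathbf 1}):M\bar\otimes(e\bowtie\mathbf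 1)\to M$. **Dual category.** $\mathcal{B}^*_{\mathcal{C}}=\operatorname{End}_{\mathcal{B}}(\mathcal{C})$ is the fusion category of right $\mathcal{B}$-module endofunctors $(\mathbf F,s)$ of $\mathcal{C}$, with $s_{M,X}:\mathbf F(M\bar\otimes X)\to\mathbf F(M)\bar\otimes X$, and with composition as tensor product. **Crossed extension** $\mathcal{C}^{(G,\Gamma)}$: the fusion category of equivariant objects of $(\mathcal{C},\triangleleft)$, with $(U,u)\otimes(U',u')=(U\otimes U',w)$, where $w_g$ restricted to $(U\otimes U'_s)\triangleleft g$ ($U'_s$ the degree $s\in\Gamma$ component of $U'$) is $(u_{s\blacktriangleright g}\otimes u'_g)\,\eta^g_{U,U'_s}$; unit $(\mathbf 1,\{\eta_0^g\})$; associativity and unit constraints those of $\mathcal{C}$. *)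

theory Defs
  imports "HOL-Algebra.Module" "HOL-Computational_Algebra.Polynomial"
begin

section \<open>Linear categories\<close>

text \<open>Categories have explicit sets of objects and arrows; every arrow has a unique domain and
  codomain.  The operations are only meaningful on the given objects and arrows.\<close>

record ('o, 'm, 'k) lincat =
  Ob :: "'o set"
  Arr :: "'m set"
  Dom :: "'m \<Rightarrow> 'o"
  Cod :: "'m \<Rightarrow> 'o"
  Id :: "'o \<Rightarrow> 'm"
  Comp :: "'m \<Rightarrow> 'm \<Rightarrow> 'm" (infixr "\<cdot>\<index>" 65)
  Zero :: "'o \<Rightarrow> 'o \<Rightarrow> 'm"
  Plus :: "'m \<Rightarrow> 'm \<Rightarrow> 'm"
  Scale :: "'k \<Rightarrow> 'm \<Rightarrow> 'm"

definition Hom :: "('o, 'm, 'k, 'z) lincat_scheme \<Rightarrow> 'o \<Rightarrow> 'o \<Rightarrow> 'm set" where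
  "Hom C a b = {f \<in> Arr C. Dom C f = a \<and> Cod C f = b}"

definition scalars :: "'k::field ring" where
  "scalars = \<lparr>carrier = UNIV, monoid.mult = (*), one = 1, zero = 0, add = (+)\<rparr>"

text \<open>The fields \<open>mult\<close> and \<open>one\<close> of the record play no role for modules.\<close>

definition hom_module :: "('o, 'm, 'k, 'z) lincat_scheme \<Rightarrow> 'o \<Rightarrow> 'o \<Rightarrow> ('k, 'm) module" where
  "hom_module C a b = \<lparr>carrier = Hom C a b, monoid.mult = undefined, one = undefined,
     zero = Zero C a b, add = Plus C, module.smult = Scale C\<rparr>"

definition asum :: "('o, 'm, 'k, 'z) lincat_scheme \<Rightarrow> 'o \<Rightarrow> 'o \<Rightarrow> 'i set \<Rightarrow> ('i \<Rightarrow> 'm) \<Rightarrow> 'm" where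
  "asum C a b I f = finsum (hom_module C a b) f I"

locale linear_category =
  fixes C :: "('o, 'm, 'k::field, 'z) lincat_scheme" (structure)
  assumes dom_in: "f \<in> Arr C \<Longrightarrow> Dom C f \<in> Ob C"
    and cod_in: "f \<in> Arr C \<Longrightarrow> Cod C f \<in> Ob C"
    and id_in: "a \<in> Ob C \<Longrightarrow> Id C a \<in> Hom C a a"
    and comp_in: "f \<in> Hom C a b \<Longrightarrow> g \<in> Hom C b c \<Longrightarrow> g \<cdot> f \<in> Hom C a c"
    and id_left: "f \<in> Hom C a b \<Longrightarrow> Id C b \<cdot> f = f"
    and id_right: "f \<in> Hom C a b \<Longrightarrow> f \<cdot> Id C a = f"
    and comp_assoc: "f \<in> Hom C a b \<Longrightarrow> g \<in> Hom C b c \<Longrightarrow> h \<in> Hom C c d \<Longrightarrow>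
      (h \<cdot> g) \<cdot> f = h \<cdot> (g \<cdot> f)"
    and hom_is_module: "a \<in> Ob C \<Longrightarrow> b \<in> Ob C \<Longrightarrow>
      Module.module (scalars :: 'k ring) (hom_module C a b)"
    and comp_plus_left: "f \<in> Hom C a b \<Longrightarrow> g \<in> Hom C b c \<Longrightarrow> g' \<in> Hom C b c \<Longrightarrow>
      Plus C g g' \<cdot> f = Plus C (g \<cdot> f) (g' \<cdot> f)"
    and comp_plus_right: "f \<in> Hom C a b \<Longrightarrow> f' \<in> Hom C a b \<Longrightarrow> g \<in> Hom C b c \<Longrightarrow>
      g \<cdot> Plus C f f' = Plus C (g \<cdot> f) (g \<cdot> f')"
    and comp_scale_left: "f \<in> Hom C a b \<Longrightarrow> g \<in> Hom C b c \<Longrightarrow>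
      Scale C x g \<cdot> f = Scale C x (g \<cdot> f)"
    and comp_scale_right: "f \<in> Hom C a b \<Longrightarrow> g \<in> Hom C b c \<Longrightarrow>
      g \<cdot> Scale C x f = Scale C x (g \<cdot> f)"

context
  fixes C :: "('o, 'm, 'k, 'z) lincat_scheme" (structure)
begin

definition inverse_arrows :: "'m \<Rightarrow> 'm \<Rightarrow> bool" where
  "inverse_arrows f g \<longleftrightarrow> f \<in> Arr C \<and> g \<in> Hom C (Cod C f) (Dom C f) \<and>
     g \<cdot> f = Id C (Dom C f) \<and> f \<cdot> g = Id C (Cod C f)"

definition is_iso :: "'m \<Rightarrow> bool" where
  "is_iso f \<longleftrightarrow> (\<exists>g. inverse_arrows f g)"

definition inv_arr :: "'m \<Rightarrow> 'm" where
  "inv_arr f = (THE g. inverse_arrows f g)"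

definition Iso :: "'o \<Rightarrow> 'o \<Rightarrow> 'm set" where
  "Iso a b = {f \<in> Hom C a b. is_iso f}"

definition is_zero :: "'o \<Rightarrow> bool" where
  "is_zero z \<longleftrightarrow> z \<in> Ob C \<and> Id C z = Zero C z z"

definition zero_ob :: 'o where
  "zero_ob = (SOME z. is_zero z)"

definition is_mono :: "'m \<Rightarrow> bool" where
  "is_mono f \<longleftrightarrow> f \<in> Arr C \<and> (\<forall>a. \<forall>g\<in>Hom C a (Dom C f). \<forall>h\<in>Hom C a (Dom C f).
     f \<cdot> g = f \<cdot> h \<longrightarrow> g = h)"

definition is_epi :: "'m \<Rightarrow> bool" where
  "is_epi f \<longleftrightarrow> f \<in> Arr C \<and> (\<forall>a. \<forall>g\<in>Hom C (Cod C f) a. \<forall>h\<in>Hom C (Cod C f) a.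
     g \<cdot> f = h \<cdot> f \<longrightarrow> g = h)"

definition is_kernel :: "'m \<Rightarrow> 'm \<Rightarrow> bool" where
  "is_kernel f i \<longleftrightarrow> f \<in> Arr C \<and> i \<in> Arr C \<and> Cod C i = Dom C f \<and>
     f \<cdot> i = Zero C (Dom C i) (Cod C f) \<and>
     (\<forall>a. \<forall>h\<in>Hom C a (Dom C f). f \<cdot> h = Zero C a (Cod C f) \<longrightarrow>
        (\<exists>!t. t \<in> Hom C a (Dom C i) \<and> i \<cdot> t = h))"

definition is_cokernel :: "'m \<Rightarrow> 'm \<Rightarrow> bool" where
  "is_cokernel f p \<longleftrightarrow> f \<in> Arr C \<and> p \<in> Arr C \<and> Dom C p = Cod C f \<and>
     p \<cdot> f = Zero C (Dom C f) (Cod C p) \<and>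
     (\<forall>a. \<forall>h\<in>Hom C (Cod C f) a. h \<cdot> f = Zero C (Dom C f) a \<longrightarrow>
        (\<exists>!t. t \<in> Hom C (Cod C p) a \<and> t \<cdot> p = h))"

definition is_biproduct :: "'i set \<Rightarrow> ('i \<Rightarrow> 'o) \<Rightarrow> 'o \<Rightarrow> ('i \<Rightarrow> 'm) \<Rightarrow> ('i \<Rightarrow> 'm) \<Rightarrow> bool" where
  "is_biproduct I A S \<iota> \<pi> \<longleftrightarrow> finite I \<and> S \<in> Ob C \<and>
     (\<forall>i\<in>I. A i \<in> Ob C \<and> \<iota> i \<in> Hom C (A i) S \<and> \<pi> i \<in> Hom C S (A i)) \<and>
     (\<forall>i\<in>I. \<forall>j\<in>I. \<pi> i \<cdot> \<iota> j = (if i = j then Id C (A i) else Zero C (A j) (A i))) \<and>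
     asum C S S I (\<lambda>i. \<iota> i \<cdot> \<pi> i) = Id C S"

text \<open>A chosen direct sum of a finite family, with its injections and projections.\<close>

definition biprod :: "'i set \<Rightarrow> ('i \<Rightarrow> 'o) \<Rightarrow> 'o \<times> ('i \<Rightarrow> 'm) \<times> ('i \<Rightarrow> 'm)" where
  "biprod I A = (SOME t. is_biproduct I A (fst t) (fst (snd t)) (snd (snd t)))"

definition dsum :: "'i set \<Rightarrow> ('i \<Rightarrow> 'o) \<Rightarrow> 'o" where
  "dsum I A = fst (biprod I A)"

definition dinj :: "'i set \<Rightarrow> ('i \<Rightarrow> 'o) \<Rightarrow> 'i \<Rightarrow> 'm" where
  "dinj I A = fst (snd (biprod I A))"

definition dprj :: "'i set \<Rightarrow> ('i \<Rightarrow> 'o) \<Rightarrow> 'i \<Rightarrow> 'm" where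
  "dprj I A = snd (snd (biprod I A))"

definition is_simple :: "'o \<Rightarrow> bool" where
  "is_simple S \<longleftrightarrow> S \<in> Ob C \<and> \<not> is_zero S \<and>
     (\<forall>f. is_mono f \<and> Cod C f = S \<longrightarrow> is_zero (Dom C f) \<or> is_iso f)"

end

text \<open>Additivity is stated as existence of all finite direct sums; the empty one is a zero object.\<close>

locale abelian_category = linear_category +
  assumes finite_direct_sums: "(\<And>i::nat. i < n \<Longrightarrow> A i \<in> Ob C) \<Longrightarrow>
      \<exists>S \<iota> \<pi>. is_biproduct C {..<n} A S \<iota> \<pi>"
    and has_kernels: "f \<in> Arr C \<Longrightarrow> \<exists>i. is_kernel C f i"
    and has_cokernels: "f \<in> Arr C \<Longrightarrow> \<exists>p. is_cokernel C f p"
    and mono_is_kernel: "is_mono C i \<Longrightarrow> \<exists>f. is_kernel C f i"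
    and epi_is_cokernel: "is_epi C p \<Longrightarrow> \<exists>f. is_cokernel C f p"

locale finite_semisimple_category = abelian_category C
  for C :: "('o, 'm, 'k::field, 'z) lincat_scheme" (structure) +
  assumes semisimple: "X \<in> Ob C \<Longrightarrow>
      \<exists>(n::nat) A \<iota> \<pi>. (\<forall>i<n. is_simple C (A i)) \<and> is_biproduct C {..<n} A X \<iota> \<pi>"
    and finitely_many_simples:
      "\<exists>T. finite T \<and> (\<forall>S. is_simple C S \<longrightarrow> (\<exists>S'\<in>T. Iso C S S' \<noteq> {}))"
    and hom_finite_dimensional: "a \<in> Ob C \<Longrightarrow> b \<in> Ob C \<Longrightarrow>
      \<exists>B. finite B \<and> B \<subseteq> Hom C a b \<and>
        (\<forall>H. Module.submodule H (scalars :: 'k ring) (hom_module C a b) \<and> B \<subseteq> H \<longrightarrow> H = Hom C a b)"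


section \<open>Functors and natural transformations\<close>

definition is_functor :: "('o, 'm, 'k, 'z) lincat_scheme \<Rightarrow> ('o2, 'm2, 'k, 'z2) lincat_scheme \<Rightarrow>
    ('o \<Rightarrow> 'o2) \<Rightarrow> ('m \<Rightarrow> 'm2) \<Rightarrow> bool" where
  "is_functor A B Fo Fa \<longleftrightarrow>
     (\<forall>X\<in>Ob A. Fo X \<in> Ob B \<and> Fa (Id A X) = Id B (Fo X)) \<and>
     (\<forall>X Y. \<forall>f\<in>Hom A X Y. Fa f \<in> Hom B (Fo X) (Fo Y)) \<and>
     (\<forall>X Y Z. \<forall>f\<in>Hom A X Y. \<forall>g\<in>Hom A Y Z. Fa (g \<cdot>\<^bsub>A\<^esub> f) = Fa g \<cdot>\<^bsub>B\<^esub> Fa f)"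

definition is_linear_functor :: "('o, 'm, 'k, 'z) lincat_scheme \<Rightarrow>
    ('o2, 'm2, 'k, 'z2) lincat_scheme \<Rightarrow> ('o \<Rightarrow> 'o2) \<Rightarrow> ('m \<Rightarrow> 'm2) \<Rightarrow> bool" where
  "is_linear_functor A B Fo Fa \<longleftrightarrow> is_functor A B Fo Fa \<and>
     (\<forall>X Y. \<forall>f\<in>Hom A X Y. \<forall>g\<in>Hom A X Y. Fa (Plus A f g) = Plus B (Fa f) (Fa g)) \<and>
     (\<forall>X Y. \<forall>f\<in>Hom A X Y. \<forall>x. Fa (Scale A x f) = Scale B x (Fa f))"

definition is_exact_functor :: "('o, 'm, 'k, 'z) lincat_scheme \<Rightarrow>
    ('o2, 'm2, 'k, 'z2) lincat_scheme \<Rightarrow> ('o \<Rightarrow> 'o2) \<Rightarrow> ('m \<Rightarrow> 'm2) \<Rightarrow> bool" where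
  "is_exact_functor A B Fo Fa \<longleftrightarrow> is_linear_functor A B Fo Fa \<and>
     (\<forall>f i. is_kernel A f i \<longrightarrow> is_kernel B (Fa f) (Fa i)) \<and>
     (\<forall>f p. is_cokernel A f p \<longrightarrow> is_cokernel B (Fa f) (Fa p))"

definition is_natural :: "('o, 'm, 'k, 'z) lincat_scheme \<Rightarrow> ('o2, 'm2, 'k, 'z2) lincat_scheme \<Rightarrow>
    ('o \<Rightarrow> 'o2) \<Rightarrow> ('m \<Rightarrow> 'm2) \<Rightarrow> ('o \<Rightarrow> 'o2) \<Rightarrow> ('m \<Rightarrow> 'm2) \<Rightarrow> ('o \<Rightarrow> 'm2) \<Rightarrow> bool" where
  "is_natural A B Fo Fa Ho Ha \<tau> \<longleftrightarrow>
     (\<forall>X\<in>Ob A. \<tau> X \<in> Hom B (Fo X) (Ho X)) \<and>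
     (\<forall>X Y. \<forall>f\<in>Hom A X Y. \<tau> Y \<cdot>\<^bsub>B\<^esub> Fa f = Ha f \<cdot>\<^bsub>B\<^esub> \<tau> X)"

definition is_natural_iso :: "('o, 'm, 'k, 'z) lincat_scheme \<Rightarrow>
    ('o2, 'm2, 'k, 'z2) lincat_scheme \<Rightarrow>
    ('o \<Rightarrow> 'o2) \<Rightarrow> ('m \<Rightarrow> 'm2) \<Rightarrow> ('o \<Rightarrow> 'o2) \<Rightarrow> ('m \<Rightarrow> 'm2) \<Rightarrow> ('o \<Rightarrow> 'm2) \<Rightarrow> bool" where
  "is_natural_iso A B Fo Fa Ho Ha \<tau> \<longleftrightarrow>
     is_natural A B Fo Fa Ho Ha \<tau> \<and> (\<forall>X\<in>Ob A. is_iso B (\<tau> X))"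

definition is_equivalence :: "('o, 'm, 'k, 'z) lincat_scheme \<Rightarrow>
    ('o2, 'm2, 'k, 'z2) lincat_scheme \<Rightarrow> ('o \<Rightarrow> 'o2) \<Rightarrow> ('m \<Rightarrow> 'm2) \<Rightarrow> bool" where
  "is_equivalence A B Fo Fa \<longleftrightarrow> is_functor A B Fo Fa \<and>
     (\<exists>Ho Ha \<sigma> \<tau>. is_functor B A Ho Ha \<and>
        is_natural_iso A A id id (Ho \<circ> Fo) (Ha \<circ> Fa) \<sigma> \<and>
        is_natural_iso B B (Fo \<circ> Ho) (Fa \<circ> Ha) id id \<tau>)"


section \<open>Monoidal and fusion categories\<close>

record ('o, 'm, 'k) moncat = "('o, 'm, 'k) lincat" +
  Unit :: 'o
  TenO :: "'o \<Rightarrow> 'o \<Rightarrow> 'o" (infixl "\<otimes>\<^sub>o\<index>" 70)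
  TenA :: "'m \<Rightarrow> 'm \<Rightarrow> 'm" (infixl "\<otimes>\<^sub>a\<index>" 70)
  Assoc :: "'o \<Rightarrow> 'o \<Rightarrow> 'o \<Rightarrow> 'm"
  LUnit :: "'o \<Rightarrow> 'm"
  RUnit :: "'o \<Rightarrow> 'm"

locale linear_monoidal_category = linear_category C
  for C :: "('o, 'm, 'k::field, 'z) moncat_scheme" (structure) +
  assumes unit_in: "Unit C \<in> Ob C"
    and ten_ob: "X \<in> Ob C \<Longrightarrow> Y \<in> Ob C \<Longrightarrow> X \<otimes>\<^sub>o Y \<in> Ob C"
    and ten_arr: "f \<in> Hom C X X' \<Longrightarrow> g \<in> Hom C Y Y' \<Longrightarrow>
      f \<otimes>\<^sub>a g \<in> Hom C (X \<otimes>\<^sub>o Y) (X' \<otimes>\<^sub>o Y')"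
    and ten_id: "X \<in> Ob C \<Longrightarrow> Y \<in> Ob C \<Longrightarrow> Id C X \<otimes>\<^sub>a Id C Y = Id C (X \<otimes>\<^sub>o Y)"
    and ten_comp: "f \<in> Hom C X X' \<Longrightarrow> f' \<in> Hom C X' X'' \<Longrightarrow> g \<in> Hom C Y Y' \<Longrightarrow>
      g' \<in> Hom C Y' Y'' \<Longrightarrow> (f' \<cdot> f) \<otimes>\<^sub>a (g' \<cdot> g) = (f' \<otimes>\<^sub>a g') \<cdot> (f \<otimes>\<^sub>a g)"
    and ten_plus_left: "f \<in> Hom C X X' \<Longrightarrow> f' \<in> Hom C X X' \<Longrightarrow> g \<in> Hom C Y Y' \<Longrightarrow>
      Plus C f f' \<otimes>\<^sub>a g = Plus C (f \<otimes>\<^sub>a g) (f' \<otimes>\<^sub>a g)"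
    and ten_plus_right: "f \<in> Hom C X X' \<Longrightarrow> g \<in> Hom C Y Y' \<Longrightarrow> g' \<in> Hom C Y Y' \<Longrightarrow>
      f \<otimes>\<^sub>a Plus C g g' = Plus C (f \<otimes>\<^sub>a g) (f \<otimes>\<^sub>a g')"
    and ten_scale_left: "f \<in> Hom C X X' \<Longrightarrow> g \<in> Hom C Y Y' \<Longrightarrow>
      Scale C x f \<otimes>\<^sub>a g = Scale C x (f \<otimes>\<^sub>a g)"
    and ten_scale_right: "f \<in> Hom C X X' \<Longrightarrow> g \<in> Hom C Y Y' \<Longrightarrow>
      f \<otimes>\<^sub>a Scale C x g = Scale C x (f \<otimes>\<^sub>a g)"
    and assoc_iso: "X \<in> Ob C \<Longrightarrow> Y \<in> Ob C \<Longrightarrow> Z \<in> Ob C \<Longrightarrow>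
      Assoc C X Y Z \<in> Iso C (X \<otimes>\<^sub>o Y \<otimes>\<^sub>o Z) (X \<otimes>\<^sub>o (Y \<otimes>\<^sub>o Z))"
    and assoc_natural: "f \<in> Hom C X X' \<Longrightarrow> g \<in> Hom C Y Y' \<Longrightarrow> h \<in> Hom C Z Z' \<Longrightarrow>
      Assoc C X' Y' Z' \<cdot> (f \<otimes>\<^sub>a g \<otimes>\<^sub>a h) = (f \<otimes>\<^sub>a (g \<otimes>\<^sub>a h)) \<cdot> Assoc C X Y Z"
    and lunit_iso: "X \<in> Ob C \<Longrightarrow> LUnit C X \<in> Iso C (Unit C \<otimes>\<^sub>o X) X"
    and lunit_natural: "f \<in> Hom C X X' \<Longrightarrow>
      LUnit C X' \<cdot> (Id C (Unit C) \<otimes>\<^sub>a f) = f \<cdot> LUnit C X"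
    and runit_iso: "X \<in> Ob C \<Longrightarrow> RUnit C X \<in> Iso C (X \<otimes>\<^sub>o Unit C) X"
    and runit_natural: "f \<in> Hom C X X' \<Longrightarrow>
      RUnit C X' \<cdot> (f \<otimes>\<^sub>a Id C (Unit C)) = f \<cdot> RUnit C X"
    and pentagon: "W \<in> Ob C \<Longrightarrow> X \<in> Ob C \<Longrightarrow> Y \<in> Ob C \<Longrightarrow> Z \<in> Ob C \<Longrightarrow>
      Assoc C W X (Y \<otimes>\<^sub>o Z) \<cdot> Assoc C (W \<otimes>\<^sub>o X) Y Z =
      (Id C W \<otimes>\<^sub>a Assoc C X Y Z) \<cdot> Assoc C W (X \<otimes>\<^sub>o Y) Z \<cdot> (Assoc C W X Y \<otimes>\<^sub>a Id C Z)"
    and triangle: "X \<in> Ob C \<Longrightarrow> Y \<in> Ob C \<Longrightarrow>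
      (Id C X \<otimes>\<^sub>a LUnit C Y) \<cdot> Assoc C X (Unit C) Y = RUnit C X \<otimes>\<^sub>a Id C Y"

text \<open>\<open>V\<close> is a left dual of \<open>X\<close>, and \<open>X\<close> a right dual of \<open>V\<close>.\<close>

definition is_duality :: "('o, 'm, 'k, 'z) moncat_scheme \<Rightarrow> 'o \<Rightarrow> 'o \<Rightarrow> 'm \<Rightarrow> 'm \<Rightarrow> bool" where
  "is_duality C V X ev coev \<longleftrightarrow> V \<in> Ob C \<and> X \<in> Ob C \<and>
     ev \<in> Hom C (V \<otimes>\<^sub>o\<^bsub>C\<^esub> X) (Unit C) \<and> coev \<in> Hom C (Unit C) (X \<otimes>\<^sub>o\<^bsub>C\<^esub> V) \<and>
     RUnit C X \<cdot>\<^bsub>C\<^esub> (Id C X \<otimes>\<^sub>a\<^bsub>C\<^esub> ev) \<cdot>\<^bsub>C\<^esub> Assoc C X V X \<cdot>\<^bsub>C\<^esub> (coev \<otimes>\<^sub>a\<^bsub>C\<^esub> Id C X) = LUnit C X \<and>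
     LUnit C V \<cdot>\<^bsub>C\<^esub> (ev \<otimes>\<^sub>a\<^bsub>C\<^esub> Id C V) \<cdot>\<^bsub>C\<^esub> inv_arr C (Assoc C V X V) \<cdot>\<^bsub>C\<^esub> (Id C V \<otimes>\<^sub>a\<^bsub>C\<^esub> coev)
       = RUnit C V"

locale fusion_category =
  linear_monoidal_category C + finite_semisimple_category C
  for C :: "('o, 'm, 'k::field, 'z) moncat_scheme" (structure) +
  assumes left_dual: "X \<in> Ob C \<Longrightarrow> \<exists>V ev coev. is_duality C V X ev coev"
    and right_dual: "X \<in> Ob C \<Longrightarrow> \<exists>V ev coev. is_duality C X V ev coev"
    and unit_simple: "is_simple C (Unit C)"

definition is_monoidal_functor :: "('o, 'm, 'k, 'z) moncat_scheme \<Rightarrow>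
    ('o2, 'm2, 'k, 'z2) moncat_scheme \<Rightarrow> ('o \<Rightarrow> 'o2) \<Rightarrow> ('m \<Rightarrow> 'm2) \<Rightarrow>
    ('o \<Rightarrow> 'o \<Rightarrow> 'm2) \<Rightarrow> 'm2 \<Rightarrow> bool" where
  "is_monoidal_functor A B Fo Fa J \<phi> \<longleftrightarrow> is_functor A B Fo Fa \<and>
     (\<forall>X\<in>Ob A. \<forall>Y\<in>Ob A. J X Y \<in> Iso B (Fo X \<otimes>\<^sub>o\<^bsub>B\<^esub> Fo Y) (Fo (X \<otimes>\<^sub>o\<^bsub>A\<^esub> Y))) \<and>
     (\<forall>X X' Y Y'. \<forall>f\<in>Hom A X X'. \<forall>g\<in>Hom A Y Y'.
        J X' Y' \<cdot>\<^bsub>B\<^esub> (Fa f \<otimes>\<^sub>a\<^bsub>B\<^esub> Fa g) = Fa (f \<otimes>\<^sub>a\<^bsub>A\<^esub> g) \<cdot>\<^bsub>B\<^esub> J X Y) \<and>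
     \<phi> \<in> Iso B (Unit B) (Fo (Unit A)) \<and>
     (\<forall>X\<in>Ob A. \<forall>Y\<in>Ob A. \<forall>Z\<in>Ob A.
        Fa (Assoc A X Y Z) \<cdot>\<^bsub>B\<^esub> J (X \<otimes>\<^sub>o\<^bsub>A\<^esub> Y) Z \<cdot>\<^bsub>B\<^esub> (J X Y \<otimes>\<^sub>a\<^bsub>B\<^esub> Id B (Fo Z)) =
        J X (Y \<otimes>\<^sub>o\<^bsub>A\<^esub> Z) \<cdot>\<^bsub>B\<^esub> (Id B (Fo X) \<otimes>\<^sub>a\<^bsub>B\<^esub> J Y Z) \<cdot>\<^bsub>B\<^esub> Assoc B (Fo X) (Fo Y) (Fo Z)) \<and>
     (\<forall>X\<in>Ob A.
        Fa (LUnit A X) \<cdot>\<^bsub>B\<^esub> J (Unit A) X \<cdot>\<^bsub>B\<^esub> (\<phi> \<otimes>\<^sub>a\<^bsub>B\<^esub> Id B (Fo X)) = LUnit B (Fo X) \<and>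
        Fa (RUnit A X) \<cdot>\<^bsub>B\<^esub> J X (Unit A) \<cdot>\<^bsub>B\<^esub> (Id B (Fo X) \<otimes>\<^sub>a\<^bsub>B\<^esub> \<phi>) = RUnit B (Fo X))"

definition tensor_equivalent :: "('o, 'm, 'k::field, 'z) moncat_scheme \<Rightarrow>
    ('o2, 'm2, 'k, 'z2) moncat_scheme \<Rightarrow> bool" where
  "tensor_equivalent A B \<longleftrightarrow> linear_monoidal_category A \<and> linear_monoidal_category B \<and>
     (\<exists>Fo Fa J \<phi>. is_linear_functor A B Fo Fa \<and> is_monoidal_functor A B Fo Fa J \<phi> \<and>
        is_equivalence A B Fo Fa)"


section \<open>Right module categories and their dual categories\<close>

text \<open>A right action of a monoidal category with objects \<open>'b\<close> and arrows \<open>'n\<close>.\<close>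

record ('o, 'm, 'b, 'n) modcat =
  MActO :: "'o \<Rightarrow> 'b \<Rightarrow> 'o"
  MActA :: "'m \<Rightarrow> 'n \<Rightarrow> 'm"
  MAssoc :: "'o \<Rightarrow> 'b \<Rightarrow> 'b \<Rightarrow> 'm"
  MUnit :: "'o \<Rightarrow> 'm"

type_synonym ('o, 'm, 'b) modfun = "('o \<Rightarrow> 'o) \<times> ('m \<Rightarrow> 'm) \<times> ('o \<times> 'b \<Rightarrow> 'm)"
type_synonym ('o, 'm, 'b) modfun_arr = "('o, 'm, 'b) modfun \<times> ('o \<Rightarrow> 'm) \<times> ('o, 'm, 'b) modfun"

locale modcat_data =
  fixes M :: "('o, 'm, 'k, 'y) lincat_scheme" (structure)
    and B :: "('b, 'n, 'k, 'z) moncat_scheme"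
    and A :: "('o, 'm, 'b, 'n) modcat"
begin

abbreviation act_ob (infixl "\<star>\<^sub>o" 70) where "X \<star>\<^sub>o Y \<equiv> MActO A X Y"
abbreviation act_arr (infixl "\<star>\<^sub>a" 70) where "f \<star>\<^sub>a h \<equiv> MActA A f h"

text \<open>Functors are recorded as extensional functions, so that equality of module functors is the
  usual one.\<close>

definition is_module_endofunctor :: "('o, 'm, 'b) modfun \<Rightarrow> bool" where
  "is_module_endofunctor F \<longleftrightarrow> (case F of (Fo, Fa, s) \<Rightarrow>
     is_exact_functor M M Fo Fa \<and>
     Fo \<in> extensional (Ob M) \<and> Fa \<in> extensional (Arr M) \<and> s \<in> extensional (Ob M \<times> Ob B) \<and>
     (\<forall>X\<in>Ob M. \<forall>Y\<in>Ob B. s (X, Y) \<in> Iso M (Fo (X \<star>\<^sub>o Y)) (Fo X \<star>\<^sub>o Y)) \<and>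
     (\<forall>X X' Y Y'. \<forall>f\<in>Hom M X X'. \<forall>h\<in>Hom B Y Y'.
        s (X', Y') \<cdot> Fa (f \<star>\<^sub>a h) = (Fa f \<star>\<^sub>a h) \<cdot> s (X, Y)) \<and>
     (\<forall>X\<in>Ob M. \<forall>Y\<in>Ob B. \<forall>Z\<in>Ob B.
        MAssoc A (Fo X) Y Z \<cdot> s (X, Y \<otimes>\<^sub>o\<^bsub>B\<^esub> Z) =
        (s (X, Y) \<star>\<^sub>a Id B Z) \<cdot> s (X \<star>\<^sub>o Y, Z) \<cdot> Fa (MAssoc A X Y Z)) \<and>
     (\<forall>X\<in>Ob M. MUnit A (Fo X) \<cdot> s (X, Unit B) = Fa (MUnit A X)))"

definition is_module_natural ::
  "('o, 'm, 'b) modfun \<Rightarrow> ('o, 'm, 'b) modfun \<Rightarrow> ('o \<Rightarrow> 'm) \<Rightarrow> bool" where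
  "is_module_natural F H \<tau> \<longleftrightarrow> (case F of (Fo, Fa, s) \<Rightarrow> case H of (Ho, Ha, t) \<Rightarrow>
     is_natural M M Fo Fa Ho Ha \<tau> \<and> \<tau> \<in> extensional (Ob M) \<and>
     (\<forall>X\<in>Ob M. \<forall>Y\<in>Ob B. t (X, Y) \<cdot> \<tau> (X \<star>\<^sub>o Y) = (\<tau> X \<star>\<^sub>a Id B Y) \<cdot> s (X, Y)))"

definition modfun_id :: "('o, 'm, 'b) modfun" where
  "modfun_id = (\<lambda>X\<in>Ob M. X, \<lambda>f\<in>Arr M. f, \<lambda>(X, Y)\<in>Ob M \<times> Ob B. Id M (X \<star>\<^sub>o Y))"

definition modfun_comp ::
  "('o, 'm, 'b) modfun \<Rightarrow> ('o, 'm, 'b) modfun \<Rightarrow> ('o, 'm, 'b) modfun" where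
  "modfun_comp F H = (case F of (Fo, Fa, s) \<Rightarrow> case H of (Ho, Ha, t) \<Rightarrow>
     (\<lambda>X\<in>Ob M. Fo (Ho X), \<lambda>f\<in>Arr M. Fa (Ha f),
      \<lambda>(X, Y)\<in>Ob M \<times> Ob B. s (Ho X, Y) \<cdot> Fa (t (X, Y))))"

definition modfun_arr_id :: "('o, 'm, 'b) modfun \<Rightarrow> ('o, 'm, 'b) modfun_arr" where
  "modfun_arr_id F = (F, \<lambda>X\<in>Ob M. Id M (fst F X), F)"

text \<open>The monoidal category of module endofunctors, with composition as (strict) tensor product.\<close>

definition dual_category ::
  "(('o, 'm, 'b) modfun, ('o, 'm, 'b) modfun_arr, 'k) moncat" where
  "dual_category = \<lparr>
     Ob = {F. is_module_endofunctor F},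
     Arr = {(F, \<tau>, H). is_module_endofunctor F \<and> is_module_endofunctor H \<and>
              is_module_natural F H \<tau>},
     Dom = (\<lambda>(F, \<tau>, H). F),
     Cod = (\<lambda>(F, \<tau>, H). H),
     Id = modfun_arr_id,
     Comp = (\<lambda>(_, \<sigma>, K) (F, \<tau>, _). (F, \<lambda>X\<in>Ob M. \<sigma> X \<cdot> \<tau> X, K)),
     Zero = (\<lambda>F H. (F, \<lambda>X\<in>Ob M. Zero M (fst F X) (fst H X), H)),
     Plus = (\<lambda>(F, \<tau>, H) (_, \<tau>', _). (F, \<lambda>X\<in>Ob M. Plus M (\<tau> X) (\<tau>' X), H)),
     Scale = (\<lambda>x (F, \<tau>, H). (F, \<lambda>X\<in>Ob M. Scale M x (\<tau> X), H)),
     Unit = modfun_id,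
     TenO = modfun_comp,
     TenA = (\<lambda>(F, \<tau>, H) (F', \<tau>', H'). (modfun_comp F F',
               \<lambda>X\<in>Ob M. \<tau> (fst H' X) \<cdot> fst (snd F) (\<tau>' X), modfun_comp H H')),
     Assoc = (\<lambda>F H K. modfun_arr_id (modfun_comp F (modfun_comp H K))),
     LUnit = modfun_arr_id,
     RUnit = modfun_arr_id\<rparr>"

end


section \<open>Matched pairs and crossed actions\<close>

record ('g, 't) matched_pair_data =
  grpG :: "'g monoid"
  grpGam :: "'t monoid"
  lact :: "'t \<Rightarrow> 'g \<Rightarrow> 'g"
  ract :: "'t \<Rightarrow> 'g \<Rightarrow> 't"

locale matched_pair =
  fixes P :: "('g, 't) matched_pair_data"
  assumes group_G: "group (grpG P)"
    and group_Gam: "group (grpGam P)"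
    and lact_in: "k \<in> carrier (grpGam P) \<Longrightarrow> g \<in> carrier (grpG P) \<Longrightarrow>
      lact P k g \<in> carrier (grpG P)"
    and lact_one: "g \<in> carrier (grpG P) \<Longrightarrow> lact P \<one>\<^bsub>grpGam P\<^esub> g = g"
    and lact_mult: "k \<in> carrier (grpGam P) \<Longrightarrow> t \<in> carrier (grpGam P) \<Longrightarrow>
      g \<in> carrier (grpG P) \<Longrightarrow> lact P (k \<otimes>\<^bsub>grpGam P\<^esub> t) g = lact P k (lact P t g)"
    and ract_in: "k \<in> carrier (grpGam P) \<Longrightarrow> g \<in> carrier (grpG P) \<Longrightarrow>
      ract P k g \<in> carrier (grpGam P)"
    and ract_one: "k \<in> carrier (grpGam P) \<Longrightarrow> ract P k \<one>\<^bsub>grpG P\<^esub> = k"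
    and ract_mult: "k \<in> carrier (grpGam P) \<Longrightarrow> g \<in> carrier (grpG P) \<Longrightarrow>
      h \<in> carrier (grpG P) \<Longrightarrow> ract P k (g \<otimes>\<^bsub>grpG P\<^esub> h) = ract P (ract P k g) h"
    and matched_ract: "k \<in> carrier (grpGam P) \<Longrightarrow> t \<in> carrier (grpGam P) \<Longrightarrow>
      g \<in> carrier (grpG P) \<Longrightarrow>
      ract P (k \<otimes>\<^bsub>grpGam P\<^esub> t) g = ract P k (lact P t g) \<otimes>\<^bsub>grpGam P\<^esub> ract P t g"
    and matched_lact: "k \<in> carrier (grpGam P) \<Longrightarrow> g \<in> carrier (grpG P) \<Longrightarrow>
      h \<in> carrier (grpG P) \<Longrightarrow>
      lact P k (g \<otimes>\<^bsub>grpG P\<^esub> h) = lact P k g \<otimes>\<^bsub>grpG P\<^esub> lact P (ract P k g) h"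

text \<open>\<open>Deg D k\<close> is the set of objects of the component of degree \<open>k\<close>.  The arrow \<open>Eta D g k X Y\<close>
  is $\eta^g_{X,Y}$ for an object \<open>Y\<close> of degree \<open>k\<close>; the degree is an explicit argument because a
  zero object has every degree.\<close>

record ('g, 't, 'o, 'm) crossed_action_data =
  Deg :: "'t \<Rightarrow> 'o set"
  ActO :: "'o \<Rightarrow> 'g \<Rightarrow> 'o"
  ActA :: "'m \<Rightarrow> 'g \<Rightarrow> 'm"
  R2 :: "'g \<Rightarrow> 'g \<Rightarrow> 'o \<Rightarrow> 'm"
  R0 :: "'o \<Rightarrow> 'm"
  Eta :: "'g \<Rightarrow> 't \<Rightarrow> 'o \<Rightarrow> 'o \<Rightarrow> 'm"
  Eta0 :: "'g \<Rightarrow> 'm"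

locale crossed_data =
  fixes C :: "('o, 'm, 'k::field) moncat" (structure)
    and P :: "('g, 't) matched_pair_data"
    and D :: "('g, 't, 'o, 'm) crossed_action_data"
begin

abbreviation G where "G \<equiv> grpG P"
abbreviation \<Gamma> where "\<Gamma> \<equiv> grpGam P"
abbreviation lact_syntax (infixr "\<triangleright>" 75) where "k \<triangleright> g \<equiv> lact P k g"
abbreviation ract_syntax (infixl "\<triangleleft>" 75) where "k \<triangleleft> g \<equiv> ract P k g"
abbreviation act_ob_syntax (infixl "\<lhd>\<^sub>o" 75) where "X \<lhd>\<^sub>o g \<equiv> ActO D X g"
abbreviation act_arr_syntax (infixl "\<lhd>\<^sub>a" 75) where "f \<lhd>\<^sub>a g \<equiv> ActA D f g"
abbreviation unit_syntax ("\<I>") where "\<I> \<equiv> Unit C"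

end

text \<open>Grading components are full, replete subcategories; \<open>act_deg\<close> describes the replete image
  of the component of degree \<open>k\<close>.\<close>

locale crossed_action = crossed_data C P D + fusion_category C + matched_pair P
  for C :: "('o, 'm, 'k::field) moncat" (structure)
    and P :: "('g, 't) matched_pair_data"
    and D :: "('g, 't, 'o, 'm) crossed_action_data" +
  assumes deg_ob: "k \<in> carrier \<Gamma> \<Longrightarrow> Deg D k \<subseteq> Ob C"
    and deg_replete: "k \<in> carrier \<Gamma> \<Longrightarrow> X \<in> Deg D k \<Longrightarrow> Iso C X Y \<noteq> {} \<Longrightarrow> Y \<in> Deg D k"
    and deg_orthogonal: "k \<in> carrier \<Gamma> \<Longrightarrow> t \<in> carrier \<Gamma> \<Longrightarrow> k \<noteq> t \<Longrightarrow> X \<in> Deg D k \<Longrightarrow>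
      Y \<in> Deg D t \<Longrightarrow> f \<in> Hom C X Y \<Longrightarrow> f = Zero C X Y"
    and deg_decomposition: "X \<in> Ob C \<Longrightarrow>
      \<exists>A \<iota> \<pi>. (\<forall>k\<in>carrier \<Gamma>. A k \<in> Deg D k) \<and> is_biproduct C (carrier \<Gamma>) A X \<iota> \<pi>"
    and deg_tensor: "k \<in> carrier \<Gamma> \<Longrightarrow> t \<in> carrier \<Gamma> \<Longrightarrow> X \<in> Deg D k \<Longrightarrow> Y \<in> Deg D t \<Longrightarrow>
      X \<otimes>\<^sub>o Y \<in> Deg D (k \<otimes>\<^bsub>\<Gamma>\<^esub> t)"
    and deg_faithful: "k \<in> carrier \<Gamma> \<Longrightarrow> \<exists>X\<in>Deg D k. \<not> is_zero C X"
    and act_functor: "g \<in> carrier G \<Longrightarrow>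
      is_exact_functor C C (\<lambda>X. X \<lhd>\<^sub>o g) (\<lambda>f. f \<lhd>\<^sub>a g)"
    and R2_natural_iso: "g \<in> carrier G \<Longrightarrow> h \<in> carrier G \<Longrightarrow>
      is_natural_iso C C (\<lambda>X. X \<lhd>\<^sub>o g \<lhd>\<^sub>o h) (\<lambda>f. f \<lhd>\<^sub>a g \<lhd>\<^sub>a h)
        (\<lambda>X. X \<lhd>\<^sub>o (g \<otimes>\<^bsub>G\<^esub> h)) (\<lambda>f. f \<lhd>\<^sub>a (g \<otimes>\<^bsub>G\<^esub> h)) (R2 D g h)"
    and R0_natural_iso:
      "is_natural_iso C C id id (\<lambda>X. X \<lhd>\<^sub>o \<one>\<^bsub>G\<^esub>) (\<lambda>f. f \<lhd>\<^sub>a \<one>\<^bsub>G\<^esub>) (R0 D)"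
    and R2_assoc: "g \<in> carrier G \<Longrightarrow> h \<in> carrier G \<Longrightarrow> l \<in> carrier G \<Longrightarrow> X \<in> Ob C \<Longrightarrow>
      R2 D (g \<otimes>\<^bsub>G\<^esub> h) l X \<cdot> (R2 D g h X \<lhd>\<^sub>a l) = R2 D g (h \<otimes>\<^bsub>G\<^esub> l) X \<cdot> R2 D h l (X \<lhd>\<^sub>o g)"
    and R2_R0_right: "g \<in> carrier G \<Longrightarrow> X \<in> Ob C \<Longrightarrow>
      R2 D g \<one>\<^bsub>G\<^esub> X \<cdot> R0 D (X \<lhd>\<^sub>o g) = Id C (X \<lhd>\<^sub>o g)"
    and R2_R0_left: "g \<in> carrier G \<Longrightarrow> X \<in> Ob C \<Longrightarrow>
      R2 D \<one>\<^bsub>G\<^esub> g X \<cdot> (R0 D X \<lhd>\<^sub>a g) = Id C (X \<lhd>\<^sub>o g)"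
    and act_deg: "k \<in> carrier \<Gamma> \<Longrightarrow> g \<in> carrier G \<Longrightarrow>
      {Y \<in> Ob C. \<exists>X\<in>Deg D k. Iso C (X \<lhd>\<^sub>o g) Y \<noteq> {}} = Deg D (k \<triangleleft> g)"
    and eta_iso: "g \<in> carrier G \<Longrightarrow> k \<in> carrier \<Gamma> \<Longrightarrow> X \<in> Ob C \<Longrightarrow> Y \<in> Deg D k \<Longrightarrow>
      Eta D g k X Y \<in> Iso C ((X \<otimes>\<^sub>o Y) \<lhd>\<^sub>o g) ((X \<lhd>\<^sub>o (k \<triangleright> g)) \<otimes>\<^sub>o (Y \<lhd>\<^sub>o g))"
    and eta_natural: "g \<in> carrier G \<Longrightarrow> k \<in> carrier \<Gamma> \<Longrightarrow> f \<in> Hom C X X' \<Longrightarrow>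
      Y \<in> Deg D k \<Longrightarrow> Y' \<in> Deg D k \<Longrightarrow> j \<in> Hom C Y Y' \<Longrightarrow>
      Eta D g k X' Y' \<cdot> ((f \<otimes>\<^sub>a j) \<lhd>\<^sub>a g) = ((f \<lhd>\<^sub>a (k \<triangleright> g)) \<otimes>\<^sub>a (j \<lhd>\<^sub>a g)) \<cdot> Eta D g k X Y"
    and eta0_iso: "g \<in> carrier G \<Longrightarrow> Eta0 D g \<in> Iso C (\<I> \<lhd>\<^sub>o g) \<I>"
    and C1: "g \<in> carrier G \<Longrightarrow> k \<in> carrier \<Gamma> \<Longrightarrow> t \<in> carrier \<Gamma> \<Longrightarrow> X \<in> Ob C \<Longrightarrow>
      Y \<in> Deg D k \<Longrightarrow> Z \<in> Deg D t \<Longrightarrow>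
      Assoc C (X \<lhd>\<^sub>o (k \<triangleright> t \<triangleright> g)) (Y \<lhd>\<^sub>o (t \<triangleright> g)) (Z \<lhd>\<^sub>o g) \<cdot>
        (Eta D (t \<triangleright> g) k X Y \<otimes>\<^sub>a Id C (Z \<lhd>\<^sub>o g)) \<cdot> Eta D g t (X \<otimes>\<^sub>o Y) Z =
      (Id C (X \<lhd>\<^sub>o (k \<triangleright> t \<triangleright> g)) \<otimes>\<^sub>a Eta D g t Y Z) \<cdot>
        Eta D g (k \<otimes>\<^bsub>\<Gamma>\<^esub> t) X (Y \<otimes>\<^sub>o Z) \<cdot> (Assoc C X Y Z \<lhd>\<^sub>a g)"
    and C2_left: "g \<in> carrier G \<Longrightarrow> k \<in> carrier \<Gamma> \<Longrightarrow> X \<in> Deg D k \<Longrightarrow>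
      LUnit C (X \<lhd>\<^sub>o g) \<cdot> (Eta0 D (k \<triangleright> g) \<otimes>\<^sub>a Id C (X \<lhd>\<^sub>o g)) \<cdot> Eta D g k \<I> X = LUnit C X \<lhd>\<^sub>a g"
    and C2_right: "g \<in> carrier G \<Longrightarrow> X \<in> Ob C \<Longrightarrow>
      RUnit C (X \<lhd>\<^sub>o g) \<cdot> (Id C (X \<lhd>\<^sub>o g) \<otimes>\<^sub>a Eta0 D g) \<cdot> Eta D g \<one>\<^bsub>\<Gamma>\<^esub> X \<I> = RUnit C X \<lhd>\<^sub>a g"
    and C3: "g \<in> carrier G \<Longrightarrow> h \<in> carrier G \<Longrightarrow> k \<in> carrier \<Gamma> \<Longrightarrow> X \<in> Ob C \<Longrightarrow>
      Y \<in> Deg D k \<Longrightarrow>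
      Eta D (g \<otimes>\<^bsub>G\<^esub> h) k X Y \<cdot> R2 D g h (X \<otimes>\<^sub>o Y) =
      (R2 D (k \<triangleright> g) ((k \<triangleleft> g) \<triangleright> h) X \<otimes>\<^sub>a R2 D g h Y) \<cdot>
        Eta D h (k \<triangleleft> g) (X \<lhd>\<^sub>o (k \<triangleright> g)) (Y \<lhd>\<^sub>o g) \<cdot> (Eta D g k X Y \<lhd>\<^sub>a h)"
    and C4: "g \<in> carrier G \<Longrightarrow> h \<in> carrier G \<Longrightarrow>
      Eta0 D (g \<otimes>\<^bsub>G\<^esub> h) \<cdot> R2 D g h \<I> = Eta0 D h \<cdot> (Eta0 D g \<lhd>\<^sub>a h)"
    and C5: "k \<in> carrier \<Gamma> \<Longrightarrow> X \<in> Ob C \<Longrightarrow> Y \<in> Deg D k \<Longrightarrow>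
      Eta D \<one>\<^bsub>G\<^esub> k X Y \<cdot> R0 D (X \<otimes>\<^sub>o Y) = R0 D X \<otimes>\<^sub>a R0 D Y"
    and C5_unit: "Eta0 D \<one>\<^bsub>G\<^esub> \<cdot> R0 D \<I> = Id C \<I>"


section \<open>The bicrossed product and its action\<close>

text \<open>As an abelian category $\mathrm{vec}_G\boxtimes\mathcal C$ is
  $\bigoplus_{(g,k)\in G\times\Gamma}\mathcal C_k$, where the summand at \<open>(g, k)\<close> consists of the
  objects $g\bowtie C$ with $C\in\mathcal C_k$.  Objects and arrows are therefore families indexed by
  \<open>(g, k)\<close>, and the formulas for homogeneous objects are extended additively through a choice of finite
  direct sums.\<close>

type_synonym ('g, 't, 'o) bicrossed_ob = "'g \<times> 't \<Rightarrow> 'o"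
type_synonym ('g, 't, 'o, 'm) bicrossed_arr =
  "('g, 't, 'o) bicrossed_ob \<times> ('g \<times> 't \<Rightarrow> 'm) \<times> ('g, 't, 'o) bicrossed_ob"

context crossed_data
begin

abbreviation Idx :: "('g \<times> 't) set" where "Idx \<equiv> carrier G \<times> carrier \<Gamma>"

text \<open>The tensor product of $g\bowtie\mathcal C_k$ and $g'\bowtie\mathcal C_{k'}$ lies in the summand
  with index \<open>(g, k) \<diamondop> (g', k')\<close>; this is the multiplication of the bicrossed product group.\<close>

definition idx_mult :: "'g \<times> 't \<Rightarrow> 'g \<times> 't \<Rightarrow> 'g \<times> 't" (infixl "\<diamondop>" 70) where
  "p \<diamondop> q = (fst p \<otimes>\<^bsub>G\<^esub> (snd p \<triangleright> fst q), (snd p \<triangleleft> fst q) \<otimes>\<^bsub>\<Gamma>\<^esub> snd q)"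

definition idx_one :: "'g \<times> 't" where
  "idx_one = (\<one>\<^bsub>G\<^esub>, \<one>\<^bsub>\<Gamma>\<^esub>)"

definition splits :: "'g \<times> 't \<Rightarrow> (('g \<times> 't) \<times> ('g \<times> 't)) set" where
  "splits r = {(p, q). p \<in> Idx \<and> q \<in> Idx \<and> p \<diamondop> q = r}"

definition bi_summand :: "('g, 't, 'o) bicrossed_ob \<Rightarrow> ('g, 't, 'o) bicrossed_ob \<Rightarrow>
    ('g \<times> 't) \<times> ('g \<times> 't) \<Rightarrow> 'o" where
  "bi_summand X Y = (\<lambda>(p, q). (X p \<lhd>\<^sub>o fst q) \<otimes>\<^sub>o Y q)"

definition bi_tensor :: "('g, 't, 'o) bicrossed_ob \<Rightarrow> ('g, 't, 'o) bicrossed_ob \<Rightarrow>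
    ('g, 't, 'o) bicrossed_ob" where
  "bi_tensor X Y = (\<lambda>r\<in>Idx. dsum C (splits r) (bi_summand X Y))"

definition bi_inj :: "('g, 't, 'o) bicrossed_ob \<Rightarrow> ('g, 't, 'o) bicrossed_ob \<Rightarrow>
    'g \<times> 't \<Rightarrow> 'g \<times> 't \<Rightarrow> 'm" where
  "bi_inj X Y p q = dinj C (splits (p \<diamondop> q)) (bi_summand X Y) (p, q)"

definition bi_prj :: "('g, 't, 'o) bicrossed_ob \<Rightarrow> ('g, 't, 'o) bicrossed_ob \<Rightarrow>
    'g \<times> 't \<Rightarrow> 'g \<times> 't \<Rightarrow> 'm" where
  "bi_prj X Y p q = dprj C (splits (p \<diamondop> q)) (bi_summand X Y) (p, q)"

definition bi_unit :: "('g, 't, 'o) bicrossed_ob" where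
  "bi_unit = (\<lambda>p\<in>Idx. if p = idx_one then \<I> else zero_ob C)"

text \<open>The map $((A\triangleleft g')\otimes B)\triangleleft g''\otimes Z\to
  (A\triangleleft g'(k'\blacktriangleright g''))\otimes((B\triangleleft g'')\otimes Z)$ for \<open>B\<close> of
  degree \<open>k'\<close>, where \<open>q = (g', k')\<close> and \<open>g = g''\<close>.\<close>

definition assoc_component :: "'g \<times> 't \<Rightarrow> 'g \<Rightarrow> 'o \<Rightarrow> 'o \<Rightarrow> 'o \<Rightarrow> 'm" where
  "assoc_component q g A B Z =
     Assoc C (A \<lhd>\<^sub>o (fst q \<otimes>\<^bsub>G\<^esub> (snd q \<triangleright> g))) (B \<lhd>\<^sub>o g) Z \<cdot>
     (R2 D (fst q) (snd q \<triangleright> g) A \<otimes>\<^sub>a Id C (B \<lhd>\<^sub>o g) \<otimes>\<^sub>a Id C Z) \<cdot>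
     (Eta D g (snd q) (A \<lhd>\<^sub>o fst q) B \<otimes>\<^sub>a Id C Z)"

definition bi_assoc :: "('g, 't, 'o) bicrossed_ob \<Rightarrow> ('g, 't, 'o) bicrossed_ob \<Rightarrow>
    ('g, 't, 'o) bicrossed_ob \<Rightarrow> ('g, 't, 'o, 'm) bicrossed_arr" where
  "bi_assoc X Y Z =
     (bi_tensor (bi_tensor X Y) Z,
      \<lambda>r\<in>Idx. asum C (bi_tensor (bi_tensor X Y) Z r) (bi_tensor X (bi_tensor Y Z) r)
        {(p, q, w). p \<in> Idx \<and> q \<in> Idx \<and> w \<in> Idx \<and> p \<diamondop> q \<diamondop> w = r}
        (\<lambda>(p, q, w). bi_inj X (bi_tensor Y Z) p (q \<diamondop> w) \<cdot>
           (Id C (X p \<lhd>\<^sub>o fst (q \<diamondop> w)) \<otimes>\<^sub>a bi_inj Y Z q w) \<cdot>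
           assoc_component q (fst w) (X p) (Y q) (Z w) \<cdot>
           ((bi_prj X Y p q \<lhd>\<^sub>a fst w) \<otimes>\<^sub>a Id C (Z w)) \<cdot>
           bi_prj (bi_tensor X Y) Z (p \<diamondop> q) w),
      bi_tensor X (bi_tensor Y Z))"

definition bicrossed_product ::
  "(('g, 't, 'o) bicrossed_ob, ('g, 't, 'o, 'm) bicrossed_arr, 'k) moncat" where
  "bicrossed_product = \<lparr>
     Ob = (\<Pi>\<^sub>E p\<in>Idx. Deg D (snd p)),
     Arr = {(X, f, Y). X \<in> (\<Pi>\<^sub>E p\<in>Idx. Deg D (snd p)) \<and> Y \<in> (\<Pi>\<^sub>E p\<in>Idx. Deg D (snd p)) \<and>
              f \<in> (\<Pi>\<^sub>E p\<in>Idx. Hom C (X p) (Y p))},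
     Dom = (\<lambda>(X, f, Y). X),
     Cod = (\<lambda>(X, f, Y). Y),
     Id = (\<lambda>X. (X, \<lambda>p\<in>Idx. Id C (X p), X)),
     Comp = (\<lambda>(_, h, Z) (X, f, _). (X, \<lambda>p\<in>Idx. h p \<cdot> f p, Z)),
     Zero = (\<lambda>X Y. (X, \<lambda>p\<in>Idx. Zero C (X p) (Y p), Y)),
     Plus = (\<lambda>(X, f, Y) (_, h, _). (X, \<lambda>p\<in>Idx. Plus C (f p) (h p), Y)),
     Scale = (\<lambda>x (X, f, Y). (X, \<lambda>p\<in>Idx. Scale C x (f p), Y)),
     Unit = bi_unit,
     TenO = bi_tensor,
     TenA = (\<lambda>(X, f, Y) (X', f', Y').
       (bi_tensor X X',
        \<lambda>r\<in>Idx. asum C (bi_tensor X X' r) (bi_tensor Y Y' r) (splits r)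
          (\<lambda>(p, q). bi_inj Y Y' p q \<cdot> ((f p \<lhd>\<^sub>a fst q) \<otimes>\<^sub>a f' q) \<cdot> bi_prj X X' p q),
        bi_tensor Y Y')),
     Assoc = bi_assoc,
     LUnit = (\<lambda>X. (bi_tensor bi_unit X,
        \<lambda>r\<in>Idx. LUnit C (X r) \<cdot> (Eta0 D (fst r) \<otimes>\<^sub>a Id C (X r)) \<cdot> bi_prj bi_unit X idx_one r,
        X)),
     RUnit = (\<lambda>X. (bi_tensor X bi_unit,
        \<lambda>r\<in>Idx. RUnit C (X r) \<cdot> (inv_arr C (R0 D (X r)) \<otimes>\<^sub>a Id C \<I>) \<cdot> bi_prj X bi_unit r idx_one,
        X))\<rparr>"

definition mod_summand :: "'o \<Rightarrow> ('g, 't, 'o) bicrossed_ob \<Rightarrow> 'g \<times> 't \<Rightarrow> 'o" where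
  "mod_summand M X p = (M \<lhd>\<^sub>o fst p) \<otimes>\<^sub>o X p"

definition mod_act :: "'o \<Rightarrow> ('g, 't, 'o) bicrossed_ob \<Rightarrow> 'o" where
  "mod_act M X = dsum C Idx (mod_summand M X)"

definition mod_inj :: "'o \<Rightarrow> ('g, 't, 'o) bicrossed_ob \<Rightarrow> 'g \<times> 't \<Rightarrow> 'm" where
  "mod_inj M X = dinj C Idx (mod_summand M X)"

definition mod_prj :: "'o \<Rightarrow> ('g, 't, 'o) bicrossed_ob \<Rightarrow> 'g \<times> 't \<Rightarrow> 'm" where
  "mod_prj M X = dprj C Idx (mod_summand M X)"

text \<open>The map $(M\triangleleft g(k\blacktriangleright g'))\otimes((A\triangleleft g')\otimes B)\to
  ((M\triangleleft g)\otimes A)\triangleleft g'\otimes B$ for \<open>A\<close> of degree \<open>k\<close>, where \<open>p = (g, k)\<close>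
  and the argument \<open>g\<close> is $g'$.\<close>

definition mod_assoc_component :: "'o \<Rightarrow> 'g \<times> 't \<Rightarrow> 'g \<Rightarrow> 'o \<Rightarrow> 'o \<Rightarrow> 'm" where
  "mod_assoc_component M p g A B =
     (inv_arr C (Eta D g (snd p) (M \<lhd>\<^sub>o fst p) A) \<otimes>\<^sub>a Id C B) \<cdot>
     (inv_arr C (R2 D (fst p) (snd p \<triangleright> g) M) \<otimes>\<^sub>a Id C (A \<lhd>\<^sub>o g) \<otimes>\<^sub>a Id C B) \<cdot>
     inv_arr C (Assoc C (M \<lhd>\<^sub>o (fst p \<otimes>\<^bsub>G\<^esub> (snd p \<triangleright> g))) (A \<lhd>\<^sub>o g) B)"

definition bicrossed_module ::
  "('o, 'm, ('g, 't, 'o) bicrossed_ob, ('g, 't, 'o, 'm) bicrossed_arr) modcat" where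
  "bicrossed_module = \<lparr>
     MActO = mod_act,
     MActA = (\<lambda>f (X, h, Y). asum C (mod_act (Dom C f) X) (mod_act (Cod C f) Y) Idx
       (\<lambda>p. mod_inj (Cod C f) Y p \<cdot> ((f \<lhd>\<^sub>a fst p) \<otimes>\<^sub>a h p) \<cdot> mod_prj (Dom C f) X p)),
     MAssoc = (\<lambda>M X Y. asum C (mod_act M (bi_tensor X Y)) (mod_act (mod_act M X) Y) (Idx \<times> Idx)
       (\<lambda>(p, q). mod_inj (mod_act M X) Y q \<cdot>
          ((mod_inj M X p \<lhd>\<^sub>a fst q) \<otimes>\<^sub>a Id C (Y q)) \<cdot>
          mod_assoc_component M p (fst q) (X p) (Y q) \<cdot>
          (Id C (M \<lhd>\<^sub>o fst (p \<diamondop> q)) \<otimes>\<^sub>a bi_prj X Y p q) \<cdot>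
          mod_prj M (bi_tensor X Y) (p \<diamondop> q))),
     MUnit = (\<lambda>M. RUnit C M \<cdot> (inv_arr C (R0 D M) \<otimes>\<^sub>a Id C \<I>) \<cdot> mod_prj M bi_unit idx_one)\<rparr>"

end


section \<open>The crossed extension\<close>

type_synonym ('g, 'o, 'm) equiv_ob = "'o \<times> ('g \<Rightarrow> 'm)"
type_synonym ('g, 'o, 'm) equiv_arr = "('g, 'o, 'm) equiv_ob \<times> 'm \<times> ('g, 'o, 'm) equiv_ob"

context crossed_data
begin

definition is_equivariant :: "('g, 'o, 'm) equiv_ob \<Rightarrow> bool" where
  "is_equivariant W \<longleftrightarrow> (case W of (X, u) \<Rightarrow> X \<in> Ob C \<and>
     u \<in> (\<Pi>\<^sub>E g\<in>carrier G. Iso C (X \<lhd>\<^sub>o g) X) \<and>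
     (\<forall>g\<in>carrier G. \<forall>h\<in>carrier G. u (g \<otimes>\<^bsub>G\<^esub> h) \<cdot> R2 D g h X = u h \<cdot> (u g \<lhd>\<^sub>a h)))"

definition is_equivariant_arr ::
  "('g, 'o, 'm) equiv_ob \<Rightarrow> ('g, 'o, 'm) equiv_ob \<Rightarrow> 'm \<Rightarrow> bool" where
  "is_equivariant_arr W W' f \<longleftrightarrow> f \<in> Hom C (fst W) (fst W') \<and>
     (\<forall>g\<in>carrier G. snd W' g \<cdot> (f \<lhd>\<^sub>a g) = f \<cdot> snd W g)"

definition decomposition :: "'o \<Rightarrow> ('t \<Rightarrow> 'o) \<times> ('t \<Rightarrow> 'm) \<times> ('t \<Rightarrow> 'm)" where
  "decomposition X = (SOME d. (\<forall>k\<in>carrier \<Gamma>. fst d k \<in> Deg D k) \<and>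
     is_biproduct C (carrier \<Gamma>) (fst d) X (fst (snd d)) (snd (snd d)))"

definition comp_ob :: "'o \<Rightarrow> 't \<Rightarrow> 'o" where
  "comp_ob X = fst (decomposition X)"

definition comp_inj :: "'o \<Rightarrow> 't \<Rightarrow> 'm" where
  "comp_inj X = fst (snd (decomposition X))"

definition comp_prj :: "'o \<Rightarrow> 't \<Rightarrow> 'm" where
  "comp_prj X = snd (snd (decomposition X))"

text \<open>On the summand $(U\otimes V_s)\triangleleft g$ the structure map is
  $(u_{s\blacktriangleright g}\otimes v_g|_{V_s\triangleleft g})\,\eta^g_{U,V_s}$.\<close>

definition ext_tensor ::
  "('g, 'o, 'm) equiv_ob \<Rightarrow> ('g, 'o, 'm) equiv_ob \<Rightarrow> ('g, 'o, 'm) equiv_ob" where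
  "ext_tensor W W' = (case W of (U, u) \<Rightarrow> case W' of (V, v) \<Rightarrow> (U \<otimes>\<^sub>o V,
     \<lambda>g\<in>carrier G. asum C ((U \<otimes>\<^sub>o V) \<lhd>\<^sub>o g) (U \<otimes>\<^sub>o V) (carrier \<Gamma>)
       (\<lambda>s. (u (s \<triangleright> g) \<otimes>\<^sub>a (v g \<cdot> (comp_inj V s \<lhd>\<^sub>a g))) \<cdot>
          Eta D g s U (comp_ob V s) \<cdot> ((Id C U \<otimes>\<^sub>a comp_prj V s) \<lhd>\<^sub>a g))))"

definition ext_unit :: "('g, 'o, 'm) equiv_ob" where
  "ext_unit = (\<I>, \<lambda>g\<in>carrier G. Eta0 D g)"

definition crossed_extension ::
  "(('g, 'o, 'm) equiv_ob, ('g, 'o, 'm) equiv_arr, 'k) moncat" where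
  "crossed_extension = \<lparr>
     Ob = {W. is_equivariant W},
     Arr = {(W, f, W'). is_equivariant W \<and> is_equivariant W' \<and> is_equivariant_arr W W' f},
     Dom = (\<lambda>(W, f, W'). W),
     Cod = (\<lambda>(W, f, W'). W'),
     Id = (\<lambda>W. (W, Id C (fst W), W)),
     Comp = (\<lambda>(_, h, W'') (W, f, _). (W, h \<cdot> f, W'')),
     Zero = (\<lambda>W W'. (W, Zero C (fst W) (fst W'), W')),
     Plus = (\<lambda>(W, f, W') (_, h, _). (W, Plus C f h, W')),
     Scale = (\<lambda>x (W, f, W'). (W, Scale C x f, W')),
     Unit = ext_unit,
     TenO = ext_tensor,
     TenA = (\<lambda>(W, f, W') (V, h, V'). (ext_tensor W V, f \<otimes>\<^sub>a h, ext_tensor W' V')),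
     Assoc = (\<lambda>W W' W''. (ext_tensor (ext_tensor W W') W'',
        Assoc C (fst W) (fst W') (fst W''), ext_tensor W (ext_tensor W' W''))),
     LUnit = (\<lambda>W. (ext_tensor ext_unit W, LUnit C (fst W), W)),
     RUnit = (\<lambda>W. (ext_tensor W ext_unit, RUnit C (fst W), W))\<rparr>"

end

end

theory Submission
  imports Defs
begin

text \<open>An equivariant object $(U,u)$ makes $U\otimes -$ a module endofunctor of $\mathcal C$: composing
  $\eta^g_{U,M}$ with $u_{|M|\blacktriangleright g}\otimes\mathrm{id}$ gives maps
  $\gamma^g_M:(U\otimes M)\triangleleft g\to U\otimes(M\triangleleft g)$, and the module constraint is
  the inverse of $\alpha\,(\gamma^g_M\otimes\mathrm{id})$ on each $g\bowtie A$.  A module functor is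
  determined by its constraints on the homogeneous pieces $g\bowtie\mathcal C_k$, where module
  associativity becomes a finite list of identities between maps in $\mathcal C$; these identities are the
  equivariance of $u$ together with (C1)--(C5).

  A module endofunctor $\mathbf F$ is isomorphic to $\mathbf F(\mathbf 1)\otimes -$, because
  $M\cong\mathbf 1\bar\otimes(e\bowtie M)$, and $\mathbf F(\mathbf 1)$ is equivariant through
  $\mathbf F(\mathbf 1)\triangleleft g\cong\mathbf F(\mathbf 1\bar\otimes(g\bowtie\mathbf 1))\cong
  \mathbf F(\mathbf 1\triangleleft g)\cong\mathbf F(\mathbf 1)$.  A module transformation is likewise
  determined by its value at $\mathbf 1$, so $(U,u)\mapsto U\otimes -$ is an equivalence onto the
  dual category.  It is monoidal by means of $\alpha_{U,V,M}$ and $\ell_M$, and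
  a quasi-inverse inherits the monoidal structure.\<close>

section \<open>Calculations in linear categories\<close>

text \<open>A general object of C has no degree, a zero object has all of them, and tensor product
  and action of the bicrossed product are chosen direct sums of families indexed by G \<times>
  \<Gamma>. No identity is therefore computed on the objects as given. It is restricted along
  injections to homogeneous summands, where it becomes an axiom of the crossed action, and recovered
  because the injections are jointly epimorphic. \<open>extend\<close> does this for natural maps on
  C, \<open>assemble\<close> and \<open>component\<close> for module constraints. A module
  constraint is natural also in the arrows of the bicrossed product, hence against the idempotents
  that cut out one member of a family; so it is block-diagonal, and the passage to components works
  in both directions. Rigidity enters because module functors are exact: both adjoints of X
  \<otimes> - are needed. Simplicity of the unit enters because the degree of the unit object is not
  given but deduced. The inverse of a module constraint points the way \<alpha> and \<eta> do, so
  calculations use the inverses \<open>sig\<close> and \<open>scomp\<close>.\<close>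

definition into :: "('o, 'm, 'k, 'z) lincat_scheme \<Rightarrow> 'o \<Rightarrow> 'm set" where
  "into C b = {f \<in> Arr C. Cod C f = b}"

lemma into_arr: "f \<in> Arr C \<Longrightarrow> Cod C f = b \<Longrightarrow> f \<in> into C b"
  by (simp add: into_def)

lemma HomI: "f \<in> Arr C \<Longrightarrow> Dom C f = a \<Longrightarrow> Cod C f = b \<Longrightarrow> f \<in> Hom C a b"
  by (simp add: Hom_def)

lemma HomD:
  assumes "f \<in> Hom C a b"
  shows "f \<in> Arr C" "Dom C f = a" "Cod C f = b"
  using assms by (simp_all add: Hom_def)

context linear_category
begin

declare dom_in [simp] cod_in [simp]

lemma Hom_ob:
  assumes "f \<in> Hom C a b"
  shows "a \<in> Ob C" "b \<in> Ob C"
  using assms by (auto simp: Hom_def)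

lemma arr_id [simp]: "a \<in> Ob C \<Longrightarrow> Id C a \<in> Arr C"
  and dom_id [simp]: "a \<in> Ob C \<Longrightarrow> Dom C (Id C a) = a"
  and cod_id [simp]: "a \<in> Ob C \<Longrightarrow> Cod C (Id C a) = a"
  using id_in HomD by metis+

lemma
  assumes "f \<in> Arr C" "g \<in> Arr C" "Dom C g = Cod C f"
  shows arr_comp [simp]: "g \<cdot> f \<in> Arr C"
    and dom_comp [simp]: "Dom C (g \<cdot> f) = Dom C f"
    and cod_comp [simp]: "Cod C (g \<cdot> f) = Cod C g"
proof -
  have "g \<cdot> f \<in> Hom C (Dom C f) (Cod C g)"
    using assms by (intro comp_in[of f _ "Cod C f"]) (auto simp: Hom_def)
  then show "g \<cdot> f \<in> Arr C" "Dom C (g \<cdot> f) = Dom C f" "Cod C (g \<cdot> f) = Cod C g"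
    by (auto simp: Hom_def)
qed

declare into_arr [simp]

lemma into_comp [simp]:
  "g \<in> Arr C \<Longrightarrow> Cod C g = b \<Longrightarrow> f \<in> into C (Dom C g) \<Longrightarrow> g \<cdot> f \<in> into C b"
  by (simp add: into_def)

text \<open>\<open>into\<close> fixes the codomain of the inner arrow and leaves its domain open, so
  this side condition is proved by walking down a composite. Oriented this way, associativity brings
  every composite into right-nested form.\<close>

lemma comp_assoc_into [simp]:
  "g \<in> Arr C \<Longrightarrow> h \<in> Arr C \<Longrightarrow> Dom C h = Cod C g \<Longrightarrow> f \<in> into C (Dom C g) \<Longrightarrow>
    (h \<cdot> g) \<cdot> f = h \<cdot> g \<cdot> f"
  by (rule comp_assoc[of f "Dom C f" "Cod C f" g "Cod C g" h "Cod C h"])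
    (auto simp: Hom_def into_def)

lemma id_comp [simp]: "f \<in> into C a \<Longrightarrow> Id C a \<cdot> f = f"
  by (rule id_left[of f "Dom C f"]) (auto simp: into_def Hom_def)

lemma comp_id [simp]: "f \<in> Arr C \<Longrightarrow> Dom C f = a \<Longrightarrow> f \<cdot> Id C a = f"
  by (rule id_right[of f _ "Cod C f"]) (auto simp: Hom_def)

text \<open>Composites are kept in right-nested form; these rules turn an equation between short
  composites into a rewrite rule that applies inside a longer one.\<close>

lemma pre2: "a \<cdot> b = r \<Longrightarrow> a \<in> Arr C \<Longrightarrow> b \<in> Arr C \<Longrightarrow> Dom C a = Cod C b \<Longrightarrow>
    z \<in> into C (Dom C b) \<Longrightarrow> a \<cdot> b \<cdot> z = r \<cdot> z"
  by (metis comp_assoc_into)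

lemma pre3: "a \<cdot> b \<cdot> c = r \<Longrightarrow> a \<in> Arr C \<Longrightarrow> b \<in> Arr C \<Longrightarrow> Dom C a = Cod C b \<Longrightarrow>
    c \<in> Arr C \<Longrightarrow> Dom C b = Cod C c \<Longrightarrow>
    z \<in> into C (Dom C c) \<Longrightarrow> a \<cdot> b \<cdot> c \<cdot> z = r \<cdot> z"
  by (metis comp_assoc_into into_arr into_comp arr_comp dom_comp cod_comp)

subsection \<open>Isomorphisms\<close>

lemma inverse_arrows_unique:
  assumes "inverse_arrows C f g" "inverse_arrows C f h"
  shows "g = h"
proof -
  have "(g \<cdot> f) \<cdot> h = g \<cdot> f \<cdot> h"
    using assms by (intro comp_assoc_into) (auto simp: inverse_arrows_def Hom_def)
  then show ?thesis
    using assms by (auto simp: inverse_arrows_def Hom_def)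
qed

lemma inv_arr_eq: "inverse_arrows C f g \<Longrightarrow> inv_arr C f = g"
  unfolding inv_arr_def by (blast intro: the_equality inverse_arrows_unique)

lemma is_isoI:
  "f \<in> Hom C a b \<Longrightarrow> g \<in> Hom C b a \<Longrightarrow> g \<cdot> f = Id C a \<Longrightarrow> f \<cdot> g = Id C b \<Longrightarrow> is_iso C f"
  by (auto simp: is_iso_def inverse_arrows_def Hom_def)

lemma inv_arrI:
  "f \<in> Hom C a b \<Longrightarrow> g \<in> Hom C b a \<Longrightarrow> g \<cdot> f = Id C a \<Longrightarrow> f \<cdot> g = Id C b \<Longrightarrow> inv_arr C f = g"
  by (rule inv_arr_eq) (auto simp: inverse_arrows_def Hom_def)

lemma inverse_arrows_inv: "is_iso C f \<Longrightarrow> inverse_arrows C f (inv_arr C f)"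
  unfolding is_iso_def using inv_arr_eq by blast

lemma
  assumes "is_iso C f"
  shows is_iso_arr: "f \<in> Arr C"
    and arr_inv [simp]: "inv_arr C f \<in> Arr C"
    and dom_inv [simp]: "Dom C (inv_arr C f) = Cod C f"
    and cod_inv [simp]: "Cod C (inv_arr C f) = Dom C f"
    and inv_comp_self: "inv_arr C f \<cdot> f = Id C (Dom C f)"
    and comp_inv_self: "f \<cdot> inv_arr C f = Id C (Cod C f)"
  using inverse_arrows_inv[OF assms] by (auto simp: inverse_arrows_def Hom_def)

lemma inv_comp_cancel [simp]: "is_iso C f \<Longrightarrow> Dom C f = a \<Longrightarrow> inv_arr C f \<cdot> f = Id C a"
  and comp_inv_cancel [simp]: "is_iso C f \<Longrightarrow> Cod C f = b \<Longrightarrow> f \<cdot> inv_arr C f = Id C b"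
  by (simp_all add: inv_comp_self comp_inv_self)

lemma inv_comp_cancel_pre [simp]:
  "is_iso C f \<Longrightarrow> z \<in> into C (Dom C f) \<Longrightarrow> inv_arr C f \<cdot> f \<cdot> z = z"
  using pre2[OF inv_comp_self] by (simp add: is_iso_arr)

lemma comp_inv_cancel_pre [simp]:
  "is_iso C f \<Longrightarrow> z \<in> into C (Cod C f) \<Longrightarrow> f \<cdot> inv_arr C f \<cdot> z = z"
  using pre2[OF comp_inv_self] by (simp add: is_iso_arr)

lemma is_iso_inv [simp]: "is_iso C f \<Longrightarrow> is_iso C (inv_arr C f)"
  by (rule is_isoI[of _ "Cod C f" "Dom C f" f])
    (simp_all add: Hom_def is_iso_arr inv_comp_self comp_inv_self)

lemma is_iso_id [simp]: "a \<in> Ob C \<Longrightarrow> is_iso C (Id C a)"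
  by (rule is_isoI[of _ a a "Id C a"]) (simp_all add: Hom_def)

lemma is_iso_comp [simp]:
  assumes "is_iso C f" "is_iso C g" "Dom C g = Cod C f"
  shows "is_iso C (g \<cdot> f)"
  using assms
  by (intro is_isoI[of _ "Dom C f" "Cod C g" "inv_arr C f \<cdot> inv_arr C g"])
    (simp_all add: Hom_def is_iso_arr)

lemma iso_left_cancel:
  assumes "a \<cdot> f = a \<cdot> g" "is_iso C a" "f \<in> into C (Dom C a)" "g \<in> into C (Dom C a)"
  shows "f = g"
proof -
  have "f = inv_arr C a \<cdot> a \<cdot> f" "g = inv_arr C a \<cdot> a \<cdot> g"
    using assms(2-) by (simp_all add: is_iso_arr)
  with assms(1) show ?thesis by metis
qed

lemma iso_right_cancel:
  assumes "f \<cdot> a = g \<cdot> a" "is_iso C a" "f \<in> Arr C" "Dom C f = Cod C a" "g \<in> Arr C" "Dom C g = Cod C a"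
  shows "f = g"
proof -
  have "f = (f \<cdot> a) \<cdot> inv_arr C a" "g = (g \<cdot> a) \<cdot> inv_arr C a"
    using assms(2-) by (simp_all add: is_iso_arr)
  with assms(1) show ?thesis by metis
qed

lemma Iso_iff: "f \<in> Iso C a b \<longleftrightarrow> is_iso C f \<and> Dom C f = a \<and> Cod C f = b"
  by (auto simp: Iso_def Hom_def is_iso_arr)

lemma inv_inv [simp]: "is_iso C f \<Longrightarrow> inv_arr C (inv_arr C f) = f"
  by (rule inv_arrI[of _ "Cod C f" "Dom C f"]) (simp_all add: Hom_def is_iso_arr)

lemma comp_eq_iff_inv:
  assumes "is_iso C a" "f \<in> into C (Dom C a)" "g \<in> into C (Cod C a)"
  shows "a \<cdot> f = g \<longleftrightarrow> f = inv_arr C a \<cdot> g"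
proof
  assume "a \<cdot> f = g"
  then show "f = inv_arr C a \<cdot> g"
    using assms by auto
qed (use assms in simp)

text \<open>Turns a commuting square with two invertible opposite sides into the square with these
  sides reversed. It is the usual way to read naturality or a coherence for inverse maps.\<close>

lemma inv_slide:
  assumes "a \<cdot> f = g \<cdot> b" "is_iso C a" "is_iso C b" "f \<in> Arr C" "Cod C f = Dom C a"
    "g \<in> Arr C" "Dom C g = Cod C b"
  shows "inv_arr C a \<cdot> g = f \<cdot> inv_arr C b"
proof (rule iso_right_cancel[where a = b])
  \<comment> \<open>These two typings are extracted from the equation by taking \<open>Dom C\<close>
    and \<open>Cod C\<close> of both sides.\<close>
  have "Dom C f = Dom C b" "Cod C g = Cod C a"
    using arg_cong[OF assms(1), of "Dom C"] arg_cong[OF assms(1), of "Cod C"] assms(2-)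
    by (simp_all add: is_iso_arr)
  then show "(inv_arr C a \<cdot> g) \<cdot> b = (f \<cdot> inv_arr C b) \<cdot> b"
    "inv_arr C a \<cdot> g \<in> Arr C" "Dom C (inv_arr C a \<cdot> g) = Cod C b"
    "f \<cdot> inv_arr C b \<in> Arr C" "Dom C (f \<cdot> inv_arr C b) = Cod C b"
    using assms(2-) by (simp_all add: is_iso_arr assms(1)[symmetric])
qed fact

lemma inv_comp: "is_iso C f \<Longrightarrow> is_iso C g \<Longrightarrow> Dom C g = Cod C f \<Longrightarrow>
    inv_arr C (g \<cdot> f) = inv_arr C f \<cdot> inv_arr C g"
  by (rule inv_arrI[of _ "Dom C f" "Cod C g"]) (simp_all add: Hom_def is_iso_arr)

subsection \<open>Sums of parallel arrows\<close>

lemma hom_ab: "a \<in> Ob C \<Longrightarrow> b \<in> Ob C \<Longrightarrow> abelian_group (hom_module C a b)"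
  using hom_is_module module.axioms by blast

lemma hom_simps [simp]:
  "carrier (hom_module C a b) = Hom C a b" "\<zero>\<^bsub>hom_module C a b\<^esub> = Zero C a b"
  "f \<oplus>\<^bsub>hom_module C a b\<^esub> g = Plus C f g" "x \<odot>\<^bsub>hom_module C a b\<^esub> f = Scale C x f"
  by (simp_all add: hom_module_def)

lemma zero_in: "a \<in> Ob C \<Longrightarrow> b \<in> Ob C \<Longrightarrow> Zero C a b \<in> Hom C a b"
  using abelian_monoid.zero_closed[OF abelian_group.axioms(1)[OF hom_ab]] by fastforce

lemma plus_in:
  assumes "f \<in> Hom C a b" "g \<in> Hom C a b"
  shows "Plus C f g \<in> Hom C a b"
proof -
  have "a \<in> Ob C" "b \<in> Ob C"
    using assms by (auto simp: Hom_def)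
  then show ?thesis
    using abelian_monoid.a_closed[OF abelian_group.axioms(1)[OF hom_ab]] assms by fastforce
qed

lemma scale_in:
  assumes "f \<in> Hom C a b"
  shows "Scale C x f \<in> Hom C a b"
proof -
  have "a \<in> Ob C" "b \<in> Ob C"
    using assms by (auto simp: Hom_def)
  then show ?thesis
    using module.smult_closed[OF hom_is_module, of a b x f] assms by (simp add: scalars_def)
qed

lemma arr_zero [simp]: "a \<in> Ob C \<Longrightarrow> b \<in> Ob C \<Longrightarrow> Zero C a b \<in> Arr C"
  and dom_zero [simp]: "a \<in> Ob C \<Longrightarrow> b \<in> Ob C \<Longrightarrow> Dom C (Zero C a b) = a"
  and cod_zero [simp]: "a \<in> Ob C \<Longrightarrow> b \<in> Ob C \<Longrightarrow> Cod C (Zero C a b) = b"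
  using zero_in HomD by metis+

lemma plus_zero:
  assumes "f \<in> Hom C a b"
  shows "Plus C (Zero C a b) f = f" "Plus C f (Zero C a b) = f"
proof -
  have "a \<in> Ob C" "b \<in> Ob C"
    using assms by (auto simp: Hom_def)
  then show "Plus C (Zero C a b) f = f" "Plus C f (Zero C a b) = f"
    using abelian_monoid.l_zero[OF abelian_group.axioms(1)[OF hom_ab]]
      abelian_monoid.r_zero[OF abelian_group.axioms(1)[OF hom_ab]] assms by fastforce+
qed

text \<open>In the abelian group of arrows from \<open>a\<close> to \<open>b\<close> only zero
  equals its own double. Preservation of zero by an additive operation is always derived from
  this.\<close>

lemma plus_idem_zero:
  assumes "f \<in> Hom C a b" "Plus C f f = f"
  shows "f = Zero C a b"
proof -
  have "a \<in> Ob C" "b \<in> Ob C"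
    using assms by (auto simp: Hom_def)
  then interpret abelian_group "hom_module C a b"
    by (rule hom_ab)
  show ?thesis
    using assms add.l_cancel_one[of f f] by simp
qed

lemma comp_zero:
  assumes "f \<in> Hom C a b" "c \<in> Ob C"
  shows "Zero C b c \<cdot> f = Zero C a c"
proof (rule plus_idem_zero)
  have ab: "a \<in> Ob C" "b \<in> Ob C"
    using assms by (auto simp: Hom_def)
  have z: "Zero C b c \<in> Hom C b c"
    by (rule zero_in) fact+
  show "Zero C b c \<cdot> f \<in> Hom C a c"
    by (rule comp_in) fact+
  show "Plus C (Zero C b c \<cdot> f) (Zero C b c \<cdot> f) = Zero C b c \<cdot> f"
    using comp_plus_left[OF assms(1) z z] plus_zero(1)[OF z] by simp
qed

lemma zero_comp:
  assumes "f \<in> Hom C b c" "a \<in> Ob C"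
  shows "f \<cdot> Zero C a b = Zero C a c"
proof (rule plus_idem_zero)
  have ab: "b \<in> Ob C" "c \<in> Ob C"
    using assms by (auto simp: Hom_def)
  have z: "Zero C a b \<in> Hom C a b"
    by (rule zero_in) fact+
  show "f \<cdot> Zero C a b \<in> Hom C a c"
    by (rule comp_in) fact+
  show "Plus C (f \<cdot> Zero C a b) (f \<cdot> Zero C a b) = f \<cdot> Zero C a b"
    using comp_plus_right[OF z z assms(1)] plus_zero(1)[OF z] by simp
qed

lemma comp_zero_simp [simp]:
  "b \<in> Ob C \<Longrightarrow> c \<in> Ob C \<Longrightarrow> f \<in> into C b \<Longrightarrow> Zero C b c \<cdot> f = Zero C (Dom C f) c"
  by (rule comp_zero) (auto simp: into_def Hom_def)

lemma zero_comp_simp [simp]: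
  "a \<in> Ob C \<Longrightarrow> f \<in> Arr C \<Longrightarrow> Dom C f = b \<Longrightarrow> f \<cdot> Zero C a b = Zero C a (Cod C f)"
  by (rule zero_comp) (auto simp: Hom_def)

lemma asum_empty [simp]: "a \<in> Ob C \<Longrightarrow> b \<in> Ob C \<Longrightarrow> asum C a b {} f = Zero C a b"
  using abelian_monoid.finsum_empty[OF abelian_group.axioms(1)[OF hom_ab]]
  by (fastforce simp: asum_def)

lemma asum_insert:
  assumes "finite I" "i \<notin> I" "\<And>j. j \<in> insert i I \<Longrightarrow> f j \<in> Hom C a b"
  shows "asum C a b (insert i I) f = Plus C (f i) (asum C a b I f)"
proof -
  have "a \<in> Ob C" "b \<in> Ob C"
    using assms(3)[of i] by (auto simp: Hom_def)
  then interpret abelian_group "hom_module C a b"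
    by (rule hom_ab)
  show ?thesis
    using assms by (auto simp: asum_def)
qed

lemma asum_in:
  assumes "a \<in> Ob C" "b \<in> Ob C" "\<And>j. j \<in> I \<Longrightarrow> f j \<in> Hom C a b"
  shows "asum C a b I f \<in> Hom C a b"
proof -
  interpret abelian_group "hom_module C a b"
    by (rule hom_ab) fact+
  show ?thesis
    using assms finsum_closed[of f I] by (auto simp: asum_def)
qed

lemma asum_cong:
  assumes "a \<in> Ob C" "b \<in> Ob C" "\<And>j. j \<in> I \<Longrightarrow> f j \<in> Hom C a b" "\<And>j. j \<in> I \<Longrightarrow> f j = g j"
  shows "asum C a b I f = asum C a b I g"
proof -
  interpret abelian_group "hom_module C a b"
    by (rule hom_ab) fact+
  show ?thesis
    unfolding asum_def by (rule finsum_cong') (use assms in auto)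
qed

text \<open>Stated for an additive map between Hom groups of two possibly different categories, so
  that one induction serves composition on either side and the application of a linear
  functor.\<close>

lemma asum_hom:
  fixes E :: "('o2, 'm2, 'k, 'z2) lincat_scheme"
  assumes "linear_category E"
    and "finite I" "a \<in> Ob C" "b \<in> Ob C" "a' \<in> Ob E" "b' \<in> Ob E"
    and f: "\<And>j. j \<in> I \<Longrightarrow> f j \<in> Hom C a b"
    and \<phi>: "\<And>h. h \<in> Hom C a b \<Longrightarrow> \<phi> h \<in> Hom E a' b'"
    and "\<phi> (Zero C a b) = Zero E a' b'"
    and "\<And>h h'. h \<in> Hom C a b \<Longrightarrow> h' \<in> Hom C a b \<Longrightarrow> \<phi> (Plus C h h') = Plus E (\<phi> h) (\<phi> h')"
  shows "\<phi> (asum C a b I f) = asum E a' b' I (\<lambda>i. \<phi> (f i))"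
  using \<open>finite I\<close> f
proof (induction I)
  case empty
  then show ?case
    using assms by (simp add: linear_category.asum_empty[OF assms(1)])
next
  case (insert i I)
  have "asum C a b (insert i I) f = Plus C (f i) (asum C a b I f)"
    using insert by (intro asum_insert) auto
  moreover have "asum E a' b' (insert i I) (\<lambda>i. \<phi> (f i)) = Plus E (\<phi> (f i)) (asum E a' b' I (\<lambda>i. \<phi> (f i)))"
    using insert assms by (intro linear_category.asum_insert[OF assms(1)]) auto
  moreover have "asum C a b I f \<in> Hom C a b"
    using insert assms by (intro asum_in) auto
  ultimately show ?case
    using insert assms(10) by simp
qed

lemma asum_comp_left:
  assumes "finite I" "a \<in> Ob C" "b \<in> Ob C" "\<And>j. j \<in> I \<Longrightarrow> f j \<in> Hom C a b" "g \<in> Hom C b c"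
  shows "g \<cdot> asum C a b I f = asum C a c I (\<lambda>i. g \<cdot> f i)"
  using assms Hom_ob(2)[OF assms(5)]
  by (intro asum_hom[OF linear_category_axioms])
    (auto simp: comp_plus_right zero_comp intro: comp_in dest: HomD)

lemma asum_comp_right:
  assumes "finite I" "b \<in> Ob C" "c \<in> Ob C" "\<And>j. j \<in> I \<Longrightarrow> f j \<in> Hom C b c" "g \<in> Hom C a b"
  shows "asum C b c I f \<cdot> g = asum C a c I (\<lambda>i. f i \<cdot> g)"
  using assms Hom_ob(1)[OF assms(5)]
  by (intro asum_hom[OF linear_category_axioms, where \<phi> = "\<lambda>f. f \<cdot> g"])
    (auto simp: comp_plus_left comp_zero intro: comp_in dest: HomD)

lemma asum_zero:
  assumes "finite I" "a \<in> Ob C" "b \<in> Ob C" "\<And>i. i \<in> I \<Longrightarrow> f i = Zero C a b"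
  shows "asum C a b I f = Zero C a b"
  using assms(1,4)
proof (induction I)
  case (insert i I)
  have "asum C a b (insert i I) f = Plus C (f i) (asum C a b I f)"
    using insert assms(2,3) by (intro asum_insert) (auto intro: zero_in)
  then show ?case
    using insert plus_zero[OF zero_in[OF assms(2,3)]] by simp
qed (simp add: assms)

lemma asum_single:
  assumes "finite I" "j \<in> I" "f j \<in> Hom C a b" "\<And>i. i \<in> I \<Longrightarrow> i \<noteq> j \<Longrightarrow> f i = Zero C a b"
  shows "asum C a b I f = f j"
proof -
  have ab: "a \<in> Ob C" "b \<in> Ob C"
    using assms(3) by (auto simp: Hom_def)
  have I: "I = insert j (I - {j})"
    using assms by auto
  have "asum C a b (insert j (I - {j})) f = Plus C (f j) (asum C a b (I - {j}) f)"
    using assms ab by (intro asum_insert) (auto, metis zero_in)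
  also have "asum C a b (I - {j}) f = Zero C a b"
    using assms ab by (intro asum_zero) auto
  finally show ?thesis
    using I assms(3) by (simp add: plus_zero)
qed

lemma asum_reindex:
  assumes "inj_on h I" "a \<in> Ob C" "b \<in> Ob C" "\<And>i. i \<in> I \<Longrightarrow> f (h i) \<in> Hom C a b"
  shows "asum C a b (h ` I) f = asum C a b I (\<lambda>i. f (h i))"
proof -
  interpret abelian_group "hom_module C a b"
    by (rule hom_ab) fact+
  show ?thesis
    unfolding asum_def using assms by (intro finsum_reindex) auto
qed

subsection \<open>Direct sums\<close>

lemma
  assumes "is_biproduct C I A S \<iota> \<pi>"
  shows biproduct_finite: "finite I"
    and biproduct_ob: "S \<in> Ob C"
    and biproduct_summand: "i \<in> I \<Longrightarrow> A i \<in> Ob C"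
    and biproduct_inj: "i \<in> I \<Longrightarrow> \<iota> i \<in> Hom C (A i) S"
    and biproduct_prj: "i \<in> I \<Longrightarrow> \<pi> i \<in> Hom C S (A i)"
    and biproduct_same: "i \<in> I \<Longrightarrow> \<pi> i \<cdot> \<iota> i = Id C (A i)"
    and biproduct_diff: "i \<in> I \<Longrightarrow> j \<in> I \<Longrightarrow> i \<noteq> j \<Longrightarrow> \<pi> i \<cdot> \<iota> j = Zero C (A j) (A i)"
    and biproduct_sum: "asum C S S I (\<lambda>i. \<iota> i \<cdot> \<pi> i) = Id C S"
  using assms by (auto simp: is_biproduct_def)

text \<open>The identity of \<open>S\<close> is the sum of the idempotents \<iota> i \<cdot> \<pi>
  i, so an arrow out of \<open>S\<close> can be rebuilt from its restrictions. This is the device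
  that reduces identities to summands.\<close>

lemma biproduct_epi:
  assumes bp: "is_biproduct C I A S \<iota> \<pi>"
    and "f \<in> Hom C S b" "f' \<in> Hom C S b" "\<And>i. i \<in> I \<Longrightarrow> f \<cdot> \<iota> i = f' \<cdot> \<iota> i"
  shows "f = f'"
proof -
  note [simp] = HomD[OF biproduct_inj[OF bp]] HomD[OF biproduct_prj[OF bp]] biproduct_finite[OF bp]
    biproduct_ob[OF bp] HomD[OF assms(2)] HomD[OF assms(3)]
  have *: "h = asum C S b I (\<lambda>i. (h \<cdot> \<iota> i) \<cdot> \<pi> i)" if h: "h \<in> Hom C S b" for h
  proof -
    note [simp] = HomD[OF h]
    have "h = h \<cdot> asum C S S I (\<lambda>i. \<iota> i \<cdot> \<pi> i)"
      by (simp add: biproduct_sum[OF bp])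
    also have "\<dots> = asum C S b I (\<lambda>i. h \<cdot> \<iota> i \<cdot> \<pi> i)"
      using h by (intro asum_comp_left) (auto intro: HomI)
    also have "\<dots> = asum C S b I (\<lambda>i. (h \<cdot> \<iota> i) \<cdot> \<pi> i)"
      using cod_in[of h] by (intro asum_cong) (auto intro: HomI)
    finally show ?thesis .
  qed
  have "asum C S b I (\<lambda>i. (f \<cdot> \<iota> i) \<cdot> \<pi> i) = asum C S b I (\<lambda>i. (f' \<cdot> \<iota> i) \<cdot> \<pi> i)"
    using cod_in[of f] by (intro asum_cong) (auto simp: assms(4) intro: HomI)
  with *[OF assms(2)] *[OF assms(3)] show ?thesis
    by simp
qed

lemma biproduct_mono:
  assumes bp: "is_biproduct C I A S \<iota> \<pi>"
    and "f \<in> Hom C b S" "f' \<in> Hom C b S" "\<And>i. i \<in> I \<Longrightarrow> \<pi> i \<cdot> f = \<pi> i \<cdot> f'"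
  shows "f = f'"
proof -
  note [simp] = HomD[OF biproduct_inj[OF bp]] HomD[OF biproduct_prj[OF bp]] biproduct_finite[OF bp]
    biproduct_ob[OF bp] HomD[OF assms(2)] HomD[OF assms(3)]
  have *: "h = asum C b S I (\<lambda>i. \<iota> i \<cdot> \<pi> i \<cdot> h)" if h: "h \<in> Hom C b S" for h
  proof -
    note [simp] = HomD[OF h]
    have "h = asum C S S I (\<lambda>i. \<iota> i \<cdot> \<pi> i) \<cdot> h"
      by (simp add: biproduct_sum[OF bp])
    also have "\<dots> = asum C b S I (\<lambda>i. (\<iota> i \<cdot> \<pi> i) \<cdot> h)"
      using h by (intro asum_comp_right) (auto intro: HomI)
    also have "\<dots> = asum C b S I (\<lambda>i. \<iota> i \<cdot> \<pi> i \<cdot> h)"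
      using dom_in[of h] by (intro asum_cong) (auto intro: HomI)
    finally show ?thesis .
  qed
  have "asum C b S I (\<lambda>i. \<iota> i \<cdot> \<pi> i \<cdot> f) = asum C b S I (\<lambda>i. \<iota> i \<cdot> \<pi> i \<cdot> f')"
    using dom_in[of f] by (intro asum_cong) (auto simp: assms(4) intro: HomI)
  with *[OF assms(2)] *[OF assms(3)] show ?thesis
    by simp
qed

text \<open>The universal property with an explicit mediating arrow, in the shape in which
  \<open>extend\<close> and \<open>assemble\<close> are written. Against \<iota> j all terms of the
  sum but the j-th vanish.\<close>

lemma biproduct_copair:
  assumes bp: "is_biproduct C I A S \<iota> \<pi>" and b: "b \<in> Ob C"
    and f: "\<And>i. i \<in> I \<Longrightarrow> f i \<in> Hom C (A i) b"
  shows "asum C S b I (\<lambda>i. f i \<cdot> \<pi> i) \<in> Hom C S b"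
    and "j \<in> I \<Longrightarrow> asum C S b I (\<lambda>i. f i \<cdot> \<pi> i) \<cdot> \<iota> j = f j"
proof -
  note [simp] = HomD[OF biproduct_inj[OF bp]] HomD[OF biproduct_prj[OF bp]] biproduct_finite[OF bp]
    biproduct_ob[OF bp] biproduct_summand[OF bp] HomD[OF f] b
  show "asum C S b I (\<lambda>i. f i \<cdot> \<pi> i) \<in> Hom C S b"
    by (rule asum_in) (auto intro: HomI)
  assume j: "j \<in> I"
  have "asum C S b I (\<lambda>i. f i \<cdot> \<pi> i) \<cdot> \<iota> j = asum C (A j) b I (\<lambda>i. (f i \<cdot> \<pi> i) \<cdot> \<iota> j)"
    using j by (intro asum_comp_right) (auto intro: HomI)
  also have "\<dots> = (f j \<cdot> \<pi> j) \<cdot> \<iota> j"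
    using j by (intro asum_single) (auto intro: HomI simp: biproduct_diff[OF bp])
  finally show "asum C S b I (\<lambda>i. f i \<cdot> \<pi> i) \<cdot> \<iota> j = f j"
    using j by (simp add: biproduct_same[OF bp])
qed

lemma biproduct_pair:
  assumes bp: "is_biproduct C I A S \<iota> \<pi>" and b: "b \<in> Ob C"
    and f: "\<And>i. i \<in> I \<Longrightarrow> f i \<in> Hom C b (A i)"
  shows "asum C b S I (\<lambda>i. \<iota> i \<cdot> f i) \<in> Hom C b S"
    and "j \<in> I \<Longrightarrow> \<pi> j \<cdot> asum C b S I (\<lambda>i. \<iota> i \<cdot> f i) = f j"
proof -
  note [simp] = HomD[OF biproduct_inj[OF bp]] HomD[OF biproduct_prj[OF bp]] biproduct_finite[OF bp]
    biproduct_ob[OF bp] biproduct_summand[OF bp] HomD[OF f] b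
  show "asum C b S I (\<lambda>i. \<iota> i \<cdot> f i) \<in> Hom C b S"
    by (rule asum_in) (auto intro: HomI)
  assume j: "j \<in> I"
  have "\<pi> j \<cdot> asum C b S I (\<lambda>i. \<iota> i \<cdot> f i) = asum C b (A j) I (\<lambda>i. \<pi> j \<cdot> \<iota> i \<cdot> f i)"
    using j by (intro asum_comp_left) (auto intro: HomI)
  also have "\<dots> = \<pi> j \<cdot> \<iota> j \<cdot> f j"
    using j
    by (intro asum_single) (auto intro: HomI simp: pre2[OF biproduct_diff[OF bp]])
  finally show "\<pi> j \<cdot> asum C b S I (\<lambda>i. \<iota> i \<cdot> f i) = f j"
    using j by (simp add: pre2[OF biproduct_same[OF bp]])
qed

end

text \<open>The axiom provides direct sums over initial segments of the natural numbers; a bijection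
  transports them to any finite index set. The index sets needed are G \<times> \<Gamma> and the
  sets of factorizations of one of its elements.\<close>

lemma (in abelian_category) biproduct_exists:
  assumes "finite I" "\<And>i. i \<in> I \<Longrightarrow> A i \<in> Ob C"
  shows "\<exists>S \<iota> \<pi>. is_biproduct C I A S \<iota> \<pi>"
proof -
  obtain h where h: "bij_betw h I {..<card I}"
    using ex_bij_betw_finite_nat[OF assms(1)] by (auto simp: atLeast0LessThan)
  define h' where "h' = the_inv_into I h"
  have h': "h' n \<in> I" "h (h' n) = n" if "n < card I" for n
    using that h unfolding h'_def bij_betw_def
    by (auto intro!: the_inv_into_into f_the_inv_into_f)
  have hh: "h i < card I" "h' (h i) = i" if "i \<in> I" for i
    using that h unfolding h'_def bij_betw_def by (auto intro!: the_inv_into_f_f)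
  obtain S \<iota> \<pi> where bp: "is_biproduct C {..<card I} (A \<circ> h') S \<iota> \<pi>"
    using finite_direct_sums[of "card I" "A \<circ> h'"] assms(2) h' by auto
  note [simp] = biproduct_ob[OF bp]
  have inj: "\<iota> (h i) \<in> Hom C (A i) S" and prj: "\<pi> (h i) \<in> Hom C S (A i)" if "i \<in> I" for i
    using that biproduct_inj[OF bp, of "h i"] biproduct_prj[OF bp, of "h i"] by (simp_all add: hh)
  have "asum C S S I (\<lambda>i. \<iota> (h i) \<cdot> \<pi> (h i)) = asum C S S (h ` I) (\<lambda>n. \<iota> n \<cdot> \<pi> n)"
    using h inj prj
    by (subst asum_reindex) (auto simp: bij_betw_def intro!: comp_in)
  also have "\<dots> = Id C S"
    using biproduct_sum[OF bp] h by (simp add: bij_betw_def)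
  finally have "is_biproduct C I A S (\<iota> \<circ> h) (\<pi> \<circ> h)"
    using assms inj prj biproduct_same[OF bp, of "h _"] biproduct_diff[OF bp, of "h _" "h _"] hh
    unfolding is_biproduct_def by (fastforce dest: arg_cong[where f = h'])
  then show ?thesis
    by blast
qed

lemma (in abelian_category) biprod_is_biproduct:
  assumes "finite I" "\<And>i. i \<in> I \<Longrightarrow> A i \<in> Ob C"
  shows "is_biproduct C I A (dsum C I A) (dinj C I A) (dprj C I A)"
proof -
  have "\<exists>t. is_biproduct C I A (fst t) (fst (snd t)) (snd (snd t))"
    using biproduct_exists[OF assms] by auto
  then show ?thesis
    unfolding dsum_def dinj_def dprj_def biprod_def by (rule someI_ex)
qed

text \<open>The empty direct sum is a zero object, since its identity is an empty sum of
  arrows.\<close>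

lemma (in abelian_category) zero_ob_is_zero: "is_zero C (zero_ob C)"
proof -
  obtain S \<iota> \<pi> where bp: "is_biproduct C {} (\<lambda>_. undefined) S \<iota> \<pi>"
    using biproduct_exists[of "{}" "\<lambda>_. undefined"] by auto
  have "is_zero C S"
    using biproduct_sum[OF bp] biproduct_ob[OF bp] by (simp add: is_zero_def)
  then show ?thesis
    unfolding zero_ob_def by (rule someI)
qed

section \<open>Functors and natural transformations\<close>

context linear_category
begin

lemma
  assumes "is_functor C E Fo Fa"
  shows functor_ob: "X \<in> Ob C \<Longrightarrow> Fo X \<in> Ob E"
    and functor_id: "X \<in> Ob C \<Longrightarrow> Fa (Id C X) = Id E (Fo X)"
    and functor_arr: "f \<in> Arr C \<Longrightarrow> Fa f \<in> Arr E"
    and functor_dom: "f \<in> Arr C \<Longrightarrow> Dom E (Fa f) = Fo (Dom C f)"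
    and functor_cod: "f \<in> Arr C \<Longrightarrow> Cod E (Fa f) = Fo (Cod C f)"
    and functor_comp: "f \<in> Arr C \<Longrightarrow> g \<in> Arr C \<Longrightarrow> Dom C g = Cod C f \<Longrightarrow>
      Fa (g \<cdot> f) = Fa g \<cdot>\<^bsub>E\<^esub> Fa f"
    and functor_Hom: "f \<in> Hom C X Y \<Longrightarrow> Fa f \<in> Hom E (Fo X) (Fo Y)"
  using assms by (auto simp: is_functor_def Hom_def)

lemmas functor_simps = functor_ob functor_id functor_arr functor_dom functor_cod functor_comp

lemma functor_inverse_arrows:
  assumes "is_functor C E Fo Fa" "inverse_arrows C f g"
  shows "inverse_arrows E (Fa f) (Fa g)"
  using assms functor_simps[OF assms(1)]
  unfolding inverse_arrows_def
  by (auto simp: Hom_def functor_comp[OF assms(1), symmetric])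

lemma functor_iso: "is_functor C E Fo Fa \<Longrightarrow> is_iso C f \<Longrightarrow> is_iso E (Fa f)"
  using functor_inverse_arrows unfolding is_iso_def by blast

lemma functor_inv:
  assumes "linear_category E" "is_functor C E Fo Fa" "is_iso C f"
  shows "inv_arr E (Fa f) = Fa (inv_arr C f)"
  using linear_category.inv_arr_eq[OF assms(1)]
    functor_inverse_arrows[OF assms(2) inverse_arrows_inv[OF assms(3)]] .

lemma linear_is_functor: "is_linear_functor C E Fo Fa \<Longrightarrow> is_functor C E Fo Fa"
  by (simp add: is_linear_functor_def)

lemma linear_functor_zero:
  assumes "linear_category E" "is_linear_functor C E Fo Fa" "X \<in> Ob C" "Y \<in> Ob C"
  shows "Fa (Zero C X Y) = Zero E (Fo X) (Fo Y)"
proof (rule linear_category.plus_idem_zero[OF assms(1)])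
  note z = zero_in[OF assms(3,4)]
  show "Fa (Zero C X Y) \<in> Hom E (Fo X) (Fo Y)"
    using functor_Hom[OF linear_is_functor[OF assms(2)] z] .
  show "Plus E (Fa (Zero C X Y)) (Fa (Zero C X Y)) = Fa (Zero C X Y)"
    using assms(2) z plus_zero(1)[OF z] unfolding is_linear_functor_def by metis
qed

lemma linear_functor_plus:
  "is_linear_functor C E Fo Fa \<Longrightarrow> f \<in> Hom C X Y \<Longrightarrow> g \<in> Hom C X Y \<Longrightarrow>
    Fa (Plus C f g) = Plus E (Fa f) (Fa g)"
  unfolding is_linear_functor_def by blast

text \<open>A biproduct is given by equations between composites and sums, all of which an additive
  functor respects. Hence arrows out of \<open>Fo X\<close> may be compared on the images of the
  injections of \<open>X\<close>, for functors such as M \<mapsto> (U \<otimes> M) \<lhd> g.\<close>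

lemma linear_functor_biproduct:
  assumes "linear_category E" "is_linear_functor C E Fo Fa" "is_biproduct C I A S \<iota> \<pi>"
  shows "is_biproduct E I (\<lambda>i. Fo (A i)) (Fo S) (\<lambda>i. Fa (\<iota> i)) (\<lambda>i. Fa (\<pi> i))"
proof -
  note bp = assms(3)
  note F = linear_is_functor[OF assms(2)]
  note [simp] = HomD[OF biproduct_inj[OF bp]] HomD[OF biproduct_prj[OF bp]] biproduct_finite[OF bp]
    biproduct_ob[OF bp] biproduct_summand[OF bp] functor_simps[OF F]
  have "Id E (Fo S) = Fa (asum C S S I (\<lambda>i. \<iota> i \<cdot> \<pi> i))"
    by (simp add: biproduct_sum[OF bp])
  also have "\<dots> = asum E (Fo S) (Fo S) I (\<lambda>i. Fa (\<iota> i \<cdot> \<pi> i))"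
    using linear_functor_zero[OF assms(1,2)] linear_functor_plus[OF assms(2)] functor_Hom[OF F]
    by (intro asum_hom[OF assms(1)]) (auto intro: HomI)
  also have "\<dots> = asum E (Fo S) (Fo S) I (\<lambda>i. Fa (\<iota> i) \<cdot>\<^bsub>E\<^esub> Fa (\<pi> i))"
    by (rule linear_category.asum_cong[OF assms(1)])
      (auto intro!: HomI linear_category.arr_comp[OF assms(1)]
        linear_category.dom_comp[OF assms(1), THEN trans] linear_category.cod_comp[OF assms(1), THEN trans])
  finally have "asum E (Fo S) (Fo S) I (\<lambda>i. Fa (\<iota> i) \<cdot>\<^bsub>E\<^esub> Fa (\<pi> i)) = Id E (Fo S)" ..
  moreover have "Fa (\<pi> i) \<cdot>\<^bsub>E\<^esub> Fa (\<iota> j) =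
      (if i = j then Id E (Fo (A i)) else Zero E (Fo (A j)) (Fo (A i)))" if "i \<in> I" "j \<in> I" for i j
  proof -
    have "Fa (\<pi> i) \<cdot>\<^bsub>E\<^esub> Fa (\<iota> j) = Fa (\<pi> i \<cdot> \<iota> j)"
      using that by (intro functor_comp[OF F, symmetric]) simp_all
    then show ?thesis
      using that biproduct_same[OF bp, of i] biproduct_diff[OF bp, of i j]
      by (cases "i = j") (simp_all add: linear_functor_zero[OF assms(1,2)] del: functor_comp[OF F])
  qed
  ultimately show ?thesis
    by (simp add: is_biproduct_def Hom_def)
qed

lemma functor_comp_functor:
  "is_functor C E Fo Fa \<Longrightarrow> is_functor E E' Ho Ha \<Longrightarrow> is_functor C E' (\<lambda>X. Ho (Fo X)) (\<lambda>f. Ha (Fa f))"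
  unfolding is_functor_def by metis

lemma linear_functor_comp:
  assumes "is_linear_functor C E Fo Fa" "is_linear_functor E E' Ho Ha"
  shows "is_linear_functor C E' (\<lambda>X. Ho (Fo X)) (\<lambda>f. Ha (Fa f))"
proof -
  note H = functor_Hom[OF linear_is_functor[OF assms(1)]]
  have "Ha (Fa (Plus C f g)) = Plus E' (Ha (Fa f)) (Ha (Fa g))"
    if "f \<in> Hom C X Y" "g \<in> Hom C X Y" for X Y f g
    using that assms H[OF that(1)] H[OF that(2)] unfolding is_linear_functor_def by auto
  moreover have "Ha (Fa (Scale C x f)) = Scale E' x (Ha (Fa f))" if "f \<in> Hom C X Y" for X Y f x
    using that assms H[OF that(1)] unfolding is_linear_functor_def by auto
  ultimately show ?thesis
    using functor_comp_functor[of E Fo Fa E' Ho Ha] assms by (simp add: is_linear_functor_def)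
qed

lemma is_functor_id: "is_functor C C (\<lambda>X. X) (\<lambda>f. f)"
  by (simp add: is_functor_def)

lemma is_linear_functor_id: "is_linear_functor C C (\<lambda>X. X) (\<lambda>f. f)"
  by (simp add: is_linear_functor_def is_functor_id)

lemma natural_Hom: "is_natural C E Fo Fa Ho Ha \<tau> \<Longrightarrow> X \<in> Ob C \<Longrightarrow> \<tau> X \<in> Hom E (Fo X) (Ho X)"
  unfolding is_natural_def by blast

lemma natural_square:
  "is_natural C E Fo Fa Ho Ha \<tau> \<Longrightarrow> f \<in> Arr C \<Longrightarrow>
    \<tau> (Cod C f) \<cdot>\<^bsub>E\<^esub> Fa f = Ha f \<cdot>\<^bsub>E\<^esub> \<tau> (Dom C f)"
  unfolding is_natural_def Hom_def by blast

end

section \<open>Monoidal categories\<close>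

context linear_monoidal_category
begin

declare unit_in [simp] ten_ob [simp]

lemma
  assumes "f \<in> Arr C" "g \<in> Arr C"
  shows arr_ten [simp]: "f \<otimes>\<^sub>a g \<in> Arr C"
    and dom_ten [simp]: "Dom C (f \<otimes>\<^sub>a g) = Dom C f \<otimes>\<^sub>o Dom C g"
    and cod_ten [simp]: "Cod C (f \<otimes>\<^sub>a g) = Cod C f \<otimes>\<^sub>o Cod C g"
  using ten_arr[of f "Dom C f" "Cod C f" g "Dom C g" "Cod C g"] assms by (auto simp: Hom_def)

declare ten_id [simp]

lemma ten_collapse:
  "f \<in> Arr C \<Longrightarrow> g \<in> Arr C \<Longrightarrow> f' \<in> Arr C \<Longrightarrow> g' \<in> Arr C \<Longrightarrow> Dom C f' = Cod C f \<Longrightarrow>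
    Dom C g' = Cod C g \<Longrightarrow> (f' \<otimes>\<^sub>a g') \<cdot> (f \<otimes>\<^sub>a g) = (f' \<cdot> f) \<otimes>\<^sub>a (g' \<cdot> g)"
  by (rule ten_comp[symmetric]) (auto simp: Hom_def)

lemma ten_collapse_pre:
  "f \<in> Arr C \<Longrightarrow> g \<in> Arr C \<Longrightarrow> f' \<in> Arr C \<Longrightarrow> g' \<in> Arr C \<Longrightarrow> Dom C f' = Cod C f \<Longrightarrow>
    Dom C g' = Cod C g \<Longrightarrow> z \<in> into C (Dom C f \<otimes>\<^sub>o Dom C g) \<Longrightarrow>
    (f' \<otimes>\<^sub>a g') \<cdot> (f \<otimes>\<^sub>a g) \<cdot> z = ((f' \<cdot> f) \<otimes>\<^sub>a (g' \<cdot> g)) \<cdot> z"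
  using pre2[OF ten_collapse] by simp

lemmas ten_collapse_simps = ten_collapse ten_collapse_pre

lemma
  assumes "X \<in> Ob C" "Y \<in> Ob C" "Z \<in> Ob C"
  shows is_iso_assoc [simp]: "is_iso C (Assoc C X Y Z)"
    and arr_assoc [simp]: "Assoc C X Y Z \<in> Arr C"
    and dom_assoc [simp]: "Dom C (Assoc C X Y Z) = X \<otimes>\<^sub>o Y \<otimes>\<^sub>o Z"
    and cod_assoc [simp]: "Cod C (Assoc C X Y Z) = X \<otimes>\<^sub>o (Y \<otimes>\<^sub>o Z)"
  using assoc_iso[OF assms] by (auto simp: Iso_def Hom_def)

lemma
  assumes "X \<in> Ob C"
  shows is_iso_lunit [simp]: "is_iso C (LUnit C X)"
    and arr_lunit [simp]: "LUnit C X \<in> Arr C"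
    and dom_lunit [simp]: "Dom C (LUnit C X) = Unit C \<otimes>\<^sub>o X"
    and cod_lunit [simp]: "Cod C (LUnit C X) = X"
    and is_iso_runit [simp]: "is_iso C (RUnit C X)"
    and arr_runit [simp]: "RUnit C X \<in> Arr C"
    and dom_runit [simp]: "Dom C (RUnit C X) = X \<otimes>\<^sub>o Unit C"
    and cod_runit [simp]: "Cod C (RUnit C X) = X"
  using lunit_iso[OF assms] runit_iso[OF assms] by (auto simp: Iso_def Hom_def)

lemma assoc_nat:
  "f \<in> Arr C \<Longrightarrow> g \<in> Arr C \<Longrightarrow> h \<in> Arr C \<Longrightarrow> Cod C f = X \<Longrightarrow> Cod C g = Y \<Longrightarrow> Cod C h = Z \<Longrightarrow>
    Assoc C X Y Z \<cdot> (f \<otimes>\<^sub>a g \<otimes>\<^sub>a h) = (f \<otimes>\<^sub>a (g \<otimes>\<^sub>a h)) \<cdot> Assoc C (Dom C f) (Dom C g) (Dom C h)"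
  using assoc_natural[of f "Dom C f" "Cod C f" g "Dom C g" "Cod C g" h "Dom C h" "Cod C h"]
  by (simp add: Hom_def)

lemma assoc_nat_id:
  "X \<in> Ob C \<Longrightarrow> Y \<in> Ob C \<Longrightarrow> h \<in> Arr C \<Longrightarrow> Cod C h = Z \<Longrightarrow>
    Assoc C X Y Z \<cdot> (Id C (X \<otimes>\<^sub>o Y) \<otimes>\<^sub>a h) = (Id C X \<otimes>\<^sub>a (Id C Y \<otimes>\<^sub>a h)) \<cdot> Assoc C X Y (Dom C h)"
  using assoc_nat[of "Id C X" "Id C Y" h X Y Z] by simp

lemmas assoc_nat_simps = assoc_nat pre2[OF assoc_nat] assoc_nat_id pre2[OF assoc_nat_id]

lemma lunit_nat: "f \<in> Arr C \<Longrightarrow> Cod C f = X \<Longrightarrow>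
    LUnit C X \<cdot> (Id C (Unit C) \<otimes>\<^sub>a f) = f \<cdot> LUnit C (Dom C f)"
  using lunit_natural[of f "Dom C f" "Cod C f"] by (simp add: Hom_def)

lemma runit_nat: "f \<in> Arr C \<Longrightarrow> Cod C f = X \<Longrightarrow>
    RUnit C X \<cdot> (f \<otimes>\<^sub>a Id C (Unit C)) = f \<cdot> RUnit C (Dom C f)"
  using runit_natural[of f "Dom C f" "Cod C f"] by (simp add: Hom_def)

lemmas lunit_nat_simps = lunit_nat pre2[OF lunit_nat]
lemmas runit_nat_simps = runit_nat pre2[OF runit_nat]

lemma inverse_arrows_ten:
  "inverse_arrows C f f' \<Longrightarrow> inverse_arrows C g g' \<Longrightarrow> inverse_arrows C (f \<otimes>\<^sub>a g) (f' \<otimes>\<^sub>a g')"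
  by (auto simp: inverse_arrows_def Hom_def ten_collapse)

lemma is_iso_ten [simp]: "is_iso C f \<Longrightarrow> is_iso C g \<Longrightarrow> is_iso C (f \<otimes>\<^sub>a g)"
  using inverse_arrows_ten unfolding is_iso_def by blast

lemma inv_ten: "is_iso C f \<Longrightarrow> is_iso C g \<Longrightarrow> inv_arr C (f \<otimes>\<^sub>a g) = inv_arr C f \<otimes>\<^sub>a inv_arr C g"
  by (rule inv_arr_eq) (simp add: inverse_arrows_ten inverse_arrows_inv)

section \<open>Unit coherence deduced from the pentagon and the triangle\<close>

lemma unit_ten_faithful:
  assumes "Id C (Unit C) \<otimes>\<^sub>a f = Id C (Unit C) \<otimes>\<^sub>a g" "f \<in> Hom C a b" "g \<in> Hom C a b"
  shows "f = g"
proof -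
  note [simp] = HomD[OF assms(2)] HomD[OF assms(3)] Hom_ob[OF assms(2)]
  have "f \<cdot> LUnit C a = g \<cdot> LUnit C a"
    using lunit_nat[of f b] lunit_nat[of g b] assms(1) by simp
  then show ?thesis
    by (rule iso_right_cancel) simp_all
qed

lemma ten_unit_faithful:
  assumes "f \<otimes>\<^sub>a Id C (Unit C) = g \<otimes>\<^sub>a Id C (Unit C)" "f \<in> Hom C a b" "g \<in> Hom C a b"
  shows "f = g"
proof -
  note [simp] = HomD[OF assms(2)] HomD[OF assms(3)] Hom_ob[OF assms(2)]
  have "f \<cdot> RUnit C a = g \<cdot> RUnit C a"
    using runit_nat[of f b] runit_nat[of g b] assms(1) by simp
  then show ?thesis
    by (rule iso_right_cancel) simp_all
qed

text \<open>Kelly's argument: tensoring with the unit on the left is faithful, so the identity is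
  checked after doing so and composing with the invertible \<open>?h\<close>. There the pentagon and
  two instances of the triangle connect the two sides.\<close>

lemma lunit_ten:
  assumes [simp]: "X \<in> Ob C" "Y \<in> Ob C"
  shows "LUnit C (X \<otimes>\<^sub>o Y) \<cdot> Assoc C (Unit C) X Y = LUnit C X \<otimes>\<^sub>a Id C Y"
proof (rule unit_ten_faithful)
  let ?I = "Unit C"
  let ?h = "Assoc C ?I (?I \<otimes>\<^sub>o X) Y \<cdot> (Assoc C ?I ?I X \<otimes>\<^sub>a Id C Y)"
  show "Id C ?I \<otimes>\<^sub>a (LUnit C (X \<otimes>\<^sub>o Y) \<cdot> Assoc C ?I X Y) = Id C ?I \<otimes>\<^sub>a (LUnit C X \<otimes>\<^sub>a Id C Y)"
  proof (rule iso_right_cancel[where a = ?h])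
    have "(Id C ?I \<otimes>\<^sub>a (LUnit C (X \<otimes>\<^sub>o Y) \<cdot> Assoc C ?I X Y)) \<cdot> ?h =
        (Id C ?I \<otimes>\<^sub>a LUnit C (X \<otimes>\<^sub>o Y)) \<cdot> (Id C ?I \<otimes>\<^sub>a Assoc C ?I X Y) \<cdot> ?h"
      by (simp add: ten_collapse_pre)
    also have "\<dots> = (Id C ?I \<otimes>\<^sub>a LUnit C (X \<otimes>\<^sub>o Y)) \<cdot> Assoc C ?I ?I (X \<otimes>\<^sub>o Y) \<cdot> Assoc C (?I \<otimes>\<^sub>o ?I) X Y"
      by (simp add: pentagon)
    also have "\<dots> = Assoc C ?I X Y \<cdot> (RUnit C ?I \<otimes>\<^sub>a Id C X \<otimes>\<^sub>a Id C Y)"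
      by (simp add: pre2[OF triangle] assoc_nat del: ten_id) (simp add: assoc_nat)
    also have "\<dots> = Assoc C ?I X Y \<cdot> (((Id C ?I \<otimes>\<^sub>a LUnit C X) \<cdot> Assoc C ?I ?I X) \<otimes>\<^sub>a Id C Y)"
      by (simp add: triangle)
    also have "\<dots> = Assoc C ?I X Y \<cdot> (Id C ?I \<otimes>\<^sub>a LUnit C X \<otimes>\<^sub>a Id C Y) \<cdot> (Assoc C ?I ?I X \<otimes>\<^sub>a Id C Y)"
      by (simp add: ten_collapse)
    also have "\<dots> = (Id C ?I \<otimes>\<^sub>a (LUnit C X \<otimes>\<^sub>a Id C Y)) \<cdot> ?h"
      by (simp add: assoc_nat_simps)
    finally show "(Id C ?I \<otimes>\<^sub>a (LUnit C (X \<otimes>\<^sub>o Y) \<cdot> Assoc C ?I X Y)) \<cdot> ?h =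
        (Id C ?I \<otimes>\<^sub>a (LUnit C X \<otimes>\<^sub>a Id C Y)) \<cdot> ?h" .
  qed simp_all
qed (simp_all add: Hom_def)

text \<open>Mirror image of \<open>lunit_ten\<close>: tensor with the unit on the right, compose
  with the associator \<open>?a\<close>, and use the pentagon with the triangles for
  \<open>Y\<close> and for X \<otimes> Y.\<close>

lemma runit_ten:
  assumes [simp]: "X \<in> Ob C" "Y \<in> Ob C"
  shows "(Id C X \<otimes>\<^sub>a RUnit C Y) \<cdot> Assoc C X Y (Unit C) = RUnit C (X \<otimes>\<^sub>o Y)"
proof (rule ten_unit_faithful)
  let ?I = "Unit C"
  let ?a = "Assoc C X Y ?I"
  show "((Id C X \<otimes>\<^sub>a RUnit C Y) \<cdot> ?a) \<otimes>\<^sub>a Id C ?I = RUnit C (X \<otimes>\<^sub>o Y) \<otimes>\<^sub>a Id C ?I"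
  proof (rule iso_left_cancel[where a = ?a])
    have "?a \<cdot> (((Id C X \<otimes>\<^sub>a RUnit C Y) \<cdot> ?a) \<otimes>\<^sub>a Id C ?I) =
        ?a \<cdot> (Id C X \<otimes>\<^sub>a RUnit C Y \<otimes>\<^sub>a Id C ?I) \<cdot> (?a \<otimes>\<^sub>a Id C ?I)"
      by (simp add: ten_collapse)
    also have "\<dots> = (Id C X \<otimes>\<^sub>a (RUnit C Y \<otimes>\<^sub>a Id C ?I)) \<cdot> Assoc C X (Y \<otimes>\<^sub>o ?I) ?I \<cdot> (?a \<otimes>\<^sub>a Id C ?I)"
      by (simp add: assoc_nat_simps)
    also have "\<dots> = (Id C X \<otimes>\<^sub>a (Id C Y \<otimes>\<^sub>a LUnit C ?I)) \<cdot> (Id C X \<otimes>\<^sub>a Assoc C Y ?I ?I) \<cdot>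
        Assoc C X (Y \<otimes>\<^sub>o ?I) ?I \<cdot> (?a \<otimes>\<^sub>a Id C ?I)"
      by (simp add: triangle[symmetric] ten_collapse_pre)
    also have "\<dots> = (Id C X \<otimes>\<^sub>a (Id C Y \<otimes>\<^sub>a LUnit C ?I)) \<cdot> Assoc C X Y (?I \<otimes>\<^sub>o ?I) \<cdot> Assoc C (X \<otimes>\<^sub>o Y) ?I ?I"
      by (simp add: pentagon)
    also have "\<dots> = ?a \<cdot> (Id C (X \<otimes>\<^sub>o Y) \<otimes>\<^sub>a LUnit C ?I) \<cdot> Assoc C (X \<otimes>\<^sub>o Y) ?I ?I"
      by (simp add: assoc_nat_simps)
    also have "\<dots> = ?a \<cdot> (RUnit C (X \<otimes>\<^sub>o Y) \<otimes>\<^sub>a Id C ?I)"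
      by (simp add: triangle)
    finally show "?a \<cdot> (((Id C X \<otimes>\<^sub>a RUnit C Y) \<cdot> ?a) \<otimes>\<^sub>a Id C ?I) = ?a \<cdot> (RUnit C (X \<otimes>\<^sub>o Y) \<otimes>\<^sub>a Id C ?I)" .
  qed simp_all
qed (simp_all add: Hom_def)

lemma assoc_inv_nat:
  "f \<in> Arr C \<Longrightarrow> g \<in> Arr C \<Longrightarrow> h \<in> Arr C \<Longrightarrow> Cod C f = X \<Longrightarrow> Cod C g = Y \<Longrightarrow> Cod C h = Z \<Longrightarrow>
    inv_arr C (Assoc C X Y Z) \<cdot> (f \<otimes>\<^sub>a (g \<otimes>\<^sub>a h)) =
    (f \<otimes>\<^sub>a g \<otimes>\<^sub>a h) \<cdot> inv_arr C (Assoc C (Dom C f) (Dom C g) (Dom C h))"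
  by (rule inv_slide) (auto simp: assoc_nat)

lemmas assoc_inv_nat_simps =
  assoc_inv_nat pre2[OF assoc_inv_nat]

lemma assoc_back:
  "f \<in> Arr C \<Longrightarrow> g \<in> Arr C \<Longrightarrow> h \<in> Arr C \<Longrightarrow> Dom C f = X \<Longrightarrow> Dom C g = Y \<Longrightarrow> Dom C h = Z \<Longrightarrow>
    (f \<otimes>\<^sub>a (g \<otimes>\<^sub>a h)) \<cdot> Assoc C X Y Z = Assoc C (Cod C f) (Cod C g) (Cod C h) \<cdot> (f \<otimes>\<^sub>a g \<otimes>\<^sub>a h)"
  using assoc_nat[of f g h] by simp

lemma assoc_nat_left_id:
  "f \<in> Arr C \<Longrightarrow> Dom C f = X \<Longrightarrow> Y \<in> Ob C \<Longrightarrow> Z \<in> Ob C \<Longrightarrow>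
    (f \<otimes>\<^sub>a Id C (Y \<otimes>\<^sub>o Z)) \<cdot> Assoc C X Y Z = Assoc C (Cod C f) Y Z \<cdot> (f \<otimes>\<^sub>a Id C Y \<otimes>\<^sub>a Id C Z)"
  using assoc_nat[of f "Id C Y" "Id C Z"] by simp

lemma ten_zero_right:
  assumes "f \<in> Arr C" "Y \<in> Ob C" "Y' \<in> Ob C"
  shows "f \<otimes>\<^sub>a Zero C Y Y' = Zero C (Dom C f \<otimes>\<^sub>o Y) (Cod C f \<otimes>\<^sub>o Y')"
proof (rule plus_idem_zero)
  have f: "f \<in> Hom C (Dom C f) (Cod C f)"
    using assms by (simp add: Hom_def)
  have z: "Zero C Y Y' \<in> Hom C Y Y'"
    using assms zero_in by simp
  show "f \<otimes>\<^sub>a Zero C Y Y' \<in> Hom C (Dom C f \<otimes>\<^sub>o Y) (Cod C f \<otimes>\<^sub>o Y')"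
    by (rule ten_arr[OF f z])
  show "Plus C (f \<otimes>\<^sub>a Zero C Y Y') (f \<otimes>\<^sub>a Zero C Y Y') = f \<otimes>\<^sub>a Zero C Y Y'"
    using ten_plus_right[OF f z z] plus_zero(1)[OF z] by simp
qed

subsection \<open>Tensoring with a dualizable object is exact\<close>

lemma ten_linear_functor:
  assumes [simp]: "X \<in> Ob C"
  shows "is_linear_functor C C (\<lambda>M. X \<otimes>\<^sub>o M) (\<lambda>f. Id C X \<otimes>\<^sub>a f)"
  by (auto simp: is_linear_functor_def is_functor_def Hom_def ten_collapse
      intro: ten_plus_right[OF id_in] ten_scale_right[OF id_in])

lemma ten_linear_functor_right:
  assumes [simp]: "X \<in> Ob C"
  shows "is_linear_functor C C (\<lambda>M. M \<otimes>\<^sub>o X) (\<lambda>f. f \<otimes>\<^sub>a Id C X)"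
  by (auto simp: is_linear_functor_def is_functor_def Hom_def ten_collapse
      intro: ten_plus_left[OF _ _ id_in] ten_scale_left[OF _ id_in])

text \<open>The first zigzag equation tensored with \<open>b\<close>, which is one triangle identity
  for the adjunction between V \<otimes> - and X \<otimes> -. The pentagon and the triangle regroup
  the factors, and \<open>lunit_ten\<close> identifies the result.\<close>

lemma dual_zigzag_left:
  assumes "is_duality C V X ev coev" and [simp]: "b \<in> Ob C"
  shows "(Id C X \<otimes>\<^sub>a LUnit C b) \<cdot> (Id C X \<otimes>\<^sub>a (ev \<otimes>\<^sub>a Id C b)) \<cdot> (Id C X \<otimes>\<^sub>a inv_arr C (Assoc C V X b)) \<cdot>
      Assoc C X V (X \<otimes>\<^sub>o b) \<cdot> (coev \<otimes>\<^sub>a Id C (X \<otimes>\<^sub>o b)) = LUnit C (X \<otimes>\<^sub>o b)"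
    (is "?Z = _")
proof (rule iso_right_cancel[where a = "Assoc C (Unit C) X b"])
  have [simp]: "V \<in> Ob C" "X \<in> Ob C" and ev: "ev \<in> Hom C (V \<otimes>\<^sub>o X) (Unit C)"
    and coev: "coev \<in> Hom C (Unit C) (X \<otimes>\<^sub>o V)"
    and zz: "RUnit C X \<cdot> (Id C X \<otimes>\<^sub>a ev) \<cdot> Assoc C X V X \<cdot> (coev \<otimes>\<^sub>a Id C X) = LUnit C X"
    using assms by (auto simp: is_duality_def)
  note [simp] = HomD[OF ev] HomD[OF coev]
  have eq: "(coev \<otimes>\<^sub>a Id C (X \<otimes>\<^sub>o b)) \<cdot> Assoc C (Unit C) X b = Assoc C (X \<otimes>\<^sub>o V) X b \<cdot> (coev \<otimes>\<^sub>a Id C X \<otimes>\<^sub>a Id C b)"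
    by (simp add: assoc_nat)
  have "?Z \<cdot> Assoc C (Unit C) X b =
      (Id C X \<otimes>\<^sub>a LUnit C b) \<cdot> (Id C X \<otimes>\<^sub>a (ev \<otimes>\<^sub>a Id C b)) \<cdot> (Id C X \<otimes>\<^sub>a inv_arr C (Assoc C V X b)) \<cdot>
      Assoc C X V (X \<otimes>\<^sub>o b) \<cdot> Assoc C (X \<otimes>\<^sub>o V) X b \<cdot> (coev \<otimes>\<^sub>a Id C X \<otimes>\<^sub>a Id C b)"
    by (simp add: eq)
  also have "\<dots> = (Id C X \<otimes>\<^sub>a LUnit C b) \<cdot> (Id C X \<otimes>\<^sub>a (ev \<otimes>\<^sub>a Id C b)) \<cdot>
      Assoc C X (V \<otimes>\<^sub>o X) b \<cdot> (Assoc C X V X \<otimes>\<^sub>a Id C b) \<cdot> (coev \<otimes>\<^sub>a Id C X \<otimes>\<^sub>a Id C b)"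
    by (simp add: pre2[OF pentagon] ten_collapse_pre)
  also have "\<dots> = ((RUnit C X \<otimes>\<^sub>a Id C b) \<cdot> (Id C X \<otimes>\<^sub>a ev \<otimes>\<^sub>a Id C b)) \<cdot> (Assoc C X V X \<otimes>\<^sub>a Id C b) \<cdot>
      (coev \<otimes>\<^sub>a Id C X \<otimes>\<^sub>a Id C b)"
    by (simp add: triangle[symmetric] assoc_nat_simps)
  also have "\<dots> = (RUnit C X \<cdot> (Id C X \<otimes>\<^sub>a ev) \<cdot> Assoc C X V X \<cdot> (coev \<otimes>\<^sub>a Id C X)) \<otimes>\<^sub>a Id C b"
    by (simp add: ten_collapse_simps)
  also have "\<dots> = LUnit C (X \<otimes>\<^sub>o b) \<cdot> Assoc C (Unit C) X b"
    by (simp only: zz) (simp add: lunit_ten)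
  finally show "?Z \<cdot> Assoc C (Unit C) X b = LUnit C (X \<otimes>\<^sub>o b) \<cdot> Assoc C (Unit C) X b" .
  show "?Z \<in> Arr C" "Dom C ?Z = Cod C (Assoc C (Unit C) X b)"
    by simp_all
qed (use assms in \<open>simp_all add: is_duality_def\<close>)

text \<open>The other triangle identity of the same adjunction, from the second zigzag
  equation.\<close>

lemma dual_zigzag_right:
  assumes "is_duality C V X ev coev" and [simp]: "a \<in> Ob C"
  shows "LUnit C (V \<otimes>\<^sub>o a) \<cdot> (ev \<otimes>\<^sub>a Id C (V \<otimes>\<^sub>o a)) \<cdot> inv_arr C (Assoc C V X (V \<otimes>\<^sub>o a)) \<cdot>
      (Id C V \<otimes>\<^sub>a Assoc C X V a) \<cdot> (Id C V \<otimes>\<^sub>a (coev \<otimes>\<^sub>a Id C a)) = Id C V \<otimes>\<^sub>a LUnit C a"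
    (is "?Z = _")
proof (rule iso_right_cancel[where a = "Assoc C V (Unit C) a"])
  have [simp]: "V \<in> Ob C" "X \<in> Ob C" and ev: "ev \<in> Hom C (V \<otimes>\<^sub>o X) (Unit C)"
    and coev: "coev \<in> Hom C (Unit C) (X \<otimes>\<^sub>o V)"
    and zz: "LUnit C V \<cdot> (ev \<otimes>\<^sub>a Id C V) \<cdot> inv_arr C (Assoc C V X V) \<cdot> (Id C V \<otimes>\<^sub>a coev) = RUnit C V"
    using assms by (auto simp: is_duality_def)
  note [simp] = HomD[OF ev] HomD[OF coev]
  \<comment> \<open>The pentagon with the associator of V, X, V moved to the other side, where it
    becomes the inverse that occurs in the second zigzag equation.\<close>
  have pent: "(Id C V \<otimes>\<^sub>a Assoc C X V a) \<cdot> Assoc C V (X \<otimes>\<^sub>o V) a =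
      Assoc C V X (V \<otimes>\<^sub>o a) \<cdot> Assoc C (V \<otimes>\<^sub>o X) V a \<cdot> (inv_arr C (Assoc C V X V) \<otimes>\<^sub>a Id C a)"
    using pre2[OF pentagon, of V X V a "inv_arr C (Assoc C V X V) \<otimes>\<^sub>a Id C a"]
    by (simp add: ten_collapse)
  have "?Z \<cdot> Assoc C V (Unit C) a =
      LUnit C (V \<otimes>\<^sub>o a) \<cdot> (ev \<otimes>\<^sub>a Id C (V \<otimes>\<^sub>o a)) \<cdot> inv_arr C (Assoc C V X (V \<otimes>\<^sub>o a)) \<cdot>
      (Id C V \<otimes>\<^sub>a Assoc C X V a) \<cdot> Assoc C V (X \<otimes>\<^sub>o V) a \<cdot> (Id C V \<otimes>\<^sub>a coev \<otimes>\<^sub>a Id C a)"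
    by (simp add: assoc_nat)
  also have "\<dots> = LUnit C (V \<otimes>\<^sub>o a) \<cdot> (ev \<otimes>\<^sub>a Id C (V \<otimes>\<^sub>o a)) \<cdot>
      Assoc C (V \<otimes>\<^sub>o X) V a \<cdot> (inv_arr C (Assoc C V X V) \<otimes>\<^sub>a Id C a) \<cdot> (Id C V \<otimes>\<^sub>a coev \<otimes>\<^sub>a Id C a)"
    by (simp add: pre2[OF pent])
  also have "\<dots> = LUnit C (V \<otimes>\<^sub>o a) \<cdot> Assoc C (Unit C) V a \<cdot> (ev \<otimes>\<^sub>a Id C V \<otimes>\<^sub>a Id C a) \<cdot>
      (inv_arr C (Assoc C V X V) \<otimes>\<^sub>a Id C a) \<cdot> (Id C V \<otimes>\<^sub>a coev \<otimes>\<^sub>a Id C a)"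
    by (simp add: assoc_nat_simps)
  also have "\<dots> = (LUnit C V \<otimes>\<^sub>a Id C a) \<cdot> (ev \<otimes>\<^sub>a Id C V \<otimes>\<^sub>a Id C a) \<cdot>
      (inv_arr C (Assoc C V X V) \<otimes>\<^sub>a Id C a) \<cdot> (Id C V \<otimes>\<^sub>a coev \<otimes>\<^sub>a Id C a)"
    by (simp add: lunit_ten[symmetric])
  also have "\<dots> = (LUnit C V \<cdot> (ev \<otimes>\<^sub>a Id C V) \<cdot> inv_arr C (Assoc C V X V) \<cdot> (Id C V \<otimes>\<^sub>a coev)) \<otimes>\<^sub>a Id C a"
    by (simp add: ten_collapse_simps)
  also have "\<dots> = (Id C V \<otimes>\<^sub>a LUnit C a) \<cdot> Assoc C V (Unit C) a"
    by (simp only: zz) (simp add: triangle)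
  finally show "?Z \<cdot> Assoc C V (Unit C) a = (Id C V \<otimes>\<^sub>a LUnit C a) \<cdot> Assoc C V (Unit C) a" .
  show "?Z \<in> Arr C" "Dom C ?Z = Cod C (Assoc C V (Unit C) a)"
    by simp_all
qed (use assms in \<open>simp_all add: is_duality_def\<close>)

text \<open>A left dual \<open>V\<close> of \<open>X\<close> makes $V\otimes -$ left adjoint to $X\otimes -$; these are the two
  transposition maps.\<close>

definition transpose_down :: "'o \<Rightarrow> 'o \<Rightarrow> 'm \<Rightarrow> 'o \<Rightarrow> 'm \<Rightarrow> 'm" where
  "transpose_down V X ev b h =
     LUnit C b \<cdot> (ev \<otimes>\<^sub>a Id C b) \<cdot> inv_arr C (Assoc C V X b) \<cdot> (Id C V \<otimes>\<^sub>a h)"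

definition transpose_up :: "'o \<Rightarrow> 'o \<Rightarrow> 'm \<Rightarrow> 'o \<Rightarrow> 'm \<Rightarrow> 'm" where
  "transpose_up V X coev a f =
     (Id C X \<otimes>\<^sub>a f) \<cdot> Assoc C X V a \<cdot> (coev \<otimes>\<^sub>a Id C a) \<cdot> inv_arr C (LUnit C a)"

context
  fixes V X ev coev
  assumes dual: "is_duality C V X ev coev"
begin

lemma dual_obs: "V \<in> Ob C" "X \<in> Ob C" "ev \<in> Hom C (V \<otimes>\<^sub>o X) (Unit C)" "coev \<in> Hom C (Unit C) (X \<otimes>\<^sub>o V)"
  using dual by (simp_all add: is_duality_def)

lemma transpose_down_in: "h \<in> Hom C a (X \<otimes>\<^sub>o b) \<Longrightarrow> b \<in> Ob C \<Longrightarrow> transpose_down V X ev b h \<in> Hom C (V \<otimes>\<^sub>o a) b"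
  using dual_obs by (auto simp: transpose_down_def Hom_def)

lemma transpose_up_in: "f \<in> Hom C (V \<otimes>\<^sub>o a) b \<Longrightarrow> a \<in> Ob C \<Longrightarrow> transpose_up V X coev a f \<in> Hom C a (X \<otimes>\<^sub>o b)"
  using dual_obs by (auto simp: transpose_up_def Hom_def)

lemma transpose_down_nat:
  assumes "h \<in> Hom C a (X \<otimes>\<^sub>o b)" "f \<in> Hom C b c"
  shows "transpose_down V X ev c ((Id C X \<otimes>\<^sub>a f) \<cdot> h) = f \<cdot> transpose_down V X ev b h"
proof -
  note [simp] = dual_obs(1,2) HomD[OF dual_obs(3)] HomD[OF dual_obs(4)] HomD[OF assms(1)]
    HomD[OF assms(2)] Hom_ob[OF assms(2)]
  have "transpose_down V X ev c ((Id C X \<otimes>\<^sub>a f) \<cdot> h) =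
      LUnit C c \<cdot> (ev \<otimes>\<^sub>a Id C c) \<cdot> inv_arr C (Assoc C V X c) \<cdot> (Id C V \<otimes>\<^sub>a (Id C X \<otimes>\<^sub>a f)) \<cdot> (Id C V \<otimes>\<^sub>a h)"
    by (simp add: transpose_down_def ten_collapse)
  also have "\<dots> = LUnit C c \<cdot> (ev \<otimes>\<^sub>a Id C c) \<cdot> (Id C (V \<otimes>\<^sub>o X) \<otimes>\<^sub>a f) \<cdot> inv_arr C (Assoc C V X b) \<cdot> (Id C V \<otimes>\<^sub>a h)"
    by (simp add: assoc_inv_nat_simps)
  also have "\<dots> = LUnit C c \<cdot> (Id C (Unit C) \<otimes>\<^sub>a f) \<cdot> (ev \<otimes>\<^sub>a Id C b) \<cdot> inv_arr C (Assoc C V X b) \<cdot> (Id C V \<otimes>\<^sub>a h)"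
    by (simp add: ten_collapse_pre)
  also have "\<dots> = f \<cdot> transpose_down V X ev b h"
    by (simp add: lunit_nat_simps transpose_down_def)
  finally show ?thesis .
qed

lemma transpose_up_nat:
  assumes "f \<in> Hom C (V \<otimes>\<^sub>o a) b" "h \<in> Hom C c a"
  shows "transpose_up V X coev c (f \<cdot> (Id C V \<otimes>\<^sub>a h)) = transpose_up V X coev a f \<cdot> h"
proof -
  note [simp] = dual_obs(1,2) HomD[OF dual_obs(3)] HomD[OF dual_obs(4)] HomD[OF assms(1)]
    HomD[OF assms(2)] Hom_ob[OF assms(2)]
  have l: "(Id C (Unit C) \<otimes>\<^sub>a h) \<cdot> inv_arr C (LUnit C c) = inv_arr C (LUnit C a) \<cdot> h"
    by (rule inv_slide[symmetric]) (simp_all add: lunit_nat)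
  have "transpose_up V X coev a f \<cdot> h =
      (Id C X \<otimes>\<^sub>a f) \<cdot> Assoc C X V a \<cdot> (coev \<otimes>\<^sub>a Id C a) \<cdot> (Id C (Unit C) \<otimes>\<^sub>a h) \<cdot> inv_arr C (LUnit C c)"
    by (simp add: transpose_up_def l)
  also have "\<dots> = (Id C X \<otimes>\<^sub>a f) \<cdot> Assoc C X V a \<cdot> (Id C (X \<otimes>\<^sub>o V) \<otimes>\<^sub>a h) \<cdot> (coev \<otimes>\<^sub>a Id C c) \<cdot> inv_arr C (LUnit C c)"
    by (simp add: ten_collapse_pre)
  also have "\<dots> = (Id C X \<otimes>\<^sub>a f) \<cdot> (Id C X \<otimes>\<^sub>a (Id C V \<otimes>\<^sub>a h)) \<cdot> Assoc C X V c \<cdot> (coev \<otimes>\<^sub>a Id C c) \<cdot> inv_arr C (LUnit C c)"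
    by (simp add: assoc_nat_simps)
  also have "\<dots> = transpose_up V X coev c (f \<cdot> (Id C V \<otimes>\<^sub>a h))"
    by (simp add: ten_collapse_pre transpose_up_def)
  finally show ?thesis ..
qed

text \<open>A Yoneda argument: naturality in the domain reduces the claim to the identity of X
  \<otimes> b, and there it is the first zigzag.\<close>

lemma transpose_up_down:
  assumes "h \<in> Hom C a (X \<otimes>\<^sub>o b)" and [simp]: "b \<in> Ob C"
  shows "transpose_up V X coev a (transpose_down V X ev b h) = h"
proof -
  note [simp] = dual_obs(1,2) HomD[OF dual_obs(3)] HomD[OF dual_obs(4)] HomD[OF assms(1)]
    Hom_ob[OF assms(1)]
  have "transpose_up V X coev a (transpose_down V X ev b h) =
      transpose_up V X coev a (transpose_down V X ev b (Id C (X \<otimes>\<^sub>o b)) \<cdot> (Id C V \<otimes>\<^sub>a h))"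
    by (simp add: transpose_down_def)
  also have "\<dots> = transpose_up V X coev (X \<otimes>\<^sub>o b) (transpose_down V X ev b (Id C (X \<otimes>\<^sub>o b))) \<cdot> h"
    by (rule transpose_up_nat[OF transpose_down_in]) (auto intro: HomI)
  also have "transpose_up V X coev (X \<otimes>\<^sub>o b) (transpose_down V X ev b (Id C (X \<otimes>\<^sub>o b))) =
      ((Id C X \<otimes>\<^sub>a LUnit C b) \<cdot> (Id C X \<otimes>\<^sub>a (ev \<otimes>\<^sub>a Id C b)) \<cdot> (Id C X \<otimes>\<^sub>a inv_arr C (Assoc C V X b)) \<cdot>
      Assoc C X V (X \<otimes>\<^sub>o b) \<cdot> (coev \<otimes>\<^sub>a Id C (X \<otimes>\<^sub>o b))) \<cdot> inv_arr C (LUnit C (X \<otimes>\<^sub>o b))"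
    by (simp add: transpose_up_def transpose_down_def ten_collapse_pre)
  also have "\<dots> = LUnit C (X \<otimes>\<^sub>o b) \<cdot> inv_arr C (LUnit C (X \<otimes>\<^sub>o b))"
    by (simp only: dual_zigzag_left[OF dual \<open>b \<in> Ob C\<close>])
  finally show ?thesis
    by simp
qed

text \<open>Dually, naturality in the codomain reduces the claim to the identity of V \<otimes> a
  and the second zigzag.\<close>

lemma transpose_down_up:
  assumes "f \<in> Hom C (V \<otimes>\<^sub>o a) b" and [simp]: "a \<in> Ob C"
  shows "transpose_down V X ev b (transpose_up V X coev a f) = f"
proof -
  note [simp] = dual_obs(1,2) HomD[OF dual_obs(3)] HomD[OF dual_obs(4)] HomD[OF assms(1)]
    Hom_ob[OF assms(1)]
  let ?u = "transpose_up V X coev a (Id C (V \<otimes>\<^sub>o a))"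
  have u: "?u \<in> Hom C a (X \<otimes>\<^sub>o (V \<otimes>\<^sub>o a))"
    by (rule transpose_up_in) (auto intro: HomI)
  have "transpose_down V X ev b (transpose_up V X coev a f) =
      transpose_down V X ev b ((Id C X \<otimes>\<^sub>a f) \<cdot> ?u)"
    by (simp add: transpose_up_def)
  also have "\<dots> = f \<cdot> transpose_down V X ev (V \<otimes>\<^sub>o a) ?u"
    by (rule transpose_down_nat[OF u assms(1)])
  also have "transpose_down V X ev (V \<otimes>\<^sub>o a) ?u = (LUnit C (V \<otimes>\<^sub>o a) \<cdot> (ev \<otimes>\<^sub>a Id C (V \<otimes>\<^sub>o a)) \<cdot>
      inv_arr C (Assoc C V X (V \<otimes>\<^sub>o a)) \<cdot> (Id C V \<otimes>\<^sub>a Assoc C X V a) \<cdot> (Id C V \<otimes>\<^sub>a (coev \<otimes>\<^sub>a Id C a))) \<cdot>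
      (Id C V \<otimes>\<^sub>a inv_arr C (LUnit C a))"
    by (simp add: transpose_up_def transpose_down_def ten_collapse)
  also have "\<dots> = Id C (V \<otimes>\<^sub>o a)"
    unfolding dual_zigzag_right[OF dual \<open>a \<in> Ob C\<close>] by (simp add: ten_collapse)
  finally show ?thesis
    by simp
qed

text \<open>X \<otimes> - is a right adjoint and so preserves kernels: an arrow killed by X
  \<otimes> f is transposed, factored through \<open>i\<close>, and transposed back. Uniqueness
  passes through the same bijection.\<close>

lemma right_factor_preserves_kernel:
  assumes k: "is_kernel C f i"
  shows "is_kernel C (Id C X \<otimes>\<^sub>a f) (Id C X \<otimes>\<^sub>a i)"
proof -
  have [simp]: "f \<in> Arr C" "i \<in> Arr C" "Cod C i = Dom C f" and fi: "f \<cdot> i = Zero C (Dom C i) (Cod C f)"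
    and ex: "\<And>a h. h \<in> Hom C a (Dom C f) \<Longrightarrow> f \<cdot> h = Zero C a (Cod C f) \<Longrightarrow>
        \<exists>!t. t \<in> Hom C a (Dom C i) \<and> i \<cdot> t = h"
    using k by (auto simp: is_kernel_def)
  note X = dual_obs(2)
  note [simp] = dual_obs(1,2)
  let ?down = "transpose_down V X ev" and ?up = "transpose_up V X coev"
  note zero = linear_functor_zero[OF linear_category_axioms ten_linear_functor[OF X]]
  have f: "f \<in> Hom C (Dom C f) (Cod C f)" and i: "i \<in> Hom C (Dom C i) (Dom C f)"
    by (auto intro: HomI)
  have "\<exists>!t. t \<in> Hom C a (X \<otimes>\<^sub>o Dom C i) \<and> (Id C X \<otimes>\<^sub>a i) \<cdot> t = h"
    if h: "h \<in> Hom C a (X \<otimes>\<^sub>o Dom C f)" and 0: "(Id C X \<otimes>\<^sub>a f) \<cdot> h = Zero C a (X \<otimes>\<^sub>o Cod C f)" for a h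
  proof -
    have a [simp]: "a \<in> Ob C"
      using Hom_ob[OF h] by simp
    have "f \<cdot> ?down (Dom C f) h = ?down (Cod C f) ((Id C X \<otimes>\<^sub>a f) \<cdot> Zero C a (X \<otimes>\<^sub>o Dom C f))"
      using transpose_down_nat[OF h f] 0 by simp
    also have "\<dots> = f \<cdot> ?down (Dom C f) (Zero C a (X \<otimes>\<^sub>o Dom C f))"
      by (rule transpose_down_nat[OF zero_in f]) simp_all
    also have "?down (Dom C f) (Zero C a (X \<otimes>\<^sub>o Dom C f)) = Zero C (V \<otimes>\<^sub>o a) (Dom C f)"
      using HomD[OF dual_obs(3)]
      by (simp add: transpose_down_def
          linear_functor_zero[OF linear_category_axioms ten_linear_functor[OF dual_obs(1)]])
    finally have "f \<cdot> ?down (Dom C f) h = Zero C (V \<otimes>\<^sub>o a) (Cod C f)"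
      by simp
    with ex[OF transpose_down_in[OF h]] obtain t
      where t: "t \<in> Hom C (V \<otimes>\<^sub>o a) (Dom C i)" and it: "i \<cdot> t = ?down (Dom C f) h"
        and un: "\<And>t'. t' \<in> Hom C (V \<otimes>\<^sub>o a) (Dom C i) \<Longrightarrow> i \<cdot> t' = ?down (Dom C f) h \<Longrightarrow> t' = t"
      by auto
    show ?thesis
    proof (rule ex1I[of _ "?up a t"], intro conjI)
      show "?up a t \<in> Hom C a (X \<otimes>\<^sub>o Dom C i)"
        by (rule transpose_up_in[OF t]) simp
      have "(Id C X \<otimes>\<^sub>a i) \<cdot> ?up a t = ?up a (i \<cdot> t)"
        using HomD[OF t] HomD[OF dual_obs(4)] by (simp add: transpose_up_def ten_collapse_pre)
      then show "(Id C X \<otimes>\<^sub>a i) \<cdot> ?up a t = h"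
        by (simp add: it transpose_up_down[OF h])
    next
      fix s assume "s \<in> Hom C a (X \<otimes>\<^sub>o Dom C i) \<and> (Id C X \<otimes>\<^sub>a i) \<cdot> s = h"
      then have s: "s \<in> Hom C a (X \<otimes>\<^sub>o Dom C i)" and sh: "(Id C X \<otimes>\<^sub>a i) \<cdot> s = h"
        by auto
      have "?down (Dom C i) s = t"
        using transpose_down_in[OF s] transpose_down_nat[OF s i] sh by (intro un) auto
      then show "s = ?up a t"
        using transpose_up_down[OF s] by simp
    qed
  qed
  then show ?thesis
    by (simp add: is_kernel_def ten_collapse fi zero)
qed

text \<open>The dual statement for the left adjoint V \<otimes> -.\<close>

lemma left_factor_preserves_cokernel:
  assumes k: "is_cokernel C f p"
  shows "is_cokernel C (Id C V \<otimes>\<^sub>a f) (Id C V \<otimes>\<^sub>a p)"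
proof -
  have [simp]: "f \<in> Arr C" "p \<in> Arr C" "Dom C p = Cod C f" and pf: "p \<cdot> f = Zero C (Dom C f) (Cod C p)"
    and ex: "\<And>a h. h \<in> Hom C (Cod C f) a \<Longrightarrow> h \<cdot> f = Zero C (Dom C f) a \<Longrightarrow>
        \<exists>!t. t \<in> Hom C (Cod C p) a \<and> t \<cdot> p = h"
    using k by (auto simp: is_cokernel_def)
  note V = dual_obs(1)
  note [simp] = dual_obs(1,2)
  let ?down = "transpose_down V X ev" and ?up = "transpose_up V X coev"
  note zero = linear_functor_zero[OF linear_category_axioms ten_linear_functor[OF V]]
  have f: "f \<in> Hom C (Dom C f) (Cod C f)" and p: "p \<in> Hom C (Cod C f) (Cod C p)"
    by (auto intro: HomI)
  have "\<exists>!t. t \<in> Hom C (V \<otimes>\<^sub>o Cod C p) a \<and> t \<cdot> (Id C V \<otimes>\<^sub>a p) = h"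
    if h: "h \<in> Hom C (V \<otimes>\<^sub>o Cod C f) a" and 0: "h \<cdot> (Id C V \<otimes>\<^sub>a f) = Zero C (V \<otimes>\<^sub>o Dom C f) a" for a h
  proof -
    have a [simp]: "a \<in> Ob C"
      using Hom_ob[OF h] by simp
    have "?up (Cod C f) h \<cdot> f = ?up (Dom C f) (Zero C (V \<otimes>\<^sub>o Dom C f) a)"
      using transpose_up_nat[OF h f] 0 by simp
    also have "\<dots> = Zero C (Dom C f) (X \<otimes>\<^sub>o a)"
      using HomD[OF dual_obs(4)]
      by (simp add: transpose_up_def linear_functor_zero[OF linear_category_axioms ten_linear_functor[OF dual_obs(2)]])
    finally obtain t
      where t: "t \<in> Hom C (Cod C p) (X \<otimes>\<^sub>o a)" and tp: "t \<cdot> p = ?up (Cod C f) h"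
        and un: "\<And>t'. t' \<in> Hom C (Cod C p) (X \<otimes>\<^sub>o a) \<Longrightarrow> t' \<cdot> p = ?up (Cod C f) h \<Longrightarrow> t' = t"
      using ex[OF transpose_up_in[OF h]] by auto
    show ?thesis
    proof (rule ex1I[of _ "?down a t"], intro conjI)
      show "?down a t \<in> Hom C (V \<otimes>\<^sub>o Cod C p) a"
        by (rule transpose_down_in[OF t]) simp
      have "?down a t \<cdot> (Id C V \<otimes>\<^sub>a p) = ?down a (t \<cdot> p)"
        using HomD[OF t] HomD[OF dual_obs(3)] by (simp add: transpose_down_def ten_collapse)
      then show "?down a t \<cdot> (Id C V \<otimes>\<^sub>a p) = h"
        by (simp add: tp transpose_down_up[OF h])
    next
      fix s assume "s \<in> Hom C (V \<otimes>\<^sub>o Cod C p) a \<and> s \<cdot> (Id C V \<otimes>\<^sub>a p) = h"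
      then have s: "s \<in> Hom C (V \<otimes>\<^sub>o Cod C p) a" and sh: "s \<cdot> (Id C V \<otimes>\<^sub>a p) = h"
        by auto
      have "?up (Cod C p) s = t"
        using transpose_up_in[OF s] transpose_up_nat[OF s p] sh by (intro un) auto
      then show "s = ?down a t"
        using transpose_down_up[OF s] by simp
    qed
  qed
  then show ?thesis
    by (simp add: is_cokernel_def ten_collapse pf zero)
qed

end

end

text \<open>A left dual of \<open>X\<close> makes X \<otimes> - a right adjoint, which settles
  kernels. A right dual puts \<open>X\<close> into the role of \<open>V\<close> above, which settles
  cokernels.\<close>

lemma (in fusion_category) ten_exact_functor:
  assumes "X \<in> Ob C"
  shows "is_exact_functor C C (\<lambda>M. X \<otimes>\<^sub>o M) (\<lambda>f. Id C X \<otimes>\<^sub>a f)"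
  using ten_linear_functor[OF assms] left_dual[OF assms] right_dual[OF assms]
    right_factor_preserves_kernel left_factor_preserves_cokernel
  unfolding is_exact_functor_def by blast

section \<open>Crossed actions\<close>

locale finite_crossed_action = crossed_action C P D
  for C :: "('o, 'm, 'k::field) moncat" (structure)
    and P :: "('g, 't) matched_pair_data"
    and D :: "('g, 't, 'o, 'm) crossed_action_data" +
  assumes finite_G [simp]: "finite (carrier G)" and finite_Gam [simp]: "finite (carrier \<Gamma>)"
begin

lemma
  shows G_closed [simp]: "g \<in> carrier G \<Longrightarrow> h \<in> carrier G \<Longrightarrow> g \<otimes>\<^bsub>G\<^esub> h \<in> carrier G"
    and G_one [simp]: "\<one>\<^bsub>G\<^esub> \<in> carrier G"
    and G_l_one [simp]: "g \<in> carrier G \<Longrightarrow> \<one>\<^bsub>G\<^esub> \<otimes>\<^bsub>G\<^esub> g = g"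
    and G_r_one [simp]: "g \<in> carrier G \<Longrightarrow> g \<otimes>\<^bsub>G\<^esub> \<one>\<^bsub>G\<^esub> = g"
proof -
  interpret group G by (rule group_G)
  show "g \<in> carrier G \<Longrightarrow> h \<in> carrier G \<Longrightarrow> g \<otimes>\<^bsub>G\<^esub> h \<in> carrier G"
    "\<one>\<^bsub>G\<^esub> \<in> carrier G" "g \<in> carrier G \<Longrightarrow> \<one>\<^bsub>G\<^esub> \<otimes>\<^bsub>G\<^esub> g = g" "g \<in> carrier G \<Longrightarrow> g \<otimes>\<^bsub>G\<^esub> \<one>\<^bsub>G\<^esub> = g"
    by simp_all
qed

lemma
  shows Gam_closed [simp]: "k \<in> carrier \<Gamma> \<Longrightarrow> t \<in> carrier \<Gamma> \<Longrightarrow> k \<otimes>\<^bsub>\<Gamma>\<^esub> t \<in> carrier \<Gamma>"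
    and Gam_one [simp]: "\<one>\<^bsub>\<Gamma>\<^esub> \<in> carrier \<Gamma>"
    and Gam_l_one [simp]: "k \<in> carrier \<Gamma> \<Longrightarrow> \<one>\<^bsub>\<Gamma>\<^esub> \<otimes>\<^bsub>\<Gamma>\<^esub> k = k"
    and Gam_r_one [simp]: "k \<in> carrier \<Gamma> \<Longrightarrow> k \<otimes>\<^bsub>\<Gamma>\<^esub> \<one>\<^bsub>\<Gamma>\<^esub> = k"
    and Gam_idem: "k \<in> carrier \<Gamma> \<Longrightarrow> k \<otimes>\<^bsub>\<Gamma>\<^esub> k = k \<Longrightarrow> k = \<one>\<^bsub>\<Gamma>\<^esub>"
proof -
  interpret group \<Gamma> by (rule group_Gam)
  show "k \<in> carrier \<Gamma> \<Longrightarrow> t \<in> carrier \<Gamma> \<Longrightarrow> k \<otimes>\<^bsub>\<Gamma>\<^esub> t \<in> carrier \<Gamma>"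
    "\<one>\<^bsub>\<Gamma>\<^esub> \<in> carrier \<Gamma>" "k \<in> carrier \<Gamma> \<Longrightarrow> \<one>\<^bsub>\<Gamma>\<^esub> \<otimes>\<^bsub>\<Gamma>\<^esub> k = k" "k \<in> carrier \<Gamma> \<Longrightarrow> k \<otimes>\<^bsub>\<Gamma>\<^esub> \<one>\<^bsub>\<Gamma>\<^esub> = k"
    "k \<in> carrier \<Gamma> \<Longrightarrow> k \<otimes>\<^bsub>\<Gamma>\<^esub> k = k \<Longrightarrow> k = \<one>\<^bsub>\<Gamma>\<^esub>"
    by (simp_all add: l_cancel_one)
qed

declare lact_in [simp] lact_one [simp] ract_in [simp] ract_one [simp]

text \<open>The matched pair identity at g = h = 1 says that k \<triangleright> 1 is idempotent,
  because k \<triangleleft> 1 = k, and a group has only one idempotent.\<close>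

lemma lact_unit [simp]:
  assumes "k \<in> carrier \<Gamma>"
  shows "k \<triangleright> \<one>\<^bsub>G\<^esub> = \<one>\<^bsub>G\<^esub>"
proof -
  interpret group G by (rule group_G)
  show ?thesis
    using matched_lact[OF assms G_one G_one] assms by (simp add: l_cancel_one)
qed

lemma ract_unit [simp]: "g \<in> carrier G \<Longrightarrow> \<one>\<^bsub>\<Gamma>\<^esub> \<triangleleft> g = \<one>\<^bsub>\<Gamma>\<^esub>"
  using matched_ract[OF Gam_one Gam_one] by (intro Gam_idem) auto

subsection \<open>Typing rules\<close>

lemma act_linear: "g \<in> carrier G \<Longrightarrow> is_linear_functor C C (\<lambda>X. X \<lhd>\<^sub>o g) (\<lambda>f. f \<lhd>\<^sub>a g)"
  using act_functor by (simp add: is_exact_functor_def)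

lemma act_is_functor: "g \<in> carrier G \<Longrightarrow> is_functor C C (\<lambda>X. X \<lhd>\<^sub>o g) (\<lambda>f. f \<lhd>\<^sub>a g)"
  using act_linear by (rule linear_is_functor)

lemma
  assumes "g \<in> carrier G"
  shows act_ob [simp]: "X \<in> Ob C \<Longrightarrow> X \<lhd>\<^sub>o g \<in> Ob C"
    and act_id [simp]: "X \<in> Ob C \<Longrightarrow> Id C X \<lhd>\<^sub>a g = Id C (X \<lhd>\<^sub>o g)"
    and arr_act [simp]: "f \<in> Arr C \<Longrightarrow> f \<lhd>\<^sub>a g \<in> Arr C"
    and dom_act [simp]: "f \<in> Arr C \<Longrightarrow> Dom C (f \<lhd>\<^sub>a g) = Dom C f \<lhd>\<^sub>o g"
    and cod_act [simp]: "f \<in> Arr C \<Longrightarrow> Cod C (f \<lhd>\<^sub>a g) = Cod C f \<lhd>\<^sub>o g"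
    and act_expand: "f \<in> Arr C \<Longrightarrow> h \<in> Arr C \<Longrightarrow> Dom C h = Cod C f \<Longrightarrow>
      (h \<cdot> f) \<lhd>\<^sub>a g = (h \<lhd>\<^sub>a g) \<cdot> (f \<lhd>\<^sub>a g)"
    and act_zero [simp]: "X \<in> Ob C \<Longrightarrow> Y \<in> Ob C \<Longrightarrow> Zero C X Y \<lhd>\<^sub>a g = Zero C (X \<lhd>\<^sub>o g) (Y \<lhd>\<^sub>o g)"
    and is_iso_act [simp]: "is_iso C f \<Longrightarrow> is_iso C (f \<lhd>\<^sub>a g)"
    and inv_act: "is_iso C f \<Longrightarrow> inv_arr C (f \<lhd>\<^sub>a g) = inv_arr C f \<lhd>\<^sub>a g"
  using functor_simps[OF act_is_functor[OF assms]] functor_iso[OF act_is_functor[OF assms]]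
    functor_inv[OF linear_category_axioms act_is_functor[OF assms]]
    linear_functor_zero[OF linear_category_axioms act_linear[OF assms]]
  by auto

lemma
  assumes "g \<in> carrier G" "h \<in> carrier G" "X \<in> Ob C"
  shows is_iso_R2 [simp]: "is_iso C (R2 D g h X)"
    and arr_R2 [simp]: "R2 D g h X \<in> Arr C"
    and dom_R2 [simp]: "Dom C (R2 D g h X) = X \<lhd>\<^sub>o g \<lhd>\<^sub>o h"
    and cod_R2 [simp]: "Cod C (R2 D g h X) = X \<lhd>\<^sub>o (g \<otimes>\<^bsub>G\<^esub> h)"
  using R2_natural_iso[OF assms(1,2)] assms(3)
  by (auto simp: is_natural_iso_def is_natural_def Hom_def)

lemma R2_nat:
  assumes "g \<in> carrier G" "h \<in> carrier G" "f \<in> Arr C" "Cod C f = X"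
  shows "R2 D g h X \<cdot> (f \<lhd>\<^sub>a g \<lhd>\<^sub>a h) = (f \<lhd>\<^sub>a (g \<otimes>\<^bsub>G\<^esub> h)) \<cdot> R2 D g h (Dom C f)"
  using R2_natural_iso[OF assms(1,2)] assms(3,4)
  by (auto simp: is_natural_iso_def is_natural_def Hom_def)

lemma
  assumes "X \<in> Ob C"
  shows is_iso_R0 [simp]: "is_iso C (R0 D X)"
    and arr_R0 [simp]: "R0 D X \<in> Arr C"
    and dom_R0 [simp]: "Dom C (R0 D X) = X"
    and cod_R0 [simp]: "Cod C (R0 D X) = X \<lhd>\<^sub>o \<one>\<^bsub>G\<^esub>"
  using R0_natural_iso assms by (auto simp: is_natural_iso_def is_natural_def Hom_def)

lemma R0_nat:
  assumes "f \<in> Arr C" "Cod C f = X"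
  shows "R0 D X \<cdot> f = (f \<lhd>\<^sub>a \<one>\<^bsub>G\<^esub>) \<cdot> R0 D (Dom C f)"
  using R0_natural_iso assms by (auto simp: is_natural_iso_def is_natural_def Hom_def)

lemma
  assumes "g \<in> carrier G"
  shows is_iso_Eta0 [simp]: "is_iso C (Eta0 D g)"
    and arr_Eta0 [simp]: "Eta0 D g \<in> Arr C"
    and dom_Eta0 [simp]: "Dom C (Eta0 D g) = \<I> \<lhd>\<^sub>o g"
    and cod_Eta0 [simp]: "Cod C (Eta0 D g) = \<I>"
  using eta0_iso[OF assms] by (auto simp: Iso_def Hom_def)

lemma
  assumes "g \<in> carrier G" "k \<in> carrier \<Gamma>" "X \<in> Ob C" "Y \<in> Deg D k"
  shows is_iso_Eta [simp]: "is_iso C (Eta D g k X Y)"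
    and arr_Eta [simp]: "Eta D g k X Y \<in> Arr C"
    and dom_Eta [simp]: "Dom C (Eta D g k X Y) = (X \<otimes>\<^sub>o Y) \<lhd>\<^sub>o g"
    and cod_Eta [simp]: "Cod C (Eta D g k X Y) = (X \<lhd>\<^sub>o (k \<triangleright> g)) \<otimes>\<^sub>o (Y \<lhd>\<^sub>o g)"
  using eta_iso[OF assms] by (auto simp: Iso_def Hom_def)

lemma eta_nat:
  assumes "g \<in> carrier G" "k \<in> carrier \<Gamma>" "f \<in> Arr C" "Cod C f = X" "j \<in> Arr C" "Cod C j = Y"
    "Y \<in> Deg D k" "Dom C j \<in> Deg D k"
  shows "Eta D g k X Y \<cdot> ((f \<otimes>\<^sub>a j) \<lhd>\<^sub>a g) =
    ((f \<lhd>\<^sub>a (k \<triangleright> g)) \<otimes>\<^sub>a (j \<lhd>\<^sub>a g)) \<cdot> Eta D g k (Dom C f) (Dom C j)"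
  using assms by (intro eta_natural) (auto simp: Hom_def)

lemmas eta_nat_simps = eta_nat pre2[OF eta_nat]

subsection \<open>Degrees\<close>

lemma deg_in_ob: "X \<in> Deg D k \<Longrightarrow> k \<in> carrier \<Gamma> \<Longrightarrow> X \<in> Ob C"
  using deg_ob by blast

lemma deg_act [simp]:
  assumes "X \<in> Deg D k" "k \<in> carrier \<Gamma>" "g \<in> carrier G"
  shows "X \<lhd>\<^sub>o g \<in> Deg D (k \<triangleleft> g)"
proof -
  have "X \<in> Ob C"
    using assms deg_in_ob by blast
  moreover from this have "Id C (X \<lhd>\<^sub>o g) \<in> Iso C (X \<lhd>\<^sub>o g) (X \<lhd>\<^sub>o g)"
    using assms by (simp add: Iso_iff)
  ultimately have "X \<lhd>\<^sub>o g \<in> {Y \<in> Ob C. \<exists>X\<in>Deg D k. Iso C (X \<lhd>\<^sub>o g) Y \<noteq> {}}"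
    using assms(1,3) act_ob by blast
  then show ?thesis
    by (simp only: act_deg[OF assms(2,3)])
qed

declare deg_tensor [simp]

lemma deg_iso: "X \<in> Deg D k \<Longrightarrow> k \<in> carrier \<Gamma> \<Longrightarrow> is_iso C f \<Longrightarrow> Dom C f = X \<Longrightarrow> Cod C f = Y \<Longrightarrow> Y \<in> Deg D k"
  by (rule deg_replete) (auto simp: Iso_iff)

lemma decomposition_spec:
  assumes "X \<in> Ob C"
  shows "k \<in> carrier \<Gamma> \<Longrightarrow> comp_ob X k \<in> Deg D k"
    and "is_biproduct C (carrier \<Gamma>) (comp_ob X) X (comp_inj X) (comp_prj X)"
proof -
  have "\<exists>d. (\<forall>k\<in>carrier \<Gamma>. fst d k \<in> Deg D k) \<and>
     is_biproduct C (carrier \<Gamma>) (fst d) X (fst (snd d)) (snd (snd d))"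
    using deg_decomposition[OF assms] by auto
  from someI_ex[OF this]
  show "k \<in> carrier \<Gamma> \<Longrightarrow> comp_ob X k \<in> Deg D k"
    and "is_biproduct C (carrier \<Gamma>) (comp_ob X) X (comp_inj X) (comp_prj X)"
    by (auto simp: comp_ob_def comp_inj_def comp_prj_def decomposition_def)
qed

lemma
  assumes "X \<in> Ob C" "k \<in> carrier \<Gamma>"
  shows comp_deg [simp]: "comp_ob X k \<in> Deg D k"
    and comp_in_ob [simp]: "comp_ob X k \<in> Ob C"
    and arr_comp_inj [simp]: "comp_inj X k \<in> Arr C"
    and dom_comp_inj [simp]: "Dom C (comp_inj X k) = comp_ob X k"
    and cod_comp_inj [simp]: "Cod C (comp_inj X k) = X"
    and arr_comp_prj [simp]: "comp_prj X k \<in> Arr C"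
    and dom_comp_prj [simp]: "Dom C (comp_prj X k) = X"
    and cod_comp_prj [simp]: "Cod C (comp_prj X k) = comp_ob X k"
    and comp_prj_inj [simp]: "comp_prj X k \<cdot> comp_inj X k = Id C (comp_ob X k)"
    and comp_prj_inj_diff: "t \<in> carrier \<Gamma> \<Longrightarrow> k \<noteq> t \<Longrightarrow>
      comp_prj X k \<cdot> comp_inj X t = Zero C (comp_ob X t) (comp_ob X k)"
  using decomposition_spec[OF assms(1)] assms(2) deg_in_ob unfolding is_biproduct_def Hom_def by auto

lemma zero_into_zero:
  assumes "is_zero C z" "f \<in> Hom C a z"
  shows "f = Zero C a z"
proof -
  have "f = Id C z \<cdot> f"
    using HomD[OF assms(2)] by simp
  also have "\<dots> = Zero C z z \<cdot> f"
    using assms(1) by (simp add: is_zero_def)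
  also have "\<dots> = Zero C a z"
    using comp_zero[OF assms(2)] Hom_ob[OF assms(2)] by simp
  finally show ?thesis .
qed

lemma zero_from_zero:
  assumes "is_zero C z" "f \<in> Hom C z b"
  shows "f = Zero C z b"
proof -
  have "f = f \<cdot> Id C z"
    using HomD[OF assms(2)] by simp
  also have "\<dots> = f \<cdot> Zero C z z"
    using assms(1) by (simp add: is_zero_def)
  also have "\<dots> = Zero C z b"
    using zero_comp[OF assms(2)] Hom_ob[OF assms(2)] by simp
  finally show ?thesis .
qed

text \<open>Injection and projection of the k-th summand have the zero object as target and source,
  so both vanish. The summand is then a zero object as well, the injection is invertible, and
  components are replete.\<close>

lemma zero_deg:
  assumes "is_zero C z" "k \<in> carrier \<Gamma>"
  shows "z \<in> Deg D k"
proof -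
  have [simp]: "z \<in> Ob C"
    using assms by (simp add: is_zero_def)
  have inj: "comp_inj z k = Zero C (comp_ob z k) z" and prj: "comp_prj z k = Zero C z (comp_ob z k)"
    by (rule zero_into_zero[OF assms(1)] zero_from_zero[OF assms(1)]; use assms in \<open>simp add: Hom_def\<close>)+
  then have "Id C (comp_ob z k) = Zero C (comp_ob z k) (comp_ob z k)"
    using comp_prj_inj[of z k] assms(2) inj prj by simp
  then have iso: "is_iso C (comp_inj z k)"
    using assms inj prj
    by (intro is_isoI[of _ "comp_ob z k" z "comp_prj z k"]) (auto simp: Hom_def is_zero_def)
  show ?thesis
    by (rule deg_iso[of "comp_ob z k" k "comp_inj z k"]) (use iso assms(2) in auto)
qed

lemma zero_ob_deg [simp]: "k \<in> carrier \<Gamma> \<Longrightarrow> zero_ob C \<in> Deg D k"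
  by (rule zero_deg[OF zero_ob_is_zero])

text \<open>By orthogonality the projection of \<open>S\<close> to a degree t \<noteq> k vanishes on
  every summand, hence altogether. Tensor products in the bicrossed product are such sums of objects
  of one degree.\<close>

lemma biproduct_deg:
  assumes bp: "is_biproduct C I A S \<iota> \<pi>" and k: "k \<in> carrier \<Gamma>" and A: "\<And>i. i \<in> I \<Longrightarrow> A i \<in> Deg D k"
  shows "S \<in> Deg D k"
proof -
  note [simp] = biproduct_ob[OF bp] HomD[OF biproduct_inj[OF bp]]
  have "comp_prj S t = Zero C S (comp_ob S t)" if t: "t \<in> carrier \<Gamma>" "t \<noteq> k" for t
  proof (rule biproduct_epi[OF bp])
    fix i assume i: "i \<in> I"
    have "comp_prj S t \<cdot> \<iota> i = Zero C (A i) (comp_ob S t)"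
      by (rule deg_orthogonal[of k t]) (use i t k A in \<open>auto intro: HomI\<close>)
    then show "comp_prj S t \<cdot> \<iota> i = Zero C S (comp_ob S t) \<cdot> \<iota> i"
      using i t by simp
  qed (use t in \<open>auto intro: HomI\<close>)
  \<comment> \<open>In the decomposition of the identity of \<open>S\<close> only the term of degree
    k survives.\<close>
  then have "comp_inj S k \<cdot> comp_prj S k = Id C S"
    using k asum_single[of "carrier \<Gamma>" k "\<lambda>t. comp_inj S t \<cdot> comp_prj S t" S S]
    by (simp add: biproduct_sum[OF decomposition_spec(2)] Hom_def)
  then have iso: "is_iso C (comp_inj S k)"
    using k by (intro is_isoI[of _ "comp_ob S k" S "comp_prj S k"]) (auto simp: Hom_def)
  show ?thesis
    by (rule deg_iso[of "comp_ob S k" k "comp_inj S k"]) (use iso k in auto)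
qed

text \<open>Some graded summand of the unit is nonzero, and its injection is a split monomorphism
  into a simple object, hence invertible; so the unit is homogeneous. Its degree is idempotent
  because the unit is isomorphic to its own tensor square.\<close>

lemma unit_deg [simp]: "\<I> \<in> Deg D \<one>\<^bsub>\<Gamma>\<^esub>"
proof -
  have nz: "Id C \<I> \<noteq> Zero C \<I> \<I>"
    using unit_simple by (simp add: is_simple_def is_zero_def)
  have "\<exists>k\<in>carrier \<Gamma>. \<not> is_zero C (comp_ob \<I> k)"
  proof (rule ccontr)
    assume "\<not> ?thesis"
    then have z: "is_zero C (comp_ob \<I> k)" if "k \<in> carrier \<Gamma>" for k
      using that by blast
    have "Id C \<I> = Zero C \<I> \<I>"
    proof (rule biproduct_epi[OF decomposition_spec(2)])
      fix k assume k: "k \<in> carrier \<Gamma>"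
      then have "comp_inj \<I> k = Zero C (comp_ob \<I> k) \<I>"
        by (intro zero_from_zero[OF z]) (auto simp: Hom_def)
      then show "Id C \<I> \<cdot> comp_inj \<I> k = Zero C \<I> \<I> \<cdot> comp_inj \<I> k"
        using k by simp
    qed (auto simp: Hom_def)
    with nz show False ..
  qed
  then obtain k where k: "k \<in> carrier \<Gamma>" and nzk: "\<not> is_zero C (comp_ob \<I> k)"
    by blast
  have "g = h" if "g \<in> Hom C a (comp_ob \<I> k)" "h \<in> Hom C a (comp_ob \<I> k)"
    "comp_inj \<I> k \<cdot> g = comp_inj \<I> k \<cdot> h" for a g h
    using arg_cong[OF that(3), of "\<lambda>x. comp_prj \<I> k \<cdot> x"] HomD[OF that(1)] HomD[OF that(2)] k
    by (simp add: pre2[OF comp_prj_inj])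
  then have "is_mono C (comp_inj \<I> k)"
    using k by (auto simp: is_mono_def)
  then have iso: "is_iso C (comp_inj \<I> k)"
    using unit_simple k nzk unfolding is_simple_def by auto
  have I: "\<I> \<in> Deg D k"
    by (rule deg_iso[of "comp_ob \<I> k" k "comp_inj \<I> k"]) (use iso k in auto)
  have "\<I> \<in> Deg D (k \<otimes>\<^bsub>\<Gamma>\<^esub> k)"
    by (rule deg_iso[of "\<I> \<otimes>\<^sub>o \<I>" _ "LUnit C \<I>"]) (use I k in auto)
  \<comment> \<open>If the two degrees differed, orthogonality would make the identity of the unit
    zero.\<close>
  then have "k \<otimes>\<^bsub>\<Gamma>\<^esub> k = k"
    using deg_orthogonal[of "k \<otimes>\<^bsub>\<Gamma>\<^esub> k" k \<I> \<I> "Id C \<I>"] I k nz by (auto simp: Hom_def)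
  then show ?thesis
    using I k Gam_idem by auto
qed

subsection \<open>Additive extension from homogeneous objects\<close>

text \<open>Naturality is required within one degree only, since between different degrees all
  arrows vanish. The degree is an index of \<tau> because zero objects have every degree.\<close>

definition hom_natural :: "('o \<Rightarrow> 'o) \<Rightarrow> ('m \<Rightarrow> 'm) \<Rightarrow> ('o \<Rightarrow> 'o) \<Rightarrow> ('m \<Rightarrow> 'm) \<Rightarrow> ('t \<Rightarrow> 'o \<Rightarrow> 'm) \<Rightarrow> bool" where
  "hom_natural Fo Fa Ho Ha \<tau> \<longleftrightarrow> is_linear_functor C C Fo Fa \<and> is_linear_functor C C Ho Ha \<and>
     (\<forall>k\<in>carrier \<Gamma>. \<forall>A\<in>Deg D k. \<tau> k A \<in> Hom C (Fo A) (Ho A)) \<and>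
     (\<forall>k\<in>carrier \<Gamma>. \<forall>A\<in>Deg D k. \<forall>B\<in>Deg D k. \<forall>f\<in>Hom C A B. \<tau> k B \<cdot> Fa f = Ha f \<cdot> \<tau> k A)"

definition extend :: "('o \<Rightarrow> 'o) \<Rightarrow> ('m \<Rightarrow> 'm) \<Rightarrow> ('o \<Rightarrow> 'o) \<Rightarrow> ('m \<Rightarrow> 'm) \<Rightarrow> ('t \<Rightarrow> 'o \<Rightarrow> 'm) \<Rightarrow> 'o \<Rightarrow> 'm" where
  "extend Fo Fa Ho Ha \<tau> X = asum C (Fo X) (Ho X) (carrier \<Gamma>)
     (\<lambda>k. (Ha (comp_inj X k) \<cdot> \<tau> k (comp_ob X k)) \<cdot> Fa (comp_prj X k))"

lemma linear_functor_epi: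
  assumes "is_linear_functor C C Fo Fa" "X \<in> Ob C" "f \<in> Hom C (Fo X) b" "f' \<in> Hom C (Fo X) b"
    and "\<And>k. k \<in> carrier \<Gamma> \<Longrightarrow> f \<cdot> Fa (comp_inj X k) = f' \<cdot> Fa (comp_inj X k)"
  shows "f = f'"
  using biproduct_epi[OF linear_functor_biproduct[OF linear_category_axioms assms(1) decomposition_spec(2)[OF assms(2)]]]
    assms(3-) by blast

lemma linear_functor_mono:
  assumes "is_linear_functor C C Fo Fa" "X \<in> Ob C" "f \<in> Hom C b (Fo X)" "f' \<in> Hom C b (Fo X)"
    and "\<And>k. k \<in> carrier \<Gamma> \<Longrightarrow> Fa (comp_prj X k) \<cdot> f = Fa (comp_prj X k) \<cdot> f'"
  shows "f = f'"
  using biproduct_mono[OF linear_functor_biproduct[OF linear_category_axioms assms(1) decomposition_spec(2)[OF assms(2)]]]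
    assms(3-) by blast

context
  fixes Fo Fa Ho Ha \<tau>
  assumes hn: "hom_natural Fo Fa Ho Ha \<tau>"
begin

lemma hn_F: "is_linear_functor C C Fo Fa" and hn_H: "is_linear_functor C C Ho Ha"
  using hn by (auto simp: hom_natural_def)

lemma hn_in: "A \<in> Deg D k \<Longrightarrow> k \<in> carrier \<Gamma> \<Longrightarrow> \<tau> k A \<in> Hom C (Fo A) (Ho A)"
  using hn by (auto simp: hom_natural_def)

lemma hn_nat: "k \<in> carrier \<Gamma> \<Longrightarrow> f \<in> Arr C \<Longrightarrow> Dom C f \<in> Deg D k \<Longrightarrow> Cod C f \<in> Deg D k \<Longrightarrow>
    \<tau> k (Cod C f) \<cdot> Fa f = Ha f \<cdot> \<tau> k (Dom C f)"
  using hn unfolding hom_natural_def Hom_def by blast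

lemmas hn_simps = functor_simps[OF linear_is_functor[OF hn_F]] functor_simps[OF linear_is_functor[OF hn_H]]
  linear_functor_zero[OF linear_category_axioms hn_F] linear_functor_zero[OF linear_category_axioms hn_H]
  HomD[OF hn_in]

lemma extend_in: "X \<in> Ob C \<Longrightarrow> extend Fo Fa Ho Ha \<tau> X \<in> Hom C (Fo X) (Ho X)"
  unfolding extend_def by (intro asum_in HomI) (auto simp: hn_simps)

lemma extend_inj:
  assumes [simp]: "X \<in> Ob C" "k \<in> carrier \<Gamma>"
  shows "extend Fo Fa Ho Ha \<tau> X \<cdot> Fa (comp_inj X k) = Ha (comp_inj X k) \<cdot> \<tau> k (comp_ob X k)"
  unfolding extend_def
  by (rule biproduct_copair(2)[OF linear_functor_biproduct[OF linear_category_axioms hn_F decomposition_spec(2)]])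
    (auto simp: hn_simps intro!: HomI)

lemma extend_prj:
  assumes [simp]: "X \<in> Ob C" "k \<in> carrier \<Gamma>"
  shows "Ha (comp_prj X k) \<cdot> extend Fo Fa Ho Ha \<tau> X = \<tau> k (comp_ob X k) \<cdot> Fa (comp_prj X k)"
proof (rule linear_functor_epi[OF hn_F assms(1)])
  note [simp] = HomD[OF extend_in[of X]] hn_simps
  fix t assume t [simp]: "t \<in> carrier \<Gamma>"
  have "(Ha (comp_prj X k) \<cdot> extend Fo Fa Ho Ha \<tau> X) \<cdot> Fa (comp_inj X t) =
      (Ha (comp_prj X k) \<cdot> Ha (comp_inj X t)) \<cdot> \<tau> t (comp_ob X t)"
    by (simp add: extend_inj)
  also have "\<dots> = Ha (comp_prj X k \<cdot> comp_inj X t) \<cdot> \<tau> t (comp_ob X t)"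
    by (subst hn_simps) simp_all
  also have "\<dots> = \<tau> k (comp_ob X k) \<cdot> Fa (comp_prj X k \<cdot> comp_inj X t)"
  proof (cases "k = t")
    case True
    then show ?thesis by simp
  next
    case False
    then show ?thesis by (simp add: comp_prj_inj_diff del: hn_simps(6,12))
  qed
  finally show "(Ha (comp_prj X k) \<cdot> extend Fo Fa Ho Ha \<tau> X) \<cdot> Fa (comp_inj X t) =
      (\<tau> k (comp_ob X k) \<cdot> Fa (comp_prj X k)) \<cdot> Fa (comp_inj X t)"
    by simp
qed (use extend_in[of X] in \<open>auto simp: hn_simps Hom_def\<close>)

text \<open>Compare matrix entries for the chosen decompositions. The entry of \<open>f\<close> from
  degree k to t \<noteq> k is zero by orthogonality, and for k = t it is an arrow inside one
  component, where \<tau> is natural.\<close>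

lemma extend_nat:
  assumes "f \<in> Arr C" "Cod C f = Y"
  shows "extend Fo Fa Ho Ha \<tau> Y \<cdot> Fa f = Ha f \<cdot> extend Fo Fa Ho Ha \<tau> (Dom C f)"
proof (rule linear_functor_epi[OF hn_F dom_in[OF assms(1)]])
  have Y [simp]: "Y \<in> Ob C"
    using assms cod_in by blast
  note [simp] = HomD[OF extend_in] hn_simps assms
  fix k assume k [simp]: "k \<in> carrier \<Gamma>"
  show "(extend Fo Fa Ho Ha \<tau> Y \<cdot> Fa f) \<cdot> Fa (comp_inj (Dom C f) k) =
      (Ha f \<cdot> extend Fo Fa Ho Ha \<tau> (Dom C f)) \<cdot> Fa (comp_inj (Dom C f) k)"
  proof (rule linear_functor_mono[OF hn_H Y])
    fix t assume t [simp]: "t \<in> carrier \<Gamma>"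
    let ?h = "comp_prj Y t \<cdot> f \<cdot> comp_inj (Dom C f) k"
    have "Ha (comp_prj Y t) \<cdot> (extend Fo Fa Ho Ha \<tau> Y \<cdot> Fa f) \<cdot> Fa (comp_inj (Dom C f) k) =
        \<tau> t (comp_ob Y t) \<cdot> Fa ?h"
      by (simp add: pre2[OF extend_prj])
    also have "\<dots> = Ha ?h \<cdot> \<tau> k (comp_ob (Dom C f) k)"
    proof (cases "k = t")
      case True
      then show ?thesis
        using hn_nat[of t ?h] by simp
    next
      case False
      then have "?h = Zero C (comp_ob (Dom C f) k) (comp_ob Y t)"
        by (intro deg_orthogonal[of k t]) (auto intro: HomI)
      then show ?thesis
        by (simp del: hn_simps(6,12))
    qed
    also have "\<dots> = Ha (comp_prj Y t) \<cdot> (Ha f \<cdot> extend Fo Fa Ho Ha \<tau> (Dom C f)) \<cdot> Fa (comp_inj (Dom C f) k)"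
      by (simp add: extend_inj)
    finally show "Ha (comp_prj Y t) \<cdot> (extend Fo Fa Ho Ha \<tau> Y \<cdot> Fa f) \<cdot> Fa (comp_inj (Dom C f) k) =
        Ha (comp_prj Y t) \<cdot> (Ha f \<cdot> extend Fo Fa Ho Ha \<tau> (Dom C f)) \<cdot> Fa (comp_inj (Dom C f) k)" .
  qed (auto intro: HomI)
qed (use assms extend_in in \<open>auto simp: hn_simps Hom_def\<close>)

text \<open>On an object of degree k the injections of other degrees vanish, and naturality of
  \<tau> along the k-th one gives the value. Thus the chosen decomposition leaves no trace on
  homogeneous objects.\<close>

lemma extend_homogeneous:
  assumes A: "A \<in> Deg D k" and k [simp]: "k \<in> carrier \<Gamma>"
  shows "extend Fo Fa Ho Ha \<tau> A = \<tau> k A"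
proof (rule linear_functor_epi[OF hn_F deg_in_ob[OF assms], where b = "Ho A"])
  have A' [simp]: "A \<in> Ob C"
    using deg_in_ob assms by blast
  note [simp] = HomD[OF extend_in] hn_simps A
  fix t assume t [simp]: "t \<in> carrier \<Gamma>"
  show "extend Fo Fa Ho Ha \<tau> A \<cdot> Fa (comp_inj A t) = \<tau> k A \<cdot> Fa (comp_inj A t)"
  proof (cases "t = k")
    case True
    then show ?thesis
      using hn_nat[of k "comp_inj A k"] by (simp add: extend_inj)
  next
    case False
    then have "comp_inj A t = Zero C (comp_ob A t) A"
      by (intro deg_orthogonal[of t k]) (auto intro: HomI)
    then show ?thesis
      by simp
  qed
qed (use extend_in hn_in assms deg_in_ob in auto)

end

text \<open>The inverses of \<tau> are again natural within each degree, and their extension is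
  inverse to that of \<tau>, as the injections show.\<close>

lemma extend_iso:
  assumes hn: "hom_natural Fo Fa Ho Ha \<tau>"
    and iso: "\<And>k A. k \<in> carrier \<Gamma> \<Longrightarrow> A \<in> Deg D k \<Longrightarrow> is_iso C (\<tau> k A)"
    and [simp]: "X \<in> Ob C"
  shows "is_iso C (extend Fo Fa Ho Ha \<tau> X)"
proof -
  let ?\<tau>' = "\<lambda>k A. inv_arr C (\<tau> k A)"
  note [simp] = hn_simps[OF hn] iso
  have "?\<tau>' k B \<cdot> Ha f = Fa f \<cdot> ?\<tau>' k A"
    if "k \<in> carrier \<Gamma>" "A \<in> Deg D k" "B \<in> Deg D k" "f \<in> Hom C A B" for k A B f
    using that HomD[OF that(4)] hn_nat[OF hn, of k f] by (intro inv_slide) auto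
  then have hn': "hom_natural Ho Ha Fo Fa ?\<tau>'"
    using hn_F[OF hn] hn_H[OF hn] by (auto simp: hom_natural_def Hom_def)
  note [simp] = HomD[OF extend_in[OF hn]] HomD[OF extend_in[OF hn']]
  show ?thesis
  proof (rule is_isoI)
    show "extend Fo Fa Ho Ha \<tau> X \<in> Hom C (Fo X) (Ho X)" "extend Ho Ha Fo Fa ?\<tau>' X \<in> Hom C (Ho X) (Fo X)"
      using extend_in hn hn' by auto
    show "extend Ho Ha Fo Fa ?\<tau>' X \<cdot> extend Fo Fa Ho Ha \<tau> X = Id C (Fo X)"
      by (rule linear_functor_epi[OF hn_F[OF hn]])
        (auto intro: HomI simp: extend_inj[OF hn] pre2[OF extend_inj[OF hn']])
    show "extend Fo Fa Ho Ha \<tau> X \<cdot> extend Ho Ha Fo Fa ?\<tau>' X = Id C (Ho X)"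
      by (rule linear_functor_epi[OF hn_H[OF hn]])
        (auto intro: HomI simp: extend_inj[OF hn'] pre2[OF extend_inj[OF hn]])
  qed
qed

section \<open>Equivariant objects\<close>

lemma
  assumes "is_equivariant (U, u)"
  shows equiv_ob: "U \<in> Ob C"
    and equiv_iso: "g \<in> carrier G \<Longrightarrow> is_iso C (u g)"
    and equiv_arr: "g \<in> carrier G \<Longrightarrow> u g \<in> Arr C"
    and equiv_dom: "g \<in> carrier G \<Longrightarrow> Dom C (u g) = U \<lhd>\<^sub>o g"
    and equiv_cod: "g \<in> carrier G \<Longrightarrow> Cod C (u g) = U"
    and equiv_mult: "g \<in> carrier G \<Longrightarrow> h \<in> carrier G \<Longrightarrow>
      u (g \<otimes>\<^bsub>G\<^esub> h) \<cdot> R2 D g h U = u h \<cdot> (u g \<lhd>\<^sub>a h)"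
  using assms by (auto simp: is_equivariant_def PiE_def Pi_def Iso_iff is_iso_arr)

lemmas equiv_simps = equiv_ob equiv_iso equiv_arr equiv_dom equiv_cod

lemma equivI:
  assumes "U \<in> Ob C" "u \<in> extensional (carrier G)"
    and "\<And>g. g \<in> carrier G \<Longrightarrow> is_iso C (u g)"
    and "\<And>g. g \<in> carrier G \<Longrightarrow> Dom C (u g) = U \<lhd>\<^sub>o g"
    and "\<And>g. g \<in> carrier G \<Longrightarrow> Cod C (u g) = U"
    and "\<And>g h. g \<in> carrier G \<Longrightarrow> h \<in> carrier G \<Longrightarrow>
      u (g \<otimes>\<^bsub>G\<^esub> h) \<cdot> R2 D g h U = u h \<cdot> (u g \<lhd>\<^sub>a h)"
  shows "is_equivariant (U, u)"
  using assms by (auto simp: is_equivariant_def PiE_def Pi_def Iso_iff)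

text \<open>Equivariance is formulated through \<open>R2\<close> alone; the unit law follows.
  Cancelling \<open>u\<close> at 1 in the multiplicativity at (1, 1) gives \<open>R2\<close> as the
  action of 1 on that map, and the unit law of \<open>R2\<close> with naturality of
  \<open>R0\<close> makes it the inverse of \<open>R0\<close>.\<close>

lemma equiv_R0:
  assumes eq: "is_equivariant (U, u)"
  shows "u \<one>\<^bsub>G\<^esub> \<cdot> R0 D U = Id C U"
proof -
  note [simp] = equiv_simps[OF eq]
  have "u \<one>\<^bsub>G\<^esub> \<cdot> R2 D \<one>\<^bsub>G\<^esub> \<one>\<^bsub>G\<^esub> U = u \<one>\<^bsub>G\<^esub> \<cdot> (u \<one>\<^bsub>G\<^esub> \<lhd>\<^sub>a \<one>\<^bsub>G\<^esub>)"
    using equiv_mult[OF eq, of "\<one>\<^bsub>G\<^esub>" "\<one>\<^bsub>G\<^esub>"] by simp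
  then have "R2 D \<one>\<^bsub>G\<^esub> \<one>\<^bsub>G\<^esub> U = u \<one>\<^bsub>G\<^esub> \<lhd>\<^sub>a \<one>\<^bsub>G\<^esub>"
    by (rule iso_left_cancel) simp_all
  then have "R0 D U \<cdot> u \<one>\<^bsub>G\<^esub> = Id C (U \<lhd>\<^sub>o \<one>\<^bsub>G\<^esub>)"
    using R2_R0_right[of "\<one>\<^bsub>G\<^esub>" U] by (simp add: R0_nat)
  then have "u \<one>\<^bsub>G\<^esub> = inv_arr C (R0 D U)"
    using comp_eq_iff_inv[of "R0 D U" "u \<one>\<^bsub>G\<^esub>" "Id C (U \<lhd>\<^sub>o \<one>\<^bsub>G\<^esub>)"] by simp
  then show ?thesis
    by simp
qed

text \<open>The exponent k \<triangleright> g depends on the degree of \<open>M\<close>, so the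
  formula is given in each degree and extended additively. This also absorbs the sum over degrees in
  the tensor product of equivariant objects.\<close>

definition gam :: "'o \<Rightarrow> ('g \<Rightarrow> 'm) \<Rightarrow> 'g \<Rightarrow> 'o \<Rightarrow> 'm" where
  "gam U u g = extend (\<lambda>M. (U \<otimes>\<^sub>o M) \<lhd>\<^sub>o g) (\<lambda>f. (Id C U \<otimes>\<^sub>a f) \<lhd>\<^sub>a g)
     (\<lambda>M. U \<otimes>\<^sub>o (M \<lhd>\<^sub>o g)) (\<lambda>f. Id C U \<otimes>\<^sub>a (f \<lhd>\<^sub>a g))
     (\<lambda>k A. (u (k \<triangleright> g) \<otimes>\<^sub>a Id C (A \<lhd>\<^sub>o g)) \<cdot> Eta D g k U A)"

lemma ten_act_linear: "U \<in> Ob C \<Longrightarrow> g \<in> carrier G \<Longrightarrow>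
    is_linear_functor C C (\<lambda>M. (U \<otimes>\<^sub>o M) \<lhd>\<^sub>o g) (\<lambda>f. (Id C U \<otimes>\<^sub>a f) \<lhd>\<^sub>a g)"
  using linear_functor_comp[OF ten_linear_functor act_linear] .

lemma act_ten_linear: "U \<in> Ob C \<Longrightarrow> g \<in> carrier G \<Longrightarrow>
    is_linear_functor C C (\<lambda>M. U \<otimes>\<^sub>o (M \<lhd>\<^sub>o g)) (\<lambda>f. Id C U \<otimes>\<^sub>a (f \<lhd>\<^sub>a g))"
  using linear_functor_comp[OF act_linear ten_linear_functor] .

section \<open>How gamma inherits the axioms of the crossed action\<close>

context
  fixes U u
  assumes eq: "is_equivariant (U, u)"
begin

lemma gam_hom_natural:
  assumes [simp]: "g \<in> carrier G"
  shows "hom_natural (\<lambda>M. (U \<otimes>\<^sub>o M) \<lhd>\<^sub>o g) (\<lambda>f. (Id C U \<otimes>\<^sub>a f) \<lhd>\<^sub>a g)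
     (\<lambda>M. U \<otimes>\<^sub>o (M \<lhd>\<^sub>o g)) (\<lambda>f. Id C U \<otimes>\<^sub>a (f \<lhd>\<^sub>a g))
     (\<lambda>k A. (u (k \<triangleright> g) \<otimes>\<^sub>a Id C (A \<lhd>\<^sub>o g)) \<cdot> Eta D g k U A)"
proof -
  note [simp] = equiv_simps[OF eq] deg_in_ob
  have "((u (k \<triangleright> g) \<otimes>\<^sub>a Id C (B \<lhd>\<^sub>o g)) \<cdot> Eta D g k U B) \<cdot> ((Id C U \<otimes>\<^sub>a f) \<lhd>\<^sub>a g) =
      (Id C U \<otimes>\<^sub>a (f \<lhd>\<^sub>a g)) \<cdot> (u (k \<triangleright> g) \<otimes>\<^sub>a Id C (A \<lhd>\<^sub>o g)) \<cdot> Eta D g k U A"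
    if "k \<in> carrier \<Gamma>" "A \<in> Deg D k" "B \<in> Deg D k" "f \<in> Hom C A B" for k A B f
    using that HomD[OF that(4)] deg_in_ob[OF that(2,1)] deg_in_ob[OF that(3,1)]
    by (simp add: eta_nat ten_collapse_pre)
  then show ?thesis
    using ten_act_linear[of U g] act_ten_linear[of U g]
    by (auto simp: hom_natural_def intro!: HomI)
qed

lemma
  assumes "g \<in> carrier G" "M \<in> Ob C"
  shows is_iso_gam: "is_iso C (gam U u g M)"
    and arr_gam: "gam U u g M \<in> Arr C"
    and dom_gam: "Dom C (gam U u g M) = (U \<otimes>\<^sub>o M) \<lhd>\<^sub>o g"
    and cod_gam: "Cod C (gam U u g M) = U \<otimes>\<^sub>o (M \<lhd>\<^sub>o g)"
  using extend_in[OF gam_hom_natural[OF assms(1)] assms(2)]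
    extend_iso[OF gam_hom_natural[OF assms(1)] _ assms(2)] assms equiv_simps[OF eq] deg_in_ob
  by (auto simp: gam_def Hom_def)

lemmas gam_simps = is_iso_gam arr_gam dom_gam cod_gam

lemma gam_nat:
  assumes "g \<in> carrier G" "f \<in> Arr C" "Cod C f = M"
  shows "gam U u g M \<cdot> ((Id C U \<otimes>\<^sub>a f) \<lhd>\<^sub>a g) = (Id C U \<otimes>\<^sub>a (f \<lhd>\<^sub>a g)) \<cdot> gam U u g (Dom C f)"
  using extend_nat[OF gam_hom_natural[OF assms(1)] assms(2,3)] by (simp add: gam_def)

lemma gam_homogeneous:
  assumes "g \<in> carrier G" "k \<in> carrier \<Gamma>" "A \<in> Deg D k"
  shows "gam U u g A = (u (k \<triangleright> g) \<otimes>\<^sub>a Id C (A \<lhd>\<^sub>o g)) \<cdot> Eta D g k U A"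
  using extend_homogeneous[OF gam_hom_natural[OF assms(1)] assms(3,2)] by (simp add: gam_def)

text \<open>In degree k this is (C3) with the multiplicativity of \<open>u\<close>. The exponents
  fit because A \<lhd> g has degree k \<triangleleft> g and k \<triangleright> (g h) = (k
  \<triangleright> g)((k \<triangleleft> g) \<triangleright> h). Naturality passes from summands to
  all \<open>M\<close>.\<close>

lemma gam_mult:
  assumes [simp]: "g \<in> carrier G" "h \<in> carrier G" "M \<in> Ob C"
  shows "gam U u (g \<otimes>\<^bsub>G\<^esub> h) M \<cdot> R2 D g h (U \<otimes>\<^sub>o M) =
    (Id C U \<otimes>\<^sub>a R2 D g h M) \<cdot> gam U u h (M \<lhd>\<^sub>o g) \<cdot> (gam U u g M \<lhd>\<^sub>a h)"
proof (rule linear_functor_epi[OF linear_functor_comp[OF ten_act_linear act_linear] assms(3)])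
  note [simp] = equiv_simps[OF eq] gam_simps
  have hom: "gam U u (g \<otimes>\<^bsub>G\<^esub> h) A \<cdot> R2 D g h (U \<otimes>\<^sub>o A) =
      (Id C U \<otimes>\<^sub>a R2 D g h A) \<cdot> gam U u h (A \<lhd>\<^sub>o g) \<cdot> (gam U u g A \<lhd>\<^sub>a h)"
    if A [simp]: "A \<in> Deg D k" and k [simp]: "k \<in> carrier \<Gamma>" for A k
  proof -
    have [simp]: "A \<in> Ob C"
      using A k deg_in_ob by blast
    show ?thesis
      by (simp add: gam_homogeneous[of _ k] gam_homogeneous[of _ "k \<triangleleft> g"] C3 ten_collapse_simps
          matched_lact equiv_mult[OF eq] act_expand eta_nat_simps)
  qed
  fix k assume k [simp]: "k \<in> carrier \<Gamma>"
  show "(gam U u (g \<otimes>\<^bsub>G\<^esub> h) M \<cdot> R2 D g h (U \<otimes>\<^sub>o M)) \<cdot> ((Id C U \<otimes>\<^sub>a comp_inj M k) \<lhd>\<^sub>a g \<lhd>\<^sub>a h) =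
      ((Id C U \<otimes>\<^sub>a R2 D g h M) \<cdot> gam U u h (M \<lhd>\<^sub>o g) \<cdot> (gam U u g M \<lhd>\<^sub>a h)) \<cdot>
        ((Id C U \<otimes>\<^sub>a comp_inj M k) \<lhd>\<^sub>a g \<lhd>\<^sub>a h)"
    using hom[OF comp_deg k]
    by (simp add: R2_nat pre2[OF gam_nat] act_expand[symmetric] gam_nat)
      (simp add: act_expand pre2[OF gam_nat] ten_collapse_pre R2_nat)
qed (use eq in \<open>auto intro!: HomI simp: equiv_simps[OF eq] gam_simps\<close>)

text \<open>From (C5) and \<open>equiv_R0\<close>, since k \<triangleright> 1 = 1 in every
  degree.\<close>

lemma gam_one:
  assumes [simp]: "M \<in> Ob C"
  shows "gam U u \<one>\<^bsub>G\<^esub> M \<cdot> R0 D (U \<otimes>\<^sub>o M) = Id C U \<otimes>\<^sub>a R0 D M"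
proof (rule linear_functor_epi[OF ten_linear_functor assms])
  note [simp] = equiv_simps[OF eq] gam_simps
  fix k assume k [simp]: "k \<in> carrier \<Gamma>"
  have "gam U u \<one>\<^bsub>G\<^esub> A \<cdot> R0 D (U \<otimes>\<^sub>o A) = Id C U \<otimes>\<^sub>a R0 D A" if A [simp]: "A \<in> Deg D k" for A
  proof -
    have [simp]: "A \<in> Ob C"
      using A k deg_in_ob by blast
    show ?thesis
      by (simp add: gam_homogeneous[of _ k] C5 ten_collapse_simps equiv_R0[OF eq])
  qed
  from this[OF comp_deg]
  show "(gam U u \<one>\<^bsub>G\<^esub> M \<cdot> R0 D (U \<otimes>\<^sub>o M)) \<cdot> (Id C U \<otimes>\<^sub>a comp_inj M k) =
      (Id C U \<otimes>\<^sub>a R0 D M) \<cdot> (Id C U \<otimes>\<^sub>a comp_inj M k)"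
    by (simp add: R0_nat pre2[OF gam_nat] ten_collapse_simps)
qed (use eq in \<open>auto intro!: HomI simp: equiv_simps[OF eq] gam_simps\<close>)

text \<open>This is (C1) with \<open>u\<close> inserted; the exponents agree by (t k)
  \<triangleright> g = t \<triangleright> (k \<triangleright> g). Only \<open>M\<close> is
  decomposed: \<open>A\<close> stays homogeneous because its degree is an argument of
  \<open>Eta\<close>.\<close>

lemma gam_eta:
  assumes [simp]: "g \<in> carrier G" "k \<in> carrier \<Gamma>" "M \<in> Ob C" "A \<in> Deg D k"
  shows "(Id C U \<otimes>\<^sub>a Eta D g k M A) \<cdot> gam U u g (M \<otimes>\<^sub>o A) \<cdot> (Assoc C U M A \<lhd>\<^sub>a g) =
    Assoc C U (M \<lhd>\<^sub>o (k \<triangleright> g)) (A \<lhd>\<^sub>o g) \<cdot> (gam U u (k \<triangleright> g) M \<otimes>\<^sub>a Id C (A \<lhd>\<^sub>o g)) \<cdot> Eta D g k (U \<otimes>\<^sub>o M) A"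
proof -
  have A [simp]: "A \<in> Ob C"
    using assms deg_in_ob by blast
  note U [simp] = equiv_simps[OF eq] 
  note [simp] = gam_simps
  show ?thesis
  proof (rule linear_functor_epi[OF linear_functor_comp[OF linear_functor_comp[OF
          ten_linear_functor ten_linear_functor_right] act_linear], OF U(1) A assms(1) assms(3)])
    fix t assume t [simp]: "t \<in> carrier \<Gamma>"
    let ?M = "comp_ob M t"
    have "(Id C U \<otimes>\<^sub>a Eta D g k ?M A) \<cdot> gam U u g (?M \<otimes>\<^sub>o A) \<cdot> (Assoc C U ?M A \<lhd>\<^sub>a g) =
        (u (t \<triangleright> k \<triangleright> g) \<otimes>\<^sub>a Id C (?M \<lhd>\<^sub>o (k \<triangleright> g) \<otimes>\<^sub>o (A \<lhd>\<^sub>o g))) \<cdot> (Id C (U \<lhd>\<^sub>o (t \<triangleright> k \<triangleright> g)) \<otimes>\<^sub>a Eta D g k ?M A) \<cdot>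
        Eta D g (t \<otimes>\<^bsub>\<Gamma>\<^esub> k) U (?M \<otimes>\<^sub>o A) \<cdot> (Assoc C U ?M A \<lhd>\<^sub>a g)"
      by (simp add: gam_homogeneous[of _ "t \<otimes>\<^bsub>\<Gamma>\<^esub> k"] lact_mult ten_collapse_simps)
    also have "\<dots> = Assoc C U (?M \<lhd>\<^sub>o (k \<triangleright> g)) (A \<lhd>\<^sub>o g) \<cdot> (gam U u (k \<triangleright> g) ?M \<otimes>\<^sub>a Id C (A \<lhd>\<^sub>o g)) \<cdot> Eta D g k (U \<otimes>\<^sub>o ?M) A"
      by (simp add: C1[symmetric] gam_homogeneous[of _ t] pre2[OF assoc_nat_left_id] ten_collapse_simps)
    finally have hom: "(Id C U \<otimes>\<^sub>a Eta D g k ?M A) \<cdot> gam U u g (?M \<otimes>\<^sub>o A) \<cdot> (Assoc C U ?M A \<lhd>\<^sub>a g) =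
      Assoc C U (?M \<lhd>\<^sub>o (k \<triangleright> g)) (A \<lhd>\<^sub>o g) \<cdot> (gam U u (k \<triangleright> g) ?M \<otimes>\<^sub>a Id C (A \<lhd>\<^sub>o g)) \<cdot> Eta D g k (U \<otimes>\<^sub>o ?M) A" .
    have a: "(Assoc C U M A \<lhd>\<^sub>a g) \<cdot> ((Id C U \<otimes>\<^sub>a comp_inj M t \<otimes>\<^sub>a Id C A) \<lhd>\<^sub>a g) =
        ((Id C U \<otimes>\<^sub>a (comp_inj M t \<otimes>\<^sub>a Id C A)) \<lhd>\<^sub>a g) \<cdot> (Assoc C U ?M A \<lhd>\<^sub>a g)"
      by (simp add: act_expand[symmetric] assoc_nat)
    have "((Id C U \<otimes>\<^sub>a Eta D g k M A) \<cdot> gam U u g (M \<otimes>\<^sub>o A) \<cdot> (Assoc C U M A \<lhd>\<^sub>a g)) \<cdot>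
        ((Id C U \<otimes>\<^sub>a comp_inj M t \<otimes>\<^sub>a Id C A) \<lhd>\<^sub>a g) =
        (Id C U \<otimes>\<^sub>a (comp_inj M t \<lhd>\<^sub>a (k \<triangleright> g) \<otimes>\<^sub>a Id C (A \<lhd>\<^sub>o g))) \<cdot>
        (Id C U \<otimes>\<^sub>a Eta D g k ?M A) \<cdot> gam U u g (?M \<otimes>\<^sub>o A) \<cdot> (Assoc C U ?M A \<lhd>\<^sub>a g)"
      by (simp add: a pre2[OF gam_nat] ten_collapse_simps eta_nat)
    also have "\<dots> = (Assoc C U (M \<lhd>\<^sub>o (k \<triangleright> g)) (A \<lhd>\<^sub>o g) \<cdot> (gam U u (k \<triangleright> g) M \<otimes>\<^sub>a Id C (A \<lhd>\<^sub>o g)) \<cdot>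
        Eta D g k (U \<otimes>\<^sub>o M) A) \<cdot> ((Id C U \<otimes>\<^sub>a comp_inj M t \<otimes>\<^sub>a Id C A) \<lhd>\<^sub>a g)"
      by (simp add: hom eta_nat ten_collapse_simps gam_nat pre2[OF assoc_back])
    finally show "((Id C U \<otimes>\<^sub>a Eta D g k M A) \<cdot> gam U u g (M \<otimes>\<^sub>o A) \<cdot> (Assoc C U M A \<lhd>\<^sub>a g)) \<cdot>
        ((Id C U \<otimes>\<^sub>a comp_inj M t \<otimes>\<^sub>a Id C A) \<lhd>\<^sub>a g) =
      (Assoc C U (M \<lhd>\<^sub>o (k \<triangleright> g)) (A \<lhd>\<^sub>o g) \<cdot> (gam U u (k \<triangleright> g) M \<otimes>\<^sub>a Id C (A \<lhd>\<^sub>o g)) \<cdot>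
        Eta D g k (U \<otimes>\<^sub>o M) A) \<cdot> ((Id C U \<otimes>\<^sub>a comp_inj M t \<otimes>\<^sub>a Id C A) \<lhd>\<^sub>a g)" .
  qed (auto intro!: HomI)
qed

text \<open>By (C2), gamma at the unit object gives back \<open>u\<close>, as the unit has degree 1
  and 1 \<triangleright> g = g. The right unit constraint of the extension and the fullness of the
  comparison functor rest on this.\<close>

lemma gam_unit:
  assumes [simp]: "g \<in> carrier G"
  shows "RUnit C U \<cdot> (Id C U \<otimes>\<^sub>a Eta0 D g) \<cdot> gam U u g \<I> = u g \<cdot> (RUnit C U \<lhd>\<^sub>a g)"
proof -
  note [simp] = equiv_simps[OF eq] gam_simps
  have "RUnit C U \<cdot> (Id C U \<otimes>\<^sub>a Eta0 D g) \<cdot> gam U u g \<I> =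
      RUnit C U \<cdot> (u g \<otimes>\<^sub>a Id C \<I>) \<cdot> (Id C (U \<lhd>\<^sub>o g) \<otimes>\<^sub>a Eta0 D g) \<cdot> Eta D g \<one>\<^bsub>\<Gamma>\<^esub> U \<I>"
    by (simp add: gam_homogeneous[of _ "\<one>\<^bsub>\<Gamma>\<^esub>"] ten_collapse_simps)
  also have "\<dots> = u g \<cdot> (RUnit C U \<lhd>\<^sub>a g)"
    by (simp add: runit_nat_simps C2_right)
  finally show ?thesis .
qed

end

text \<open>In degree k the claim combines naturality of \<eta> in its first argument with
  equivariance of \<open>f\<close> at k \<triangleright> g.\<close>

lemma gam_equivariant_arr:
  assumes eq: "is_equivariant (U, u)" "is_equivariant (V, v)"
    and f: "is_equivariant_arr (U, u) (V, v) f" and [simp]: "g \<in> carrier G" "M \<in> Ob C"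
  shows "gam V v g M \<cdot> ((f \<otimes>\<^sub>a Id C M) \<lhd>\<^sub>a g) = (f \<otimes>\<^sub>a Id C (M \<lhd>\<^sub>o g)) \<cdot> gam U u g M"
proof -
  note U [simp] = equiv_simps[OF eq(1)] 
  note [simp] = gam_simps[OF eq(1)] equiv_simps[OF eq(2)] gam_simps[OF eq(2)]
  have [simp]: "f \<in> Arr C" "Dom C f = U" "Cod C f = V"
    and fe: "\<And>g. g \<in> carrier G \<Longrightarrow> v g \<cdot> (f \<lhd>\<^sub>a g) = f \<cdot> u g"
    using f by (auto simp: is_equivariant_arr_def Hom_def)
  show ?thesis
  proof (rule linear_functor_epi[OF ten_act_linear[OF U(1)], OF assms(4,5)])
    fix k assume [simp]: "k \<in> carrier \<Gamma>"
    let ?M = "comp_ob M k"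
    have hom: "gam V v g ?M \<cdot> ((f \<otimes>\<^sub>a Id C ?M) \<lhd>\<^sub>a g) = (f \<otimes>\<^sub>a Id C (?M \<lhd>\<^sub>o g)) \<cdot> gam U u g ?M"
      by (simp add: gam_homogeneous[OF eq(1), of _ k] gam_homogeneous[OF eq(2), of _ k] eta_nat ten_collapse_simps fe)
    have "(gam V v g M \<cdot> ((f \<otimes>\<^sub>a Id C M) \<lhd>\<^sub>a g)) \<cdot> ((Id C U \<otimes>\<^sub>a comp_inj M k) \<lhd>\<^sub>a g) =
        gam V v g M \<cdot> ((Id C V \<otimes>\<^sub>a comp_inj M k) \<lhd>\<^sub>a g) \<cdot> ((f \<otimes>\<^sub>a Id C ?M) \<lhd>\<^sub>a g)"
      by (simp add: act_expand[symmetric] ten_collapse_simps)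
    also have "\<dots> = ((f \<otimes>\<^sub>a Id C (M \<lhd>\<^sub>o g)) \<cdot> gam U u g M) \<cdot> ((Id C U \<otimes>\<^sub>a comp_inj M k) \<lhd>\<^sub>a g)"
      by (simp add: pre2[OF gam_nat[OF eq(2)]] gam_nat[OF eq(1)] hom ten_collapse_pre)
    finally show "(gam V v g M \<cdot> ((f \<otimes>\<^sub>a Id C M) \<lhd>\<^sub>a g)) \<cdot> ((Id C U \<otimes>\<^sub>a comp_inj M k) \<lhd>\<^sub>a g) =
      ((f \<otimes>\<^sub>a Id C (M \<lhd>\<^sub>o g)) \<cdot> gam U u g M) \<cdot> ((Id C U \<otimes>\<^sub>a comp_inj M k) \<lhd>\<^sub>a g)" .
  qed (auto intro!: HomI)
qed

end

section \<open>The crossed extension is a monoidal category\<close>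

lemma (in linear_category)
  assumes a [simp]: "a \<in> Ob C" and b [simp]: "b \<in> Ob C"
  shows plus_assoc: "f \<in> Hom C a b \<Longrightarrow> g \<in> Hom C a b \<Longrightarrow> h \<in> Hom C a b \<Longrightarrow>
      Plus C (Plus C f g) h = Plus C f (Plus C g h)"
    and plus_comm: "f \<in> Hom C a b \<Longrightarrow> g \<in> Hom C a b \<Longrightarrow> Plus C f g = Plus C g f"
    and plus_scale: "f \<in> Hom C a b \<Longrightarrow> Plus C (Scale C x f) (Scale C y f) = Scale C (x + y) f"
    and scale_plus: "f \<in> Hom C a b \<Longrightarrow> g \<in> Hom C a b \<Longrightarrow>
      Scale C x (Plus C f g) = Plus C (Scale C x f) (Scale C x g)"
    and scale_scale: "f \<in> Hom C a b \<Longrightarrow> Scale C x (Scale C y f) = Scale C (x * y) f"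
    and scale_one: "f \<in> Hom C a b \<Longrightarrow> Scale C 1 f = f"
    and scale_zero: "f \<in> Hom C a b \<Longrightarrow> Scale C 0 f = Zero C a b"
proof -
  interpret Module.module "scalars :: 'k ring" "hom_module C a b"
    by (rule hom_is_module) simp_all
  show "f \<in> Hom C a b \<Longrightarrow> g \<in> Hom C a b \<Longrightarrow> h \<in> Hom C a b \<Longrightarrow>
      Plus C (Plus C f g) h = Plus C f (Plus C g h)"
    "f \<in> Hom C a b \<Longrightarrow> g \<in> Hom C a b \<Longrightarrow> Plus C f g = Plus C g f"
    using M.a_assoc M.a_comm by simp_all
  show "f \<in> Hom C a b \<Longrightarrow> Plus C (Scale C x f) (Scale C y f) = Scale C (x + y) f"
    "f \<in> Hom C a b \<Longrightarrow> g \<in> Hom C a b \<Longrightarrow> Scale C x (Plus C f g) = Plus C (Scale C x f) (Scale C x g)"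
    "f \<in> Hom C a b \<Longrightarrow> Scale C x (Scale C y f) = Scale C (x * y) f"
    "f \<in> Hom C a b \<Longrightarrow> Scale C 1 f = f"
    "f \<in> Hom C a b \<Longrightarrow> Scale C 0 f = Zero C a b"
    using smult_l_distr[of x y f] smult_r_distr[of x f g] smult_assoc1[of x y f] smult_one[of f]
      smult_l_null[of f]
    by (simp_all add: scalars_def)
qed

text \<open>The additive inverse of an arrow is produced as its multiple by -1, so a Hom set with
  zero, sum and scalar multiples already carries all the data of a module.\<close>

lemma hom_moduleI:
  fixes E :: "('o, 'm, 'k::field, 'z) lincat_scheme"
  assumes "Zero E a b \<in> Hom E a b"
    and "\<And>f g. f \<in> Hom E a b \<Longrightarrow> g \<in> Hom E a b \<Longrightarrow> Plus E f g \<in> Hom E a b"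
    and "\<And>f x. f \<in> Hom E a b \<Longrightarrow> Scale E x f \<in> Hom E a b"
    and "\<And>f g h. f \<in> Hom E a b \<Longrightarrow> g \<in> Hom E a b \<Longrightarrow> h \<in> Hom E a b \<Longrightarrow>
      Plus E (Plus E f g) h = Plus E f (Plus E g h)"
    and "\<And>f g. f \<in> Hom E a b \<Longrightarrow> g \<in> Hom E a b \<Longrightarrow> Plus E f g = Plus E g f"
    and "\<And>f. f \<in> Hom E a b \<Longrightarrow> Plus E (Zero E a b) f = f"
    and "\<And>f x y. f \<in> Hom E a b \<Longrightarrow> Scale E (x + y) f = Plus E (Scale E x f) (Scale E y f)"
    and "\<And>f g x. f \<in> Hom E a b \<Longrightarrow> g \<in> Hom E a b \<Longrightarrow>
      Scale E x (Plus E f g) = Plus E (Scale E x f) (Scale E x g)"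
    and "\<And>f x y. f \<in> Hom E a b \<Longrightarrow> Scale E (x * y) f = Scale E x (Scale E y f)"
    and "\<And>f. f \<in> Hom E a b \<Longrightarrow> Scale E 1 f = f"
    and "\<And>f. f \<in> Hom E a b \<Longrightarrow> Scale E 0 f = Zero E a b"
  shows "Module.module (scalars :: 'k ring) (hom_module E a b)"
proof (rule moduleI)
  show "cring (scalars :: 'k ring)"
    by (rule cringI; (rule abelian_groupI comm_monoidI)?)
      (auto simp: scalars_def algebra_simps intro: exI[of _ "- x" for x])
  show "abelian_group (hom_module E a b)"
  proof (rule abelian_groupI)
    fix f assume "f \<in> carrier (hom_module E a b)"
    then have f: "f \<in> Hom E a b"
      by (simp add: hom_module_def)
    have "Plus E (Scale E (- 1) f) f = Scale E (- 1 + 1) f"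
      using assms(7)[OF f, of "- 1" 1] by (simp add: assms(10)[OF f])
    also have "\<dots> = Zero E a b"
      by (simp add: assms(11)[OF f])
    finally show "\<exists>g\<in>carrier (hom_module E a b). g \<oplus>\<^bsub>hom_module E a b\<^esub> f = \<zero>\<^bsub>hom_module E a b\<^esub>"
      using assms(3)[OF f] by (auto simp: hom_module_def)
  qed (use assms in \<open>auto simp: hom_module_def\<close>)
qed (use assms in \<open>auto simp: hom_module_def scalars_def\<close>)

context finite_crossed_action
begin

text \<open>The sum over degrees in the definition is the one inside gamma at \<open>V\<close>,
  followed by the structure map of \<open>V\<close>. All later calculations with tensor products of
  equivariant objects use this closed form.\<close>

lemma ext_tensor_eq:
  assumes eq: "is_equivariant (U, u)" "is_equivariant (V, v)"
  shows "ext_tensor (U, u) (V, v) = (U \<otimes>\<^sub>o V, \<lambda>g\<in>carrier G. (Id C U \<otimes>\<^sub>a v g) \<cdot> gam U u g V)"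
proof -
  note [simp] = equiv_simps[OF eq(1)] equiv_simps[OF eq(2)] gam_simps[OF eq(1)] deg_in_ob
  have "asum C ((U \<otimes>\<^sub>o V) \<lhd>\<^sub>o g) (U \<otimes>\<^sub>o V) (carrier \<Gamma>)
       (\<lambda>s. (u (s \<triangleright> g) \<otimes>\<^sub>a (v g \<cdot> (comp_inj V s \<lhd>\<^sub>a g))) \<cdot>
          Eta D g s U (comp_ob V s) \<cdot> ((Id C U \<otimes>\<^sub>a comp_prj V s) \<lhd>\<^sub>a g)) =
      (Id C U \<otimes>\<^sub>a v g) \<cdot> gam U u g V" if [simp]: "g \<in> carrier G" for g
  proof -
    have "(Id C U \<otimes>\<^sub>a v g) \<cdot> gam U u g V = asum C ((U \<otimes>\<^sub>o V) \<lhd>\<^sub>o g) (U \<otimes>\<^sub>o V) (carrier \<Gamma>)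
        (\<lambda>s. (Id C U \<otimes>\<^sub>a v g) \<cdot> ((Id C U \<otimes>\<^sub>a (comp_inj V s \<lhd>\<^sub>a g)) \<cdot>
          (u (s \<triangleright> g) \<otimes>\<^sub>a Id C (comp_ob V s \<lhd>\<^sub>o g)) \<cdot> Eta D g s U (comp_ob V s)) \<cdot>
          ((Id C U \<otimes>\<^sub>a comp_prj V s) \<lhd>\<^sub>a g))"
      unfolding gam_def extend_def by (rule asum_comp_left) (auto intro!: HomI)
    also have "\<dots> = asum C ((U \<otimes>\<^sub>o V) \<lhd>\<^sub>o g) (U \<otimes>\<^sub>o V) (carrier \<Gamma>)
       (\<lambda>s. (u (s \<triangleright> g) \<otimes>\<^sub>a (v g \<cdot> (comp_inj V s \<lhd>\<^sub>a g))) \<cdot>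
          Eta D g s U (comp_ob V s) \<cdot> ((Id C U \<otimes>\<^sub>a comp_prj V s) \<lhd>\<^sub>a g))"
      by (rule asum_cong) (auto intro!: HomI simp: ten_collapse_simps)
    finally show ?thesis ..
  qed
  then show ?thesis
    by (auto simp: ext_tensor_def restrict_def)
qed

text \<open>\<open>gam_mult\<close> splits a product of group elements for the first factor,
  multiplicativity of \<open>v\<close> does so for the second, and naturality of gamma interchanges
  the two middle maps.\<close>

lemma ext_tensor_equivariant:
  assumes eq: "is_equivariant (U, u)" "is_equivariant (V, v)"
  shows "is_equivariant (ext_tensor (U, u) (V, v))"
  unfolding ext_tensor_eq[OF assms]
proof (rule equivI)
  note [simp] = equiv_simps[OF eq(1)] equiv_simps[OF eq(2)] gam_simps[OF eq(1)]
  fix g h assume [simp]: "g \<in> carrier G" "h \<in> carrier G"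
  have "((Id C U \<otimes>\<^sub>a v (g \<otimes>\<^bsub>G\<^esub> h)) \<cdot> gam U u (g \<otimes>\<^bsub>G\<^esub> h) V) \<cdot> R2 D g h (U \<otimes>\<^sub>o V) =
      (Id C U \<otimes>\<^sub>a v h) \<cdot> (Id C U \<otimes>\<^sub>a (v g \<lhd>\<^sub>a h)) \<cdot> gam U u h (V \<lhd>\<^sub>o g) \<cdot> (gam U u g V \<lhd>\<^sub>a h)"
    by (simp add: gam_mult[OF eq(1)] ten_collapse_simps equiv_mult[OF eq(2)])
  also have "\<dots> = ((Id C U \<otimes>\<^sub>a v h) \<cdot> gam U u h V) \<cdot> (((Id C U \<otimes>\<^sub>a v g) \<cdot> gam U u g V) \<lhd>\<^sub>a h)"
    by (simp add: act_expand pre2[OF gam_nat[OF eq(1)]])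
  finally show "(\<lambda>g\<in>carrier G. (Id C U \<otimes>\<^sub>a v g) \<cdot> gam U u g V) (g \<otimes>\<^bsub>G\<^esub> h) \<cdot> R2 D g h (U \<otimes>\<^sub>o V) =
      (\<lambda>g\<in>carrier G. (Id C U \<otimes>\<^sub>a v g) \<cdot> gam U u g V) h \<cdot>
      ((\<lambda>g\<in>carrier G. (Id C U \<otimes>\<^sub>a v g) \<cdot> gam U u g V) g \<lhd>\<^sub>a h)"
    by simp
qed (use equiv_simps[OF eq(1)] equiv_simps[OF eq(2)] gam_simps[OF eq(1)] in auto)

text \<open>Tensoring with U \<otimes> V is tensoring with V and then with U, and gamma follows
  suit. On homogeneous \<open>M\<close> it is \<open>gam_eta\<close> with \<open>V\<close> and
  \<open>M\<close> as the two factors. Both the associativity of the extension and the monoidality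
  of the comparison functor come from here.\<close>

lemma gam_ext_tensor:
  assumes eq: "is_equivariant (U, u)" "is_equivariant (V, v)" and w: "ext_tensor (U, u) (V, v) = (W, w)"
    and [simp]: "g \<in> carrier G" "M \<in> Ob C"
  shows "Assoc C U V (M \<lhd>\<^sub>o g) \<cdot> gam W w g M =
    (Id C U \<otimes>\<^sub>a gam V v g M) \<cdot> gam U u g (V \<otimes>\<^sub>o M) \<cdot> (Assoc C U V M \<lhd>\<^sub>a g)"
proof -
  have eqW: "is_equivariant (U \<otimes>\<^sub>o V, w)" and W [simp]: "W = U \<otimes>\<^sub>o V"
    using ext_tensor_equivariant[OF eq] w ext_tensor_eq[OF eq] by auto
  have w': "w g = (Id C U \<otimes>\<^sub>a v g) \<cdot> gam U u g V" if "g \<in> carrier G" for g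
    using ext_tensor_eq[OF eq] w that by auto
  note U [simp] = equiv_simps[OF eq(1)]
  note V [simp] = equiv_simps[OF eq(2)]
  note [simp] = gam_simps[OF eq(1)] gam_simps[OF eq(2)] gam_simps[OF eqW] equiv_simps[OF eqW]
  show ?thesis
    unfolding W
  proof (rule linear_functor_epi[OF ten_act_linear[of "U \<otimes>\<^sub>o V"], OF _ assms(4,5)])
    fix t assume t [simp]: "t \<in> carrier \<Gamma>"
    let ?M = "comp_ob M t"
    have "Assoc C U V (?M \<lhd>\<^sub>o g) \<cdot> gam (U \<otimes>\<^sub>o V) w g ?M =
        Assoc C U V (?M \<lhd>\<^sub>o g) \<cdot> (Id C U \<otimes>\<^sub>a v (t \<triangleright> g) \<otimes>\<^sub>a Id C (?M \<lhd>\<^sub>o g)) \<cdot>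
        (gam U u (t \<triangleright> g) V \<otimes>\<^sub>a Id C (?M \<lhd>\<^sub>o g)) \<cdot> Eta D g t (U \<otimes>\<^sub>o V) ?M"
      by (simp add: gam_homogeneous[OF eqW, of _ t] w' ten_collapse_simps)
    also have "\<dots> = (Id C U \<otimes>\<^sub>a (v (t \<triangleright> g) \<otimes>\<^sub>a Id C (?M \<lhd>\<^sub>o g))) \<cdot> Assoc C U (V \<lhd>\<^sub>o (t \<triangleright> g)) (?M \<lhd>\<^sub>o g) \<cdot>
        (gam U u (t \<triangleright> g) V \<otimes>\<^sub>a Id C (?M \<lhd>\<^sub>o g)) \<cdot> Eta D g t (U \<otimes>\<^sub>o V) ?M"
      by (simp add: assoc_nat_simps)
    also have "\<dots> = (Id C U \<otimes>\<^sub>a gam V v g ?M) \<cdot> gam U u g (V \<otimes>\<^sub>o ?M) \<cdot> (Assoc C U V ?M \<lhd>\<^sub>a g)"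
      by (simp add: gam_eta[OF eq(1), symmetric] gam_homogeneous[OF eq(2), of _ t] ten_collapse_simps)
    finally have hom: "Assoc C U V (?M \<lhd>\<^sub>o g) \<cdot> gam (U \<otimes>\<^sub>o V) w g ?M =
        (Id C U \<otimes>\<^sub>a gam V v g ?M) \<cdot> gam U u g (V \<otimes>\<^sub>o ?M) \<cdot> (Assoc C U V ?M \<lhd>\<^sub>a g)" .
    have a: "(Assoc C U V M \<lhd>\<^sub>a g) \<cdot> ((Id C (U \<otimes>\<^sub>o V) \<otimes>\<^sub>a comp_inj M t) \<lhd>\<^sub>a g) =
        ((Id C U \<otimes>\<^sub>a (Id C V \<otimes>\<^sub>a comp_inj M t)) \<lhd>\<^sub>a g) \<cdot> (Assoc C U V ?M \<lhd>\<^sub>a g)"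
      by (simp add: act_expand[symmetric] assoc_nat_id)
    show "(Assoc C U V (M \<lhd>\<^sub>o g) \<cdot> gam (U \<otimes>\<^sub>o V) w g M) \<cdot> ((Id C (U \<otimes>\<^sub>o V) \<otimes>\<^sub>a comp_inj M t) \<lhd>\<^sub>a g) =
      ((Id C U \<otimes>\<^sub>a gam V v g M) \<cdot> gam U u g (V \<otimes>\<^sub>o M) \<cdot> (Assoc C U V M \<lhd>\<^sub>a g)) \<cdot>
        ((Id C (U \<otimes>\<^sub>o V) \<otimes>\<^sub>a comp_inj M t) \<lhd>\<^sub>a g)"
      by (simp add: gam_nat[OF eqW] a pre2[OF gam_nat[OF eq(1)]] assoc_nat_simps hom
          ten_collapse_simps gam_nat[OF eq(2)])
  qed (auto intro!: HomI)
qed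

lemma ext_unit_equivariant: "is_equivariant ext_unit"
  unfolding ext_unit_def by (rule equivI) (auto simp: C4)

text \<open>For the unit object gamma is \<eta> followed by \<open>Eta0\<close> on the first factor,
  which the left half of (C2) relates to the left unit constraint.\<close>

lemma gam_ext_unit:
  assumes w: "ext_unit = (W, w)" and [simp]: "g \<in> carrier G" "M \<in> Ob C"
  shows "LUnit C (M \<lhd>\<^sub>o g) \<cdot> gam W w g M = LUnit C M \<lhd>\<^sub>a g"
proof -
  have W [simp]: "W = \<I>" and eq: "is_equivariant (\<I>, w)"
    using w ext_unit_equivariant by (auto simp: ext_unit_def)
  have w': "w g = Eta0 D g" if "g \<in> carrier G" for g
    using w that by (auto simp: ext_unit_def)
  note [simp] = gam_simps[OF eq] equiv_simps[OF eq]
  show ?thesis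
    unfolding W
  proof (rule linear_functor_epi[OF ten_act_linear[OF unit_in], OF assms(2,3)])
    fix t assume t [simp]: "t \<in> carrier \<Gamma>"
    have "LUnit C (comp_ob M t \<lhd>\<^sub>o g) \<cdot> gam \<I> w g (comp_ob M t) = LUnit C (comp_ob M t) \<lhd>\<^sub>a g"
      by (simp add: gam_homogeneous[OF eq, of _ t] w' C2_left)
    then show "(LUnit C (M \<lhd>\<^sub>o g) \<cdot> gam \<I> w g M) \<cdot> ((Id C \<I> \<otimes>\<^sub>a comp_inj M t) \<lhd>\<^sub>a g) =
        (LUnit C M \<lhd>\<^sub>a g) \<cdot> ((Id C \<I> \<otimes>\<^sub>a comp_inj M t) \<lhd>\<^sub>a g)"
      by (simp add: gam_nat[OF eq] lunit_nat_simps act_expand[symmetric])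
  qed (auto intro!: HomI)
qed

subsection \<open>Equivariant arrows\<close>

lemma
  assumes "is_equivariant_arr (U, u) (V, v) f"
  shows equivariant_arr_arr: "f \<in> Arr C"
    and equivariant_arr_dom: "Dom C f = U"
    and equivariant_arr_cod: "Cod C f = V"
    and equivariant_arr_comm: "g \<in> carrier G \<Longrightarrow> v g \<cdot> (f \<lhd>\<^sub>a g) = f \<cdot> u g"
  using assms by (auto simp: is_equivariant_arr_def Hom_def)

lemmas equivariant_arr_simps = equivariant_arr_arr equivariant_arr_dom equivariant_arr_cod

lemma equivariant_arrI:
  "f \<in> Arr C \<Longrightarrow> Dom C f = U \<Longrightarrow> Cod C f = V \<Longrightarrow> (\<And>g. g \<in> carrier G \<Longrightarrow> v g \<cdot> (f \<lhd>\<^sub>a g) = f \<cdot> u g) \<Longrightarrow>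
    is_equivariant_arr (U, u) (V, v) f"
  by (auto simp: is_equivariant_arr_def Hom_def)

lemma equivariant_arr_id: "is_equivariant (U, u) \<Longrightarrow> is_equivariant_arr (U, u) (U, u) (Id C U)"
  by (rule equivariant_arrI) (auto simp: equiv_simps[of U u])

lemma equivariant_arr_comp:
  assumes "is_equivariant (U, u)" "is_equivariant (V, v)" "is_equivariant (W, w)"
    and f: "is_equivariant_arr (U, u) (V, v) f" and h: "is_equivariant_arr (V, v) (W, w) h"
  shows "is_equivariant_arr (U, u) (W, w) (h \<cdot> f)"
proof (rule equivariant_arrI)
  note [simp] = equivariant_arr_simps[OF f] equivariant_arr_simps[OF h] equiv_simps[OF assms(1)]
    equiv_simps[OF assms(2)] equiv_simps[OF assms(3)]
  fix g assume [simp]: "g \<in> carrier G"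
  show "w g \<cdot> ((h \<cdot> f) \<lhd>\<^sub>a g) = (h \<cdot> f) \<cdot> u g"
    by (simp add: act_expand pre2[OF equivariant_arr_comm[OF h]] equivariant_arr_comm[OF f])
qed (use equivariant_arr_simps[OF f] equivariant_arr_simps[OF h] in auto)

lemma equivariant_arr_inv:
  assumes "is_equivariant (U, u)" "is_equivariant (V, v)"
    and f: "is_equivariant_arr (U, u) (V, v) f" and [simp]: "is_iso C f"
  shows "is_equivariant_arr (V, v) (U, u) (inv_arr C f)"
proof (rule equivariant_arrI)
  note [simp] = equivariant_arr_simps[OF f] equiv_simps[OF assms(1)] equiv_simps[OF assms(2)]
  fix g assume [simp]: "g \<in> carrier G"
  show "u g \<cdot> (inv_arr C f \<lhd>\<^sub>a g) = inv_arr C f \<cdot> v g"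
    unfolding inv_act[OF \<open>g \<in> carrier G\<close> \<open>is_iso C f\<close>, symmetric]
    by (rule inv_slide[symmetric]) (simp_all add: equivariant_arr_comm[OF f])
qed (use equivariant_arr_simps[OF f] in auto)

lemma equivariant_arr_ten:
  assumes eq: "is_equivariant (U, u)" "is_equivariant (U', u')" "is_equivariant (V, v)" "is_equivariant (V', v')"
    and f: "is_equivariant_arr (U, u) (U', u') f" and h: "is_equivariant_arr (V, v) (V', v') h"
  shows "is_equivariant_arr (ext_tensor (U, u) (V, v)) (ext_tensor (U', u') (V', v')) (f \<otimes>\<^sub>a h)"
  unfolding ext_tensor_eq[OF eq(1,3)] ext_tensor_eq[OF eq(2,4)]
proof (rule equivariant_arrI)
  note [simp] = equivariant_arr_simps[OF f] equivariant_arr_simps[OF h] equiv_simps[OF eq(1)]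
    equiv_simps[OF eq(2)] equiv_simps[OF eq(3)] equiv_simps[OF eq(4)] gam_simps[OF eq(1)] gam_simps[OF eq(2)]
  fix g assume g [simp]: "g \<in> carrier G"
  have "((Id C U' \<otimes>\<^sub>a v' g) \<cdot> gam U' u' g V') \<cdot> ((f \<otimes>\<^sub>a h) \<lhd>\<^sub>a g) =
      (Id C U' \<otimes>\<^sub>a v' g) \<cdot> gam U' u' g V' \<cdot> ((Id C U' \<otimes>\<^sub>a h) \<lhd>\<^sub>a g) \<cdot> ((f \<otimes>\<^sub>a Id C V) \<lhd>\<^sub>a g)"
    by (simp add: act_expand[symmetric] ten_collapse)
  also have "\<dots> = (f \<otimes>\<^sub>a h) \<cdot> (Id C U \<otimes>\<^sub>a v g) \<cdot> gam U u g V"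
    by (simp add: pre2[OF gam_nat[OF eq(2)]] gam_equivariant_arr[OF eq(1,2) f] ten_collapse_simps
        equivariant_arr_comm[OF h])
  finally show "(\<lambda>g\<in>carrier G. (Id C U' \<otimes>\<^sub>a v' g) \<cdot> gam U' u' g V') g \<cdot> ((f \<otimes>\<^sub>a h) \<lhd>\<^sub>a g) =
      (f \<otimes>\<^sub>a h) \<cdot> (\<lambda>g\<in>carrier G. (Id C U \<otimes>\<^sub>a v g) \<cdot> gam U u g V) g"
    by simp
qed (use equivariant_arr_simps[OF f] equivariant_arr_simps[OF h] in auto)

text \<open>An instance of \<open>gam_ext_tensor\<close> at the underlying object \<open>W\<close>,
  followed by the structure map \<open>w\<close> on the last factor.\<close>

lemma equivariant_arr_assoc:
  assumes eq: "is_equivariant (U, u)" "is_equivariant (V, v)" "is_equivariant (W, w)"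
  shows "is_equivariant_arr (ext_tensor (ext_tensor (U, u) (V, v)) (W, w))
    (ext_tensor (U, u) (ext_tensor (V, v) (W, w))) (Assoc C U V W)"
proof -
  obtain a where UV: "ext_tensor (U, u) (V, v) = (U \<otimes>\<^sub>o V, a)"
    using ext_tensor_eq[OF eq(1,2)] by auto
  obtain b where VW: "ext_tensor (V, v) (W, w) = (V \<otimes>\<^sub>o W, b)"
    using ext_tensor_eq[OF eq(2,3)] by auto
  have b: "b g = (Id C V \<otimes>\<^sub>a w g) \<cdot> gam V v g W" if "g \<in> carrier G" for g
    using ext_tensor_eq[OF eq(2,3)] VW that by auto
  have eqUV: "is_equivariant (U \<otimes>\<^sub>o V, a)" and eqVW: "is_equivariant (V \<otimes>\<^sub>o W, b)"
    using ext_tensor_equivariant[OF eq(1,2)] ext_tensor_equivariant[OF eq(2,3)] UV VW by auto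
  note [simp] = equiv_simps[OF eq(1)] equiv_simps[OF eq(2)] equiv_simps[OF eq(3)] gam_simps[OF eq(1)]
    gam_simps[OF eq(2)] equiv_simps[OF eqUV] gam_simps[OF eqUV]
  show ?thesis
    unfolding UV VW ext_tensor_eq[OF eqUV eq(3)] ext_tensor_eq[OF eq(1) eqVW]
    by (rule equivariant_arrI)
      (simp_all add: b ten_collapse_simps assoc_nat_simps gam_ext_tensor[OF eq(1,2) UV]
        flip: ten_collapse_pre[where f' = "Id C _" and f = "Id C _"])
qed

lemma equivariant_arr_lunit:
  assumes eq: "is_equivariant (U, u)"
  shows "is_equivariant_arr (ext_tensor ext_unit (U, u)) (U, u) (LUnit C U)"
proof -
  obtain e where e: "ext_unit = (\<I>, e)"
    by (auto simp: ext_unit_def)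
  have eqe: "is_equivariant (\<I>, e)"
    using ext_unit_equivariant e by simp
  note [simp] = equiv_simps[OF eq] gam_simps[OF eqe]
  show ?thesis
    unfolding e ext_tensor_eq[OF eqe eq]
    by (rule equivariant_arrI) (simp_all add: lunit_nat_simps gam_ext_unit[OF e])
qed

lemma equivariant_arr_runit:
  assumes eq: "is_equivariant (U, u)"
  shows "is_equivariant_arr (ext_tensor (U, u) ext_unit) (U, u) (RUnit C U)"
proof -
  obtain e where e: "ext_unit = (\<I>, e)" and e': "\<And>g. g \<in> carrier G \<Longrightarrow> e g = Eta0 D g"
    by (auto simp: ext_unit_def)
  have eqe: "is_equivariant (\<I>, e)"
    using ext_unit_equivariant e by simp
  note [simp] = equiv_simps[OF eq] gam_simps[OF eq]
  show ?thesis
    unfolding e ext_tensor_eq[OF eq eqe]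
    by (rule equivariant_arrI) (simp_all add: e' gam_unit[OF eq])
qed

subsection \<open>Structure of the crossed extension\<close>

lemma ext_tensor_ob [simp]: "is_equivariant W \<Longrightarrow> is_equivariant W' \<Longrightarrow> is_equivariant (ext_tensor W W')"
  using ext_tensor_equivariant by (cases W; cases W') auto

lemma fst_ext_tensor [simp]: "is_equivariant W \<Longrightarrow> is_equivariant W' \<Longrightarrow> fst (ext_tensor W W') = fst W \<otimes>\<^sub>o fst W'"
  using ext_tensor_eq by (cases W; cases W') auto

lemma fst_ext_unit [simp]: "fst ext_unit = \<I>"
  by (simp add: ext_unit_def)

declare ext_unit_equivariant [simp]

lemma equiv_fst [simp]: "is_equivariant W \<Longrightarrow> fst W \<in> Ob C"
  using equiv_ob by (cases W) auto

lemma equivariant_arr_Hom: "is_equivariant_arr W W' f \<Longrightarrow> f \<in> Hom C (fst W) (fst W')"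
  by (simp add: is_equivariant_arr_def)

lemma equivariant_arr_plus:
  assumes "is_equivariant W" "is_equivariant W'" "is_equivariant_arr W W' f" "is_equivariant_arr W W' h"
  shows "is_equivariant_arr W W' (Plus C f h)"
proof -
  obtain U u V v where W: "W = (U, u)" "W' = (V, v)"
    by (cases W; cases W') auto
  note eq = assms(1,2)[unfolded W] and fh = assms(3,4)[unfolded W]
  have f: "f \<in> Hom C U V" and h: "h \<in> Hom C U V"
    using fh by (auto simp: is_equivariant_arr_def)
  note [simp] = HomD[OF f] HomD[OF h] equiv_simps[OF eq(1)] equiv_simps[OF eq(2)]
  have "v g \<cdot> (Plus C f h \<lhd>\<^sub>a g) = Plus C f h \<cdot> u g" if g [simp]: "g \<in> carrier G" for g
  proof -
    have "v g \<cdot> (Plus C f h \<lhd>\<^sub>a g) = Plus C (v g \<cdot> (f \<lhd>\<^sub>a g)) (v g \<cdot> (h \<lhd>\<^sub>a g))"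
      unfolding linear_functor_plus[OF act_linear[OF g] f h]
      by (rule comp_plus_right) (auto intro: HomI)
    also have "\<dots> = Plus C f h \<cdot> u g"
      unfolding equivariant_arr_comm[OF fh(1) g] equivariant_arr_comm[OF fh(2) g]
      by (rule comp_plus_left[symmetric]) (auto intro: HomI)
    finally show ?thesis .
  qed
  then show ?thesis
    using plus_in[OF f h] by (simp add: W is_equivariant_arr_def)
qed

lemma equivariant_arr_scale:
  assumes "is_equivariant W" "is_equivariant W'" "is_equivariant_arr W W' f"
  shows "is_equivariant_arr W W' (Scale C x f)"
proof -
  obtain U u V v where W: "W = (U, u)" "W' = (V, v)"
    by (cases W; cases W') auto
  note eq = assms(1,2)[unfolded W] and ff = assms(3)[unfolded W]
  have f: "f \<in> Hom C U V"
    using ff by (auto simp: is_equivariant_arr_def)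
  note [simp] = HomD[OF f] equiv_simps[OF eq(1)] equiv_simps[OF eq(2)]
  have "v g \<cdot> (Scale C x f \<lhd>\<^sub>a g) = Scale C x f \<cdot> u g" if g [simp]: "g \<in> carrier G" for g
  proof -
    have "Scale C x f \<lhd>\<^sub>a g = Scale C x (f \<lhd>\<^sub>a g)"
      using act_linear[OF g] f unfolding is_linear_functor_def by blast
    then have "v g \<cdot> (Scale C x f \<lhd>\<^sub>a g) = Scale C x (v g \<cdot> (f \<lhd>\<^sub>a g))"
      using comp_scale_right[of "f \<lhd>\<^sub>a g" "U \<lhd>\<^sub>o g" "V \<lhd>\<^sub>o g" "v g" V x] by (simp add: Hom_def)
    also have "\<dots> = Scale C x f \<cdot> u g"
      unfolding equivariant_arr_comm[OF ff g]
      by (rule comp_scale_left[symmetric, where b = U and c = V]) (auto intro: HomI)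
    finally show ?thesis .
  qed
  then show ?thesis
    using scale_in[OF f] by (simp add: W is_equivariant_arr_def)
qed

lemma equivariant_arr_zero:
  assumes "is_equivariant W" "is_equivariant W'"
  shows "is_equivariant_arr W W' (Zero C (fst W) (fst W'))"
  using assms equiv_simps[of "fst W" "snd W"] equiv_simps[of "fst W'" "snd W'"]
  by (auto simp: is_equivariant_arr_def zero_in)

lemma ext_sel [simp]:
  "Ob crossed_extension = {W. is_equivariant W}"
  "Arr crossed_extension = {(W, f, W'). is_equivariant W \<and> is_equivariant W' \<and> is_equivariant_arr W W' f}"
  "Dom crossed_extension (W, f, W') = W"
  "Cod crossed_extension (W, f, W') = W'"
  "Id crossed_extension W = (W, Id C (fst W), W)"
  "Comp crossed_extension (V, h, W'') (W, f, V') = (W, h \<cdot> f, W'')"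
  "Zero crossed_extension W W' = (W, Zero C (fst W) (fst W'), W')"
  "Plus crossed_extension (W, f, W') (V, h, V') = (W, Plus C f h, W')"
  "Scale crossed_extension x (W, f, W') = (W, Scale C x f, W')"
  "Unit crossed_extension = ext_unit"
  "TenO crossed_extension = ext_tensor"
  "TenA crossed_extension (W, f, W') (V, h, V') = (ext_tensor W V, f \<otimes>\<^sub>a h, ext_tensor W' V')"
  "Assoc crossed_extension W W' W'' = (ext_tensor (ext_tensor W W') W'',
        Assoc C (fst W) (fst W') (fst W''), ext_tensor W (ext_tensor W' W''))"
  "LUnit crossed_extension W = (ext_tensor ext_unit W, LUnit C (fst W), W)"
  "RUnit crossed_extension W = (ext_tensor W ext_unit, RUnit C (fst W), W)"
  by (simp_all add: crossed_extension_def)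

lemma ext_Hom: "Hom crossed_extension W W' =
    {(W, f, W') | f. is_equivariant W \<and> is_equivariant W' \<and> is_equivariant_arr W W' f}"
proof -
  have "Dom crossed_extension p = fst p" "Cod crossed_extension p = snd (snd p)" for p
    by (cases p; simp)+
  then show ?thesis
    by (force simp: Hom_def)
qed

lemma ext_HomE:
  assumes "p \<in> Hom crossed_extension W W'"
  obtains f where "p = (W, f, W')" "is_equivariant W" "is_equivariant W'" "is_equivariant_arr W W' f"
    "f \<in> Hom C (fst W) (fst W')"
  using assms equivariant_arr_Hom by (auto simp: ext_Hom)

lemma equivariant_arr_comp': "is_equivariant W \<Longrightarrow> is_equivariant W' \<Longrightarrow> is_equivariant W'' \<Longrightarrow>
    is_equivariant_arr W W' f \<Longrightarrow> is_equivariant_arr W' W'' h \<Longrightarrow> is_equivariant_arr W W'' (h \<cdot> f)"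
  using equivariant_arr_comp by (cases W; cases W'; cases W'') blast

lemma equivariant_arr_id': "is_equivariant W \<Longrightarrow> is_equivariant_arr W W (Id C (fst W))"
  using equivariant_arr_id by (cases W) auto

lemma equivariant_arr_ten': "is_equivariant W \<Longrightarrow> is_equivariant W' \<Longrightarrow> is_equivariant V \<Longrightarrow> is_equivariant V' \<Longrightarrow>
    is_equivariant_arr W W' f \<Longrightarrow> is_equivariant_arr V V' h \<Longrightarrow>
    is_equivariant_arr (ext_tensor W V) (ext_tensor W' V') (f \<otimes>\<^sub>a h)"
  using equivariant_arr_ten by (cases W; cases W'; cases V; cases V') blast

lemma ext_is_isoI:
  assumes "is_equivariant W" "is_equivariant W'" "is_equivariant_arr W W' f" "is_iso C f"
  shows "(W, f, W') \<in> Iso crossed_extension W W'"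
proof -
  have "is_equivariant_arr W' W (inv_arr C f)"
    using assms equivariant_arr_inv by (cases W; cases W') blast
  moreover have "Dom C f = fst W" "Cod C f = fst W'"
    using equivariant_arr_Hom[OF assms(3)] by (auto simp: Hom_def)
  ultimately have "inverse_arrows crossed_extension (W, f, W') (W', inv_arr C f, W)"
    using assms by (auto simp: inverse_arrows_def ext_Hom)
  then have "is_iso crossed_extension (W, f, W')"
    unfolding is_iso_def by blast
  then show ?thesis
    using assms by (auto simp: Iso_def ext_Hom)
qed

lemma ext_assoc_arr:
  assumes "is_equivariant W" "is_equivariant W'" "is_equivariant W''"
  shows "is_equivariant_arr (ext_tensor (ext_tensor W W') W'') (ext_tensor W (ext_tensor W' W''))
    (Assoc C (fst W) (fst W') (fst W''))"
  using equivariant_arr_assoc assms by (cases W; cases W'; cases W'') auto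

lemma ext_lunit_arr: "is_equivariant W \<Longrightarrow> is_equivariant_arr (ext_tensor ext_unit W) W (LUnit C (fst W))"
  using equivariant_arr_lunit by (cases W) auto

lemma ext_runit_arr: "is_equivariant W \<Longrightarrow> is_equivariant_arr (ext_tensor W ext_unit) W (RUnit C (fst W))"
  using equivariant_arr_runit by (cases W) auto

lemma ext_hom_module:
  assumes W: "is_equivariant W" "is_equivariant W'"
  shows "Module.module (scalars :: 'k ring) (hom_module crossed_extension W W')"
proof -
  note obs = equiv_fst[OF W(1)] equiv_fst[OF W(2)]
  note [simp] = W
  show ?thesis
    by (rule hom_moduleI; (elim ext_HomE)?;
        simp add: ext_Hom plus_zero plus_assoc[OF obs] plus_scale[OF obs] scale_plus[OF obs] scale_scale[OF obs]
          scale_one[OF obs] scale_zero[OF obs] equivariant_arr_zero equivariant_arr_plus equivariant_arr_scale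
          plus_comm[OF obs])
qed

text \<open>Arrows are arrows of C tagged with equivariant source and target, so once the structure
  maps are known to be equivariant each axiom is inherited from C.\<close>

theorem crossed_extension_monoidal: "linear_monoidal_category crossed_extension"
proof (intro linear_monoidal_category.intro linear_category.intro linear_monoidal_category_axioms.intro)
  let ?E = crossed_extension
  show "f \<in> Arr ?E \<Longrightarrow> Dom ?E f \<in> Ob ?E" "f \<in> Arr ?E \<Longrightarrow> Cod ?E f \<in> Ob ?E" for f
    by auto
  show "Id ?E a \<in> Hom ?E a a" if "a \<in> Ob ?E" for a
    using that by (auto simp: ext_Hom intro: equivariant_arr_id')
  show "Comp ?E g f \<in> Hom ?E a c" if "f \<in> Hom ?E a b" "g \<in> Hom ?E b c" for f g a b c
    using that by (auto elim!: ext_HomE simp: ext_Hom intro: equivariant_arr_comp')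
  show "Comp ?E (Id ?E b) f = f" "Comp ?E f (Id ?E a) = f" if "f \<in> Hom ?E a b" for f a b
    using that by (auto elim!: ext_HomE simp: id_left id_right)
  show "Comp ?E (Comp ?E h g) f = Comp ?E h (Comp ?E g f)"
    if "f \<in> Hom ?E a b" "g \<in> Hom ?E b c" "h \<in> Hom ?E c d" for f g h a b c d
    using that by (auto elim!: ext_HomE intro: comp_assoc)
  show "Module.module (scalars :: 'k ring) (hom_module ?E a b)" if "a \<in> Ob ?E" "b \<in> Ob ?E" for a b
    using that ext_hom_module by auto
  show "Comp ?E (Plus ?E g g') f = Plus ?E (Comp ?E g f) (Comp ?E g' f)"
    if "f \<in> Hom ?E a b" "g \<in> Hom ?E b c" "g' \<in> Hom ?E b c" for f g g' a b c
    using that by (auto elim!: ext_HomE intro: comp_plus_left)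
  show "Comp ?E g (Plus ?E f f') = Plus ?E (Comp ?E g f) (Comp ?E g f')"
    if "f \<in> Hom ?E a b" "f' \<in> Hom ?E a b" "g \<in> Hom ?E b c" for f f' g a b c
    using that by (auto elim!: ext_HomE intro: comp_plus_right)
  show "Comp ?E (Scale ?E x g) f = Scale ?E x (Comp ?E g f)"
    "Comp ?E g (Scale ?E x f) = Scale ?E x (Comp ?E g f)"
    if "f \<in> Hom ?E a b" "g \<in> Hom ?E b c" for f g a b c x
    using that by (auto elim!: ext_HomE intro: comp_scale_left comp_scale_right)
  show "Unit ?E \<in> Ob ?E"
    by simp
  show "TenO ?E X Y \<in> Ob ?E" if "X \<in> Ob ?E" "Y \<in> Ob ?E" for X Y
    using that by simp
  show "TenA ?E f g \<in> Hom ?E (TenO ?E X Y) (TenO ?E X' Y')"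
    if "f \<in> Hom ?E X X'" "g \<in> Hom ?E Y Y'" for f g X X' Y Y'
    using that by (auto elim!: ext_HomE simp: ext_Hom intro: equivariant_arr_ten')
  show "TenA ?E (Id ?E X) (Id ?E Y) = Id ?E (TenO ?E X Y)" if "X \<in> Ob ?E" "Y \<in> Ob ?E" for X Y
    using that by simp
  show "TenA ?E (Comp ?E f' f) (Comp ?E g' g) = Comp ?E (TenA ?E f' g') (TenA ?E f g)"
    if "f \<in> Hom ?E X X'" "f' \<in> Hom ?E X' X''" "g \<in> Hom ?E Y Y'" "g' \<in> Hom ?E Y' Y''" for f f' g g' X X' X'' Y Y' Y''
    using that by (auto elim!: ext_HomE intro: ten_comp)
  show "TenA ?E (Plus ?E f f') g = Plus ?E (TenA ?E f g) (TenA ?E f' g)"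
    if "f \<in> Hom ?E X X'" "f' \<in> Hom ?E X X'" "g \<in> Hom ?E Y Y'" for f f' g X X' Y Y'
    using that by (auto elim!: ext_HomE intro: ten_plus_left)
  show "TenA ?E f (Plus ?E g g') = Plus ?E (TenA ?E f g) (TenA ?E f g')"
    if "f \<in> Hom ?E X X'" "g \<in> Hom ?E Y Y'" "g' \<in> Hom ?E Y Y'" for f g g' X X' Y Y'
    using that by (auto elim!: ext_HomE intro: ten_plus_right)
  show "TenA ?E (Scale ?E x f) g = Scale ?E x (TenA ?E f g)"
    "TenA ?E f (Scale ?E x g) = Scale ?E x (TenA ?E f g)"
    if "f \<in> Hom ?E X X'" "g \<in> Hom ?E Y Y'" for f g X X' Y Y' x
    using that by (auto elim!: ext_HomE intro: ten_scale_left ten_scale_right)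
  show "Assoc ?E X Y Z \<in> Iso ?E (TenO ?E (TenO ?E X Y) Z) (TenO ?E X (TenO ?E Y Z))"
    if "X \<in> Ob ?E" "Y \<in> Ob ?E" "Z \<in> Ob ?E" for X Y Z
    using that by (auto intro!: ext_is_isoI ext_assoc_arr)
  show "Comp ?E (Assoc ?E X' Y' Z') (TenA ?E (TenA ?E f g) h) =
      Comp ?E (TenA ?E f (TenA ?E g h)) (Assoc ?E X Y Z)"
    if "f \<in> Hom ?E X X'" "g \<in> Hom ?E Y Y'" "h \<in> Hom ?E Z Z'" for f g h X X' Y Y' Z Z'
    using that by (auto elim!: ext_HomE intro: assoc_natural)
  show "LUnit ?E X \<in> Iso ?E (TenO ?E (Unit ?E) X) X" "RUnit ?E X \<in> Iso ?E (TenO ?E X (Unit ?E)) X"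
    if "X \<in> Ob ?E" for X
    using that by (auto intro!: ext_is_isoI ext_lunit_arr ext_runit_arr)
  show "Comp ?E (LUnit ?E X') (TenA ?E (Id ?E (Unit ?E)) f) = Comp ?E f (LUnit ?E X)"
    "Comp ?E (RUnit ?E X') (TenA ?E f (Id ?E (Unit ?E))) = Comp ?E f (RUnit ?E X)"
    if "f \<in> Hom ?E X X'" for f X X'
    using that by (auto elim!: ext_HomE intro: lunit_natural runit_natural)
  show "Comp ?E (Assoc ?E W X (TenO ?E Y Z)) (Assoc ?E (TenO ?E W X) Y Z) =
      Comp ?E (TenA ?E (Id ?E W) (Assoc ?E X Y Z))
        (Comp ?E (Assoc ?E W (TenO ?E X Y) Z) (TenA ?E (Assoc ?E W X Y) (Id ?E Z)))"
    if "W \<in> Ob ?E" "X \<in> Ob ?E" "Y \<in> Ob ?E" "Z \<in> Ob ?E" for W X Y Z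
    using that by (simp add: pentagon)
  show "Comp ?E (TenA ?E (Id ?E X) (LUnit ?E Y)) (Assoc ?E X (Unit ?E) Y) = TenA ?E (RUnit ?E X) (Id ?E Y)"
    if "X \<in> Ob ?E" "Y \<in> Ob ?E" for X Y
    using that by (simp add: triangle)
qed

end

section \<open>The dual category of a right module category\<close>

lemma restrict_eqI: "f \<in> extensional A \<Longrightarrow> (\<And>x. x \<in> A \<Longrightarrow> f x = g x) \<Longrightarrow> restrict g A = f"
  by (auto simp: restrict_def extensional_def)

lemma restrict_cong_on: "(\<And>x. x \<in> A \<Longrightarrow> f x = g x) \<Longrightarrow> restrict f A = restrict g A"
  by auto

text \<open>Isolates what the dual category draws from the action: well-typed objects and structure
  maps, and an action that for a fixed acting object is a linear functor in the module
  variable.\<close>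

locale right_action = modcat_data M B A + linear_category M
  for M :: "('o, 'm, 'k::field, 'y) lincat_scheme" (structure)
    and B :: "('b, 'n, 'k, 'z) moncat_scheme"
    and A :: "('o, 'm, 'b, 'n) modcat" +
  assumes B_hom_ob: "h \<in> Hom B Y Y' \<Longrightarrow> Y \<in> Ob B \<and> Y' \<in> Ob B"
    and B_id: "Y \<in> Ob B \<Longrightarrow> Id B Y \<in> Hom B Y Y"
    and B_unit: "Unit B \<in> Ob B"
    and B_ten: "Y \<in> Ob B \<Longrightarrow> Z \<in> Ob B \<Longrightarrow> Y \<otimes>\<^sub>o\<^bsub>B\<^esub> Z \<in> Ob B"
    and mact_ob: "X \<in> Ob M \<Longrightarrow> Y \<in> Ob B \<Longrightarrow> X \<star>\<^sub>o Y \<in> Ob M"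
    and mact_arr: "f \<in> Hom M X X' \<Longrightarrow> h \<in> Hom B Y Y' \<Longrightarrow> f \<star>\<^sub>a h \<in> Hom M (X \<star>\<^sub>o Y) (X' \<star>\<^sub>o Y')"
    and mact_id: "X \<in> Ob M \<Longrightarrow> Y \<in> Ob B \<Longrightarrow> Id M X \<star>\<^sub>a Id B Y = Id M (X \<star>\<^sub>o Y)"
    and mact_comp: "f \<in> Hom M X X' \<Longrightarrow> f' \<in> Hom M X' X'' \<Longrightarrow> Y \<in> Ob B \<Longrightarrow>
      (f' \<cdot> f) \<star>\<^sub>a Id B Y = (f' \<star>\<^sub>a Id B Y) \<cdot> (f \<star>\<^sub>a Id B Y)"
    and mact_plus: "f \<in> Hom M X X' \<Longrightarrow> f' \<in> Hom M X X' \<Longrightarrow> Y \<in> Ob B \<Longrightarrow>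
      Plus M f f' \<star>\<^sub>a Id B Y = Plus M (f \<star>\<^sub>a Id B Y) (f' \<star>\<^sub>a Id B Y)"
    and mact_scale: "f \<in> Hom M X X' \<Longrightarrow> Y \<in> Ob B \<Longrightarrow>
      Scale M x f \<star>\<^sub>a Id B Y = Scale M x (f \<star>\<^sub>a Id B Y)"
    and massoc_in: "X \<in> Ob M \<Longrightarrow> Y \<in> Ob B \<Longrightarrow> Z \<in> Ob B \<Longrightarrow>
      MAssoc A X Y Z \<in> Hom M (X \<star>\<^sub>o (Y \<otimes>\<^sub>o\<^bsub>B\<^esub> Z)) (X \<star>\<^sub>o Y \<star>\<^sub>o Z)"
    and munit_in: "X \<in> Ob M \<Longrightarrow> MUnit A X \<in> Hom M (X \<star>\<^sub>o Unit B) X"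
begin

abbreviation fo where "fo F \<equiv> fst F"
abbreviation fa where "fa F \<equiv> fst (snd F)"
abbreviation fs where "fs F \<equiv> snd (snd F)"

declare B_unit [simp] B_ten [simp] mact_ob [simp] mact_id [simp]

lemma
  assumes "f \<in> Arr M" "Y \<in> Ob B"
  shows arr_mact [simp]: "f \<star>\<^sub>a Id B Y \<in> Arr M"
    and dom_mact [simp]: "Dom M (f \<star>\<^sub>a Id B Y) = Dom M f \<star>\<^sub>o Y"
    and cod_mact [simp]: "Cod M (f \<star>\<^sub>a Id B Y) = Cod M f \<star>\<^sub>o Y"
  using mact_arr[OF HomI[OF assms(1) refl refl] B_id[OF assms(2)]] by (auto simp: Hom_def)

lemma mact_expand: "f \<in> Arr M \<Longrightarrow> f' \<in> Arr M \<Longrightarrow> Dom M f' = Cod M f \<Longrightarrow> Y \<in> Ob B \<Longrightarrow>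
    (f' \<cdot> f) \<star>\<^sub>a Id B Y = (f' \<star>\<^sub>a Id B Y) \<cdot> (f \<star>\<^sub>a Id B Y)"
  by (rule mact_comp) (auto simp: Hom_def)

lemma mact_linear: "Y \<in> Ob B \<Longrightarrow> is_linear_functor M M (\<lambda>X. X \<star>\<^sub>o Y) (\<lambda>f. f \<star>\<^sub>a Id B Y)"
  by (auto simp: is_linear_functor_def is_functor_def mact_plus mact_scale mact_expand mact_arr B_id Hom_def)

lemma mact_zero [simp]: "X \<in> Ob M \<Longrightarrow> X' \<in> Ob M \<Longrightarrow> Y \<in> Ob B \<Longrightarrow>
    Zero M X X' \<star>\<^sub>a Id B Y = Zero M (X \<star>\<^sub>o Y) (X' \<star>\<^sub>o Y)"
  using linear_functor_zero[OF linear_category_axioms mact_linear] .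

lemma mact_iso [simp]: "is_iso M f \<Longrightarrow> Y \<in> Ob B \<Longrightarrow> is_iso M (f \<star>\<^sub>a Id B Y)"
  using functor_iso[OF linear_is_functor[OF mact_linear]] .

lemma
  assumes "X \<in> Ob M"
  shows arr_munit [simp]: "MUnit A X \<in> Arr M"
    and dom_munit [simp]: "Dom M (MUnit A X) = X \<star>\<^sub>o Unit B"
    and cod_munit [simp]: "Cod M (MUnit A X) = X"
  using HomD[OF munit_in[OF assms]] by auto

lemma
  assumes "X \<in> Ob M" "Y \<in> Ob B" "Z \<in> Ob B"
  shows arr_massoc [simp]: "MAssoc A X Y Z \<in> Arr M"
    and dom_massoc [simp]: "Dom M (MAssoc A X Y Z) = X \<star>\<^sub>o (Y \<otimes>\<^sub>o\<^bsub>B\<^esub> Z)"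
    and cod_massoc [simp]: "Cod M (MAssoc A X Y Z) = X \<star>\<^sub>o Y \<star>\<^sub>o Z"
  using HomD[OF massoc_in[OF assms]] by auto

subsection \<open>Module endofunctors\<close>

lemma
  assumes "is_module_endofunctor F"
  shows mf_exact: "is_exact_functor M M (fo F) (fa F)"
    and mf_linear: "is_linear_functor M M (fo F) (fa F)"
    and mf_functor: "is_functor M M (fo F) (fa F)"
    and mf_ext: "fo F \<in> extensional (Ob M)" "fa F \<in> extensional (Arr M)" "fs F \<in> extensional (Ob M \<times> Ob B)"
    and mf_iso: "X \<in> Ob M \<Longrightarrow> Y \<in> Ob B \<Longrightarrow> is_iso M (fs F (X, Y))"
    and mf_s_arr: "X \<in> Ob M \<Longrightarrow> Y \<in> Ob B \<Longrightarrow> fs F (X, Y) \<in> Arr M"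
    and mf_s_dom: "X \<in> Ob M \<Longrightarrow> Y \<in> Ob B \<Longrightarrow> Dom M (fs F (X, Y)) = fo F (X \<star>\<^sub>o Y)"
    and mf_s_cod: "X \<in> Ob M \<Longrightarrow> Y \<in> Ob B \<Longrightarrow> Cod M (fs F (X, Y)) = fo F X \<star>\<^sub>o Y"
    and mf_nat: "f \<in> Hom M X X' \<Longrightarrow> h \<in> Hom B Y Y' \<Longrightarrow>
      fs F (X', Y') \<cdot> fa F (f \<star>\<^sub>a h) = (fa F f \<star>\<^sub>a h) \<cdot> fs F (X, Y)"
    and mf_assoc: "X \<in> Ob M \<Longrightarrow> Y \<in> Ob B \<Longrightarrow> Z \<in> Ob B \<Longrightarrow>
      MAssoc A (fo F X) Y Z \<cdot> fs F (X, Y \<otimes>\<^sub>o\<^bsub>B\<^esub> Z) =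
      (fs F (X, Y) \<star>\<^sub>a Id B Z) \<cdot> fs F (X \<star>\<^sub>o Y, Z) \<cdot> fa F (MAssoc A X Y Z)"
    and mf_unit: "X \<in> Ob M \<Longrightarrow> MUnit A (fo F X) \<cdot> fs F (X, Unit B) = fa F (MUnit A X)"
  using assms unfolding is_module_endofunctor_def is_exact_functor_def is_linear_functor_def
  by (auto simp: Iso_iff is_iso_arr)

lemmas mf_simps = functor_ob[OF mf_functor] functor_id[OF mf_functor] functor_arr[OF mf_functor]
  functor_dom[OF mf_functor] functor_cod[OF mf_functor] functor_comp[OF mf_functor]
  mf_iso mf_s_arr mf_s_dom mf_s_cod

lemma mf_nat_id:
  assumes "is_module_endofunctor F" "f \<in> Arr M" "Y \<in> Ob B" "Cod M f = X"
  shows "fs F (X, Y) \<cdot> fa F (f \<star>\<^sub>a Id B Y) = (fa F f \<star>\<^sub>a Id B Y) \<cdot> fs F (Dom M f, Y)"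
  using mf_nat[OF assms(1) HomI[OF assms(2) refl assms(4)] B_id[OF assms(3)]] .

lemma modfun_eqI: "fo F = fo H \<Longrightarrow> fa F = fa H \<Longrightarrow> fs F = fs H \<Longrightarrow> F = H"
  by (cases F; cases H) auto

text \<open>Module functors are stored as extensional functions, so identities and composites appear
  as restrictions. Exactness depends only on values at genuine objects and arrows.\<close>

lemma exact_functor_cong:
  assumes "is_exact_functor M M Fo Fa" "\<And>X. X \<in> Ob M \<Longrightarrow> Fo' X = Fo X" "\<And>f. f \<in> Arr M \<Longrightarrow> Fa' f = Fa f"
  shows "is_exact_functor M M Fo' Fa'"
proof -
  have o: "Fo' X = Fo X" "Fo' Y = Fo Y" "Fa' f = Fa f" if "f \<in> Hom M X Y" for f X Y
    using that assms(2,3) Hom_ob[OF that] HomD[OF that] by auto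
  have "is_functor M M Fo' Fa'"
    using assms(1) unfolding is_exact_functor_def is_linear_functor_def is_functor_def
    by (auto simp: assms(2,3) o comp_in id_in HomD[OF id_in])
      (metis o(3) comp_in)
  moreover have "Fa' (Plus M f g) = Plus M (Fa' f) (Fa' g)" if "f \<in> Hom M X Y" "g \<in> Hom M X Y" for f g X Y
    using assms(1) that o(3)[OF plus_in[OF that]] o(3)[OF that(1)] o(3)[OF that(2)]
    unfolding is_exact_functor_def is_linear_functor_def by auto
  moreover have "Fa' (Scale M x f) = Scale M x (Fa' f)" if "f \<in> Hom M X Y" for f x X Y
    using assms(1) that o(3)[OF scale_in[OF that]] o(3)[OF that]
    unfolding is_exact_functor_def is_linear_functor_def by auto
  moreover have "Fa' f = Fa f" "Fa' i = Fa i" if "is_kernel M f i" for f i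
    using that assms(3) by (auto simp: is_kernel_def)
  moreover have "Fa' f = Fa f" "Fa' i = Fa i" if "is_cokernel M f i" for f i
    using that assms(3) by (auto simp: is_cokernel_def)
  ultimately show ?thesis
    using assms(1) unfolding is_exact_functor_def is_linear_functor_def by simp
qed

lemma modfun_id_in: "is_module_endofunctor modfun_id"
proof -
  have id: "is_exact_functor M M (\<lambda>X. X) (\<lambda>f. f)"
    by (simp add: is_exact_functor_def is_linear_functor_id)
  have "is_exact_functor M M (\<lambda>X\<in>Ob M. X) (\<lambda>f\<in>Arr M. f)"
    by (rule exact_functor_cong[OF id]) auto
  moreover have "f \<star>\<^sub>a h \<in> Arr M" "Dom M (f \<star>\<^sub>a h) = X \<star>\<^sub>o Y" "Cod M (f \<star>\<^sub>a h) = X' \<star>\<^sub>o Y'"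
    "X \<in> Ob M" "X' \<in> Ob M" "Y \<in> Ob B" "Y' \<in> Ob B" "f \<in> Arr M"
    if "f \<in> Hom M X X'" "h \<in> Hom B Y Y'" for f h X X' Y Y'
    using HomD[OF mact_arr[OF that]] Hom_ob[OF that(1)] B_hom_ob[OF that(2)] HomD[OF that(1)] by auto
  ultimately show ?thesis
    by (auto simp: is_module_endofunctor_def modfun_id_def Iso_iff)
qed

lemma modfun_id_sel:
  "fo modfun_id = (\<lambda>X\<in>Ob M. X)" "fa modfun_id = (\<lambda>f\<in>Arr M. f)"
  by (simp_all add: modfun_id_def)

lemma modfun_comp_sel:
  "fo (modfun_comp F H) = (\<lambda>X\<in>Ob M. fo F (fo H X))"
  "fa (modfun_comp F H) = (\<lambda>f\<in>Arr M. fa F (fa H f))"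
  "fs (modfun_comp F H) = (\<lambda>(X, Y)\<in>Ob M \<times> Ob B. fs F (fo H X, Y) \<cdot> fa F (fs H (X, Y)))"
  by (simp_all add: modfun_comp_def case_prod_beta)

lemma exact_functor_comp:
  "is_exact_functor M M Fo Fa \<Longrightarrow> is_exact_functor M M Ho Ha \<Longrightarrow>
    is_exact_functor M M (\<lambda>X. Ho (Fo X)) (\<lambda>f. Ha (Fa f))"
  using linear_functor_comp unfolding is_exact_functor_def by blast

text \<open>Each axiom for the composite is the axiom for \<open>H\<close> pushed through the
  functor \<open>F\<close> and pasted with the axiom for \<open>F\<close> at the value of
  \<open>H\<close>.\<close>

lemma modfun_comp_in:
  assumes F: "is_module_endofunctor F" and H: "is_module_endofunctor H"
  shows "is_module_endofunctor (modfun_comp F H)"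
proof -
  note [simp] = mf_simps[OF F] mf_simps[OF H]
  have ex: "is_exact_functor M M (\<lambda>X\<in>Ob M. fo F (fo H X)) (\<lambda>f\<in>Arr M. fa F (fa H f))"
    by (rule exact_functor_cong[OF exact_functor_comp[OF mf_exact[OF H] mf_exact[OF F]]]) auto
  have nat: "(fs F (fo H X', Y') \<cdot> fa F (fs H (X', Y'))) \<cdot> fa F (fa H (f \<star>\<^sub>a h)) =
      (fa F (fa H f) \<star>\<^sub>a h) \<cdot> fs F (fo H X, Y) \<cdot> fa F (fs H (X, Y))"
    and ty: "f \<star>\<^sub>a h \<in> Arr M" "X \<in> Ob M" "X' \<in> Ob M" "Y \<in> Ob B" "Y' \<in> Ob B" "f \<in> Arr M"
    if f: "f \<in> Hom M X X'" and h: "h \<in> Hom B Y Y'" for f h X X' Y Y'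
  proof -
    note HH = functor_Hom[OF mf_functor[OF H] f]
    note FF = functor_Hom[OF mf_functor[OF F] HH]
    show t: "f \<star>\<^sub>a h \<in> Arr M" "X \<in> Ob M" "X' \<in> Ob M" "Y \<in> Ob B" "Y' \<in> Ob B" "f \<in> Arr M"
      using HomD[OF mact_arr[OF f h]] Hom_ob[OF f] B_hom_ob[OF h] HomD[OF f] by auto
    note [simp] = t HomD[OF mact_arr[OF f h]] HomD[OF mact_arr[OF HH h]] HomD[OF mact_arr[OF FF h]]
    have "fa F (fs H (X', Y')) \<cdot> fa F (fa H (f \<star>\<^sub>a h)) = fa F (fa H f \<star>\<^sub>a h) \<cdot> fa F (fs H (X, Y))"
      using arg_cong[OF mf_nat[OF H f h], of "fa F"] by simp
    then show "(fs F (fo H X', Y') \<cdot> fa F (fs H (X', Y'))) \<cdot> fa F (fa H (f \<star>\<^sub>a h)) =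
      (fa F (fa H f) \<star>\<^sub>a h) \<cdot> fs F (fo H X, Y) \<cdot> fa F (fs H (X, Y))"
      by (simp add: pre2[OF mf_nat[OF F HH h]])
  qed
  have as: "MAssoc A (fo F (fo H X)) Y Z \<cdot> fs F (fo H X, Y \<otimes>\<^sub>o\<^bsub>B\<^esub> Z) \<cdot> fa F (fs H (X, Y \<otimes>\<^sub>o\<^bsub>B\<^esub> Z)) =
      ((fs F (fo H X, Y) \<cdot> fa F (fs H (X, Y))) \<star>\<^sub>a Id B Z) \<cdot>
      (fs F (fo H (X \<star>\<^sub>o Y), Z) \<cdot> fa F (fs H (X \<star>\<^sub>o Y, Z))) \<cdot> fa F (fa H (MAssoc A X Y Z))"
    if [simp]: "X \<in> Ob M" "Y \<in> Ob B" "Z \<in> Ob B" for X Y Z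
  proof -
    have 1: "fa F (MAssoc A (fo H X) Y Z) \<cdot> fa F (fs H (X, Y \<otimes>\<^sub>o\<^bsub>B\<^esub> Z)) =
        fa F (fs H (X, Y) \<star>\<^sub>a Id B Z) \<cdot> fa F (fs H (X \<star>\<^sub>o Y, Z)) \<cdot> fa F (fa H (MAssoc A X Y Z))"
      using arg_cong[OF mf_assoc[OF H that], of "fa F"] by simp
    show ?thesis
      by (simp add: pre2[OF mf_assoc[OF F]] 1 pre2[OF mf_nat_id[OF F]] mact_expand)
  qed
  have un: "MUnit A (fo F (fo H X)) \<cdot> fs F (fo H X, Unit B) \<cdot> fa F (fs H (X, Unit B)) = fa F (fa H (MUnit A X))"
    if [simp]: "X \<in> Ob M" for X
    using arg_cong[OF mf_unit[OF H that], of "fa F"] by (simp add: pre2[OF mf_unit[OF F]])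
  show ?thesis
    using ex ty functor_iso[OF mf_functor[OF F]]
    by (auto simp: is_module_endofunctor_def modfun_comp_def case_prod_beta nat as un Iso_iff)
qed

text \<open>Extensionality turns agreement on objects and arrows into equality, so composition is
  strictly associative; for the constraints it suffices that \<open>F\<close> preserves
  composition.\<close>

lemma modfun_comp_assoc:
  assumes F: "is_module_endofunctor F" and H: "is_module_endofunctor H" and K: "is_module_endofunctor K"
  shows "modfun_comp (modfun_comp F H) K = modfun_comp F (modfun_comp H K)"
proof -
  note [simp] = mf_simps[OF F] mf_simps[OF H] mf_simps[OF K]
  show ?thesis
    by (rule modfun_eqI) (auto simp: modfun_comp_sel intro!: restrict_cong_on)
qed

lemma modfun_comp_id_left:
  assumes F: "is_module_endofunctor F"
  shows "modfun_comp modfun_id F = F"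
proof -
  note [simp] = mf_simps[OF F]
  show ?thesis
    by (rule modfun_eqI; unfold modfun_comp_sel; rule restrict_eqI)
      (auto simp: modfun_id_def mf_ext[OF F])
qed

lemma modfun_comp_id_right:
  assumes F: "is_module_endofunctor F"
  shows "modfun_comp F modfun_id = F"
proof -
  note [simp] = mf_simps[OF F]
  show ?thesis
    by (rule modfun_eqI; unfold modfun_comp_sel; rule restrict_eqI)
      (auto simp: modfun_id_def mf_ext[OF F])
qed

subsection \<open>Module natural transformations\<close>

lemma
  assumes "is_module_natural F H \<tau>"
  shows mn_natural: "is_natural M M (fo F) (fa F) (fo H) (fa H) \<tau>"
    and mn_ext: "\<tau> \<in> extensional (Ob M)"
    and mn_arr: "X \<in> Ob M \<Longrightarrow> \<tau> X \<in> Arr M"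
    and mn_dom: "X \<in> Ob M \<Longrightarrow> Dom M (\<tau> X) = fo F X"
    and mn_cod: "X \<in> Ob M \<Longrightarrow> Cod M (\<tau> X) = fo H X"
    and mn_nat: "f \<in> Arr M \<Longrightarrow> Cod M f = X \<Longrightarrow> \<tau> X \<cdot> fa F f = fa H f \<cdot> \<tau> (Dom M f)"
    and mn_mod: "X \<in> Ob M \<Longrightarrow> Y \<in> Ob B \<Longrightarrow> fs H (X, Y) \<cdot> \<tau> (X \<star>\<^sub>o Y) = (\<tau> X \<star>\<^sub>a Id B Y) \<cdot> fs F (X, Y)"
  using assms unfolding is_module_natural_def is_natural_def Hom_def by (auto split: prod.splits)

lemmas mn_simps = mn_arr mn_dom mn_cod

lemma mnI:
  assumes "\<tau> \<in> extensional (Ob M)"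
    and "\<And>X. X \<in> Ob M \<Longrightarrow> \<tau> X \<in> Arr M"
    and "\<And>X. X \<in> Ob M \<Longrightarrow> Dom M (\<tau> X) = fo F X"
    and "\<And>X. X \<in> Ob M \<Longrightarrow> Cod M (\<tau> X) = fo H X"
    and "\<And>f. f \<in> Arr M \<Longrightarrow> \<tau> (Cod M f) \<cdot> fa F f = fa H f \<cdot> \<tau> (Dom M f)"
    and "\<And>X Y. X \<in> Ob M \<Longrightarrow> Y \<in> Ob B \<Longrightarrow> fs H (X, Y) \<cdot> \<tau> (X \<star>\<^sub>o Y) = (\<tau> X \<star>\<^sub>a Id B Y) \<cdot> fs F (X, Y)"
  shows "is_module_natural F H \<tau>"
  using assms unfolding is_module_natural_def is_natural_def Hom_def by (auto split: prod.splits)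

lemma mn_id:
  assumes F: "is_module_endofunctor F"
  shows "is_module_natural F F (\<lambda>X\<in>Ob M. Id M (fo F X))"
proof -
  note [simp] = mf_simps[OF F]
  show ?thesis
    by (rule mnI) auto
qed

lemma mn_comp:
  assumes F: "is_module_endofunctor F" and H: "is_module_endofunctor H" and K: "is_module_endofunctor K"
    and t: "is_module_natural F H \<tau>" and s: "is_module_natural H K \<sigma>"
  shows "is_module_natural F K (\<lambda>X\<in>Ob M. \<sigma> X \<cdot> \<tau> X)"
proof -
  note [simp] = mf_simps[OF F] mf_simps[OF H] mf_simps[OF K] mn_simps[OF t] mn_simps[OF s]
  show ?thesis
  proof (rule mnI)
    fix f assume [simp]: "f \<in> Arr M"
    show "(\<lambda>X\<in>Ob M. \<sigma> X \<cdot> \<tau> X) (Cod M f) \<cdot> fa F f = fa K f \<cdot> (\<lambda>X\<in>Ob M. \<sigma> X \<cdot> \<tau> X) (Dom M f)"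
      by (simp add: mn_nat[OF t] pre2[OF mn_nat[OF s]])
  next
    fix X Y assume [simp]: "X \<in> Ob M" "Y \<in> Ob B"
    show "fs K (X, Y) \<cdot> (\<lambda>X\<in>Ob M. \<sigma> X \<cdot> \<tau> X) (X \<star>\<^sub>o Y) = ((\<lambda>X\<in>Ob M. \<sigma> X \<cdot> \<tau> X) X \<star>\<^sub>a Id B Y) \<cdot> fs F (X, Y)"
      by (simp add: mn_mod[OF t] pre2[OF mn_mod[OF s]] mact_expand)
  qed auto
qed

lemma mn_plus:
  assumes F: "is_module_endofunctor F" and H: "is_module_endofunctor H"
    and t: "is_module_natural F H \<tau>" and s: "is_module_natural F H \<sigma>"
  shows "is_module_natural F H (\<lambda>X\<in>Ob M. Plus M (\<tau> X) (\<sigma> X))"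
proof -
  note [simp] = mf_simps[OF F] mf_simps[OF H] mn_simps[OF t] mn_simps[OF s]
  have ty: "\<tau> X \<in> Hom M (fo F X) (fo H X)" "\<sigma> X \<in> Hom M (fo F X) (fo H X)" if "X \<in> Ob M" for X
    using that by (auto intro!: HomI)
  note [simp] = HomD[OF plus_in[OF ty]]
  show ?thesis
  proof (rule mnI)
    fix f assume f [simp]: "f \<in> Arr M"
    have "Plus M (\<tau> (Cod M f)) (\<sigma> (Cod M f)) \<cdot> fa F f = Plus M (\<tau> (Cod M f) \<cdot> fa F f) (\<sigma> (Cod M f) \<cdot> fa F f)"
      by (rule comp_plus_left) (auto intro!: HomI)
    also have "\<dots> = Plus M (fa H f \<cdot> \<tau> (Dom M f)) (fa H f \<cdot> \<sigma> (Dom M f))"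
      by (simp add: mn_nat[OF t] mn_nat[OF s])
    also have "\<dots> = fa H f \<cdot> Plus M (\<tau> (Dom M f)) (\<sigma> (Dom M f))"
      by (rule comp_plus_right[symmetric]) (auto intro!: HomI)
    finally show "(\<lambda>X\<in>Ob M. Plus M (\<tau> X) (\<sigma> X)) (Cod M f) \<cdot> fa F f = fa H f \<cdot> (\<lambda>X\<in>Ob M. Plus M (\<tau> X) (\<sigma> X)) (Dom M f)"
      by simp
  next
    fix X Y assume X [simp]: "X \<in> Ob M" and Y [simp]: "Y \<in> Ob B"
    have "fs H (X, Y) \<cdot> Plus M (\<tau> (X \<star>\<^sub>o Y)) (\<sigma> (X \<star>\<^sub>o Y)) =
        Plus M (fs H (X, Y) \<cdot> \<tau> (X \<star>\<^sub>o Y)) (fs H (X, Y) \<cdot> \<sigma> (X \<star>\<^sub>o Y))"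
      by (rule comp_plus_right) (auto intro!: HomI)
    also have "\<dots> = Plus M ((\<tau> X \<star>\<^sub>a Id B Y) \<cdot> fs F (X, Y)) ((\<sigma> X \<star>\<^sub>a Id B Y) \<cdot> fs F (X, Y))"
      by (simp add: mn_mod[OF t] mn_mod[OF s])
    also have "\<dots> = (Plus M (\<tau> X) (\<sigma> X) \<star>\<^sub>a Id B Y) \<cdot> fs F (X, Y)"
      unfolding mact_plus[OF ty[OF X] Y] by (rule comp_plus_left[symmetric]) (auto intro!: HomI)
    finally show "fs H (X, Y) \<cdot> (\<lambda>X\<in>Ob M. Plus M (\<tau> X) (\<sigma> X)) (X \<star>\<^sub>o Y) =
        ((\<lambda>X\<in>Ob M. Plus M (\<tau> X) (\<sigma> X)) X \<star>\<^sub>a Id B Y) \<cdot> fs F (X, Y)"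
      by simp
  qed auto
qed

lemma mn_scale:
  assumes F: "is_module_endofunctor F" and H: "is_module_endofunctor H" and t: "is_module_natural F H \<tau>"
  shows "is_module_natural F H (\<lambda>X\<in>Ob M. Scale M x (\<tau> X))"
proof -
  note [simp] = mf_simps[OF F] mf_simps[OF H] mn_simps[OF t]
  have ty: "\<tau> X \<in> Hom M (fo F X) (fo H X)" if "X \<in> Ob M" for X
    using that by (auto intro!: HomI)
  note [simp] = HomD[OF scale_in[OF ty]]
  have cl: "Scale M x g \<cdot> f = Scale M x (g \<cdot> f)" and cr: "g \<cdot> Scale M x f = Scale M x (g \<cdot> f)"
    if "f \<in> Arr M" "g \<in> Arr M" "Dom M g = Cod M f" for f g
    using that comp_scale_left[of f "Dom M f" "Cod M f" g "Cod M g" x]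
      comp_scale_right[of f "Dom M f" "Cod M f" g "Cod M g" x] by (auto simp: Hom_def)
  show ?thesis
    by (rule mnI) (simp_all add: cl cr mn_nat[OF t] mn_mod[OF t] mact_scale[OF ty])
qed

lemma mn_zero:
  assumes F: "is_module_endofunctor F" and H: "is_module_endofunctor H"
  shows "is_module_natural F H (\<lambda>X\<in>Ob M. Zero M (fo F X) (fo H X))"
proof -
  note [simp] = mf_simps[OF F] mf_simps[OF H]
  show ?thesis
    by (rule mnI) simp_all
qed

text \<open>Horizontal composition. Its module square is pasted from the square of \<sigma> under
  \<open>H\<close>, naturality of \<tau>, the square of \<tau> at \<open>fo H' X\<close>, and
  naturality of the constraint of \<open>F\<close> along \<sigma>.\<close>

lemma mn_ten:
  assumes F: "is_module_endofunctor F" and F': "is_module_endofunctor F'"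
    and H: "is_module_endofunctor H" and H': "is_module_endofunctor H'"
    and t: "is_module_natural F H \<tau>" and s: "is_module_natural F' H' \<sigma>"
  shows "is_module_natural (modfun_comp F F') (modfun_comp H H') (\<lambda>X\<in>Ob M. \<tau> (fo H' X) \<cdot> fa F (\<sigma> X))"
proof -
  note [simp] = mf_simps[OF F] mf_simps[OF H] mf_simps[OF F'] mf_simps[OF H'] mn_simps[OF t] mn_simps[OF s]
  show ?thesis
  proof (rule mnI)
    fix f assume [simp]: "f \<in> Arr M"
    have "fa F (\<sigma> (Cod M f)) \<cdot> fa F (fa F' f) = fa F (fa H' f) \<cdot> fa F (\<sigma> (Dom M f))"
      using arg_cong[OF mn_nat[OF s, of f "Cod M f"], of "fa F"] by simp
    then show "(\<lambda>X\<in>Ob M. \<tau> (fo H' X) \<cdot> fa F (\<sigma> X)) (Cod M f) \<cdot> fa (modfun_comp F F') f =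
        fa (modfun_comp H H') f \<cdot> (\<lambda>X\<in>Ob M. \<tau> (fo H' X) \<cdot> fa F (\<sigma> X)) (Dom M f)"
      by (simp add: modfun_comp_sel pre2[OF mn_nat[OF t]])
  next
    fix X Y assume [simp]: "X \<in> Ob M" "Y \<in> Ob B"
    have 1: "fa H (fs H' (X, Y)) \<cdot> fa H (\<sigma> (X \<star>\<^sub>o Y)) = fa H (\<sigma> X \<star>\<^sub>a Id B Y) \<cdot> fa H (fs F' (X, Y))"
      using arg_cong[OF mn_mod[OF s, of X Y], of "fa H"] by simp
    have 2: "fs F (fo H' X, Y) \<cdot> fa F (\<sigma> X \<star>\<^sub>a Id B Y) = (fa F (\<sigma> X) \<star>\<^sub>a Id B Y) \<cdot> fs F (fo F' X, Y)"
      by (simp add: mf_nat_id[OF F])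
    have "(fs H (fo H' X, Y) \<cdot> fa H (fs H' (X, Y))) \<cdot> \<tau> (fo H' (X \<star>\<^sub>o Y)) \<cdot> fa F (\<sigma> (X \<star>\<^sub>o Y)) =
        fs H (fo H' X, Y) \<cdot> fa H (fs H' (X, Y)) \<cdot> fa H (\<sigma> (X \<star>\<^sub>o Y)) \<cdot> \<tau> (fo F' (X \<star>\<^sub>o Y))"
      by (simp add: mn_nat[OF t])
    also have "\<dots> = fs H (fo H' X, Y) \<cdot> \<tau> (fo H' X \<star>\<^sub>o Y) \<cdot> fa F (\<sigma> X \<star>\<^sub>a Id B Y) \<cdot> fa F (fs F' (X, Y))"
      by (simp add: pre2[OF 1] mn_nat[OF t] pre2[OF mn_nat[OF t]])
    also have "\<dots> = ((\<tau> (fo H' X) \<cdot> fa F (\<sigma> X)) \<star>\<^sub>a Id B Y) \<cdot> fs F (fo F' X, Y) \<cdot> fa F (fs F' (X, Y))"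
      by (simp add: pre2[OF mn_mod[OF t]] pre2[OF 2] mact_expand)
    finally show "fs (modfun_comp H H') (X, Y) \<cdot> (\<lambda>X\<in>Ob M. \<tau> (fo H' X) \<cdot> fa F (\<sigma> X)) (X \<star>\<^sub>o Y) =
        ((\<lambda>X\<in>Ob M. \<tau> (fo H' X) \<cdot> fa F (\<sigma> X)) X \<star>\<^sub>a Id B Y) \<cdot> fs (modfun_comp F F') (X, Y)"
      by (simp add: modfun_comp_sel)
  qed (auto simp: modfun_comp_sel)
qed

lemma mn_inv:
  assumes F: "is_module_endofunctor F" and H: "is_module_endofunctor H" and t: "is_module_natural F H \<tau>"
    and iso: "\<And>X. X \<in> Ob M \<Longrightarrow> is_iso M (\<tau> X)"
  shows "is_module_natural H F (\<lambda>X\<in>Ob M. inv_arr M (\<tau> X))"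
proof -
  note [simp] = mf_simps[OF F] mf_simps[OF H] mn_simps[OF t] iso
  show ?thesis
  proof (rule mnI)
    fix f assume [simp]: "f \<in> Arr M"
    show "(\<lambda>X\<in>Ob M. inv_arr M (\<tau> X)) (Cod M f) \<cdot> fa H f = fa F f \<cdot> (\<lambda>X\<in>Ob M. inv_arr M (\<tau> X)) (Dom M f)"
      using mn_nat[OF t, of f "Cod M f"] by (auto intro: inv_slide)
  next
    fix X Y assume [simp]: "X \<in> Ob M" "Y \<in> Ob B"
    have "(inv_arr M (\<tau> X) \<star>\<^sub>a Id B Y) \<cdot> fs H (X, Y) = fs F (X, Y) \<cdot> inv_arr M (\<tau> (X \<star>\<^sub>o Y))"
      unfolding functor_inv[OF linear_category_axioms linear_is_functor[OF mact_linear], OF \<open>Y \<in> Ob B\<close> iso, OF \<open>X \<in> Ob M\<close>, symmetric]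
      using mn_mod[OF t, of X Y] by (intro inv_slide) simp_all
    then show "fs F (X, Y) \<cdot> (\<lambda>X\<in>Ob M. inv_arr M (\<tau> X)) (X \<star>\<^sub>o Y) =
        ((\<lambda>X\<in>Ob M. inv_arr M (\<tau> X)) X \<star>\<^sub>a Id B Y) \<cdot> fs H (X, Y)"
      by simp
  qed auto
qed

subsection \<open>The monoidal structure\<close>

lemma dual_sel [simp]:
  "Ob dual_category = {F. is_module_endofunctor F}"
  "Arr dual_category = {(F, \<tau>, H). is_module_endofunctor F \<and> is_module_endofunctor H \<and> is_module_natural F H \<tau>}"
  "Dom dual_category (F, \<tau>, H) = F"
  "Cod dual_category (F, \<tau>, H) = H"
  "Id dual_category F = (F, \<lambda>X\<in>Ob M. Id M (fo F X), F)"
  "Comp dual_category (H', \<sigma>, K) (F, \<tau>, H) = (F, \<lambda>X\<in>Ob M. \<sigma> X \<cdot> \<tau> X, K)"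
  "Zero dual_category F H = (F, \<lambda>X\<in>Ob M. Zero M (fo F X) (fo H X), H)"
  "Plus dual_category (F, \<tau>, H) (F', \<tau>', H') = (F, \<lambda>X\<in>Ob M. Plus M (\<tau> X) (\<tau>' X), H)"
  "Scale dual_category x (F, \<tau>, H) = (F, \<lambda>X\<in>Ob M. Scale M x (\<tau> X), H)"
  "Unit dual_category = modfun_id"
  "TenO dual_category = modfun_comp"
  "TenA dual_category (F, \<tau>, H) (F', \<tau>', H') =
     (modfun_comp F F', \<lambda>X\<in>Ob M. \<tau> (fo H' X) \<cdot> fa F (\<tau>' X), modfun_comp H H')"
  "Assoc dual_category F H K =
     (modfun_comp F (modfun_comp H K), \<lambda>X\<in>Ob M. Id M (fo (modfun_comp F (modfun_comp H K)) X), modfun_comp F (modfun_comp H K))"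
  "LUnit dual_category F = (F, \<lambda>X\<in>Ob M. Id M (fo F X), F)"
  "RUnit dual_category F = (F, \<lambda>X\<in>Ob M. Id M (fo F X), F)"
  by (simp_all add: dual_category_def modfun_arr_id_def)

lemma dual_Hom: "Hom dual_category F H =
    {(F, \<tau>, H) | \<tau>. is_module_endofunctor F \<and> is_module_endofunctor H \<and> is_module_natural F H \<tau>}"
proof -
  have "Dom dual_category p = fst p" "Cod dual_category p = snd (snd p)" for p
    by (cases p; simp)+
  then show ?thesis
    by (force simp: Hom_def)
qed

lemma dual_HomE:
  assumes "p \<in> Hom dual_category F H"
  obtains \<tau> where "p = (F, \<tau>, H)" "is_module_endofunctor F" "is_module_endofunctor H" "is_module_natural F H \<tau>"
  using assms by (auto simp: dual_Hom)

lemma dual_IsoI: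
  assumes "is_module_endofunctor F" "is_module_endofunctor H" "is_module_natural F H \<tau>"
    and iso: "\<And>X. X \<in> Ob M \<Longrightarrow> is_iso M (\<tau> X)"
  shows "(F, \<tau>, H) \<in> Iso dual_category F H"
proof -
  have "inverse_arrows dual_category (F, \<tau>, H) (H, \<lambda>X\<in>Ob M. inv_arr M (\<tau> X), F)"
    using mn_inv[OF assms] assms mn_simps[OF assms(3)]
    by (auto simp: inverse_arrows_def dual_Hom intro!: restrict_cong_on)
  then have "is_iso dual_category (F, \<tau>, H)"
    unfolding is_iso_def by blast
  then show ?thesis
    using assms by (auto simp: Iso_def dual_Hom)
qed

lemma dual_id_Iso: "is_module_endofunctor F \<Longrightarrow> (F, \<lambda>X\<in>Ob M. Id M (fo F X), F) \<in> Iso dual_category F F"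
  by (rule dual_IsoI) (auto simp: mn_id mf_simps)

lemma dual_hom_module:
  assumes F: "is_module_endofunctor F" and H: "is_module_endofunctor H"
  shows "Module.module (scalars :: 'k ring) (hom_module dual_category F H)"
proof -
  have obs: "fo F X \<in> Ob M" "fo H X \<in> Ob M" if "X \<in> Ob M" for X
    using that mf_simps(1) F H by auto
  have ty: "\<tau> X \<in> Hom M (fo F X) (fo H X)" if "is_module_natural F H \<tau>" "X \<in> Ob M" for \<tau> X
    using mn_simps[OF that(1)] that(2) by (auto intro!: HomI)
  have eq: "(\<lambda>X\<in>Ob M. \<sigma> X) = \<tau>" if "is_module_natural F H \<tau>" "\<And>X. X \<in> Ob M \<Longrightarrow> \<sigma> X = \<tau> X" for \<sigma> \<tau>
    using that by (intro restrict_eqI) (auto simp: mn_ext[OF that(1)])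
  show ?thesis
  proof (rule hom_moduleI)
    fix f g h and x y :: 'k
    let ?H = "Hom dual_category F H"
    show "Zero dual_category F H \<in> ?H"
      by (simp add: dual_Hom mn_zero F H)
    show "f \<in> ?H \<Longrightarrow> g \<in> ?H \<Longrightarrow> Plus dual_category f g \<in> ?H"
      by (elim dual_HomE) (simp add: dual_Hom mn_plus)
    show "f \<in> ?H \<Longrightarrow> Scale dual_category x f \<in> ?H"
      by (elim dual_HomE) (simp add: dual_Hom mn_scale)
    show "f \<in> ?H \<Longrightarrow> g \<in> ?H \<Longrightarrow> h \<in> ?H \<Longrightarrow>
        Plus dual_category (Plus dual_category f g) h = Plus dual_category f (Plus dual_category g h)"
      by (elim dual_HomE) (auto intro!: restrict_cong_on plus_assoc[OF obs ty ty ty])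
    show "f \<in> ?H \<Longrightarrow> g \<in> ?H \<Longrightarrow> Plus dual_category f g = Plus dual_category g f"
      by (elim dual_HomE) (auto intro!: restrict_cong_on plus_comm[OF obs ty ty])
    show "f \<in> ?H \<Longrightarrow> Plus dual_category (Zero dual_category F H) f = f"
      by (elim dual_HomE) (auto intro!: eq plus_zero[OF ty])
    show "f \<in> ?H \<Longrightarrow> Scale dual_category (x + y) f = Plus dual_category (Scale dual_category x f) (Scale dual_category y f)"
      by (elim dual_HomE) (auto intro!: restrict_cong_on plus_scale[OF obs ty, symmetric])
    show "f \<in> ?H \<Longrightarrow> g \<in> ?H \<Longrightarrow> Scale dual_category x (Plus dual_category f g) =
        Plus dual_category (Scale dual_category x f) (Scale dual_category x g)"
      by (elim dual_HomE) (auto intro!: restrict_cong_on scale_plus[OF obs ty ty])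
    show "f \<in> ?H \<Longrightarrow> Scale dual_category (x * y) f = Scale dual_category x (Scale dual_category y f)"
      by (elim dual_HomE) (auto intro!: restrict_cong_on scale_scale[OF obs ty, symmetric])
    show "f \<in> ?H \<Longrightarrow> Scale dual_category 1 f = f"
      by (elim dual_HomE) (auto intro!: eq scale_one[OF obs ty])
    show "f \<in> ?H \<Longrightarrow> Scale dual_category 0 f = Zero dual_category F H"
      by (elim dual_HomE) (auto intro!: restrict_cong_on scale_zero[OF obs ty])
  qed
qed

text \<open>Associator and unit constraints are identities by strictness, which trivializes pentagon
  and triangle. The interchange law is the axiom that uses naturality of a module
  transformation.\<close>

lemma dual_category_monoidal: "linear_monoidal_category dual_category"
proof (intro linear_monoidal_category.intro linear_category.intro linear_monoidal_category_axioms.intro)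
  let ?E = dual_category
  note [simp] = modfun_id_in modfun_comp_in modfun_comp_id_left modfun_comp_id_right
    modfun_comp_assoc modfun_comp_sel
  have ty: "\<tau> X \<in> Hom M (fo F X) (fo H X)" if "is_module_natural F H \<tau>" "X \<in> Ob M" for F H \<tau> X
    using mn_simps[OF that(1)] that(2) by (auto intro!: HomI)
  have eq: "(\<lambda>X\<in>Ob M. \<sigma> X) = \<tau>" if "is_module_natural F H \<tau>" "\<And>X. X \<in> Ob M \<Longrightarrow> \<sigma> X = \<tau> X" for F H \<sigma> \<tau>
    using that by (intro restrict_eqI) (auto simp: mn_ext[OF that(1)])
  show "f \<in> Arr ?E \<Longrightarrow> Dom ?E f \<in> Ob ?E" "f \<in> Arr ?E \<Longrightarrow> Cod ?E f \<in> Ob ?E" for f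
    by auto
  show "Id ?E a \<in> Hom ?E a a" if "a \<in> Ob ?E" for a
    using that by (simp add: dual_Hom mn_id)
  show "Comp ?E g f \<in> Hom ?E a c" if "f \<in> Hom ?E a b" "g \<in> Hom ?E b c" for f g a b c
    using that by (elim dual_HomE) (simp add: dual_Hom mn_comp[of a b c])
  show "Comp ?E (Id ?E b) f = f" "Comp ?E f (Id ?E a) = f" if "f \<in> Hom ?E a b" for f a b
    using that by (elim dual_HomE; auto intro!: eq id_left[OF ty] id_right[OF ty])+
  show "Comp ?E (Comp ?E h g) f = Comp ?E h (Comp ?E g f)"
    if "f \<in> Hom ?E a b" "g \<in> Hom ?E b c" "h \<in> Hom ?E c d" for f g h a b c d
    using that by (elim dual_HomE) (auto intro!: restrict_cong_on comp_assoc[OF ty ty ty])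
  show "Module.module (scalars :: 'k ring) (hom_module ?E a b)" if "a \<in> Ob ?E" "b \<in> Ob ?E" for a b
    using that dual_hom_module by simp
  show "Comp ?E (Plus ?E g g') f = Plus ?E (Comp ?E g f) (Comp ?E g' f)"
    if "f \<in> Hom ?E a b" "g \<in> Hom ?E b c" "g' \<in> Hom ?E b c" for f g g' a b c
    using that by (elim dual_HomE) (auto intro!: restrict_cong_on comp_plus_left[OF ty ty ty])
  show "Comp ?E g (Plus ?E f f') = Plus ?E (Comp ?E g f) (Comp ?E g f')"
    if "f \<in> Hom ?E a b" "f' \<in> Hom ?E a b" "g \<in> Hom ?E b c" for f f' g a b c
    using that by (elim dual_HomE) (auto intro!: restrict_cong_on comp_plus_right[OF ty ty ty])
  show "Comp ?E (Scale ?E x g) f = Scale ?E x (Comp ?E g f)"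
    "Comp ?E g (Scale ?E x f) = Scale ?E x (Comp ?E g f)"
    if "f \<in> Hom ?E a b" "g \<in> Hom ?E b c" for f g a b c x
    using that by (elim dual_HomE; auto intro!: restrict_cong_on comp_scale_right[OF ty ty] comp_scale_left[OF ty ty])+
  show "Unit ?E \<in> Ob ?E"
    by simp
  show "TenO ?E X Y \<in> Ob ?E" if "X \<in> Ob ?E" "Y \<in> Ob ?E" for X Y
    using that by simp
  show "TenA ?E f g \<in> Hom ?E (TenO ?E X Y) (TenO ?E X' Y')"
    if "f \<in> Hom ?E X X'" "g \<in> Hom ?E Y Y'" for f g X X' Y Y'
    using that by (elim dual_HomE) (simp add: dual_Hom mn_ten)
  show "TenA ?E (Id ?E X) (Id ?E Y) = Id ?E (TenO ?E X Y)" if "X \<in> Ob ?E" "Y \<in> Ob ?E" for X Y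
  proof -
    have XY [simp]: "is_module_endofunctor X" "is_module_endofunctor Y"
      using that by simp_all
    note [simp] = mf_simps[OF XY(1)] mf_simps[OF XY(2)]
    show ?thesis
      by (auto intro!: restrict_cong_on)
  qed
  show "TenA ?E (Comp ?E f' f) (Comp ?E g' g) = Comp ?E (TenA ?E f' g') (TenA ?E f g)"
    if "f \<in> Hom ?E X X'" "f' \<in> Hom ?E X' X''" "g \<in> Hom ?E Y Y'" "g' \<in> Hom ?E Y' Y''" for f f' g g' X X' X'' Y Y' Y''
    using that
  proof (elim dual_HomE)
    fix \<tau> \<tau>' \<sigma> \<sigma>'
    assume [simp]: "is_module_endofunctor X" "is_module_endofunctor X'" "is_module_endofunctor X''"
      "is_module_endofunctor Y" "is_module_endofunctor Y'" "is_module_endofunctor Y''"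
      and n: "is_module_natural X X' \<tau>" "is_module_natural X' X'' \<tau>'" "is_module_natural Y Y' \<sigma>"
        "is_module_natural Y' Y'' \<sigma>'"
      and eqs: "f = (X, \<tau>, X')" "f' = (X', \<tau>', X'')" "g = (Y, \<sigma>, Y')" "g' = (Y', \<sigma>', Y'')"
    note [simp] = mn_simps[OF n(1)] mn_simps[OF n(2)] mn_simps[OF n(3)] mn_simps[OF n(4)]
      mf_simps[where F = X] mf_simps[where F = X'] mf_simps[where F = Y] mf_simps[where F = Y'] mf_simps[where F = Y'']
    \<comment> \<open>Interchange: naturality of \<tau> along \<sigma>' at \<open>Z\<close>
      exchanges the two middle factors.\<close>
    have "(\<tau>' (fo Y'' Z) \<cdot> \<tau> (fo Y'' Z)) \<cdot> fa X (\<sigma>' Z \<cdot> \<sigma> Z) =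
        (\<tau>' (fo Y'' Z) \<cdot> fa X' (\<sigma>' Z)) \<cdot> \<tau> (fo Y' Z) \<cdot> fa X (\<sigma> Z)" if "Z \<in> Ob M" for Z
      using that by (simp add: pre2[OF mn_nat[OF n(1)]])
    then show ?thesis
      by (auto simp: eqs intro!: restrict_cong_on)
  qed
  show "TenA ?E (Plus ?E f f') g = Plus ?E (TenA ?E f g) (TenA ?E f' g)"
    if "f \<in> Hom ?E X X'" "f' \<in> Hom ?E X X'" "g \<in> Hom ?E Y Y'" for f f' g X X' Y Y'
    using that
    by (elim dual_HomE)
      (auto intro!: restrict_cong_on comp_plus_left[OF functor_Hom[OF mf_functor ty] ty ty] functor_ob[OF mf_functor])
  show "TenA ?E f (Plus ?E g g') = Plus ?E (TenA ?E f g) (TenA ?E f g')"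
    if "f \<in> Hom ?E X X'" "g \<in> Hom ?E Y Y'" "g' \<in> Hom ?E Y Y'" for f g g' X X' Y Y'
    using that
    by (elim dual_HomE)
      (auto intro!: restrict_cong_on comp_plus_right[OF functor_Hom[OF mf_functor ty] functor_Hom[OF mf_functor ty] ty]
        functor_ob[OF mf_functor] simp: linear_functor_plus[OF mf_linear ty ty])
  have fscale: "fa F (Scale M x f) = Scale M x (fa F f)" if "is_module_endofunctor F" "f \<in> Hom M X X'" for F x f X X'
    using mf_linear[OF that(1)] that(2) unfolding is_linear_functor_def by blast
  show "TenA ?E (Scale ?E x f) g = Scale ?E x (TenA ?E f g)"
    "TenA ?E f (Scale ?E x g) = Scale ?E x (TenA ?E f g)"
    if "f \<in> Hom ?E X X'" "g \<in> Hom ?E Y Y'" for f g X X' Y Y' x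
    using that
    by (elim dual_HomE;
        auto intro!: restrict_cong_on comp_scale_left[OF functor_Hom[OF mf_functor ty] ty]
          comp_scale_right[OF functor_Hom[OF mf_functor ty] ty] functor_ob[OF mf_functor] simp: fscale[OF _ ty])+
  show "Assoc ?E X Y Z \<in> Iso ?E (TenO ?E (TenO ?E X Y) Z) (TenO ?E X (TenO ?E Y Z))"
    if "X \<in> Ob ?E" "Y \<in> Ob ?E" "Z \<in> Ob ?E" for X Y Z
    using that dual_id_Iso[of "modfun_comp X (modfun_comp Y Z)"] by simp
  show "Comp ?E (Assoc ?E X' Y' Z') (TenA ?E (TenA ?E f g) h) =
      Comp ?E (TenA ?E f (TenA ?E g h)) (Assoc ?E X Y Z)"
    if "f \<in> Hom ?E X X'" "g \<in> Hom ?E Y Y'" "h \<in> Hom ?E Z Z'" for f g h X X' Y Y' Z Z'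
    using that
  proof (elim dual_HomE)
    fix \<tau> \<sigma> \<rho>
    assume [simp]: "is_module_endofunctor X" "is_module_endofunctor X'" "is_module_endofunctor Y"
      "is_module_endofunctor Y'" "is_module_endofunctor Z" "is_module_endofunctor Z'"
      and n: "is_module_natural X X' \<tau>" "is_module_natural Y Y' \<sigma>" "is_module_natural Z Z' \<rho>"
      and eqs: "f = (X, \<tau>, X')" "g = (Y, \<sigma>, Y')" "h = (Z, \<rho>, Z')"
    note [simp] = mn_simps[OF n(1)] mn_simps[OF n(2)] mn_simps[OF n(3)]
      mf_simps[where F = X] mf_simps[where F = X'] mf_simps[where F = Y] mf_simps[where F = Y'] mf_simps[where F = Z] mf_simps[where F = Z']
    show ?thesis
      by (auto simp: eqs intro!: restrict_cong_on)
  qed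
  show "LUnit ?E X \<in> Iso ?E (TenO ?E (Unit ?E) X) X" "RUnit ?E X \<in> Iso ?E (TenO ?E X (Unit ?E)) X"
    if "X \<in> Ob ?E" for X
    using that dual_id_Iso[of X] by simp_all
  show "Comp ?E (LUnit ?E X') (TenA ?E (Id ?E (Unit ?E)) f) = Comp ?E f (LUnit ?E X)"
    "Comp ?E (RUnit ?E X') (TenA ?E f (Id ?E (Unit ?E))) = Comp ?E f (RUnit ?E X)"
    if "f \<in> Hom ?E X X'" for f X X'
  proof -
    obtain \<tau> where F [simp]: "is_module_endofunctor X" "is_module_endofunctor X'"
      and n: "is_module_natural X X' \<tau>" and eqs: "f = (X, \<tau>, X')"
      using dual_HomE[OF \<open>f \<in> Hom ?E X X'\<close>] by metis
    note [simp] = mn_simps[OF n] mf_simps[OF F(1)] mf_simps[OF F(2)]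
    show "Comp ?E (LUnit ?E X') (TenA ?E (Id ?E (Unit ?E)) f) = Comp ?E f (LUnit ?E X)"
      "Comp ?E (RUnit ?E X') (TenA ?E f (Id ?E (Unit ?E))) = Comp ?E f (RUnit ?E X)"
      by (auto simp: eqs modfun_id_sel intro!: restrict_cong_on)
  qed
  show "Comp ?E (Assoc ?E W X (TenO ?E Y Z)) (Assoc ?E (TenO ?E W X) Y Z) =
      Comp ?E (TenA ?E (Id ?E W) (Assoc ?E X Y Z))
        (Comp ?E (Assoc ?E W (TenO ?E X Y) Z) (TenA ?E (Assoc ?E W X Y) (Id ?E Z)))"
    if "W \<in> Ob ?E" "X \<in> Ob ?E" "Y \<in> Ob ?E" "Z \<in> Ob ?E" for W X Y Z
  proof -
    have F [simp]: "is_module_endofunctor W" "is_module_endofunctor X" "is_module_endofunctor Y" "is_module_endofunctor Z"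
      using that by simp_all
    note [simp] = mf_simps[OF F(1)] mf_simps[OF F(2)] mf_simps[OF F(3)] mf_simps[OF F(4)]
    show ?thesis
      by (auto intro!: restrict_cong_on)
  qed
  show "Comp ?E (TenA ?E (Id ?E X) (LUnit ?E Y)) (Assoc ?E X (Unit ?E) Y) = TenA ?E (RUnit ?E X) (Id ?E Y)"
    if "X \<in> Ob ?E" "Y \<in> Ob ?E" for X Y
  proof -
    have F [simp]: "is_module_endofunctor X" "is_module_endofunctor Y"
      using that by simp_all
    note [simp] = mf_simps[OF F(1)] mf_simps[OF F(2)]
    show ?thesis
      by (auto simp: modfun_id_sel intro!: restrict_cong_on)
  qed
qed

end

section \<open>The bicrossed product and its action on the category\<close>

context finite_crossed_action
begin

abbreviation BB where "BB \<equiv> bicrossed_product"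
abbreviation MM where "MM \<equiv> bicrossed_module"
abbreviation ObB where "ObB \<equiv> (\<Pi>\<^sub>E p\<in>Idx. Deg D (snd p))"

lemma bi_sel [simp]:
  "Ob BB = ObB"
  "Arr BB = {(X, f, Y). X \<in> ObB \<and> Y \<in> ObB \<and> f \<in> (\<Pi>\<^sub>E p\<in>Idx. Hom C (X p) (Y p))}"
  "Dom BB (X, f, Y) = X" "Cod BB (X, f, Y) = Y"
  "Id BB X = (X, \<lambda>p\<in>Idx. Id C (X p), X)"
  "Unit BB = bi_unit" "TenO BB = bi_tensor"
  "MActO MM = mod_act"
  by (simp_all add: bicrossed_product_def bicrossed_module_def)

lemma bi_Hom: "Hom BB X Y = {(X, f, Y) | f. X \<in> ObB \<and> Y \<in> ObB \<and> f \<in> (\<Pi>\<^sub>E p\<in>Idx. Hom C (X p) (Y p))}"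
proof -
  have "Dom BB p = fst p" "Cod BB p = snd (snd p)" for p
    by (cases p; simp)+
  then show ?thesis
    by (force simp: Hom_def)
qed

lemma bi_HomE:
  assumes "h \<in> Hom BB X Y"
  obtains h' where "h = (X, h', Y)" "X \<in> ObB" "Y \<in> ObB" "\<And>p. p \<in> Idx \<Longrightarrow> h' p \<in> Hom C (X p) (Y p)"
  using assms unfolding bi_Hom by (auto simp del: mem_Sigma_iff)

lemma Idx_finite [simp]: "finite Idx"
  by simp

lemma Idx_fst [simp]: "p \<in> Idx \<Longrightarrow> fst p \<in> carrier G" and Idx_snd [simp]: "p \<in> Idx \<Longrightarrow> snd p \<in> carrier \<Gamma>"
  by auto

lemma idx_one_in [simp]: "idx_one \<in> Idx" and fst_idx_one [simp]: "fst idx_one = \<one>\<^bsub>G\<^esub>"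
  and snd_idx_one [simp]: "snd idx_one = \<one>\<^bsub>\<Gamma>\<^esub>"
  by (simp_all add: idx_one_def)

lemma idx_mult_in [simp]: "p \<in> Idx \<Longrightarrow> q \<in> Idx \<Longrightarrow> p \<diamondop> q \<in> Idx"
  and fst_idx_mult: "fst (p \<diamondop> q) = fst p \<otimes>\<^bsub>G\<^esub> (snd p \<triangleright> fst q)"
  and snd_idx_mult: "snd (p \<diamondop> q) = (snd p \<triangleleft> fst q) \<otimes>\<^bsub>\<Gamma>\<^esub> snd q"
  by (simp_all add: idx_mult_def)

lemma ObB_deg [simp]: "X \<in> ObB \<Longrightarrow> p \<in> Idx \<Longrightarrow> X p \<in> Deg D (snd p)"
  by (rule PiE_mem)

lemma ObB_ob [simp]: "X \<in> ObB \<Longrightarrow> p \<in> Idx \<Longrightarrow> X p \<in> Ob C"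
  using ObB_deg deg_in_ob Idx_snd by blast

declare mem_Sigma_iff [simp del] SigmaE [rule del] SigmaE2 [rule del]

section \<open>Direct sums behind the action and the tensor product\<close>

lemma mod_summand_ob [simp]: "M \<in> Ob C \<Longrightarrow> X \<in> ObB \<Longrightarrow> p \<in> Idx \<Longrightarrow> mod_summand M X p \<in> Ob C"
  by (simp add: mod_summand_def)

lemma mod_biproduct: "M \<in> Ob C \<Longrightarrow> X \<in> ObB \<Longrightarrow>
    is_biproduct C Idx (mod_summand M X) (mod_act M X) (mod_inj M X) (mod_prj M X)"
  unfolding mod_act_def mod_inj_def mod_prj_def by (rule biprod_is_biproduct) simp_all

lemma
  assumes "M \<in> Ob C" "X \<in> ObB"
  shows mod_act_ob [simp]: "mod_act M X \<in> Ob C"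
    and arr_mod_inj [simp]: "p \<in> Idx \<Longrightarrow> mod_inj M X p \<in> Arr C"
    and dom_mod_inj [simp]: "p \<in> Idx \<Longrightarrow> Dom C (mod_inj M X p) = (M \<lhd>\<^sub>o fst p) \<otimes>\<^sub>o X p"
    and cod_mod_inj [simp]: "p \<in> Idx \<Longrightarrow> Cod C (mod_inj M X p) = mod_act M X"
    and arr_mod_prj [simp]: "p \<in> Idx \<Longrightarrow> mod_prj M X p \<in> Arr C"
    and dom_mod_prj [simp]: "p \<in> Idx \<Longrightarrow> Dom C (mod_prj M X p) = mod_act M X"
    and cod_mod_prj [simp]: "p \<in> Idx \<Longrightarrow> Cod C (mod_prj M X p) = (M \<lhd>\<^sub>o fst p) \<otimes>\<^sub>o X p"
    and mod_prj_inj [simp]: "p \<in> Idx \<Longrightarrow> mod_prj M X p \<cdot> mod_inj M X p = Id C ((M \<lhd>\<^sub>o fst p) \<otimes>\<^sub>o X p)"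
    and mod_prj_inj_diff: "p \<in> Idx \<Longrightarrow> q \<in> Idx \<Longrightarrow> p \<noteq> q \<Longrightarrow>
      mod_prj M X p \<cdot> mod_inj M X q = Zero C ((M \<lhd>\<^sub>o fst q) \<otimes>\<^sub>o X q) ((M \<lhd>\<^sub>o fst p) \<otimes>\<^sub>o X p)"
  using biproduct_ob[OF mod_biproduct[OF assms]] biproduct_inj[OF mod_biproduct[OF assms], of p]
    biproduct_prj[OF mod_biproduct[OF assms], of p] biproduct_same[OF mod_biproduct[OF assms], of p]
    biproduct_diff[OF mod_biproduct[OF assms], of p q]
  by (simp_all add: mod_summand_def Hom_def)

lemma bi_summand_deg: "X \<in> ObB \<Longrightarrow> Y \<in> ObB \<Longrightarrow> p \<in> Idx \<Longrightarrow> q \<in> Idx \<Longrightarrow> bi_summand X Y (p, q) \<in> Deg D (snd (p \<diamondop> q))"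
  by (simp add: bi_summand_def snd_idx_mult)

lemma bi_summand_deg' [simp]: "X \<in> ObB \<Longrightarrow> Y \<in> ObB \<Longrightarrow> p \<in> Idx \<Longrightarrow> q \<in> Idx \<Longrightarrow>
    (X p \<lhd>\<^sub>o fst q) \<otimes>\<^sub>o Y q \<in> Deg D (snd (p \<diamondop> q))"
  using bi_summand_deg by (simp add: bi_summand_def)

lemma splits_finite [simp]: "finite (splits r)"
  by (rule finite_subset[of _ "Idx \<times> Idx"]) (auto simp: splits_def mem_Sigma_iff)

lemma splitsE:
  assumes "z \<in> splits r"
  obtains p q where "z = (p, q)" "p \<in> Idx" "q \<in> Idx" "r = p \<diamondop> q"
  using assms unfolding splits_def by blast

lemma splitsI: "p \<in> Idx \<Longrightarrow> q \<in> Idx \<Longrightarrow> p \<diamondop> q = r \<Longrightarrow> (p, q) \<in> splits r"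
  unfolding splits_def by blast

lemma splits_bi_summand_ob: "X \<in> ObB \<Longrightarrow> Y \<in> ObB \<Longrightarrow> z \<in> splits r \<Longrightarrow> bi_summand X Y z \<in> Ob C"
proof -
  assume "X \<in> ObB" "Y \<in> ObB" "z \<in> splits r"
  moreover from this obtain p q where "z = (p, q)" "p \<in> Idx" "q \<in> Idx"
    by (metis splitsE)
  ultimately show ?thesis
    by (simp add: bi_summand_def)
qed

lemma bi_biproduct:
  assumes "X \<in> ObB" "Y \<in> ObB" "r \<in> Idx"
  shows "is_biproduct C (splits r) (bi_summand X Y) (bi_tensor X Y r)
      (dinj C (splits r) (bi_summand X Y)) (dprj C (splits r) (bi_summand X Y))"
  using assms unfolding bi_tensor_def restrict_def
  by (simp, intro biprod_is_biproduct) (use splits_bi_summand_ob in auto)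

text \<open>The index multiplication is designed so that every summand over a factorization of
  \<open>r\<close> has degree \<open>snd r\<close>, and \<open>biproduct_deg\<close> keeps this
  degree for the sum.\<close>

lemma bi_tensor_in [simp]:
  assumes "X \<in> ObB" "Y \<in> ObB"
  shows "bi_tensor X Y \<in> ObB"
proof (rule PiE_I)
  fix r assume r: "r \<in> Idx"
  show "bi_tensor X Y r \<in> Deg D (snd r)"
  proof (rule biproduct_deg[OF bi_biproduct[OF assms r]])
    fix z assume "z \<in> splits r"
    then obtain p q where "z = (p, q)" "p \<in> Idx" "q \<in> Idx" "r = p \<diamondop> q"
      by (rule splitsE)
    then show "bi_summand X Y z \<in> Deg D (snd r)"
      using bi_summand_deg[OF assms] by simp
  qed (use r in simp)
qed (auto simp: bi_tensor_def)

lemma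
  assumes "X \<in> ObB" "Y \<in> ObB" "p \<in> Idx" "q \<in> Idx"
  shows arr_bi_inj [simp]: "bi_inj X Y p q \<in> Arr C"
    and dom_bi_inj [simp]: "Dom C (bi_inj X Y p q) = (X p \<lhd>\<^sub>o fst q) \<otimes>\<^sub>o Y q"
    and cod_bi_inj [simp]: "Cod C (bi_inj X Y p q) = bi_tensor X Y (p \<diamondop> q)"
    and arr_bi_prj [simp]: "bi_prj X Y p q \<in> Arr C"
    and dom_bi_prj [simp]: "Dom C (bi_prj X Y p q) = bi_tensor X Y (p \<diamondop> q)"
    and cod_bi_prj [simp]: "Cod C (bi_prj X Y p q) = (X p \<lhd>\<^sub>o fst q) \<otimes>\<^sub>o Y q"
    and bi_prj_inj [simp]: "bi_prj X Y p q \<cdot> bi_inj X Y p q = Id C ((X p \<lhd>\<^sub>o fst q) \<otimes>\<^sub>o Y q)"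
    and bi_prj_inj_diff: "p' \<in> Idx \<Longrightarrow> q' \<in> Idx \<Longrightarrow> (p', q') \<noteq> (p, q) \<Longrightarrow> p' \<diamondop> q' = p \<diamondop> q \<Longrightarrow>
      bi_prj X Y p' q' \<cdot> bi_inj X Y p q = Zero C ((X p \<lhd>\<^sub>o fst q) \<otimes>\<^sub>o Y q) ((X p' \<lhd>\<^sub>o fst q') \<otimes>\<^sub>o Y q')"
proof -
  have "(p, q) \<in> splits (p \<diamondop> q)" "p' \<in> Idx \<Longrightarrow> q' \<in> Idx \<Longrightarrow> p' \<diamondop> q' = p \<diamondop> q \<Longrightarrow> (p', q') \<in> splits (p \<diamondop> q)"
    using assms by (auto intro!: splitsI)
  note sp = this and bp = bi_biproduct[OF assms(1,2) idx_mult_in[OF assms(3,4)]]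
  show "bi_inj X Y p q \<in> Arr C" "Dom C (bi_inj X Y p q) = (X p \<lhd>\<^sub>o fst q) \<otimes>\<^sub>o Y q"
    "Cod C (bi_inj X Y p q) = bi_tensor X Y (p \<diamondop> q)"
    "bi_prj X Y p q \<in> Arr C" "Dom C (bi_prj X Y p q) = bi_tensor X Y (p \<diamondop> q)"
    "Cod C (bi_prj X Y p q) = (X p \<lhd>\<^sub>o fst q) \<otimes>\<^sub>o Y q"
    "bi_prj X Y p q \<cdot> bi_inj X Y p q = Id C ((X p \<lhd>\<^sub>o fst q) \<otimes>\<^sub>o Y q)"
    using biproduct_inj[OF bp sp(1)] biproduct_prj[OF bp sp(1)] biproduct_same[OF bp sp(1)]
    by (simp_all add: bi_inj_def bi_prj_def Hom_def bi_summand_def)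
  show "p' \<in> Idx \<Longrightarrow> q' \<in> Idx \<Longrightarrow> (p', q') \<noteq> (p, q) \<Longrightarrow> p' \<diamondop> q' = p \<diamondop> q \<Longrightarrow>
      bi_prj X Y p' q' \<cdot> bi_inj X Y p q = Zero C ((X p \<lhd>\<^sub>o fst q) \<otimes>\<^sub>o Y q) ((X p' \<lhd>\<^sub>o fst q') \<otimes>\<^sub>o Y q')"
    using biproduct_diff[OF bp sp(2) sp(1)] by (simp add: bi_inj_def bi_prj_def bi_summand_def)
qed

lemma bi_unit_in [simp]: "bi_unit \<in> ObB"
  by (rule PiE_I) (auto simp: bi_unit_def)

lemma bi_unit_one [simp]: "bi_unit idx_one = \<I>"
  by (simp add: bi_unit_def)

lemma bi_id_in: "X \<in> ObB \<Longrightarrow> Id BB X \<in> Hom BB X X"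
  by (auto simp: bi_Hom id_in)

subsection \<open>The action on arrows\<close>

lemma mact_in:
  assumes f: "f \<in> Hom C M M'" and h: "h \<in> Hom BB X Y"
  shows "MActA MM f h \<in> Hom C (mod_act M X) (mod_act M' Y)"
proof -
  obtain h' where hh: "h = (X, h', Y)" and [simp]: "X \<in> ObB" "Y \<in> ObB"
    and h': "\<And>p. p \<in> Idx \<Longrightarrow> h' p \<in> Hom C (X p) (Y p)"
    by (rule bi_HomE[OF h]) (rule that)
  note [simp] = HomD[OF f] Hom_ob[OF f] HomD[OF h']
  show ?thesis
    unfolding hh bicrossed_module_def by (simp, intro asum_in HomI) simp_all
qed

text \<open>The action on arrows is block-diagonal for the chosen direct sums. This and
  \<open>mact_prj\<close> stand in for the defining sum in later calculations.\<close>

lemma mact_inj: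
  assumes f: "f \<in> Hom C M M'" and h: "(X, h, Y) \<in> Hom BB X Y" and p [simp]: "p \<in> Idx"
  shows "MActA MM f (X, h, Y) \<cdot> mod_inj M X p = mod_inj M' Y p \<cdot> ((f \<lhd>\<^sub>a fst p) \<otimes>\<^sub>a h p)"
proof -
  have [simp]: "X \<in> ObB" "Y \<in> ObB" and h': "\<And>p. p \<in> Idx \<Longrightarrow> h p \<in> Hom C (X p) (Y p)"
    using h by (auto elim!: bi_HomE)
  note [simp] = HomD[OF f] Hom_ob[OF f] HomD[OF h']
  have "MActA MM f (X, h, Y) = asum C (mod_act M X) (mod_act M' Y) Idx
       (\<lambda>p. (mod_inj M' Y p \<cdot> ((f \<lhd>\<^sub>a fst p) \<otimes>\<^sub>a h p)) \<cdot> mod_prj M X p)"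
    unfolding bicrossed_module_def by (simp, intro asum_cong HomI) simp_all
  then show ?thesis
    using biproduct_copair(2)[OF mod_biproduct[of M X], of "mod_act M' Y" "\<lambda>p. mod_inj M' Y p \<cdot> ((f \<lhd>\<^sub>a fst p) \<otimes>\<^sub>a h p)" p]
    by (simp add: mod_summand_def Hom_def)
qed

lemma mact_prj:
  assumes f: "f \<in> Hom C M M'" and h: "(X, h, Y) \<in> Hom BB X Y" and p [simp]: "p \<in> Idx"
  shows "mod_prj M' Y p \<cdot> MActA MM f (X, h, Y) = ((f \<lhd>\<^sub>a fst p) \<otimes>\<^sub>a h p) \<cdot> mod_prj M X p"
proof -
  have [simp]: "X \<in> ObB" "Y \<in> ObB" and h': "\<And>p. p \<in> Idx \<Longrightarrow> h p \<in> Hom C (X p) (Y p)"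
    using h by (auto elim!: bi_HomE)
  note [simp] = HomD[OF f] Hom_ob[OF f] HomD[OF h']
  have "MActA MM f (X, h, Y) = asum C (mod_act M X) (mod_act M' Y) Idx
       (\<lambda>p. mod_inj M' Y p \<cdot> ((f \<lhd>\<^sub>a fst p) \<otimes>\<^sub>a h p) \<cdot> mod_prj M X p)"
    unfolding bicrossed_module_def by simp
  then show ?thesis
    using biproduct_pair(2)[OF mod_biproduct[of M' Y], of "mod_act M X" "\<lambda>p. ((f \<lhd>\<^sub>a fst p) \<otimes>\<^sub>a h p) \<cdot> mod_prj M X p" p]
    by (simp add: mod_summand_def Hom_def)
qed

lemma mod_epi:
  assumes "is_linear_functor C C Fo Fa" "M \<in> Ob C" "X \<in> ObB"
    and "f \<in> Arr C" "Dom C f = Fo (mod_act M X)" "f' \<in> Arr C" "Dom C f' = Fo (mod_act M X)" "Cod C f' = Cod C f"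
    and "\<And>p. p \<in> Idx \<Longrightarrow> f \<cdot> Fa (mod_inj M X p) = f' \<cdot> Fa (mod_inj M X p)"
  shows "f = f'"
  by (rule biproduct_epi[OF linear_functor_biproduct[OF linear_category_axioms assms(1) mod_biproduct[OF assms(2,3)]]])
    (use assms in \<open>auto intro: HomI\<close>)

lemmas mod_epi_id = mod_epi[OF is_linear_functor_id]

text \<open>At index r, the object obtained by letting a product act is again a direct sum, over the
  factorizations of r, because tensoring is additive. So module associativity can be tested on one
  pair of indices at a time.\<close>

lemma mod_tensor_epi:
  assumes F: "is_linear_functor C C Fo Fa" and [simp]: "M \<in> Ob C" "X \<in> ObB" "Y \<in> ObB"
    and "f \<in> Arr C" "Dom C f = Fo (mod_act M (bi_tensor X Y))" "f' \<in> Arr C"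
      "Dom C f' = Fo (mod_act M (bi_tensor X Y))" "Cod C f' = Cod C f"
    and eq: "\<And>p q. p \<in> Idx \<Longrightarrow> q \<in> Idx \<Longrightarrow>
      f \<cdot> Fa (mod_inj M (bi_tensor X Y) (p \<diamondop> q) \<cdot> (Id C (M \<lhd>\<^sub>o fst (p \<diamondop> q)) \<otimes>\<^sub>a bi_inj X Y p q)) =
      f' \<cdot> Fa (mod_inj M (bi_tensor X Y) (p \<diamondop> q) \<cdot> (Id C (M \<lhd>\<^sub>o fst (p \<diamondop> q)) \<otimes>\<^sub>a bi_inj X Y p q))"
  shows "f = f'"
proof (rule mod_epi[OF F assms(2)])
  fix r assume r [simp]: "r \<in> Idx"
  note [simp] = functor_simps[OF linear_is_functor[OF F]] assms(5-9)
  have "is_linear_functor C C (\<lambda>Z. Fo ((M \<lhd>\<^sub>o fst r) \<otimes>\<^sub>o Z)) (\<lambda>f. Fa (Id C (M \<lhd>\<^sub>o fst r) \<otimes>\<^sub>a f))"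
    by (rule linear_functor_comp[OF ten_linear_functor F]) simp
  note bp = linear_functor_biproduct[OF linear_category_axioms this bi_biproduct[OF assms(3,4) r]]
  show "f \<cdot> Fa (mod_inj M (bi_tensor X Y) r) = f' \<cdot> Fa (mod_inj M (bi_tensor X Y) r)"
  proof (rule biproduct_epi[OF bp])
    fix z assume "z \<in> splits r"
    then obtain p q where z: "z = (p, q)" and [simp]: "p \<in> Idx" "q \<in> Idx" and r: "r = p \<diamondop> q"
      by (rule splitsE)
    show "(f \<cdot> Fa (mod_inj M (bi_tensor X Y) r)) \<cdot> Fa (Id C (M \<lhd>\<^sub>o fst r) \<otimes>\<^sub>a dinj C (splits r) (bi_summand X Y) z) =
        (f' \<cdot> Fa (mod_inj M (bi_tensor X Y) r)) \<cdot> Fa (Id C (M \<lhd>\<^sub>o fst r) \<otimes>\<^sub>a dinj C (splits r) (bi_summand X Y) z)"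
      using eq[of p q] by (simp add: r z bi_inj_def[symmetric])
  qed (auto intro!: HomI)
qed (use assms in auto)

declare bi_sel(5) [simp del]

lemmas bi_norm = bi_sel(1,6,7,8)

lemma fst_bi_Id: "Id BB X = (X, \<lambda>p\<in>Idx. Id C (X p), X)"
  by (rule bi_sel(5))

lemma mact_id_inj:
  assumes "f \<in> Arr C" "Dom C f = M" "X \<in> ObB" "p \<in> Idx"
  shows "MActA MM f (Id BB X) \<cdot> mod_inj M X p = mod_inj (Cod C f) X p \<cdot> ((f \<lhd>\<^sub>a fst p) \<otimes>\<^sub>a Id C (X p))"
  using mact_inj[of f M "Cod C f" X "\<lambda>p\<in>Idx. Id C (X p)" X p] assms bi_id_in[of X]
  by (simp add: fst_bi_Id Hom_def)

text \<open>\<open>mac_eq\<close> says that, term by term, the module associativity is the inverse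
  of the associativity of the bicrossed product, with the module object in place of the first family
  member. Hence \<open>assoc_component\<close> is the only one to be studied.\<close>

lemma
  assumes "p \<in> Idx" "g \<in> carrier G" "M \<in> Ob C" "A \<in> Deg D (snd p)" "B \<in> Ob C"
  shows is_iso_mu [simp]: "is_iso C (assoc_component p g M A B)"
    and arr_mu [simp]: "assoc_component p g M A B \<in> Arr C"
    and dom_mu [simp]: "Dom C (assoc_component p g M A B) = ((M \<lhd>\<^sub>o fst p) \<otimes>\<^sub>o A) \<lhd>\<^sub>o g \<otimes>\<^sub>o B"
    and cod_mu [simp]: "Cod C (assoc_component p g M A B) =
      (M \<lhd>\<^sub>o (fst p \<otimes>\<^bsub>G\<^esub> (snd p \<triangleright> g))) \<otimes>\<^sub>o ((A \<lhd>\<^sub>o g) \<otimes>\<^sub>o B)"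
    and mac_eq: "mod_assoc_component M p g A B = inv_arr C (assoc_component p g M A B)"
proof -
  have [simp]: "A \<in> Ob C"
    using assms deg_in_ob Idx_snd by blast
  show "is_iso C (assoc_component p g M A B)" "assoc_component p g M A B \<in> Arr C"
    "Dom C (assoc_component p g M A B) = ((M \<lhd>\<^sub>o fst p) \<otimes>\<^sub>o A) \<lhd>\<^sub>o g \<otimes>\<^sub>o B"
    "Cod C (assoc_component p g M A B) =
      (M \<lhd>\<^sub>o (fst p \<otimes>\<^bsub>G\<^esub> (snd p \<triangleright> g))) \<otimes>\<^sub>o ((A \<lhd>\<^sub>o g) \<otimes>\<^sub>o B)"
    using assms by (simp_all add: assoc_component_def)
  show "mod_assoc_component M p g A B = inv_arr C (assoc_component p g M A B)"
    using assms by (simp add: assoc_component_def mod_assoc_component_def inv_comp inv_ten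
        inv_arrI[OF id_in id_in])
qed

text \<open>The second claim evaluates the double sum on the summand of one pair: exactly the term
  of that pair survives.\<close>

lemma massoc_in_Hom:
  assumes [simp]: "M \<in> Ob C" "X \<in> ObB" "Y \<in> ObB"
  shows "MAssoc MM M X Y \<in> Hom C (mod_act M (bi_tensor X Y)) (mod_act (mod_act M X) Y)"
    and "p \<in> Idx \<Longrightarrow> q \<in> Idx \<Longrightarrow>
      MAssoc MM M X Y \<cdot> mod_inj M (bi_tensor X Y) (p \<diamondop> q) \<cdot> (Id C (M \<lhd>\<^sub>o fst (p \<diamondop> q)) \<otimes>\<^sub>a bi_inj X Y p q) =
      mod_inj (mod_act M X) Y q \<cdot> ((mod_inj M X p \<lhd>\<^sub>a fst q) \<otimes>\<^sub>a Id C (Y q)) \<cdot>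
        inv_arr C (assoc_component p (fst q) M (X p) (Y q))"
proof -
  define T where "T = (\<lambda>(p, q). mod_inj (mod_act M X) Y q \<cdot>
          ((mod_inj M X p \<lhd>\<^sub>a fst q) \<otimes>\<^sub>a Id C (Y q)) \<cdot>
          inv_arr C (assoc_component p (fst q) M (X p) (Y q)) \<cdot>
          (Id C (M \<lhd>\<^sub>o fst (p \<diamondop> q)) \<otimes>\<^sub>a bi_prj X Y p q) \<cdot>
          mod_prj M (bi_tensor X Y) (p \<diamondop> q))"
  note fsts = fst_idx_mult
  have T: "T z \<in> Hom C (mod_act M (bi_tensor X Y)) (mod_act (mod_act M X) Y)" if "z \<in> Idx \<times> Idx" for z
  proof -
    obtain p q where z: "z = (p, q)" and [simp]: "p \<in> Idx" "q \<in> Idx"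
      using \<open>z \<in> Idx \<times> Idx\<close> by (rule SigmaE)
    show ?thesis
      by (simp add: z T_def Hom_def fsts)
  qed
  have eq: "MAssoc MM M X Y = asum C (mod_act M (bi_tensor X Y)) (mod_act (mod_act M X) Y) (Idx \<times> Idx) T"
  proof -
    have "asum C (mod_act M (bi_tensor X Y)) (mod_act (mod_act M X) Y) (Idx \<times> Idx) T = 
      asum C (mod_act M (bi_tensor X Y)) (mod_act (mod_act M X) Y) (Idx \<times> Idx)
       (\<lambda>(p, q). mod_inj (mod_act M X) Y q \<cdot>
          ((mod_inj M X p \<lhd>\<^sub>a fst q) \<otimes>\<^sub>a Id C (Y q)) \<cdot>
          mod_assoc_component M p (fst q) (X p) (Y q) \<cdot>
          (Id C (M \<lhd>\<^sub>o fst (p \<diamondop> q)) \<otimes>\<^sub>a bi_prj X Y p q) \<cdot>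
          mod_prj M (bi_tensor X Y) (p \<diamondop> q))"
    proof (rule asum_cong)
      fix z assume "z \<in> Idx \<times> Idx"
      then obtain p q where z: "z = (p, q)" and [simp]: "p \<in> Idx" "q \<in> Idx"
        by (rule SigmaE)
      show "T z = (case z of (p, q) \<Rightarrow> mod_inj (mod_act M X) Y q \<cdot>
          ((mod_inj M X p \<lhd>\<^sub>a fst q) \<otimes>\<^sub>a Id C (Y q)) \<cdot>
          mod_assoc_component M p (fst q) (X p) (Y q) \<cdot>
          (Id C (M \<lhd>\<^sub>o fst (p \<diamondop> q)) \<otimes>\<^sub>a bi_prj X Y p q) \<cdot>
          mod_prj M (bi_tensor X Y) (p \<diamondop> q))"
        by (simp add: z T_def mac_eq)
    qed (use T in auto)
    then show ?thesis
      by (simp add: bicrossed_module_def)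
  qed
  show "MAssoc MM M X Y \<in> Hom C (mod_act M (bi_tensor X Y)) (mod_act (mod_act M X) Y)"
    unfolding eq by (rule asum_in) (use T in auto)
  assume [simp]: "p \<in> Idx" "q \<in> Idx"
  let ?e = "mod_inj M (bi_tensor X Y) (p \<diamondop> q) \<cdot> (Id C (M \<lhd>\<^sub>o fst (p \<diamondop> q)) \<otimes>\<^sub>a bi_inj X Y p q)"
  let ?d = "(M \<lhd>\<^sub>o fst (p \<diamondop> q)) \<otimes>\<^sub>o ((X p \<lhd>\<^sub>o fst q) \<otimes>\<^sub>o Y q)"
  have e: "?e \<in> Hom C ?d (mod_act M (bi_tensor X Y))"
    by (simp add: Hom_def)
  have "MAssoc MM M X Y \<cdot> ?e = asum C ?d (mod_act (mod_act M X) Y) (Idx \<times> Idx) (\<lambda>z. T z \<cdot> ?e)"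
    unfolding eq by (rule asum_comp_right[OF _ _ _ T e]) simp_all
  also have "\<dots> = T (p, q) \<cdot> ?e"
  proof (rule asum_single)
    show "T (p, q) \<cdot> ?e \<in> Hom C ?d (mod_act (mod_act M X) Y)"
      by (rule comp_in[OF e T]) (simp add: mem_Sigma_iff)
    fix z assume "z \<in> Idx \<times> Idx" and ne: "z \<noteq> (p, q)"
    then obtain p' q' where z: "z = (p', q')" and [simp]: "p' \<in> Idx" "q' \<in> Idx"
      by (metis SigmaE)
    \<comment> \<open>A term for another pair vanishes for one of two reasons: it is a different
      factorization of the same index, or its index differs already.\<close>
    have "(Id C (M \<lhd>\<^sub>o fst (p' \<diamondop> q')) \<otimes>\<^sub>a bi_prj X Y p' q') \<cdot> mod_prj M (bi_tensor X Y) (p' \<diamondop> q') \<cdot> ?e =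
        Zero C ?d ((M \<lhd>\<^sub>o fst (p' \<diamondop> q')) \<otimes>\<^sub>o ((X p' \<lhd>\<^sub>o fst q') \<otimes>\<^sub>o Y q'))"
    proof (cases "p' \<diamondop> q' = p \<diamondop> q")
      case True
      then have "bi_prj X Y p' q' \<cdot> bi_inj X Y p q =
          Zero C ((X p \<lhd>\<^sub>o fst q) \<otimes>\<^sub>o Y q) ((X p' \<lhd>\<^sub>o fst q') \<otimes>\<^sub>o Y q')"
        using ne z by (intro bi_prj_inj_diff) auto
      then show ?thesis
        by (simp add: True pre2[OF mod_prj_inj] ten_collapse ten_zero_right)
    next
      case False
      then show ?thesis
        by (simp add: pre2[OF mod_prj_inj_diff])
    qed
    then show "T z \<cdot> ?e = Zero C ?d (mod_act (mod_act M X) Y)"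
      by (simp add: z T_def fsts)
  qed (simp_all add: mem_Sigma_iff)
  also have "\<dots> = mod_inj (mod_act M X) Y q \<cdot> ((mod_inj M X p \<lhd>\<^sub>a fst q) \<otimes>\<^sub>a Id C (Y q)) \<cdot>
        inv_arr C (assoc_component p (fst q) M (X p) (Y q))"
    by (simp add: T_def pre2[OF mod_prj_inj] ten_collapse fsts)
  finally show "MAssoc MM M X Y \<cdot> ?e = mod_inj (mod_act M X) Y q \<cdot> ((mod_inj M X p \<lhd>\<^sub>a fst q) \<otimes>\<^sub>a Id C (Y q)) \<cdot>
        inv_arr C (assoc_component p (fst q) M (X p) (Y q))" .
qed

lemma munit_eq: "MUnit MM M = RUnit C M \<cdot> (inv_arr C (R0 D M) \<otimes>\<^sub>a Id C \<I>) \<cdot> mod_prj M bi_unit idx_one"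
  by (simp add: bicrossed_module_def)

text \<open>The functor laws are checked on the injections of the direct sums, where acting on
  \<open>f\<close> becomes f \<lhd> g tensored with an identity.\<close>

lemma bicrossed_right_action: "right_action C BB MM"
proof unfold_locales
  have idB: "Id BB Y \<in> Hom BB Y Y" if "Y \<in> ObB" for Y
    using that by (rule bi_id_in)
  note [simp] = bi_norm
  show "Y \<in> Ob BB \<and> Y' \<in> Ob BB" if "h \<in> Hom BB Y Y'" for h Y Y'
    by (rule bi_HomE[OF that]) simp
  show "Id BB Y \<in> Hom BB Y Y" if "Y \<in> Ob BB" for Y
    using that idB by simp
  show "Unit BB \<in> Ob BB"
    by simp
  show "TenO BB Y Z \<in> Ob BB" if "Y \<in> Ob BB" "Z \<in> Ob BB" for Y Z
    using that by simp
  show "MActO MM X Y \<in> Ob C" if "X \<in> Ob C" "Y \<in> Ob BB" for X Y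
    using that by simp
  show act: "MActA MM f h \<in> Hom C (MActO MM X Y) (MActO MM X' Y')"
    if "f \<in> Hom C X X'" "h \<in> Hom BB Y Y'" for f h X X' Y Y'
    using mact_in[OF that] by simp
  have ty: "MActA MM f (Id BB Y) \<in> Arr C" "Dom C (MActA MM f (Id BB Y)) = mod_act (Dom C f) Y"
    "Cod C (MActA MM f (Id BB Y)) = mod_act (Cod C f) Y" if "f \<in> Arr C" "Y \<in> ObB" for f Y
    using HomD[OF mact_in[OF HomI[OF that(1) refl refl] idB[OF that(2)]]] by auto
  show "MActA MM (Id C X) (Id BB Y) = Id C (MActO MM X Y)" if "X \<in> Ob C" "Y \<in> Ob BB" for X Y
    by (rule mod_epi_id[of X Y]) (use that in \<open>simp_all add: ty mact_id_inj\<close>)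
  show "MActA MM (f' \<cdot> f) (Id BB Y) = MActA MM f' (Id BB Y) \<cdot> MActA MM f (Id BB Y)"
    if "f \<in> Hom C X X'" "f' \<in> Hom C X' X''" "Y \<in> Ob BB" for f f' X X' X'' Y
  proof -
    note [simp] = HomD[OF that(1)] HomD[OF that(2)] Hom_ob[OF that(1)] Hom_ob[OF that(2)]
    show ?thesis
      by (rule mod_epi_id[of X Y])
        (use that in \<open>simp_all add: ty mact_id_inj act_expand pre2[OF mact_id_inj] ten_collapse_simps\<close>)
  qed
  show "MActA MM (Plus C f f') (Id BB Y) = Plus C (MActA MM f (Id BB Y)) (MActA MM f' (Id BB Y))"
    if f: "f \<in> Hom C X X'" "f' \<in> Hom C X X'" and Y: "Y \<in> Ob BB" for f f' X X' Y
  proof -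
    have Y [simp]: "Y \<in> ObB"
      using Y by simp
    note [simp] = HomD[OF f(1)] HomD[OF f(2)] Hom_ob[OF f(1)] HomD[OF plus_in[OF f]]
    have m: "MActA MM f (Id BB Y) \<in> Hom C (mod_act X Y) (mod_act X' Y)" "MActA MM f' (Id BB Y) \<in> Hom C (mod_act X Y) (mod_act X' Y)"
      by (auto simp: ty intro!: HomI)
    note [simp] = HomD[OF plus_in[OF m]]
    show ?thesis
    proof (rule mod_epi_id[of X Y])
      fix p assume p [simp]: "p \<in> Idx"
      have a: "h \<lhd>\<^sub>a fst p \<in> Hom C (X \<lhd>\<^sub>o fst p) (X' \<lhd>\<^sub>o fst p)" if "h \<in> Hom C X X'" for h
        using that by (auto simp: Hom_def)
      have i: "mod_inj X Y p \<in> Hom C ((X \<lhd>\<^sub>o fst p) \<otimes>\<^sub>o Y p) (mod_act X Y)"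
        "mod_inj X' Y p \<in> Hom C ((X' \<lhd>\<^sub>o fst p) \<otimes>\<^sub>o Y p) (mod_act X' Y)"
        by (simp_all add: Hom_def)
      have "Plus C f f' \<lhd>\<^sub>a fst p \<otimes>\<^sub>a Id C (Y p) =
          Plus C (f \<lhd>\<^sub>a fst p \<otimes>\<^sub>a Id C (Y p)) (f' \<lhd>\<^sub>a fst p \<otimes>\<^sub>a Id C (Y p))"
        using linear_functor_plus[OF act_linear f, of "fst p"]
          ten_plus_left[OF a[OF f(1)] a[OF f(2)] id_in[of "Y p"]] by simp
      then show "MActA MM (Plus C f f') (Id BB Y) \<cdot> mod_inj X Y p =
          Plus C (MActA MM f (Id BB Y)) (MActA MM f' (Id BB Y)) \<cdot> mod_inj X Y p"
        by (simp add: mact_id_inj comp_plus_left[OF i(1) m]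
            comp_plus_right[OF ten_arr[OF a[OF f(1)] id_in] ten_arr[OF a[OF f(2)] id_in] i(2)])
    qed (simp_all add: ty)
  qed
  show "MActA MM (Scale C x f) (Id BB Y) = Scale C x (MActA MM f (Id BB Y))"
    if f: "f \<in> Hom C X X'" and Y: "Y \<in> Ob BB" for x f X X' Y
  proof -
    have Y [simp]: "Y \<in> ObB"
      using Y by simp
    note [simp] = HomD[OF f] Hom_ob[OF f] HomD[OF scale_in[OF f]]
    have m: "MActA MM f (Id BB Y) \<in> Hom C (mod_act X Y) (mod_act X' Y)"
      by (auto simp: ty intro!: HomI)
    note [simp] = HomD[OF scale_in[OF m]]
    show ?thesis
    proof (rule mod_epi_id[of X Y])
      fix p assume p [simp]: "p \<in> Idx"
      have a: "f \<lhd>\<^sub>a fst p \<in> Hom C (X \<lhd>\<^sub>o fst p) (X' \<lhd>\<^sub>o fst p)"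
        by (auto simp: Hom_def)
      have i: "mod_inj X Y p \<in> Hom C ((X \<lhd>\<^sub>o fst p) \<otimes>\<^sub>o Y p) (mod_act X Y)"
        "mod_inj X' Y p \<in> Hom C ((X' \<lhd>\<^sub>o fst p) \<otimes>\<^sub>o Y p) (mod_act X' Y)"
        by (simp_all add: Hom_def)
      have "Scale C x f \<lhd>\<^sub>a fst p = Scale C x (f \<lhd>\<^sub>a fst p)"
        using act_linear[OF Idx_fst[OF p]] f unfolding is_linear_functor_def by blast
      then have "Scale C x f \<lhd>\<^sub>a fst p \<otimes>\<^sub>a Id C (Y p) = Scale C x (f \<lhd>\<^sub>a fst p \<otimes>\<^sub>a Id C (Y p))"
        using ten_scale_left[OF a id_in[of "Y p"]] by simp
      then show "MActA MM (Scale C x f) (Id BB Y) \<cdot> mod_inj X Y p = Scale C x (MActA MM f (Id BB Y)) \<cdot> mod_inj X Y p"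
        by (simp add: mact_id_inj comp_scale_left[OF i(1) m] comp_scale_right[OF ten_arr[OF a id_in] i(2)])
    qed (simp_all add: ty)
  qed
  show "MAssoc MM X Y Z \<in> Hom C (MActO MM X (TenO BB Y Z)) (MActO MM (MActO MM X Y) Z)"
    if "X \<in> Ob C" "Y \<in> Ob BB" "Z \<in> Ob BB" for X Y Z
    using massoc_in_Hom(1)[of X Y Z] that by simp
  show "MUnit MM X \<in> Hom C (MActO MM X (Unit BB)) X" if "X \<in> Ob C" for X
    using that by (auto simp: munit_eq Hom_def)
qed

end

sublocale finite_crossed_action \<subseteq> RA: right_action C bicrossed_product bicrossed_module
  by (rule bicrossed_right_action)

section \<open>Module functors in terms of their homogeneous components\<close>

context finite_crossed_action
begin

text \<open>The shape of a module constraint restricted to the objects g \<bowtie> A, where p = (g,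
  k) and \<open>A\<close> has degree k. Naturality in \<open>A\<close> stays inside one
  degree.\<close>

definition component_family :: "('o \<Rightarrow> 'o) \<Rightarrow> ('m \<Rightarrow> 'm) \<Rightarrow> ('g \<times> 't \<Rightarrow> 'o \<Rightarrow> 'o \<Rightarrow> 'm) \<Rightarrow> bool" where
  "component_family Fo Fa c \<longleftrightarrow> is_exact_functor C C Fo Fa \<and>
     (\<forall>p\<in>Idx. \<forall>M\<in>Ob C. \<forall>A\<in>Deg D (snd p). is_iso C (c p M A) \<and>
        Dom C (c p M A) = Fo ((M \<lhd>\<^sub>o fst p) \<otimes>\<^sub>o A) \<and> Cod C (c p M A) = (Fo M \<lhd>\<^sub>o fst p) \<otimes>\<^sub>o A) \<and>
     (\<forall>p\<in>Idx. \<forall>f\<in>Arr C. \<forall>j\<in>Arr C. Dom C j \<in> Deg D (snd p) \<and> Cod C j \<in> Deg D (snd p) \<longrightarrow>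
        c p (Cod C f) (Cod C j) \<cdot> Fa ((f \<lhd>\<^sub>a fst p) \<otimes>\<^sub>a j) = ((Fa f \<lhd>\<^sub>a fst p) \<otimes>\<^sub>a j) \<cdot> c p (Dom C f) (Dom C j))"

text \<open>What the associativity and unit axioms of a module functor say on the objects $g\bowtie A$ and
  $g'\bowtie B$; the inverses of \<open>assoc_component\<close> are the module associativity there.\<close>

definition coherent_components :: "('o \<Rightarrow> 'o) \<Rightarrow> ('m \<Rightarrow> 'm) \<Rightarrow> ('g \<times> 't \<Rightarrow> 'o \<Rightarrow> 'o \<Rightarrow> 'm) \<Rightarrow> bool" where
  "coherent_components Fo Fa c \<longleftrightarrow>
     (\<forall>p\<in>Idx. \<forall>q\<in>Idx. \<forall>M\<in>Ob C. \<forall>A\<in>Deg D (snd p). \<forall>B\<in>Deg D (snd q).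
        inv_arr C (assoc_component p (fst q) (Fo M) A B) \<cdot> c (p \<diamondop> q) M ((A \<lhd>\<^sub>o fst q) \<otimes>\<^sub>o B) =
        ((c p M A \<lhd>\<^sub>a fst q) \<otimes>\<^sub>a Id C B) \<cdot> c q ((M \<lhd>\<^sub>o fst p) \<otimes>\<^sub>o A) B \<cdot>
          Fa (inv_arr C (assoc_component p (fst q) M A B))) \<and>
     (\<forall>M\<in>Ob C. RUnit C (Fo M) \<cdot> (inv_arr C (R0 D (Fo M)) \<otimes>\<^sub>a Id C \<I>) \<cdot> c idx_one M \<I> =
        Fa (RUnit C M \<cdot> (inv_arr C (R0 D M) \<otimes>\<^sub>a Id C \<I>)))"

lemma coherent_assoc:
  assumes "coherent_components Fo Fa c" "p \<in> Idx" "q \<in> Idx" "M \<in> Ob C" "A \<in> Deg D (snd p)" "B \<in> Deg D (snd q)"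
  shows "inv_arr C (assoc_component p (fst q) (Fo M) A B) \<cdot> c (p \<diamondop> q) M ((A \<lhd>\<^sub>o fst q) \<otimes>\<^sub>o B) =
        ((c p M A \<lhd>\<^sub>a fst q) \<otimes>\<^sub>a Id C B) \<cdot> c q ((M \<lhd>\<^sub>o fst p) \<otimes>\<^sub>o A) B \<cdot>
          Fa (inv_arr C (assoc_component p (fst q) M A B))"
  using assms unfolding coherent_components_def by blast

lemma coherent_unit:
  assumes "coherent_components Fo Fa c" "M \<in> Ob C"
  shows "RUnit C (Fo M) \<cdot> (inv_arr C (R0 D (Fo M)) \<otimes>\<^sub>a Id C \<I>) \<cdot> c idx_one M \<I> =
        Fa (RUnit C M \<cdot> (inv_arr C (R0 D M) \<otimes>\<^sub>a Id C \<I>))"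
  using assms unfolding coherent_components_def by blast

definition components_of :: "('o \<Rightarrow> 'o) \<Rightarrow> ('m \<Rightarrow> 'm) \<Rightarrow> ('o \<times> ('g, 't, 'o) bicrossed_ob \<Rightarrow> 'm) \<Rightarrow>
    ('g \<times> 't \<Rightarrow> 'o \<Rightarrow> 'o \<Rightarrow> 'm) \<Rightarrow> bool" where
  "components_of Fo Fa s c \<longleftrightarrow> (\<forall>M\<in>Ob C. \<forall>X\<in>ObB. \<forall>p\<in>Idx.
     s (M, X) \<cdot> Fa (mod_inj M X p) = mod_inj (Fo M) X p \<cdot> c p M (X p))"

lemma
  assumes "component_family Fo Fa c"
  shows cf_exact: "is_exact_functor C C Fo Fa"
    and cf_linear: "is_linear_functor C C Fo Fa"
    and cf_functor: "is_functor C C Fo Fa"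
    and cf_iso: "p \<in> Idx \<Longrightarrow> M \<in> Ob C \<Longrightarrow> A \<in> Deg D (snd p) \<Longrightarrow> is_iso C (c p M A)"
    and cf_arr: "p \<in> Idx \<Longrightarrow> M \<in> Ob C \<Longrightarrow> A \<in> Deg D (snd p) \<Longrightarrow> c p M A \<in> Arr C"
    and cf_dom: "p \<in> Idx \<Longrightarrow> M \<in> Ob C \<Longrightarrow> A \<in> Deg D (snd p) \<Longrightarrow> Dom C (c p M A) = Fo ((M \<lhd>\<^sub>o fst p) \<otimes>\<^sub>o A)"
    and cf_cod: "p \<in> Idx \<Longrightarrow> M \<in> Ob C \<Longrightarrow> A \<in> Deg D (snd p) \<Longrightarrow> Cod C (c p M A) = (Fo M \<lhd>\<^sub>o fst p) \<otimes>\<^sub>o A"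
    and cf_nat: "p \<in> Idx \<Longrightarrow> f \<in> Arr C \<Longrightarrow> j \<in> Arr C \<Longrightarrow> Dom C j \<in> Deg D (snd p) \<Longrightarrow> Cod C j \<in> Deg D (snd p) \<Longrightarrow>
      Cod C f = M \<Longrightarrow> Cod C j = A \<Longrightarrow>
      c p M A \<cdot> Fa ((f \<lhd>\<^sub>a fst p) \<otimes>\<^sub>a j) = ((Fa f \<lhd>\<^sub>a fst p) \<otimes>\<^sub>a j) \<cdot> c p (Dom C f) (Dom C j)"
  using assms is_iso_arr unfolding component_family_def is_exact_functor_def is_linear_functor_def by blast+

lemmas cf_simps = functor_ob[OF cf_functor] functor_id[OF cf_functor] functor_arr[OF cf_functor]
  functor_dom[OF cf_functor] functor_cod[OF cf_functor] functor_comp[OF cf_functor]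
  cf_iso cf_arr cf_dom cf_cod

lemma cf_nat_left:
  "component_family Fo Fa c \<Longrightarrow> p \<in> Idx \<Longrightarrow> f \<in> Arr C \<Longrightarrow> A \<in> Deg D (snd p) \<Longrightarrow> Cod C f = M \<Longrightarrow>
    c p M A \<cdot> Fa ((f \<lhd>\<^sub>a fst p) \<otimes>\<^sub>a Id C A) = ((Fa f \<lhd>\<^sub>a fst p) \<otimes>\<^sub>a Id C A) \<cdot> c p (Dom C f) A"
  using cf_nat[of Fo Fa c p f "Id C A" M A] deg_in_ob[of A "snd p"] by simp

lemma cf_nat_right:
  "component_family Fo Fa c \<Longrightarrow> p \<in> Idx \<Longrightarrow> M \<in> Ob C \<Longrightarrow> j \<in> Arr C \<Longrightarrow> Dom C j \<in> Deg D (snd p) \<Longrightarrow>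
    Cod C j \<in> Deg D (snd p) \<Longrightarrow> Cod C j = A \<Longrightarrow>
    c p M A \<cdot> Fa (Id C (M \<lhd>\<^sub>o fst p) \<otimes>\<^sub>a j) = (Id C (Fo M \<lhd>\<^sub>o fst p) \<otimes>\<^sub>a j) \<cdot> c p M (Dom C j)"
  using cf_nat[of Fo Fa c p "Id C M" j M A] functor_ob[OF cf_functor, of Fo Fa c M]
    functor_id[OF cf_functor, of Fo Fa c M] by simp

section \<open>The associativity axiom on a pair of summands\<close>

context
  fixes Fo Fa s c
  assumes cf: "component_family Fo Fa c" and co: "components_of Fo Fa s c"
    and sty: "\<And>M X. M \<in> Ob C \<Longrightarrow> X \<in> ObB \<Longrightarrow> s (M, X) \<in> Hom C (Fo (mod_act M X)) (mod_act (Fo M) X)"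
begin

lemma comps_inj: "M \<in> Ob C \<Longrightarrow> X \<in> ObB \<Longrightarrow> p \<in> Idx \<Longrightarrow>
    s (M, X) \<cdot> Fa (mod_inj M X p) = mod_inj (Fo M) X p \<cdot> c p M (X p)"
  using co unfolding components_of_def by blast

text \<open>Restricted to a pair of summands, both sides of the associativity axiom factor through
  one and the same inclusion. Behind it stand here, and in \<open>assoc_rhs_component\<close>, the
  two sides of the associativity part of \<open>coherent_components\<close>.\<close>

lemma assoc_lhs_component:
  assumes [simp]: "M \<in> Ob C" "X \<in> ObB" "Y \<in> ObB" "p \<in> Idx" "q \<in> Idx"
  shows "(MAssoc MM (Fo M) X Y \<cdot> s (M, bi_tensor X Y)) \<cdot>
      Fa (mod_inj M (bi_tensor X Y) (p \<diamondop> q) \<cdot> (Id C (M \<lhd>\<^sub>o fst (p \<diamondop> q)) \<otimes>\<^sub>a bi_inj X Y p q)) =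
    (mod_inj (mod_act (Fo M) X) Y q \<cdot> ((mod_inj (Fo M) X p \<lhd>\<^sub>a fst q) \<otimes>\<^sub>a Id C (Y q))) \<cdot>
      inv_arr C (assoc_component p (fst q) (Fo M) (X p) (Y q)) \<cdot> c (p \<diamondop> q) M ((X p \<lhd>\<^sub>o fst q) \<otimes>\<^sub>o Y q)"
proof -
  note [simp] = cf_simps[OF cf] HomD[OF sty] HomD[OF massoc_in_Hom(1)]
  show ?thesis
    by (simp add: pre2[OF comps_inj] cf_nat_right[OF cf] pre3[OF massoc_in_Hom(2)] fst_idx_mult[symmetric])
qed

lemma assoc_rhs_component:
  assumes [simp]: "M \<in> Ob C" "X \<in> ObB" "Y \<in> ObB" "p \<in> Idx" "q \<in> Idx"
  shows "(MActA MM (s (M, X)) (Id BB Y) \<cdot> s (mod_act M X, Y) \<cdot> Fa (MAssoc MM M X Y)) \<cdot>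
      Fa (mod_inj M (bi_tensor X Y) (p \<diamondop> q) \<cdot> (Id C (M \<lhd>\<^sub>o fst (p \<diamondop> q)) \<otimes>\<^sub>a bi_inj X Y p q)) =
    (mod_inj (mod_act (Fo M) X) Y q \<cdot> ((mod_inj (Fo M) X p \<lhd>\<^sub>a fst q) \<otimes>\<^sub>a Id C (Y q))) \<cdot>
      ((c p M (X p) \<lhd>\<^sub>a fst q) \<otimes>\<^sub>a Id C (Y q)) \<cdot> c q ((M \<lhd>\<^sub>o fst p) \<otimes>\<^sub>o X p) (Y q) \<cdot>
      Fa (inv_arr C (assoc_component p (fst q) M (X p) (Y q)))"
proof -
  note [simp] = cf_simps[OF cf] HomD[OF sty] HomD[OF massoc_in_Hom(1)]
  have "Fa (MAssoc MM M X Y) \<cdot> Fa (mod_inj M (bi_tensor X Y) (p \<diamondop> q)) \<cdot> Fa (Id C (M \<lhd>\<^sub>o fst (p \<diamondop> q)) \<otimes>\<^sub>a bi_inj X Y p q) =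
      Fa (mod_inj (mod_act M X) Y q) \<cdot> Fa ((mod_inj M X p \<lhd>\<^sub>a fst q) \<otimes>\<^sub>a Id C (Y q)) \<cdot>
        Fa (inv_arr C (assoc_component p (fst q) M (X p) (Y q)))"
    using arg_cong[OF massoc_in_Hom(2)[of M X Y p q], of Fa] by (simp add: fst_idx_mult[symmetric])
  then show ?thesis
    by (simp add: pre2[OF comps_inj] pre2[OF mact_id_inj] pre2[OF cf_nat_left[OF cf]])
      (simp add: ten_collapse_pre act_expand[symmetric] comps_inj)
qed

end

subsection \<open>Assembling a module functor\<close>

definition assemble :: "('o \<Rightarrow> 'o) \<Rightarrow> ('m \<Rightarrow> 'm) \<Rightarrow> ('g \<times> 't \<Rightarrow> 'o \<Rightarrow> 'o \<Rightarrow> 'm) \<Rightarrow> ('o, 'm, ('g, 't, 'o) bicrossed_ob) modfun" where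
  "assemble Fo Fa c = (restrict Fo (Ob C), restrict Fa (Arr C),
     \<lambda>(M, X)\<in>Ob C \<times> ObB. asum C (Fo (mod_act M X)) (mod_act (Fo M) X) Idx
       (\<lambda>p. (mod_inj (Fo M) X p \<cdot> c p M (X p)) \<cdot> Fa (mod_prj M X p)))"

lemma assemble_sel [simp]:
  "fst (assemble Fo Fa c) = restrict Fo (Ob C)"
  "fst (snd (assemble Fo Fa c)) = restrict Fa (Arr C)"
  by (simp_all add: assemble_def)

lemma
  assumes cf: "component_family Fo Fa c" and M [simp]: "M \<in> Ob C" and X [simp]: "X \<in> ObB"
  shows assemble_in: "snd (snd (assemble Fo Fa c)) (M, X) \<in> Hom C (Fo (mod_act M X)) (mod_act (Fo M) X)"
    and assemble_inj: "p \<in> Idx \<Longrightarrow>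
      snd (snd (assemble Fo Fa c)) (M, X) \<cdot> Fa (mod_inj M X p) = mod_inj (Fo M) X p \<cdot> c p M (X p)"
proof -
  note [simp] = cf_simps[OF cf]
  note bp = linear_functor_biproduct[OF linear_category_axioms cf_linear[OF cf] mod_biproduct[OF M X]]
  have ob: "mod_act (Fo M) X \<in> Ob C"
    by simp
  have ty: "mod_inj (Fo M) X p \<cdot> c p M (X p) \<in> Hom C (Fo (mod_summand M X p)) (mod_act (Fo M) X)" if "p \<in> Idx" for p
    using that by (simp add: Hom_def mod_summand_def)
  show "snd (snd (assemble Fo Fa c)) (M, X) \<in> Hom C (Fo (mod_act M X)) (mod_act (Fo M) X)"
    using biproduct_copair(1)[OF bp ob ty] by (simp add: assemble_def mem_Sigma_iff)
  show "p \<in> Idx \<Longrightarrow> snd (snd (assemble Fo Fa c)) (M, X) \<cdot> Fa (mod_inj M X p) = mod_inj (Fo M) X p \<cdot> c p M (X p)"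
    using biproduct_copair(2)[OF bp ob ty, of p] by (simp add: assemble_def mem_Sigma_iff)
qed

text \<open>The inverse is put together in the same way from the inverse components.\<close>

lemma assemble_iso:
  assumes cf: "component_family Fo Fa c" and M [simp]: "M \<in> Ob C" and X [simp]: "X \<in> ObB"
  shows "is_iso C (snd (snd (assemble Fo Fa c)) (M, X))"
proof -
  note [simp] = cf_simps[OF cf] HomD[OF assemble_in[OF cf]]
  have FM [simp]: "Fo M \<in> Ob C"
    by simp
  let ?s = "snd (snd (assemble Fo Fa c)) (M, X)"
  let ?i = "\<lambda>p. Fa (mod_inj M X p) \<cdot> inv_arr C (c p M (X p))"
  let ?t = "asum C (mod_act (Fo M) X) (Fo (mod_act M X)) Idx (\<lambda>p. ?i p \<cdot> mod_prj (Fo M) X p)"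
  have ob: "Fo (mod_act M X) \<in> Ob C"
    by simp
  have ty: "?i p \<in> Hom C (mod_summand (Fo M) X p) (Fo (mod_act M X))" if "p \<in> Idx" for p
    using that by (simp add: Hom_def mod_summand_def)
  note t = biproduct_copair[OF mod_biproduct[OF FM X] ob ty]
  note [simp] = HomD[OF t(1)]
  show ?thesis
  proof (rule is_isoI)
    show "?s \<in> Hom C (Fo (mod_act M X)) (mod_act (Fo M) X)" "?t \<in> Hom C (mod_act (Fo M) X) (Fo (mod_act M X))"
      using assemble_in[OF cf M X] t(1) by auto
    show "?t \<cdot> ?s = Id C (Fo (mod_act M X))"
      by (rule mod_epi[OF cf_linear[OF cf] M X]) (simp_all add: assemble_inj[OF cf] pre2[OF t(2)])
    show "?s \<cdot> ?t = Id C (mod_act (Fo M) X)"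
      by (rule mod_epi_id[OF FM X]) (simp_all add: pre2[OF assemble_inj[OF cf]] t(2))
  qed
qed

text \<open>Naturality, associativity and the unit axiom are all equations between arrows out of
  direct sums, so coherence on the pieces g \<bowtie> A is enough.\<close>

lemma assemble_module_functor:
  assumes cf: "component_family Fo Fa c" and coh: "coherent_components Fo Fa c"
  shows "RA.is_module_endofunctor (assemble Fo Fa c)"
proof -
  note [simp] = cf_simps[OF cf] HomD[OF assemble_in[OF cf]] assemble_iso[OF cf] HomD[OF massoc_in_Hom(1)]
  let ?s = "snd (snd (assemble Fo Fa c))"
  have co: "components_of Fo Fa ?s c"
    using assemble_inj[OF cf] unfolding components_of_def by blast
  have ex: "is_exact_functor C C (restrict Fo (Ob C)) (restrict Fa (Arr C))"
    by (rule RA.exact_functor_cong[OF cf_exact[OF cf]]) auto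
  have nat: "?s (M', Y) \<cdot> Fa (MActA MM f h) = MActA MM (Fa f) h \<cdot> ?s (M, X)"
    if f: "f \<in> Hom C M M'" and h: "h \<in> Hom BB X Y" for f h M M' X Y
  proof -
    obtain h' where hh: "h = (X, h', Y)" and [simp]: "X \<in> ObB" "Y \<in> ObB"
      and h': "\<And>p. p \<in> Idx \<Longrightarrow> h' p \<in> Hom C (X p) (Y p)"
      by (rule bi_HomE[OF h]) (rule that)
    have Ff: "Fa f \<in> Hom C (Fo M) (Fo M')"
      using functor_Hom[OF cf_functor[OF cf] f] .
    note [simp] = HomD[OF f] Hom_ob[OF f] HomD[OF h'] HomD[OF mact_in[OF f h]] HomD[OF mact_in[OF Ff h]]
      HomD[OF mact_in[OF f h[unfolded hh]]] HomD[OF mact_in[OF Ff h[unfolded hh]]]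
    show ?thesis
    proof (rule mod_epi[OF cf_linear[OF cf], of M X])
      fix p assume [simp]: "p \<in> Idx"
      have "Fa (MActA MM f h) \<cdot> Fa (mod_inj M X p) = Fa (mod_inj M' Y p) \<cdot> Fa ((f \<lhd>\<^sub>a fst p) \<otimes>\<^sub>a h' p)"
        using arg_cong[OF mact_inj[OF f, of X h' Y p], of Fa] h by (simp add: hh)
      then show "(?s (M', Y) \<cdot> Fa (MActA MM f h)) \<cdot> Fa (mod_inj M X p) =
          (MActA MM (Fa f) h \<cdot> ?s (M, X)) \<cdot> Fa (mod_inj M X p)"
        using pre2[OF mact_inj[OF Ff, of X h' Y p], of "c p M (X p)"] h mact_in[OF Ff h]
        by (simp add: assemble_inj[OF cf] pre2[OF assemble_inj[OF cf]] cf_nat[OF cf] hh Hom_def)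
    qed simp_all
  qed
  have as: "MAssoc MM (Fo M) X Y \<cdot> ?s (M, bi_tensor X Y) =
      MActA MM (?s (M, X)) (Id BB Y) \<cdot> ?s (mod_act M X, Y) \<cdot> Fa (MAssoc MM M X Y)"
    if [simp]: "M \<in> Ob C" "X \<in> ObB" "Y \<in> ObB" for M X Y
  proof (rule mod_tensor_epi[OF cf_linear[OF cf], of M X Y])
    fix p q assume [simp]: "p \<in> Idx" "q \<in> Idx"
    have "inv_arr C (assoc_component p (fst q) (Fo M) (X p) (Y q)) \<cdot> c (p \<diamondop> q) M ((X p \<lhd>\<^sub>o fst q) \<otimes>\<^sub>o Y q) =
        ((c p M (X p) \<lhd>\<^sub>a fst q) \<otimes>\<^sub>a Id C (Y q)) \<cdot> c q ((M \<lhd>\<^sub>o fst p) \<otimes>\<^sub>o X p) (Y q) \<cdot>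
          Fa (inv_arr C (assoc_component p (fst q) M (X p) (Y q)))"
      by (rule coherent_assoc[OF coh]) simp_all
    then show "(MAssoc MM (Fo M) X Y \<cdot> ?s (M, bi_tensor X Y)) \<cdot>
      Fa (mod_inj M (bi_tensor X Y) (p \<diamondop> q) \<cdot> (Id C (M \<lhd>\<^sub>o fst (p \<diamondop> q)) \<otimes>\<^sub>a bi_inj X Y p q)) =
      (MActA MM (?s (M, X)) (Id BB Y) \<cdot> ?s (mod_act M X, Y) \<cdot> Fa (MAssoc MM M X Y)) \<cdot>
      Fa (mod_inj M (bi_tensor X Y) (p \<diamondop> q) \<cdot> (Id C (M \<lhd>\<^sub>o fst (p \<diamondop> q)) \<otimes>\<^sub>a bi_inj X Y p q))"
      by (simp only: assoc_lhs_component[OF cf co assemble_in[OF cf]] that \<open>p \<in> Idx\<close> \<open>q \<in> Idx\<close>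
          assoc_rhs_component[OF cf co assemble_in[OF cf]])
  qed simp_all
  have un: "MUnit MM (Fo M) \<cdot> ?s (M, bi_unit) = Fa (MUnit MM M)" if [simp]: "M \<in> Ob C" for M
  proof (rule mod_epi[OF cf_linear[OF cf], of M bi_unit])
    fix p assume p [simp]: "p \<in> Idx"
    have u: "RUnit C (Fo M) \<cdot> (inv_arr C (R0 D (Fo M)) \<otimes>\<^sub>a Id C \<I>) \<cdot> c idx_one M \<I> =
        Fa (RUnit C M \<cdot> (inv_arr C (R0 D M) \<otimes>\<^sub>a Id C \<I>))"
      by (rule coherent_unit[OF coh]) simp
    show "(MUnit MM (Fo M) \<cdot> ?s (M, bi_unit)) \<cdot> Fa (mod_inj M bi_unit p) =
        Fa (MUnit MM M) \<cdot> Fa (mod_inj M bi_unit p)"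
    proof (cases "p = idx_one")
      case True
      have "Fa (mod_prj M bi_unit idx_one) \<cdot> Fa (mod_inj M bi_unit idx_one) = Id C (Fo ((M \<lhd>\<^sub>o \<one>\<^bsub>G\<^esub>) \<otimes>\<^sub>o \<I>))"
        using functor_comp[OF cf_functor[OF cf], of "mod_inj M bi_unit idx_one" "mod_prj M bi_unit idx_one", symmetric]
        by simp
      then show ?thesis
        using u by (simp add: True munit_eq assemble_inj[OF cf] pre2[OF mod_prj_inj])
    next
      \<comment> \<open>Away from the unit index, the projection to the unit summand annihilates the
        summand under consideration, and both sides are zero.\<close>
      case False
      have "Fa (mod_prj M bi_unit idx_one) \<cdot> Fa (mod_inj M bi_unit p) =
          Zero C (Fo ((M \<lhd>\<^sub>o fst p) \<otimes>\<^sub>o bi_unit p)) (Fo ((M \<lhd>\<^sub>o \<one>\<^bsub>G\<^esub>) \<otimes>\<^sub>o \<I>))"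
        using functor_comp[OF cf_functor[OF cf], of "mod_inj M bi_unit p" "mod_prj M bi_unit idx_one", symmetric]
          mod_prj_inj_diff[of M bi_unit idx_one p] False
        by (simp add: linear_functor_zero[OF linear_category_axioms cf_linear[OF cf]])
      then show ?thesis
        using False by (simp add: munit_eq assemble_inj[OF cf] pre2[OF mod_prj_inj_diff])
    qed
  qed (simp_all add: munit_eq)
  have ty: "MActA MM f h \<in> Arr C" "f \<in> Arr C" "M \<in> Ob C" "M' \<in> Ob C" "X \<in> ObB" "Y \<in> ObB"
    if "f \<in> Hom C M M'" "h \<in> Hom BB X Y" for f h M M' X Y
    using HomD[OF mact_in[OF that]] HomD[OF that(1)] Hom_ob[OF that(1)] RA.B_hom_ob[OF that(2)] by auto
  have se: "?s \<in> extensional (Ob C \<times> ObB)"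
    by (simp add: assemble_def)
  have split: "assemble Fo Fa c = (restrict Fo (Ob C), restrict Fa (Arr C), ?s)"
    by (simp add: assemble_def)
  show ?thesis
    unfolding RA.is_module_endofunctor_def
    by (subst split, unfold case_prod_conv, intro conjI allI ballI)
      (simp_all add: ex se Iso_iff ty nat as un munit_eq[symmetric])
qed

subsection \<open>The components of a module functor\<close>

lemma component_familyI:
  assumes "is_exact_functor C C Fo Fa"
    and "\<And>p M A. p \<in> Idx \<Longrightarrow> M \<in> Ob C \<Longrightarrow> A \<in> Deg D (snd p) \<Longrightarrow> is_iso C (c p M A)"
    and "\<And>p M A. p \<in> Idx \<Longrightarrow> M \<in> Ob C \<Longrightarrow> A \<in> Deg D (snd p) \<Longrightarrow> Dom C (c p M A) = Fo ((M \<lhd>\<^sub>o fst p) \<otimes>\<^sub>o A)"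
    and "\<And>p M A. p \<in> Idx \<Longrightarrow> M \<in> Ob C \<Longrightarrow> A \<in> Deg D (snd p) \<Longrightarrow> Cod C (c p M A) = (Fo M \<lhd>\<^sub>o fst p) \<otimes>\<^sub>o A"
    and "\<And>p f j. p \<in> Idx \<Longrightarrow> f \<in> Arr C \<Longrightarrow> j \<in> Arr C \<Longrightarrow> Dom C j \<in> Deg D (snd p) \<Longrightarrow> Cod C j \<in> Deg D (snd p) \<Longrightarrow>
      c p (Cod C f) (Cod C j) \<cdot> Fa ((f \<lhd>\<^sub>a fst p) \<otimes>\<^sub>a j) = ((Fa f \<lhd>\<^sub>a fst p) \<otimes>\<^sub>a j) \<cdot> c p (Dom C f) (Dom C j)"
  shows "component_family Fo Fa c"
  unfolding component_family_def using assms by blast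

text \<open>The object g \<bowtie> A for p = (g, k): a family concentrated at one index.\<close>

definition delta :: "'g \<times> 't \<Rightarrow> 'o \<Rightarrow> ('g, 't, 'o) bicrossed_ob" where
  "delta p A = (\<lambda>q\<in>Idx. if q = p then A else zero_ob C)"

text \<open>For X = Y and \<open>j\<close> an identity this is the idempotent that cuts out one
  member of the family; in general it compares two families at a single index.\<close>

definition single_arr :: "('g, 't, 'o) bicrossed_ob \<Rightarrow> ('g, 't, 'o) bicrossed_ob \<Rightarrow> 'g \<times> 't \<Rightarrow> 'm \<Rightarrow> 'g \<times> 't \<Rightarrow> 'm" where
  "single_arr X Y p j = (\<lambda>q\<in>Idx. if q = p then j else Zero C (X q) (Y q))"

lemma delta_in [simp]: "p \<in> Idx \<Longrightarrow> A \<in> Deg D (snd p) \<Longrightarrow> delta p A \<in> ObB"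
  by (rule PiE_I) (simp_all add: delta_def)

lemma delta_same [simp]: "p \<in> Idx \<Longrightarrow> delta p A p = A"
  by (simp add: delta_def)

lemma single_arr_in:
  assumes "X \<in> ObB" "Y \<in> ObB" "p \<in> Idx" "j \<in> Hom C (X p) (Y p)"
  shows "(X, single_arr X Y p j, Y) \<in> Hom BB X Y"
proof -
  have "single_arr X Y p j \<in> (\<Pi>\<^sub>E q\<in>Idx. Hom C (X q) (Y q))"
    by (rule PiE_I) (use assms in \<open>simp_all add: single_arr_def zero_in\<close>)
  then show ?thesis
    using assms by (simp add: bi_Hom)
qed

lemma single_arr_same [simp]: "p \<in> Idx \<Longrightarrow> single_arr X Y p j p = j"
  and single_arr_other: "p \<in> Idx \<Longrightarrow> q \<in> Idx \<Longrightarrow> q \<noteq> p \<Longrightarrow> single_arr X Y p j q = Zero C (X q) (Y q)"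
  by (simp_all add: single_arr_def)

definition block :: "('o, 'm, ('g, 't, 'o) bicrossed_ob) modfun \<Rightarrow> 'o \<Rightarrow> ('g, 't, 'o) bicrossed_ob \<Rightarrow> 'g \<times> 't \<Rightarrow> 'm" where
  "block F M X p = mod_prj (fst F M) X p \<cdot> snd (snd F) (M, X) \<cdot> fst (snd F) (mod_inj M X p)"

definition component :: "('o, 'm, ('g, 't, 'o) bicrossed_ob) modfun \<Rightarrow> 'g \<times> 't \<Rightarrow> 'o \<Rightarrow> 'o \<Rightarrow> 'm" where
  "component F p M A = block F M (delta p A) p"

context
  fixes F
  assumes mf: "RA.is_module_endofunctor F"
begin

lemmas mfs = RA.mf_simps[OF mf, unfolded bi_norm]

lemma mf_square:
  assumes "f \<in> Hom C M M'" "h \<in> Hom BB X Y"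
  shows "snd (snd F) (M', Y) \<cdot> fst (snd F) (MActA MM f h) = MActA MM (fst (snd F) f) h \<cdot> snd (snd F) (M, X)"
  using RA.mf_nat[OF mf assms] .

lemma block_in:
  assumes "M \<in> Ob C" "X \<in> ObB" "p \<in> Idx"
  shows "block F M X p \<in> Hom C (fst F ((M \<lhd>\<^sub>o fst p) \<otimes>\<^sub>o X p)) ((fst F M \<lhd>\<^sub>o fst p) \<otimes>\<^sub>o X p)"
  using assms by (simp add: block_def Hom_def mfs)

lemma block_nat:
  assumes f: "f \<in> Hom C M M'" and h: "(X, h, Y) \<in> Hom BB X Y" and p [simp]: "p \<in> Idx"
  shows "block F M' Y p \<cdot> fst (snd F) ((f \<lhd>\<^sub>a fst p) \<otimes>\<^sub>a h p) = ((fst (snd F) f \<lhd>\<^sub>a fst p) \<otimes>\<^sub>a h p) \<cdot> block F M X p"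
proof -
  have [simp]: "X \<in> ObB" "Y \<in> ObB" and h': "h p \<in> Hom C (X p) (Y p)"
    by (rule bi_HomE[OF h], simp)+
  have Ff: "fst (snd F) f \<in> Hom C (fst F M) (fst F M')"
    using functor_Hom[OF RA.mf_functor[OF mf] f] .
  note [simp] = mfs HomD[OF f] Hom_ob[OF f] HomD[OF h'] HomD[OF mact_in[OF f h]] HomD[OF mact_in[OF Ff h]]
  have "fst (snd F) (mod_inj M' Y p) \<cdot> fst (snd F) ((f \<lhd>\<^sub>a fst p) \<otimes>\<^sub>a h p) =
      fst (snd F) (MActA MM f (X, h, Y)) \<cdot> fst (snd F) (mod_inj M X p)"
    using arg_cong[OF mact_inj[OF f h p], of "fst (snd F)"] by simp
  then have "block F M' Y p \<cdot> fst (snd F) ((f \<lhd>\<^sub>a fst p) \<otimes>\<^sub>a h p) =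
      mod_prj (fst F M') Y p \<cdot> snd (snd F) (M', Y) \<cdot> fst (snd F) (MActA MM f (X, h, Y)) \<cdot> fst (snd F) (mod_inj M X p)"
    by (simp add: block_def)
  also have "\<dots> = ((fst (snd F) f \<lhd>\<^sub>a fst p) \<otimes>\<^sub>a h p) \<cdot> block F M X p"
    by (simp add: pre2[OF mf_square[OF f h]] pre2[OF mact_prj[OF Ff h p]] block_def)
  finally show ?thesis .
qed

text \<open>Off-diagonal entries vanish because the constraint is natural against the idempotent of
  \<open>X\<close> at index \<open>p\<close>. Inserted next to the p-th injection this idempotent
  changes nothing, yet after the constraint it is zero from the viewpoint of the q-th
  projection.\<close>

lemma block_inj:
  assumes M [simp]: "M \<in> Ob C" and X [simp]: "X \<in> ObB" and p [simp]: "p \<in> Idx"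
  shows "snd (snd F) (M, X) \<cdot> fst (snd F) (mod_inj M X p) = mod_inj (fst F M) X p \<cdot> block F M X p"
proof (rule biproduct_mono[OF mod_biproduct[of "fst F M" X]])
  note [simp] = mfs HomD[OF block_in]
  show "fst F M \<in> Ob C" "X \<in> ObB"
    by simp_all
  show "snd (snd F) (M, X) \<cdot> fst (snd F) (mod_inj M X p) \<in> Hom C (fst F ((M \<lhd>\<^sub>o fst p) \<otimes>\<^sub>o X p)) (mod_act (fst F M) X)"
    "mod_inj (fst F M) X p \<cdot> block F M X p \<in> Hom C (fst F ((M \<lhd>\<^sub>o fst p) \<otimes>\<^sub>o X p)) (mod_act (fst F M) X)"
    by (simp_all add: Hom_def)
  fix q assume q [simp]: "q \<in> Idx"
  show "mod_prj (fst F M) X q \<cdot> snd (snd F) (M, X) \<cdot> fst (snd F) (mod_inj M X p) =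
      mod_prj (fst F M) X q \<cdot> mod_inj (fst F M) X p \<cdot> block F M X p"
  proof (cases "q = p")
    case True
    then show ?thesis
      by (simp add: block_def pre2[OF mod_prj_inj])
  next
    case False
    have idM: "Id C M \<in> Hom C M M" and idFM: "Id C (fst F M) \<in> Hom C (fst F M) (fst F M)"
      by (simp_all add: id_in)
    have h: "(X, single_arr X X p (Id C (X p)), X) \<in> Hom BB X X"
      by (rule single_arr_in) (simp_all add: id_in)
    let ?e = "MActA MM (Id C M) (X, single_arr X X p (Id C (X p)), X)"
    let ?e' = "MActA MM (Id C (fst F M)) (X, single_arr X X p (Id C (X p)), X)"
    note [simp] = HomD[OF mact_in[OF idM h]] HomD[OF mact_in[OF idFM h]]
    \<comment> \<open>The idempotent \<open>?e\<close> on the module side acts as the identity on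
      the p-th summand.\<close>
    have "fst (snd F) (mod_inj M X p) = fst (snd F) ?e \<cdot> fst (snd F) (mod_inj M X p)"
      using arg_cong[OF mact_inj[OF idM h p], of "fst (snd F)"] by simp
    then have "mod_prj (fst F M) X q \<cdot> snd (snd F) (M, X) \<cdot> fst (snd F) (mod_inj M X p) =
        mod_prj (fst F M) X q \<cdot> snd (snd F) (M, X) \<cdot> fst (snd F) ?e \<cdot> fst (snd F) (mod_inj M X p)"
      by simp
    also have "\<dots> = (mod_prj (fst F M) X q \<cdot> ?e') \<cdot> snd (snd F) (M, X) \<cdot> fst (snd F) (mod_inj M X p)"
      using mf_square[OF idM h] by (simp add: pre2[OF mf_square[OF idM h]])
    \<comment> \<open>By \<open>mact_prj\<close> the idempotent \<open>?e'\<close> appears here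
      through its member at \<open>q\<close>, which is a zero arrow.\<close>
    also have "\<dots> = Zero C (fst F ((M \<lhd>\<^sub>o fst p) \<otimes>\<^sub>o X p)) ((fst F M \<lhd>\<^sub>o fst q) \<otimes>\<^sub>o X q)"
      using mact_prj[OF idFM h q] by (simp add: single_arr_other[OF p q False] ten_zero_right)
    also have "\<dots> = mod_prj (fst F M) X q \<cdot> mod_inj (fst F M) X p \<cdot> block F M X p"
      by (simp add: pre2[OF mod_prj_inj_diff] False)
    finally show ?thesis .
  qed
qed

lemma block_prj:
  assumes M [simp]: "M \<in> Ob C" and X [simp]: "X \<in> ObB" and p [simp]: "p \<in> Idx"
  shows "mod_prj (fst F M) X p \<cdot> snd (snd F) (M, X) = block F M X p \<cdot> fst (snd F) (mod_prj M X p)"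
proof (rule mod_epi[OF RA.mf_linear[OF mf] M X])
  note [simp] = mfs HomD[OF block_in]
  fix q assume q [simp]: "q \<in> Idx"
  have *: "fst (snd F) (mod_prj M X p) \<cdot> fst (snd F) (mod_inj M X q) = fst (snd F) (mod_prj M X p \<cdot> mod_inj M X q)"
    by (rule functor_comp[OF RA.mf_functor[OF mf], symmetric]) simp_all
  show "(mod_prj (fst F M) X p \<cdot> snd (snd F) (M, X)) \<cdot> fst (snd F) (mod_inj M X q) =
      (block F M X p \<cdot> fst (snd F) (mod_prj M X p)) \<cdot> fst (snd F) (mod_inj M X q)"
  proof (cases "p = q")
    case True
    then show ?thesis
      using * by (simp add: block_inj pre2[OF mod_prj_inj])
  next
    case False
    then show ?thesis
      using * mod_prj_inj_diff[OF M X p q False]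
      by (simp add: block_inj pre2[OF mod_prj_inj_diff] linear_functor_zero[OF linear_category_axioms RA.mf_linear[OF mf]])
  qed
qed (use mfs block_in[OF M X p] in \<open>auto simp: Hom_def\<close>)

text \<open>A diagonal entry of an invertible block-diagonal map is invertible, with the
  corresponding entry of the inverse map as its inverse.\<close>

lemma block_iso:
  assumes M [simp]: "M \<in> Ob C" and X [simp]: "X \<in> ObB" and p [simp]: "p \<in> Idx"
  shows "is_iso C (block F M X p)"
proof (rule is_isoI[OF block_in[OF assms]])
  note [simp] = mfs HomD[OF block_in]
  let ?i = "fst (snd F) (mod_prj M X p) \<cdot> inv_arr C (snd (snd F) (M, X)) \<cdot> mod_inj (fst F M) X p"
  show "?i \<in> Hom C ((fst F M \<lhd>\<^sub>o fst p) \<otimes>\<^sub>o X p) (fst F ((M \<lhd>\<^sub>o fst p) \<otimes>\<^sub>o X p))"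
    by (simp add: Hom_def)
  have *: "fst (snd F) (mod_prj M X p) \<cdot> fst (snd F) (mod_inj M X p) = Id C (fst F ((M \<lhd>\<^sub>o fst p) \<otimes>\<^sub>o X p))"
    using functor_comp[OF RA.mf_functor[OF mf], of "mod_inj M X p" "mod_prj M X p", symmetric] by simp
  have "?i \<cdot> block F M X p = fst (snd F) (mod_prj M X p) \<cdot> inv_arr C (snd (snd F) (M, X)) \<cdot> snd (snd F) (M, X) \<cdot> fst (snd F) (mod_inj M X p)"
    by (simp add: block_inj[symmetric])
  then show "?i \<cdot> block F M X p = Id C (fst F ((M \<lhd>\<^sub>o fst p) \<otimes>\<^sub>o X p))"
    by (simp add: *)
  have "block F M X p \<cdot> ?i = mod_prj (fst F M) X p \<cdot> snd (snd F) (M, X) \<cdot> inv_arr C (snd (snd F) (M, X)) \<cdot> mod_inj (fst F M) X p"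
    by (simp add: pre2[OF block_prj[symmetric]])
  then show "block F M X p \<cdot> ?i = Id C ((fst F M \<lhd>\<^sub>o fst p) \<otimes>\<^sub>o X p)"
    by simp
qed

text \<open>Naturality against the arrow from \<open>X\<close> to the concentrated family
  \<open>delta p (X p)\<close>, the identity at \<open>p\<close>, shows that a diagonal entry
  depends on \<open>X\<close> only through the member \<open>X p\<close>.\<close>

lemma block_component:
  assumes M [simp]: "M \<in> Ob C" and X [simp]: "X \<in> ObB" and p [simp]: "p \<in> Idx"
  shows "block F M X p = component F p M (X p)"
proof -
  note [simp] = mfs HomD[OF block_in]
  have h: "(X, single_arr X (delta p (X p)) p (Id C (X p)), delta p (X p)) \<in> Hom BB X (delta p (X p))"
    by (rule single_arr_in) (simp_all add: id_in)
  show ?thesis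
    using block_nat[OF id_in[OF M] h p] by (simp add: component_def)
qed

lemma component_family_component: "component_family (fst F) (fst (snd F)) (component F)"
proof -
  note [simp] = mfs
  have t: "component F p M A \<in> Hom C (fst F ((M \<lhd>\<^sub>o fst p) \<otimes>\<^sub>o A)) ((fst F M \<lhd>\<^sub>o fst p) \<otimes>\<^sub>o A)"
    "is_iso C (component F p M A)" if "p \<in> Idx" "M \<in> Ob C" "A \<in> Deg D (snd p)" for p M A
    using that block_in[of M "delta p A" p] block_iso[of M "delta p A" p] by (simp_all add: component_def)
  have n: "component F p (Cod C f) (Cod C j) \<cdot> fst (snd F) ((f \<lhd>\<^sub>a fst p) \<otimes>\<^sub>a j) =
      ((fst (snd F) f \<lhd>\<^sub>a fst p) \<otimes>\<^sub>a j) \<cdot> component F p (Dom C f) (Dom C j)"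
    if [simp]: "p \<in> Idx" "f \<in> Arr C" "j \<in> Arr C" "Dom C j \<in> Deg D (snd p)" "Cod C j \<in> Deg D (snd p)" for p f j
  proof -
    have h: "(delta p (Dom C j), single_arr (delta p (Dom C j)) (delta p (Cod C j)) p j, delta p (Cod C j))
        \<in> Hom BB (delta p (Dom C j)) (delta p (Cod C j))"
      by (rule single_arr_in) (simp_all add: Hom_def)
    have f: "f \<in> Hom C (Dom C f) (Cod C f)"
      by (simp add: Hom_def)
    show ?thesis
      using block_nat[OF f h \<open>p \<in> Idx\<close>] by (simp add: component_def)
  qed
  show ?thesis
    by (rule component_familyI) (use RA.mf_exact[OF mf] t n HomD[OF t(1)] in auto)
qed

lemma components_of_component: "components_of (fst F) (fst (snd F)) (snd (snd F)) (component F)"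
  unfolding components_of_def using block_inj block_component by metis

text \<open>The converse of assembling: on concentrated families the module axioms yield the wanted
  equations preceded by an inclusion, which a projection removes.\<close>

lemma coherent_components_component: "coherent_components (fst F) (fst (snd F)) (component F)"
proof -
  note cf = component_family_component and co = components_of_component
  note [simp] = cf_simps[OF cf] mfs
  have sty: "\<And>M X. M \<in> Ob C \<Longrightarrow> X \<in> ObB \<Longrightarrow> snd (snd F) (M, X) \<in> Hom C (fst F (mod_act M X)) (mod_act (fst F M) X)"
    by (simp add: Hom_def)
  have "inv_arr C (assoc_component p (fst q) (fst F M) A B) \<cdot> component F (p \<diamondop> q) M ((A \<lhd>\<^sub>o fst q) \<otimes>\<^sub>o B) =
        ((component F p M A \<lhd>\<^sub>a fst q) \<otimes>\<^sub>a Id C B) \<cdot> component F q ((M \<lhd>\<^sub>o fst p) \<otimes>\<^sub>o A) B \<cdot>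
          fst (snd F) (inv_arr C (assoc_component p (fst q) M A B))"
    if [simp]: "p \<in> Idx" "q \<in> Idx" "M \<in> Ob C" "A \<in> Deg D (snd p)" "B \<in> Deg D (snd q)" for p q M A B
  proof -
    let ?X = "delta p A" and ?Y = "delta q B"
    have [simp]: "A \<in> Ob C" "B \<in> Ob C"
      using that deg_in_ob Idx_snd by blast+
    have N [simp]: "(A \<lhd>\<^sub>o fst q) \<otimes>\<^sub>o B \<in> Deg D (snd (p \<diamondop> q))"
      using bi_summand_deg'[of ?X ?Y p q] by simp
    let ?l = "inv_arr C (assoc_component p (fst q) (fst F M) A B) \<cdot> component F (p \<diamondop> q) M ((A \<lhd>\<^sub>o fst q) \<otimes>\<^sub>o B)"
    let ?r = "((component F p M A \<lhd>\<^sub>a fst q) \<otimes>\<^sub>a Id C B) \<cdot> component F q ((M \<lhd>\<^sub>o fst p) \<otimes>\<^sub>o A) B \<cdot>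
          fst (snd F) (inv_arr C (assoc_component p (fst q) M A B))"
    let ?m = "mod_inj (mod_act (fst F M) ?X) ?Y q \<cdot> ((mod_inj (fst F M) ?X p \<lhd>\<^sub>a fst q) \<otimes>\<^sub>a Id C B)"
    let ?m' = "((mod_prj (fst F M) ?X p \<lhd>\<^sub>a fst q) \<otimes>\<^sub>a Id C B) \<cdot> mod_prj (mod_act (fst F M) ?X) ?Y q"
    have eq: "?m \<cdot> ?l = ?m \<cdot> ?r"
    proof -
      have X: "?X \<in> ObB" and Y: "?Y \<in> ObB"
        by simp_all
      note ds = delta_same[OF that(1)] delta_same[OF that(2)]
      note l = assoc_lhs_component[OF cf co sty that(3) X Y that(1,2), unfolded ds]
      note r = assoc_rhs_component[OF cf co sty that(3) X Y that(1,2), unfolded ds]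
      \<comment> \<open>The associativity axiom of \<open>F\<close> equates the left sides of
        \<open>l\<close> and \<open>r\<close>, hence also their right sides.\<close>
      show ?thesis
        using l[unfolded RA.mf_assoc[OF mf that(3), unfolded bi_norm, OF X Y]] r by (rule trans[OF sym])
    qed
    have mm: "?m' \<cdot> ?m = Id C ((((fst F M \<lhd>\<^sub>o fst p) \<otimes>\<^sub>o A) \<lhd>\<^sub>o fst q) \<otimes>\<^sub>o B)"
      by (simp add: pre2[OF mod_prj_inj] ten_collapse act_expand[symmetric])
    have ty: "?l \<in> into C (Dom C ?m)" "?r \<in> into C (Dom C ?m)"
      by (simp_all add: fst_idx_mult)
    have "?l = (?m' \<cdot> ?m) \<cdot> ?l"
      unfolding mm using ty by (simp del: into_comp)
    also have "\<dots> = ?m' \<cdot> ?m \<cdot> ?l"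
      by (rule comp_assoc_into) (use ty in \<open>simp_all del: into_comp\<close>)
    also have "\<dots> = ?m' \<cdot> ?m \<cdot> ?r"
      unfolding eq ..
    also have "\<dots> = (?m' \<cdot> ?m) \<cdot> ?r"
      by (rule comp_assoc_into[symmetric]) (use ty in \<open>simp_all del: into_comp\<close>)
    also have "\<dots> = ?r"
      unfolding mm using ty by (simp del: into_comp)
    finally show ?thesis .
  qed
  moreover have "RUnit C (fst F M) \<cdot> (inv_arr C (R0 D (fst F M)) \<otimes>\<^sub>a Id C \<I>) \<cdot> component F idx_one M \<I> =
        fst (snd F) (RUnit C M \<cdot> (inv_arr C (R0 D M) \<otimes>\<^sub>a Id C \<I>))" if [simp]: "M \<in> Ob C" for M
  proof -
    have *: "fst (snd F) (mod_prj M bi_unit idx_one) \<cdot> fst (snd F) (mod_inj M bi_unit idx_one) = Id C (fst F ((M \<lhd>\<^sub>o \<one>\<^bsub>G\<^esub>) \<otimes>\<^sub>o \<I>))"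
      using functor_comp[OF RA.mf_functor[OF mf], of "mod_inj M bi_unit idx_one" "mod_prj M bi_unit idx_one", symmetric] by simp
    have "MUnit MM (fst F M) \<cdot> snd (snd F) (M, bi_unit) \<cdot> fst (snd F) (mod_inj M bi_unit idx_one) =
        fst (snd F) (MUnit MM M) \<cdot> fst (snd F) (mod_inj M bi_unit idx_one)"
      using pre2[OF RA.mf_unit[OF mf, unfolded bi_norm, of M], of "fst (snd F) (mod_inj M bi_unit idx_one)"]
      by (simp add: munit_eq)
    then show ?thesis
      by (simp add: munit_eq comps_inj[OF cf co sty] * pre2[OF mod_prj_inj])
  qed
  ultimately show ?thesis
    unfolding coherent_components_def by blast
qed

end

subsection \<open>Module natural transformations\<close>

text \<open>Since both constraints are block-diagonal, the module condition splits into one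
  condition for each summand, and a concentrated family isolates a single one. The transformations
  constructed below are all verified in this form, and fullness uses the converse.\<close>

lemma module_natural_components:
  assumes F: "RA.is_module_endofunctor F" and H: "RA.is_module_endofunctor H"
    and c: "component_family (fst F) (fst (snd F)) c" "components_of (fst F) (fst (snd F)) (snd (snd F)) c"
    and d: "component_family (fst H) (fst (snd H)) d" "components_of (fst H) (fst (snd H)) (snd (snd H)) d"
    and nat: "is_natural C C (fst F) (fst (snd F)) (fst H) (fst (snd H)) \<tau>" and ext: "\<tau> \<in> extensional (Ob C)"
  shows "RA.is_module_natural F H \<tau> \<longleftrightarrow> (\<forall>p\<in>Idx. \<forall>M\<in>Ob C. \<forall>A\<in>Deg D (snd p).
    d p M A \<cdot> \<tau> ((M \<lhd>\<^sub>o fst p) \<otimes>\<^sub>o A) = ((\<tau> M \<lhd>\<^sub>a fst p) \<otimes>\<^sub>a Id C A) \<cdot> c p M A)"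
proof -
  note [simp] = mfs[OF F] mfs[OF H] cf_simps[OF c(1)] cf_simps[OF d(1)]
  have sF: "\<And>M X. M \<in> Ob C \<Longrightarrow> X \<in> ObB \<Longrightarrow> snd (snd F) (M, X) \<in> Hom C (fst F (mod_act M X)) (mod_act (fst F M) X)"
    and sH: "\<And>M X. M \<in> Ob C \<Longrightarrow> X \<in> ObB \<Longrightarrow> snd (snd H) (M, X) \<in> Hom C (fst H (mod_act M X)) (mod_act (fst H M) X)"
    by (simp_all add: Hom_def)
  have t [simp]: "\<tau> M \<in> Arr C" "Dom C (\<tau> M) = fst F M" "Cod C (\<tau> M) = fst H M" if "M \<in> Ob C" for M
    using HomD[OF natural_Hom[OF nat that]] by auto
  have tn: "\<tau> M \<cdot> fst (snd F) f = fst (snd H) f \<cdot> \<tau> (Dom C f)" if "f \<in> Arr C" "Cod C f = M" for f M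
    using natural_square[OF nat that(1)] that(2) by simp
  have l: "(snd (snd H) (M, X) \<cdot> \<tau> (mod_act M X)) \<cdot> fst (snd F) (mod_inj M X p) =
      mod_inj (fst H M) X p \<cdot> d p M (X p) \<cdot> \<tau> ((M \<lhd>\<^sub>o fst p) \<otimes>\<^sub>o X p)"
    and r: "(MActA MM (\<tau> M) (Id BB X) \<cdot> snd (snd F) (M, X)) \<cdot> fst (snd F) (mod_inj M X p) =
      mod_inj (fst H M) X p \<cdot> ((\<tau> M \<lhd>\<^sub>a fst p) \<otimes>\<^sub>a Id C (X p)) \<cdot> c p M (X p)"
    if [simp]: "M \<in> Ob C" "X \<in> ObB" "p \<in> Idx" for M X p
    by (simp_all add: tn pre2[OF comps_inj[OF d sH]] comps_inj[OF c sF] pre2[OF mact_id_inj])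
  show ?thesis
  proof
    assume m: "RA.is_module_natural F H \<tau>"
    show "\<forall>p\<in>Idx. \<forall>M\<in>Ob C. \<forall>A\<in>Deg D (snd p).
        d p M A \<cdot> \<tau> ((M \<lhd>\<^sub>o fst p) \<otimes>\<^sub>o A) = ((\<tau> M \<lhd>\<^sub>a fst p) \<otimes>\<^sub>a Id C A) \<cdot> c p M A"
    proof (intro ballI)
      fix p M A assume [simp]: "p \<in> Idx" "M \<in> Ob C" "A \<in> Deg D (snd p)"
      have [simp]: "A \<in> Ob C"
        using deg_in_ob[of A "snd p"] by simp
      have "mod_inj (fst H M) (delta p A) p \<cdot> d p M A \<cdot> \<tau> ((M \<lhd>\<^sub>o fst p) \<otimes>\<^sub>o A) =
          mod_inj (fst H M) (delta p A) p \<cdot> ((\<tau> M \<lhd>\<^sub>a fst p) \<otimes>\<^sub>a Id C A) \<cdot> c p M A"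
        using l[of M "delta p A" p] r[of M "delta p A" p] RA.mn_mod[OF m, unfolded bi_norm, of M "delta p A"] by simp
      then have "mod_prj (fst H M) (delta p A) p \<cdot> mod_inj (fst H M) (delta p A) p \<cdot> d p M A \<cdot> \<tau> ((M \<lhd>\<^sub>o fst p) \<otimes>\<^sub>o A) =
          mod_prj (fst H M) (delta p A) p \<cdot> mod_inj (fst H M) (delta p A) p \<cdot> ((\<tau> M \<lhd>\<^sub>a fst p) \<otimes>\<^sub>a Id C A) \<cdot> c p M A"
        by (rule arg_cong)
      then show "d p M A \<cdot> \<tau> ((M \<lhd>\<^sub>o fst p) \<otimes>\<^sub>o A) = ((\<tau> M \<lhd>\<^sub>a fst p) \<otimes>\<^sub>a Id C A) \<cdot> c p M A"
        by (simp add: pre2[OF mod_prj_inj])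
    qed
  next
    assume *: "\<forall>p\<in>Idx. \<forall>M\<in>Ob C. \<forall>A\<in>Deg D (snd p).
        d p M A \<cdot> \<tau> ((M \<lhd>\<^sub>o fst p) \<otimes>\<^sub>o A) = ((\<tau> M \<lhd>\<^sub>a fst p) \<otimes>\<^sub>a Id C A) \<cdot> c p M A"
    show "RA.is_module_natural F H \<tau>"
    proof (rule RA.mnI)
      fix M X assume "M \<in> Ob C" "X \<in> Ob BB"
      then have [simp]: "M \<in> Ob C" "X \<in> ObB"
        by (simp_all add: bi_norm)
      have "snd (snd H) (M, X) \<cdot> \<tau> (mod_act M X) = MActA MM (\<tau> M) (Id BB X) \<cdot> snd (snd F) (M, X)"
      proof (rule mod_epi[OF RA.mf_linear[OF F], of M X])
        fix p assume [simp]: "p \<in> Idx"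
        have "d p M (X p) \<cdot> \<tau> ((M \<lhd>\<^sub>o fst p) \<otimes>\<^sub>o X p) = ((\<tau> M \<lhd>\<^sub>a fst p) \<otimes>\<^sub>a Id C (X p)) \<cdot> c p M (X p)"
          using * \<open>M \<in> Ob C\<close> \<open>p \<in> Idx\<close> ObB_deg[OF \<open>X \<in> ObB\<close> \<open>p \<in> Idx\<close>] by blast
        then show "(snd (snd H) (M, X) \<cdot> \<tau> (mod_act M X)) \<cdot> fst (snd F) (mod_inj M X p) =
            (MActA MM (\<tau> M) (Id BB X) \<cdot> snd (snd F) (M, X)) \<cdot> fst (snd F) (mod_inj M X p)"
          by (simp only: l r \<open>M \<in> Ob C\<close> \<open>X \<in> ObB\<close> \<open>p \<in> Idx\<close>)
      qed simp_all
      then show "snd (snd H) (M, X) \<cdot> \<tau> (MActO MM M X) = MActA MM (\<tau> M) (Id BB X) \<cdot> snd (snd F) (M, X)"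
        by (simp add: bi_norm)
    qed (simp_all add: ext tn)
  qed
qed

text \<open>Supplies components of a composite in terms of given components of the factors, so that
  for two functors of the form U \<otimes> - they remain explicit.\<close>

lemma components_of_modfun_comp:
  assumes F: "RA.is_module_endofunctor F" and H: "RA.is_module_endofunctor H"
    and c: "component_family (fst F) (fst (snd F)) c" "components_of (fst F) (fst (snd F)) (snd (snd F)) c"
    and d: "component_family (fst H) (fst (snd H)) d" "components_of (fst H) (fst (snd H)) (snd (snd H)) d"
  defines "e \<equiv> \<lambda>p M A. c p (fst H M) A \<cdot> fst (snd F) (d p M A)"
  shows "component_family (fst (RA.modfun_comp F H)) (fst (snd (RA.modfun_comp F H))) e"
    and "components_of (fst (RA.modfun_comp F H)) (fst (snd (RA.modfun_comp F H))) (snd (snd (RA.modfun_comp F H))) e"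
proof -
  let ?K = "RA.modfun_comp F H"
  note K = RA.modfun_comp_in[OF F H]
  note [simp] = mfs[OF F] mfs[OF H] cf_simps[OF c(1)] cf_simps[OF d(1)] functor_iso[OF RA.mf_functor[OF F]]
  note sel = RA.modfun_comp_sel[of F H, unfolded bi_norm]
  have sF: "\<And>M X. M \<in> Ob C \<Longrightarrow> X \<in> ObB \<Longrightarrow> snd (snd F) (M, X) \<in> Hom C (fst F (mod_act M X)) (mod_act (fst F M) X)"
    and sH: "\<And>M X. M \<in> Ob C \<Longrightarrow> X \<in> ObB \<Longrightarrow> snd (snd H) (M, X) \<in> Hom C (fst H (mod_act M X)) (mod_act (fst H M) X)"
    by (simp_all add: Hom_def)
  have ty: "is_iso C (e p M A) \<and> Dom C (e p M A) = fst ?K ((M \<lhd>\<^sub>o fst p) \<otimes>\<^sub>o A) \<and> Cod C (e p M A) = (fst ?K M \<lhd>\<^sub>o fst p) \<otimes>\<^sub>o A"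
    if [simp]: "p \<in> Idx" "M \<in> Ob C" "A \<in> Deg D (snd p)" for p M A
    using deg_in_ob[of A "snd p"] by (simp add: e_def sel)
  have n: "e p (Cod C f) (Cod C j) \<cdot> fst (snd ?K) ((f \<lhd>\<^sub>a fst p) \<otimes>\<^sub>a j) =
      ((fst (snd ?K) f \<lhd>\<^sub>a fst p) \<otimes>\<^sub>a j) \<cdot> e p (Dom C f) (Dom C j)"
    if [simp]: "p \<in> Idx" "f \<in> Arr C" "j \<in> Arr C" "Dom C j \<in> Deg D (snd p)" "Cod C j \<in> Deg D (snd p)" for p f j
  proof -
    have "fst (snd F) (d p (Cod C f) (Cod C j)) \<cdot> fst (snd F) (fst (snd H) ((f \<lhd>\<^sub>a fst p) \<otimes>\<^sub>a j)) =
        fst (snd F) ((fst (snd H) f \<lhd>\<^sub>a fst p) \<otimes>\<^sub>a j) \<cdot> fst (snd F) (d p (Dom C f) (Dom C j))"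
      using arg_cong[OF cf_nat[OF d(1) that refl refl], of "fst (snd F)"] by simp
    then show ?thesis
      by (simp add: e_def sel pre2[OF cf_nat[OF c(1)]])
  qed
  show "component_family (fst ?K) (fst (snd ?K)) e"
    by (rule component_familyI; (rule RA.mf_exact[OF K] n; assumption)?; simp only: ty)
  have "snd (snd ?K) (M, X) \<cdot> fst (snd ?K) (mod_inj M X p) = mod_inj (fst ?K M) X p \<cdot> e p M (X p)"
    if [simp]: "M \<in> Ob C" "X \<in> ObB" "p \<in> Idx" for M X p
  proof -
    have "fst (snd F) (snd (snd H) (M, X)) \<cdot> fst (snd F) (fst (snd H) (mod_inj M X p)) =
        fst (snd F) (mod_inj (fst H M) X p) \<cdot> fst (snd F) (d p M (X p))"
      using arg_cong[OF comps_inj[OF d sH that], of "fst (snd F)"] by simp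
    then show ?thesis
      by (simp add: e_def sel mem_Sigma_iff pre2[OF comps_inj[OF c sF]])
  qed
  then show "components_of (fst ?K) (fst (snd ?K)) (snd (snd ?K)) e"
    unfolding components_of_def by blast
qed

section \<open>Equivariant objects act as module functors\<close>

lemma assemble_components:
  assumes cf: "component_family Fo Fa c"
  defines "F \<equiv> assemble Fo Fa c"
  shows "component_family (fst F) (fst (snd F)) c" "components_of (fst F) (fst (snd F)) (snd (snd F)) c"
proof -
  note [simp] = cf_simps[OF cf]
  have ex: "is_exact_functor C C (restrict Fo (Ob C)) (restrict Fa (Arr C))"
    by (rule RA.exact_functor_cong[OF cf_exact[OF cf]]) auto
  show "component_family (fst F) (fst (snd F)) c"
    unfolding F_def assemble_sel
  proof (rule component_familyI[OF ex])
    fix p M A assume [simp]: "p \<in> Idx" "M \<in> Ob C" "A \<in> Deg D (snd p)"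
    have [simp]: "A \<in> Ob C"
      using deg_in_ob[of A "snd p"] by simp
    show "is_iso C (c p M A)" "Dom C (c p M A) = restrict Fo (Ob C) ((M \<lhd>\<^sub>o fst p) \<otimes>\<^sub>o A)"
      "Cod C (c p M A) = (restrict Fo (Ob C) M \<lhd>\<^sub>o fst p) \<otimes>\<^sub>o A"
      by simp_all
  qed (simp add: cf_nat[OF cf])
  show "components_of (fst F) (fst (snd F)) (snd (snd F)) c"
    unfolding F_def assemble_sel components_of_def using assemble_inj[OF cf] by simp
qed

text \<open>Kept in the direction opposite to a module constraint, because gamma and the associators
  compose this way without inverses.\<close>

definition sig :: "'o \<Rightarrow> ('g \<Rightarrow> 'm) \<Rightarrow> 'g \<times> 't \<Rightarrow> 'o \<Rightarrow> 'o \<Rightarrow> 'm" where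
  "sig U u p M A = Assoc C U (M \<lhd>\<^sub>o fst p) A \<cdot> (gam U u (fst p) M \<otimes>\<^sub>a Id C A)"

definition Psi :: "('g, 'o, 'm) equiv_ob \<Rightarrow> ('o, 'm, ('g, 't, 'o) bicrossed_ob) modfun" where
  "Psi W = assemble (\<lambda>M. fst W \<otimes>\<^sub>o M) (\<lambda>f. Id C (fst W) \<otimes>\<^sub>a f) (\<lambda>p M A. inv_arr C (sig (fst W) (snd W) p M A))"

section \<open>Coherence of the constraint of U \<otimes> -\<close>

context
  fixes U u
  assumes eq: "is_equivariant (U, u)"
begin

lemma
  assumes "p \<in> Idx" "M \<in> Ob C" "A \<in> Deg D (snd p)"
  shows is_iso_sig: "is_iso C (sig U u p M A)"
    and arr_sig: "sig U u p M A \<in> Arr C"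
    and dom_sig: "Dom C (sig U u p M A) = ((U \<otimes>\<^sub>o M) \<lhd>\<^sub>o fst p) \<otimes>\<^sub>o A"
    and cod_sig: "Cod C (sig U u p M A) = U \<otimes>\<^sub>o ((M \<lhd>\<^sub>o fst p) \<otimes>\<^sub>o A)"
  using assms equiv_simps[OF eq] gam_simps[OF eq] deg_in_ob[of A "snd p"] by (simp_all add: sig_def)

lemmas sig_simps = is_iso_sig arr_sig dom_sig cod_sig

lemma sig_nat:
  assumes "p \<in> Idx" "f \<in> Arr C" "j \<in> Arr C" "Dom C j \<in> Deg D (snd p)" "Cod C j \<in> Deg D (snd p)"
  shows "sig U u p (Cod C f) (Cod C j) \<cdot> (((Id C U \<otimes>\<^sub>a f) \<lhd>\<^sub>a fst p) \<otimes>\<^sub>a j) =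
    (Id C U \<otimes>\<^sub>a ((f \<lhd>\<^sub>a fst p) \<otimes>\<^sub>a j)) \<cdot> sig U u p (Dom C f) (Dom C j)"
proof -
  note [simp] = assms equiv_simps[OF eq] gam_simps[OF eq]
  show ?thesis
    by (simp add: sig_def ten_collapse_simps gam_nat[OF eq] pre2[OF assoc_back] assoc_back)
qed

text \<open>The associativity axiom read for inverse constraints. The pentagon regroups the factors,
  \<open>gam_mult\<close> handles the product g (k \<triangleright> h) of group elements, and
  \<open>gam_eta\<close> the action of h on (M \<lhd> g) \<otimes> A.\<close>

lemma sig_assoc:
  assumes [simp]: "p \<in> Idx" "q \<in> Idx" "M \<in> Ob C" "A \<in> Deg D (snd p)" "B \<in> Deg D (snd q)"
  shows "sig U u (p \<diamondop> q) M ((A \<lhd>\<^sub>o fst q) \<otimes>\<^sub>o B) \<cdot> assoc_component p (fst q) (U \<otimes>\<^sub>o M) A B =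
    (Id C U \<otimes>\<^sub>a assoc_component p (fst q) M A B) \<cdot> sig U u q ((M \<lhd>\<^sub>o fst p) \<otimes>\<^sub>o A) B \<cdot>
      ((sig U u p M A \<lhd>\<^sub>a fst q) \<otimes>\<^sub>a Id C B)"
proof -
  have [simp]: "A \<in> Ob C" "B \<in> Ob C"
    using assms deg_in_ob[of A "snd p"] deg_in_ob[of B "snd q"] by auto
  note [simp] = equiv_simps[OF eq] gam_simps[OF eq]
  obtain g k h t where p: "p = (g, k)" and q: "q = (h, t)"
    by (cases p; cases q)
  have [simp]: "g \<in> carrier G" "k \<in> carrier \<Gamma>" "h \<in> carrier G" "t \<in> carrier \<Gamma>"
    "A \<in> Deg D k" "B \<in> Deg D t" "(g, k) \<in> Idx" "(h, t) \<in> Idx"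
    using assms by (auto simp: p q mem_Sigma_iff)
  let ?gh = "g \<otimes>\<^bsub>G\<^esub> (k \<triangleright> h)"
  let ?Ah = "A \<lhd>\<^sub>o h"
  have "sig U u (p \<diamondop> q) M (?Ah \<otimes>\<^sub>o B) \<cdot> assoc_component p h (U \<otimes>\<^sub>o M) A B =
      Assoc C U (M \<lhd>\<^sub>o ?gh) (?Ah \<otimes>\<^sub>o B) \<cdot> Assoc C (U \<otimes>\<^sub>o (M \<lhd>\<^sub>o ?gh)) ?Ah B \<cdot>
      ((((gam U u ?gh M \<cdot> R2 D g (k \<triangleright> h) (U \<otimes>\<^sub>o M)) \<otimes>\<^sub>a Id C ?Ah) \<cdot>
        Eta D h k ((U \<otimes>\<^sub>o M) \<lhd>\<^sub>o g) A) \<otimes>\<^sub>a Id C B)"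
    by (simp add: sig_def assoc_component_def p q fst_idx_mult pre2[OF assoc_nat_left_id] ten_collapse_simps)
  \<comment> \<open>\<open>gam_mult\<close> leaves gamma at k \<triangleright> h, the exponent at
    which \<open>gam_eta\<close> produces the factor \<open>A\<close> of degree k.\<close>
  also have "\<dots> = Assoc C U (M \<lhd>\<^sub>o ?gh) (?Ah \<otimes>\<^sub>o B) \<cdot> Assoc C (U \<otimes>\<^sub>o (M \<lhd>\<^sub>o ?gh)) ?Ah B \<cdot>
      (((Id C U \<otimes>\<^sub>a R2 D g (k \<triangleright> h) M \<otimes>\<^sub>a Id C ?Ah) \<cdot> (gam U u (k \<triangleright> h) (M \<lhd>\<^sub>o g) \<otimes>\<^sub>a Id C ?Ah) \<cdot>
        Eta D h k (U \<otimes>\<^sub>o (M \<lhd>\<^sub>o g)) A \<cdot> ((gam U u g M \<otimes>\<^sub>a Id C A) \<lhd>\<^sub>a h)) \<otimes>\<^sub>a Id C B)"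
    by (simp add: gam_mult[OF eq] ten_collapse_simps eta_nat)
  also have "\<dots> = (Id C U \<otimes>\<^sub>a Assoc C (M \<lhd>\<^sub>o ?gh) ?Ah B) \<cdot> Assoc C U ((M \<lhd>\<^sub>o ?gh) \<otimes>\<^sub>o ?Ah) B \<cdot>
      ((Assoc C U (M \<lhd>\<^sub>o ?gh) ?Ah \<cdot> (Id C U \<otimes>\<^sub>a R2 D g (k \<triangleright> h) M \<otimes>\<^sub>a Id C ?Ah) \<cdot> (gam U u (k \<triangleright> h) (M \<lhd>\<^sub>o g) \<otimes>\<^sub>a Id C ?Ah) \<cdot>
        Eta D h k (U \<otimes>\<^sub>o (M \<lhd>\<^sub>o g)) A \<cdot> ((gam U u g M \<otimes>\<^sub>a Id C A) \<lhd>\<^sub>a h)) \<otimes>\<^sub>a Id C B)"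
    by (simp add: pre2[OF pentagon] ten_collapse)
  \<comment> \<open>The factor \<open>B\<close> is a spectator: this is the part of the composite
    that is tensored with its identity.\<close>
  also have "Assoc C U (M \<lhd>\<^sub>o ?gh) ?Ah \<cdot> (Id C U \<otimes>\<^sub>a R2 D g (k \<triangleright> h) M \<otimes>\<^sub>a Id C ?Ah) \<cdot> (gam U u (k \<triangleright> h) (M \<lhd>\<^sub>o g) \<otimes>\<^sub>a Id C ?Ah) \<cdot>
        Eta D h k (U \<otimes>\<^sub>o (M \<lhd>\<^sub>o g)) A \<cdot> ((gam U u g M \<otimes>\<^sub>a Id C A) \<lhd>\<^sub>a h) =
      (Id C U \<otimes>\<^sub>a (R2 D g (k \<triangleright> h) M \<otimes>\<^sub>a Id C ?Ah)) \<cdot> (Id C U \<otimes>\<^sub>a Eta D h k (M \<lhd>\<^sub>o g) A) \<cdot>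
        gam U u h ((M \<lhd>\<^sub>o g) \<otimes>\<^sub>o A) \<cdot> (sig U u p M A \<lhd>\<^sub>a h)"
    by (simp add: assoc_nat_simps pre3[OF gam_eta[OF eq, symmetric]] sig_def act_expand p gam_eta[OF eq, symmetric]
        pre3[OF gam_eta[OF eq], symmetric])
  also have "(Id C U \<otimes>\<^sub>a Assoc C (M \<lhd>\<^sub>o ?gh) ?Ah B) \<cdot> Assoc C U ((M \<lhd>\<^sub>o ?gh) \<otimes>\<^sub>o ?Ah) B \<cdot>
      (((Id C U \<otimes>\<^sub>a (R2 D g (k \<triangleright> h) M \<otimes>\<^sub>a Id C ?Ah)) \<cdot> (Id C U \<otimes>\<^sub>a Eta D h k (M \<lhd>\<^sub>o g) A) \<cdot>
        gam U u h ((M \<lhd>\<^sub>o g) \<otimes>\<^sub>o A) \<cdot> (sig U u p M A \<lhd>\<^sub>a h)) \<otimes>\<^sub>a Id C B) =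
      (Id C U \<otimes>\<^sub>a Assoc C (M \<lhd>\<^sub>o ?gh) ?Ah B) \<cdot> Assoc C U ((M \<lhd>\<^sub>o ?gh) \<otimes>\<^sub>o ?Ah) B \<cdot>
      (Id C U \<otimes>\<^sub>a ((R2 D g (k \<triangleright> h) M \<otimes>\<^sub>a Id C ?Ah) \<cdot> Eta D h k (M \<lhd>\<^sub>o g) A) \<otimes>\<^sub>a Id C B) \<cdot>
        (gam U u h ((M \<lhd>\<^sub>o g) \<otimes>\<^sub>o A) \<otimes>\<^sub>a Id C B) \<cdot> ((sig U u p M A \<lhd>\<^sub>a h) \<otimes>\<^sub>a Id C B)"
    using sig_simps[of p M A] by (simp add: ten_collapse_simps p)
  also have "\<dots> = (Id C U \<otimes>\<^sub>a assoc_component p h M A B) \<cdot> sig U u q ((M \<lhd>\<^sub>o g) \<otimes>\<^sub>o A) B \<cdot> ((sig U u p M A \<lhd>\<^sub>a h) \<otimes>\<^sub>a Id C B)"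
    using sig_simps[of p M A]
    by (simp add: assoc_nat_simps p) (simp add: sig_def[of _ _ "(h, t)"] assoc_component_def ten_collapse_simps q)
  finally show ?thesis
    by (simp add: p q)
qed

text \<open>By \<open>gam_one\<close>, gamma at the group unit only compares two instances of
  \<open>R0\<close>; what is left is the compatibility \<open>runit_ten\<close> of the right unit
  constraint with the associator.\<close>

lemma sig_unit:
  assumes [simp]: "M \<in> Ob C"
  shows "(Id C U \<otimes>\<^sub>a (RUnit C M \<cdot> (inv_arr C (R0 D M) \<otimes>\<^sub>a Id C \<I>))) \<cdot> sig U u idx_one M \<I> =
    RUnit C (U \<otimes>\<^sub>o M) \<cdot> (inv_arr C (R0 D (U \<otimes>\<^sub>o M)) \<otimes>\<^sub>a Id C \<I>)"
proof -
  note [simp] = equiv_simps[OF eq] gam_simps[OF eq]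
  have "(Id C U \<otimes>\<^sub>a inv_arr C (R0 D M)) \<cdot> gam U u \<one>\<^bsub>G\<^esub> M = inv_arr C (R0 D (U \<otimes>\<^sub>o M))"
  proof -
    have "inv_arr C (Id C U \<otimes>\<^sub>a R0 D M) \<cdot> gam U u \<one>\<^bsub>G\<^esub> M = Id C (U \<otimes>\<^sub>o M) \<cdot> inv_arr C (R0 D (U \<otimes>\<^sub>o M))"
      by (rule inv_slide) (simp_all add: gam_one[OF eq])
    then show ?thesis
      by (simp add: inv_ten inv_arrI[OF id_in id_in])
  qed
  then have "(Id C U \<otimes>\<^sub>a (inv_arr C (R0 D M) \<otimes>\<^sub>a Id C \<I>)) \<cdot> sig U u idx_one M \<I> =
      Assoc C U M \<I> \<cdot> (inv_arr C (R0 D (U \<otimes>\<^sub>o M)) \<otimes>\<^sub>a Id C \<I>)"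
    by (simp add: sig_def pre2[OF assoc_back] ten_collapse)
  moreover have "Id C U \<otimes>\<^sub>a (RUnit C M \<cdot> (inv_arr C (R0 D M) \<otimes>\<^sub>a Id C \<I>)) =
      (Id C U \<otimes>\<^sub>a RUnit C M) \<cdot> (Id C U \<otimes>\<^sub>a (inv_arr C (R0 D M) \<otimes>\<^sub>a Id C \<I>))"
    by (simp add: ten_collapse)
  ultimately show ?thesis
    by (simp add: sig_simps pre2[OF runit_ten])
qed

lemma psi_family: "component_family (\<lambda>M. U \<otimes>\<^sub>o M) (\<lambda>f. Id C U \<otimes>\<^sub>a f) (\<lambda>p M A. inv_arr C (sig U u p M A))"
proof (rule component_familyI)
  note [simp] = equiv_simps[OF eq] sig_simps
  show "is_exact_functor C C (\<lambda>M. U \<otimes>\<^sub>o M) (\<lambda>f. Id C U \<otimes>\<^sub>a f)"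
    by (rule ten_exact_functor) simp
  fix p f j assume [simp]: "p \<in> Idx" "f \<in> Arr C" "j \<in> Arr C" "Dom C j \<in> Deg D (snd p)" "Cod C j \<in> Deg D (snd p)"
  show "inv_arr C (sig U u p (Cod C f) (Cod C j)) \<cdot> (Id C U \<otimes>\<^sub>a (f \<lhd>\<^sub>a fst p \<otimes>\<^sub>a j)) =
      ((Id C U \<otimes>\<^sub>a f) \<lhd>\<^sub>a fst p \<otimes>\<^sub>a j) \<cdot> inv_arr C (sig U u p (Dom C f) (Dom C j))"
    by (rule inv_slide) (simp_all add: sig_nat)
qed (simp_all add: sig_simps equiv_simps[OF eq])

lemma psi_coherent: "coherent_components (\<lambda>M. U \<otimes>\<^sub>o M) (\<lambda>f. Id C U \<otimes>\<^sub>a f) (\<lambda>p M A. inv_arr C (sig U u p M A))"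
proof -
  note [simp] = equiv_simps[OF eq] sig_simps
  have "inv_arr C (assoc_component p (fst q) (U \<otimes>\<^sub>o M) A B) \<cdot> inv_arr C (sig U u (p \<diamondop> q) M ((A \<lhd>\<^sub>o fst q) \<otimes>\<^sub>o B)) =
        ((inv_arr C (sig U u p M A) \<lhd>\<^sub>a fst q) \<otimes>\<^sub>a Id C B) \<cdot> inv_arr C (sig U u q ((M \<lhd>\<^sub>o fst p) \<otimes>\<^sub>o A) B) \<cdot>
          (Id C U \<otimes>\<^sub>a inv_arr C (assoc_component p (fst q) M A B))"
    if [simp]: "p \<in> Idx" "q \<in> Idx" "M \<in> Ob C" "A \<in> Deg D (snd p)" "B \<in> Deg D (snd q)" for p q M A B
  proof -
    have [simp]: "A \<in> Ob C" "B \<in> Ob C"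
      using that deg_in_ob[of A "snd p"] deg_in_ob[of B "snd q"] by auto
    have N [simp]: "(A \<lhd>\<^sub>o fst q) \<otimes>\<^sub>o B \<in> Deg D (snd (p \<diamondop> q))"
      using bi_summand_deg'[of "delta p A" "delta q B" p q] by simp
    show ?thesis
      using arg_cong[OF sig_assoc[OF that], of "inv_arr C"]
      by (simp add: inv_comp inv_ten inv_act fst_idx_mult inv_arrI[OF id_in id_in])
  qed
  moreover have "RUnit C (U \<otimes>\<^sub>o M) \<cdot> (inv_arr C (R0 D (U \<otimes>\<^sub>o M)) \<otimes>\<^sub>a Id C \<I>) \<cdot> inv_arr C (sig U u idx_one M \<I>) =
      Id C U \<otimes>\<^sub>a (RUnit C M \<cdot> (inv_arr C (R0 D M) \<otimes>\<^sub>a Id C \<I>))" if [simp]: "M \<in> Ob C" for M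
  proof -
    have "RUnit C (U \<otimes>\<^sub>o M) \<cdot> (inv_arr C (R0 D (U \<otimes>\<^sub>o M)) \<otimes>\<^sub>a Id C \<I>) \<cdot> inv_arr C (sig U u idx_one M \<I>) =
        ((Id C U \<otimes>\<^sub>a (RUnit C M \<cdot> (inv_arr C (R0 D M) \<otimes>\<^sub>a Id C \<I>))) \<cdot> sig U u idx_one M \<I>) \<cdot> inv_arr C (sig U u idx_one M \<I>)"
      unfolding sig_unit[OF that] by simp
    then show ?thesis
      by simp
  qed
  ultimately show ?thesis
    unfolding coherent_components_def by blast
qed

end

lemma Psi_endofunctor:
  assumes "is_equivariant W"
  shows "RA.is_module_endofunctor (Psi W)"
proof -
  have "is_equivariant (fst W, snd W)"
    using assms by simp
  then show ?thesis
    unfolding Psi_def by (intro assemble_module_functor psi_family psi_coherent)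
qed

lemma Psi_sel: "fst (Psi W) = (\<lambda>M\<in>Ob C. fst W \<otimes>\<^sub>o M)" "fst (snd (Psi W)) = (\<lambda>f\<in>Arr C. Id C (fst W) \<otimes>\<^sub>a f)"
  by (simp_all add: Psi_def)

lemma Psi_components:
  assumes "is_equivariant (U, u)"
  shows "component_family (fst (Psi (U, u))) (fst (snd (Psi (U, u)))) (\<lambda>p M A. inv_arr C (sig U u p M A))"
    "components_of (fst (Psi (U, u))) (fst (snd (Psi (U, u)))) (snd (snd (Psi (U, u)))) (\<lambda>p M A. inv_arr C (sig U u p M A))"
  using assemble_components[OF psi_family[OF assms]] by (simp_all add: Psi_def)

subsection \<open>Functoriality, full faithfulness and the tensor structure\<close>

text \<open>Componentwise the module condition is \<open>gam_equivariant_arr\<close> tensored with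
  \<open>A\<close>, up to an associator.\<close>

lemma Psi_natural:
  assumes eq: "is_equivariant (U, u)" "is_equivariant (V, v)" and f: "is_equivariant_arr (U, u) (V, v) f"
  shows "RA.is_module_natural (Psi (U, u)) (Psi (V, v)) (\<lambda>M\<in>Ob C. f \<otimes>\<^sub>a Id C M)"
proof -
  note [simp] = equiv_simps[OF eq(1)] equiv_simps[OF eq(2)] equivariant_arr_simps[OF f]
    sig_simps[OF eq(1)] sig_simps[OF eq(2)] gam_simps[OF eq(1)] gam_simps[OF eq(2)]
  have "is_natural C C (fst (Psi (U, u))) (fst (snd (Psi (U, u)))) (fst (Psi (V, v))) (fst (snd (Psi (V, v))))
      (\<lambda>M\<in>Ob C. f \<otimes>\<^sub>a Id C M)"
    by (auto simp: is_natural_def Psi_sel Hom_def ten_collapse)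
  moreover have "inv_arr C (sig V v p M A) \<cdot> (f \<otimes>\<^sub>a Id C ((M \<lhd>\<^sub>o fst p) \<otimes>\<^sub>o A)) =
      (((f \<otimes>\<^sub>a Id C M) \<lhd>\<^sub>a fst p) \<otimes>\<^sub>a Id C A) \<cdot> inv_arr C (sig U u p M A)"
    if [simp]: "p \<in> Idx" "M \<in> Ob C" "A \<in> Deg D (snd p)" for p M A
  proof (rule inv_slide)
    have [simp]: "A \<in> Ob C"
      using deg_in_ob[of A "snd p"] by simp
    show "sig V v p M A \<cdot> (((f \<otimes>\<^sub>a Id C M) \<lhd>\<^sub>a fst p) \<otimes>\<^sub>a Id C A) =
        (f \<otimes>\<^sub>a Id C ((M \<lhd>\<^sub>o fst p) \<otimes>\<^sub>o A)) \<cdot> sig U u p M A"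
      by (simp add: sig_def ten_collapse_simps gam_equivariant_arr[OF eq f] pre2[OF assoc_nat_left_id])
  qed (use deg_in_ob[of A "snd p"] in simp_all)
  ultimately show ?thesis
    using deg_in_ob
    by (subst module_natural_components[OF Psi_endofunctor[OF eq(1)] Psi_endofunctor[OF eq(2)]
          Psi_components[OF eq(1)] Psi_components[OF eq(2)]]) simp_all
qed

text \<open>The unit acted on by e \<bowtie> A is identified with \<open>A\<close>. Combined with
  the constraint of U \<otimes> - this identification involves \<open>A\<close> only through an
  identity factor, which is why a module transformation can be reconstructed from its value at the
  unit.\<close>

lemma lambda_sig:
  assumes eq: "is_equivariant (U, u)" and A: "A \<in> Deg D k" "k \<in> carrier \<Gamma>"
  shows "(Id C U \<otimes>\<^sub>a (LUnit C A \<cdot> (inv_arr C (R0 D \<I>) \<otimes>\<^sub>a Id C A))) \<cdot> sig U u (\<one>\<^bsub>G\<^esub>, k) \<I> A =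
    (RUnit C U \<cdot> inv_arr C (R0 D (U \<otimes>\<^sub>o \<I>))) \<otimes>\<^sub>a Id C A"
proof -
  note [simp] = equiv_simps[OF eq] gam_simps[OF eq] A
  have p [simp]: "(\<one>\<^bsub>G\<^esub>, k) \<in> Idx"
    using A by (simp add: mem_Sigma_iff)
  have [simp]: "A \<in> Ob C"
    using A deg_in_ob by blast
  have "inv_arr C (Id C U \<otimes>\<^sub>a R0 D \<I>) \<cdot> gam U u \<one>\<^bsub>G\<^esub> \<I> = Id C (U \<otimes>\<^sub>o \<I>) \<cdot> inv_arr C (R0 D (U \<otimes>\<^sub>o \<I>))"
    by (rule inv_slide) (simp_all add: gam_one[OF eq])
  then have "(Id C U \<otimes>\<^sub>a inv_arr C (R0 D \<I>)) \<cdot> gam U u \<one>\<^bsub>G\<^esub> \<I> = inv_arr C (R0 D (U \<otimes>\<^sub>o \<I>))"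
    by (simp add: inv_ten inv_arrI[OF id_in id_in])
  then have "(Id C U \<otimes>\<^sub>a (inv_arr C (R0 D \<I>) \<otimes>\<^sub>a Id C A)) \<cdot> sig U u (\<one>\<^bsub>G\<^esub>, k) \<I> A =
      Assoc C U \<I> A \<cdot> (inv_arr C (R0 D (U \<otimes>\<^sub>o \<I>)) \<otimes>\<^sub>a Id C A)"
    by (simp add: sig_def pre2[OF assoc_back] ten_collapse)
  moreover have "Id C U \<otimes>\<^sub>a (LUnit C A \<cdot> (inv_arr C (R0 D \<I>) \<otimes>\<^sub>a Id C A)) =
      (Id C U \<otimes>\<^sub>a LUnit C A) \<cdot> (Id C U \<otimes>\<^sub>a (inv_arr C (R0 D \<I>) \<otimes>\<^sub>a Id C A))"
    by (simp add: ten_collapse)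
  ultimately show ?thesis
    by (simp add: sig_simps[OF eq] pre2[OF triangle]) (simp add: ten_collapse)
qed

text \<open>\<open>f\<close> is \<tau> at the unit, read through the right unit constraints. The
  module condition at indices (1, k) on the unit expresses \<tau> on degree k through
  \<open>f\<close>; the conditions at (g, 1) say that \<open>f\<close> is equivariant.\<close>

lemma Psi_full:
  assumes eq: "is_equivariant (U, u)" "is_equivariant (V, v)"
    and t: "RA.is_module_natural (Psi (U, u)) (Psi (V, v)) \<tau>"
  defines "f \<equiv> RUnit C V \<cdot> \<tau> \<I> \<cdot> inv_arr C (RUnit C U)"
  shows "is_equivariant_arr (U, u) (V, v) f" "\<tau> = (\<lambda>M\<in>Ob C. f \<otimes>\<^sub>a Id C M)"
proof -
  note [simp] = equiv_simps[OF eq(1)] equiv_simps[OF eq(2)] sig_simps[OF eq(1)] sig_simps[OF eq(2)]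
    gam_simps[OF eq(1)] gam_simps[OF eq(2)]
  have ty [simp]: "\<tau> M \<in> Arr C" "Dom C (\<tau> M) = U \<otimes>\<^sub>o M" "Cod C (\<tau> M) = V \<otimes>\<^sub>o M" if "M \<in> Ob C" for M
    using RA.mn_simps[OF t that] that by (simp_all add: Psi_sel)
  have nat: "\<tau> M \<cdot> (Id C U \<otimes>\<^sub>a h) = (Id C V \<otimes>\<^sub>a h) \<cdot> \<tau> (Dom C h)" if "h \<in> Arr C" "Cod C h = M" for h M
    using RA.mn_nat[OF t that] that by (simp add: Psi_sel)
  have comp: "sig V v p M A \<cdot> ((\<tau> M \<lhd>\<^sub>a fst p) \<otimes>\<^sub>a Id C A) = \<tau> ((M \<lhd>\<^sub>o fst p) \<otimes>\<^sub>o A) \<cdot> sig U u p M A"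
    if p [simp]: "p \<in> Idx" and M [simp]: "M \<in> Ob C" and A [simp]: "A \<in> Deg D (snd p)" for p M A
  proof -
    have [simp]: "A \<in> Ob C"
      using deg_in_ob[of A "snd p"] by simp
    have "inv_arr C (sig V v p M A) \<cdot> \<tau> ((M \<lhd>\<^sub>o fst p) \<otimes>\<^sub>o A) =
        ((\<tau> M \<lhd>\<^sub>a fst p) \<otimes>\<^sub>a Id C A) \<cdot> inv_arr C (sig U u p M A)"
      using t p M A
      unfolding module_natural_components[OF Psi_endofunctor[OF eq(1)] Psi_endofunctor[OF eq(2)]
          Psi_components[OF eq(1)] Psi_components[OF eq(2)] RA.mn_natural[OF t] RA.mn_ext[OF t]]
      by blast
    note e = inv_slide[OF this]
    have "sig V v p M A \<cdot> (\<tau> M \<lhd>\<^sub>a fst p \<otimes>\<^sub>a Id C A) \<cdot> inv_arr C (sig U u p M A) \<cdot> sig U u p M A =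
        sig V v p M A \<cdot> inv_arr C (sig V v p M A) \<cdot> \<tau> ((M \<lhd>\<^sub>o fst p) \<otimes>\<^sub>o A) \<cdot> sig U u p M A"
      using e by (simp add: pre2[OF e])
    then show ?thesis
      by simp
  qed
  have f [simp]: "f \<in> Arr C" "Dom C f = U" "Cod C f = V"
    by (simp_all add: f_def)
  have hom: "\<tau> A = f \<otimes>\<^sub>a Id C A" if k [simp]: "k \<in> carrier \<Gamma>" and A [simp]: "A \<in> Deg D k" for A k
  proof -
    have p [simp]: "(\<one>\<^bsub>G\<^esub>, k) \<in> Idx" and Ao [simp]: "A \<in> Ob C"
      using deg_in_ob[OF A k] by (simp_all add: mem_Sigma_iff)
    let ?l = "LUnit C A \<cdot> (inv_arr C (R0 D \<I>) \<otimes>\<^sub>a Id C A)"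
    have R: "inv_arr C (R0 D (V \<otimes>\<^sub>o \<I>)) \<cdot> (\<tau> \<I> \<lhd>\<^sub>a \<one>\<^bsub>G\<^esub>) = \<tau> \<I> \<cdot> inv_arr C (R0 D (U \<otimes>\<^sub>o \<I>))"
      by (rule inv_slide) (simp_all add: R0_nat)
    \<comment> \<open>Naturality along \<open>?l\<close> and the module condition at (1, k) move
      \<tau> from \<open>A\<close> to the unit; \<open>lambda_sig\<close> enters once for U and once
      for V.\<close>
    have "\<tau> A \<cdot> ((RUnit C U \<cdot> inv_arr C (R0 D (U \<otimes>\<^sub>o \<I>))) \<otimes>\<^sub>a Id C A) =
        \<tau> A \<cdot> (Id C U \<otimes>\<^sub>a ?l) \<cdot> sig U u (\<one>\<^bsub>G\<^esub>, k) \<I> A"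
      by (simp only: lambda_sig[OF eq(1) A k])
    also have "\<dots> = (Id C V \<otimes>\<^sub>a ?l) \<cdot> \<tau> ((\<I> \<lhd>\<^sub>o \<one>\<^bsub>G\<^esub>) \<otimes>\<^sub>o A) \<cdot> sig U u (\<one>\<^bsub>G\<^esub>, k) \<I> A"
      using pre2[OF nat[of ?l A], of "sig U u (\<one>\<^bsub>G\<^esub>, k) \<I> A"] by simp
    also have "\<dots> = ((Id C V \<otimes>\<^sub>a ?l) \<cdot> sig V v (\<one>\<^bsub>G\<^esub>, k) \<I> A) \<cdot> ((\<tau> \<I> \<lhd>\<^sub>a \<one>\<^bsub>G\<^esub>) \<otimes>\<^sub>a Id C A)"
      using comp[of "(\<one>\<^bsub>G\<^esub>, k)" \<I> A] by simp
    also have "\<dots> = ((RUnit C V \<cdot> inv_arr C (R0 D (V \<otimes>\<^sub>o \<I>))) \<otimes>\<^sub>a Id C A) \<cdot> ((\<tau> \<I> \<lhd>\<^sub>a \<one>\<^bsub>G\<^esub>) \<otimes>\<^sub>a Id C A)"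
      by (simp only: lambda_sig[OF eq(2) A k])
    also have "\<dots> = (f \<otimes>\<^sub>a Id C A) \<cdot> ((RUnit C U \<cdot> inv_arr C (R0 D (U \<otimes>\<^sub>o \<I>))) \<otimes>\<^sub>a Id C A)"
      by (simp add: ten_collapse f_def R)
    finally show ?thesis
      by (rule iso_right_cancel) simp_all
  qed
  have all: "\<tau> M = f \<otimes>\<^sub>a Id C M" if [simp]: "M \<in> Ob C" for M
  proof (rule linear_functor_epi[OF ten_linear_functor[of U] that])
    fix k assume k: "k \<in> carrier \<Gamma>"
    then show "\<tau> M \<cdot> (Id C U \<otimes>\<^sub>a comp_inj M k) = (f \<otimes>\<^sub>a Id C M) \<cdot> (Id C U \<otimes>\<^sub>a comp_inj M k)"
      using hom[OF k comp_deg[OF that k]] by (simp add: nat ten_collapse)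
  qed (auto intro!: HomI)
  then show "\<tau> = (\<lambda>M\<in>Ob C. f \<otimes>\<^sub>a Id C M)"
    using RA.mn_ext[OF t] by (auto simp: extensional_def restrict_def)
  show "is_equivariant_arr (U, u) (V, v) f"
  proof (rule equivariant_arrI)
    fix g assume g [simp]: "g \<in> carrier G"
    have p [simp]: "(g, \<one>\<^bsub>\<Gamma>\<^esub>) \<in> Idx"
      by (simp add: mem_Sigma_iff)
    \<comment> \<open>The module condition for g \<bowtie> 1 acting on the unit. Cancelling the
      associator and the unit factor leaves an equation for gamma, which \<open>gam_unit\<close>
      converts into one for the structure maps.\<close>
    have "Assoc C V (\<I> \<lhd>\<^sub>o g) \<I> \<cdot> ((gam V v g \<I> \<cdot> ((f \<otimes>\<^sub>a Id C \<I>) \<lhd>\<^sub>a g)) \<otimes>\<^sub>a Id C \<I>) =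
        Assoc C V (\<I> \<lhd>\<^sub>o g) \<I> \<cdot> (((f \<otimes>\<^sub>a Id C (\<I> \<lhd>\<^sub>o g)) \<cdot> gam U u g \<I>) \<otimes>\<^sub>a Id C \<I>)"
      using comp[of "(g, \<one>\<^bsub>\<Gamma>\<^esub>)" \<I> \<I>] by (simp add: all sig_def ten_collapse pre2[OF assoc_nat_left_id])
    then have "(gam V v g \<I> \<cdot> ((f \<otimes>\<^sub>a Id C \<I>) \<lhd>\<^sub>a g)) \<otimes>\<^sub>a Id C \<I> = ((f \<otimes>\<^sub>a Id C (\<I> \<lhd>\<^sub>o g)) \<cdot> gam U u g \<I>) \<otimes>\<^sub>a Id C \<I>"
      by (rule iso_left_cancel) simp_all
    then have e: "gam V v g \<I> \<cdot> ((f \<otimes>\<^sub>a Id C \<I>) \<lhd>\<^sub>a g) = (f \<otimes>\<^sub>a Id C (\<I> \<lhd>\<^sub>o g)) \<cdot> gam U u g \<I>"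
      by (rule ten_unit_faithful) (auto intro!: HomI)
    have "(v g \<cdot> (f \<lhd>\<^sub>a g)) \<cdot> (RUnit C U \<lhd>\<^sub>a g) = (v g \<cdot> (RUnit C V \<lhd>\<^sub>a g)) \<cdot> ((f \<otimes>\<^sub>a Id C \<I>) \<lhd>\<^sub>a g)"
      by (simp add: act_expand[symmetric] runit_nat)
    also have "\<dots> = RUnit C V \<cdot> (Id C V \<otimes>\<^sub>a Eta0 D g) \<cdot> gam V v g \<I> \<cdot> ((f \<otimes>\<^sub>a Id C \<I>) \<lhd>\<^sub>a g)"
      by (simp add: gam_unit[OF eq(2), symmetric])
    also have "\<dots> = RUnit C V \<cdot> (f \<otimes>\<^sub>a Id C \<I>) \<cdot> (Id C U \<otimes>\<^sub>a Eta0 D g) \<cdot> gam U u g \<I>"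
      by (simp add: e ten_collapse_pre)
    also have "\<dots> = (f \<cdot> u g) \<cdot> (RUnit C U \<lhd>\<^sub>a g)"
      by (simp add: runit_nat_simps gam_unit[OF eq(1)])
    finally show "v g \<cdot> (f \<lhd>\<^sub>a g) = f \<cdot> u g"
      by (rule iso_right_cancel) simp_all
  qed simp_all
qed

text \<open>Componentwise this is \<open>gam_ext_tensor\<close>, with the pentagon accounting for
  the remaining associators.\<close>

lemma Psi_tensor_natural:
  assumes eq: "is_equivariant (U, u)" "is_equivariant (V, v)"
  shows "RA.is_module_natural (Psi (ext_tensor (U, u) (V, v))) (RA.modfun_comp (Psi (U, u)) (Psi (V, v)))
    (\<lambda>M\<in>Ob C. Assoc C U V M)"
proof -
  obtain w where UV: "ext_tensor (U, u) (V, v) = (U \<otimes>\<^sub>o V, w)"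
    using ext_tensor_eq[OF eq] by auto
  have eqw: "is_equivariant (U \<otimes>\<^sub>o V, w)"
    using ext_tensor_equivariant[OF eq] UV by simp
  let ?K = "RA.modfun_comp (Psi (U, u)) (Psi (V, v))"
  note P = Psi_endofunctor[OF eq(1)] Psi_endofunctor[OF eq(2)] Psi_endofunctor[OF eqw]
  note [simp] = equiv_simps[OF eq(1)] equiv_simps[OF eq(2)] sig_simps[OF eq(1)] sig_simps[OF eq(2)]
    gam_simps[OF eq(1)] gam_simps[OF eq(2)] sig_simps[OF eqw] gam_simps[OF eqw]
  note e = components_of_modfun_comp[OF P(1,2) Psi_components[OF eq(1)] Psi_components[OF eq(2)]]
  have sel: "fst ?K = (\<lambda>M\<in>Ob C. U \<otimes>\<^sub>o (V \<otimes>\<^sub>o M))" "fst (snd ?K) = (\<lambda>f\<in>Arr C. Id C U \<otimes>\<^sub>a (Id C V \<otimes>\<^sub>a f))"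
    by (auto simp: RA.modfun_comp_sel Psi_sel)
  have "is_natural C C (fst (Psi (U \<otimes>\<^sub>o V, w))) (fst (snd (Psi (U \<otimes>\<^sub>o V, w)))) (fst ?K) (fst (snd ?K))
      (\<lambda>M\<in>Ob C. Assoc C U V M)"
    unfolding sel Psi_sel by (auto simp: is_natural_def Hom_def assoc_nat_id)
  moreover have "(inv_arr C (sig U u p (fst (Psi (V, v)) M) A) \<cdot> fst (snd (Psi (U, u))) (inv_arr C (sig V v p M A))) \<cdot>
        Assoc C U V ((M \<lhd>\<^sub>o fst p) \<otimes>\<^sub>o A) =
      ((Assoc C U V M \<lhd>\<^sub>a fst p) \<otimes>\<^sub>a Id C A) \<cdot> inv_arr C (sig (U \<otimes>\<^sub>o V) w p M A)"
    if [simp]: "p \<in> Idx" "M \<in> Ob C" "A \<in> Deg D (snd p)" for p M A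
  proof -
    have [simp]: "A \<in> Ob C"
      using deg_in_ob[of A "snd p"] by simp
    let ?g = "fst p"
    have "Assoc C U V ((M \<lhd>\<^sub>o ?g) \<otimes>\<^sub>o A) \<cdot> sig (U \<otimes>\<^sub>o V) w p M A =
        (Id C U \<otimes>\<^sub>a Assoc C V (M \<lhd>\<^sub>o ?g) A) \<cdot> Assoc C U (V \<otimes>\<^sub>o (M \<lhd>\<^sub>o ?g)) A \<cdot>
          ((Assoc C U V (M \<lhd>\<^sub>o ?g) \<cdot> gam (U \<otimes>\<^sub>o V) w ?g M) \<otimes>\<^sub>a Id C A)"
      by (simp add: sig_def pre2[OF pentagon] ten_collapse)
    also have "\<dots> = (Id C U \<otimes>\<^sub>a Assoc C V (M \<lhd>\<^sub>o ?g) A) \<cdot> Assoc C U (V \<otimes>\<^sub>o (M \<lhd>\<^sub>o ?g)) A \<cdot>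
        (Id C U \<otimes>\<^sub>a gam V v ?g M \<otimes>\<^sub>a Id C A) \<cdot> (gam U u ?g (V \<otimes>\<^sub>o M) \<otimes>\<^sub>a Id C A) \<cdot> ((Assoc C U V M \<lhd>\<^sub>a ?g) \<otimes>\<^sub>a Id C A)"
      by (simp add: gam_ext_tensor[OF eq UV] ten_collapse_simps)
    also have "\<dots> = (Id C U \<otimes>\<^sub>a sig V v p M A) \<cdot> sig U u p (V \<otimes>\<^sub>o M) A \<cdot> ((Assoc C U V M \<lhd>\<^sub>a ?g) \<otimes>\<^sub>a Id C A)"
      by (simp add: assoc_nat_simps) (simp add: sig_def ten_collapse_simps)
    finally have 1: "((Id C U \<otimes>\<^sub>a sig V v p M A) \<cdot> sig U u p (V \<otimes>\<^sub>o M) A) \<cdot> ((Assoc C U V M \<lhd>\<^sub>a ?g) \<otimes>\<^sub>a Id C A) =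
        Assoc C U V ((M \<lhd>\<^sub>o ?g) \<otimes>\<^sub>o A) \<cdot> sig (U \<otimes>\<^sub>o V) w p M A"
      by simp
    have "inv_arr C ((Id C U \<otimes>\<^sub>a sig V v p M A) \<cdot> sig U u p (V \<otimes>\<^sub>o M) A) \<cdot> Assoc C U V ((M \<lhd>\<^sub>o ?g) \<otimes>\<^sub>o A) =
        ((Assoc C U V M \<lhd>\<^sub>a ?g) \<otimes>\<^sub>a Id C A) \<cdot> inv_arr C (sig (U \<otimes>\<^sub>o V) w p M A)"
      by (rule inv_slide[OF 1]) simp_all
    then show ?thesis
      by (simp add: inv_comp inv_ten inv_arrI[OF id_in id_in] Psi_sel)
  qed
  ultimately show ?thesis
    unfolding UV using deg_in_ob
    by (subst module_natural_components[OF P(3) RA.modfun_comp_in[OF P(1,2)] Psi_components[OF eqw] e]) simp_all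
qed

lemma modfun_id_components:
  "component_family (fst RA.modfun_id) (fst (snd RA.modfun_id)) (\<lambda>p M A. Id C ((M \<lhd>\<^sub>o fst p) \<otimes>\<^sub>o A))"
  "components_of (fst RA.modfun_id) (fst (snd RA.modfun_id)) (snd (snd RA.modfun_id)) (\<lambda>p M A. Id C ((M \<lhd>\<^sub>o fst p) \<otimes>\<^sub>o A))"
proof -
  have "snd (snd RA.modfun_id) (M, X) = Id C (mod_act M X)" if "M \<in> Ob C" "X \<in> ObB" for M X
    using that by (simp add: RA.modfun_id_def bi_norm mem_Sigma_iff)
  then show "components_of (fst RA.modfun_id) (fst (snd RA.modfun_id)) (snd (snd RA.modfun_id)) (\<lambda>p M A. Id C ((M \<lhd>\<^sub>o fst p) \<otimes>\<^sub>o A))"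
    unfolding components_of_def by (simp add: RA.modfun_id_sel)
  have ex: "is_exact_functor C C (fst RA.modfun_id) (fst (snd RA.modfun_id))"
    by (rule RA.mf_exact[OF RA.modfun_id_in])
  show "component_family (fst RA.modfun_id) (fst (snd RA.modfun_id)) (\<lambda>p M A. Id C ((M \<lhd>\<^sub>o fst p) \<otimes>\<^sub>o A))"
  proof (rule component_familyI[OF ex])
    fix p M A assume [simp]: "p \<in> Idx" "M \<in> Ob C" "A \<in> Deg D (snd p)"
    have [simp]: "A \<in> Ob C"
      using deg_in_ob[of A "snd p"] by simp
    show "is_iso C (Id C ((M \<lhd>\<^sub>o fst p) \<otimes>\<^sub>o A))"
      "Dom C (Id C ((M \<lhd>\<^sub>o fst p) \<otimes>\<^sub>o A)) = fst RA.modfun_id ((M \<lhd>\<^sub>o fst p) \<otimes>\<^sub>o A)"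
      "Cod C (Id C ((M \<lhd>\<^sub>o fst p) \<otimes>\<^sub>o A)) = (fst RA.modfun_id M \<lhd>\<^sub>o fst p) \<otimes>\<^sub>o A"
      by (simp_all add: RA.modfun_id_sel)
  qed (simp add: RA.modfun_id_sel)
qed

text \<open>Componentwise this combines \<open>gam_ext_unit\<close> with
  \<open>lunit_ten\<close>.\<close>

lemma Psi_unit_natural: "RA.is_module_natural (Psi ext_unit) RA.modfun_id (\<lambda>M\<in>Ob C. LUnit C M)"
proof -
  obtain e where e: "ext_unit = (\<I>, e)"
    by (auto simp: ext_unit_def)
  have eqe: "is_equivariant (\<I>, e)"
    using ext_unit_equivariant e by simp
  note [simp] = sig_simps[OF eqe] gam_simps[OF eqe]
  have "is_natural C C (fst (Psi (\<I>, e))) (fst (snd (Psi (\<I>, e)))) (fst RA.modfun_id) (fst (snd RA.modfun_id)) (\<lambda>M\<in>Ob C. LUnit C M)"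
    by (auto simp: is_natural_def Hom_def Psi_sel RA.modfun_id_sel lunit_nat)
  moreover have "Id C ((M \<lhd>\<^sub>o fst p) \<otimes>\<^sub>o A) \<cdot> LUnit C ((M \<lhd>\<^sub>o fst p) \<otimes>\<^sub>o A) =
      ((LUnit C M \<lhd>\<^sub>a fst p) \<otimes>\<^sub>a Id C A) \<cdot> inv_arr C (sig \<I> e p M A)"
    if [simp]: "p \<in> Idx" "M \<in> Ob C" "A \<in> Deg D (snd p)" for p M A
  proof -
    have [simp]: "A \<in> Ob C"
      using deg_in_ob[of A "snd p"] by simp
    have "LUnit C ((M \<lhd>\<^sub>o fst p) \<otimes>\<^sub>o A) \<cdot> sig \<I> e p M A = (LUnit C M \<lhd>\<^sub>a fst p) \<otimes>\<^sub>a Id C A"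
      by (simp add: sig_def pre2[OF lunit_ten] ten_collapse gam_ext_unit[OF e])
    then have "((LUnit C M \<lhd>\<^sub>a fst p) \<otimes>\<^sub>a Id C A) \<cdot> inv_arr C (sig \<I> e p M A) =
        (LUnit C ((M \<lhd>\<^sub>o fst p) \<otimes>\<^sub>o A) \<cdot> sig \<I> e p M A) \<cdot> inv_arr C (sig \<I> e p M A)"
      by simp
    then show ?thesis
      by simp
  qed
  ultimately show ?thesis
    unfolding e using deg_in_ob
    by (subst module_natural_components[OF Psi_endofunctor[OF eqe] RA.modfun_id_in Psi_components[OF eqe]
          modfun_id_components]) simp_all
qed

section \<open>Every module functor comes from an equivariant object\<close>

context
  fixes F
  assumes mf: "RA.is_module_endofunctor F"
begin

abbreviation (input) Fo where "Fo \<equiv> fst F"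
abbreviation (input) Fa where "Fa \<equiv> fst (snd F)"

text \<open>Reversed so as to point in the direction of \<open>sig\<close>, with which it is matched
  in \<open>theta_module\<close>.\<close>

definition scomp :: "'g \<Rightarrow> 't \<Rightarrow> 'o \<Rightarrow> 'o \<Rightarrow> 'm" where
  "scomp g k M A = inv_arr C (component F (g, k) M A)"

lemmas cfF = component_family_component[OF mf]
lemmas cohF = coherent_components_component[OF mf]

lemma
  assumes "g \<in> carrier G" "k \<in> carrier \<Gamma>" "M \<in> Ob C" "A \<in> Deg D k"
  shows is_iso_scomp: "is_iso C (scomp g k M A)"
    and arr_scomp: "scomp g k M A \<in> Arr C"
    and dom_scomp: "Dom C (scomp g k M A) = (Fo M \<lhd>\<^sub>o g) \<otimes>\<^sub>o A"
    and cod_scomp: "Cod C (scomp g k M A) = Fo ((M \<lhd>\<^sub>o g) \<otimes>\<^sub>o A)"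
  using assms cf_simps[OF cfF] by (simp_all add: scomp_def mem_Sigma_iff)

lemmas scomp_simps = is_iso_scomp arr_scomp dom_scomp cod_scomp

lemmas F_simps = functor_ob[OF RA.mf_functor[OF mf]] functor_id[OF RA.mf_functor[OF mf]]
  functor_arr[OF RA.mf_functor[OF mf]] functor_dom[OF RA.mf_functor[OF mf]]
  functor_cod[OF RA.mf_functor[OF mf]] functor_iso[OF RA.mf_functor[OF mf]]

lemmas F_comp = functor_comp[OF RA.mf_functor[OF mf]]

lemma scomp_nat:
  assumes [simp]: "g \<in> carrier G" "k \<in> carrier \<Gamma>" "f \<in> Arr C" "j \<in> Arr C" "Dom C j \<in> Deg D k" "Cod C j \<in> Deg D k"
    and eqs [simp]: "Cod C f = M" "Cod C j = A"
  shows "scomp g k M A \<cdot> ((Fa f \<lhd>\<^sub>a g) \<otimes>\<^sub>a j) = Fa ((f \<lhd>\<^sub>a g) \<otimes>\<^sub>a j) \<cdot> scomp g k (Dom C f) (Dom C j)"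
proof -
  have [simp]: "M \<in> Ob C" "A \<in> Ob C" "A \<in> Deg D k"
    using cod_in[of f] cod_in[of j] assms(6) by (simp_all del: cod_in)
  note [simp] = F_simps cf_simps(7-10)[OF cfF]
  show ?thesis
    unfolding scomp_def
    by (rule inv_slide) (use cf_nat[OF cfF, of "(g, k)" f j M A] in \<open>simp_all add: mem_Sigma_iff\<close>)
qed

lemma scomp_nat_left:
  "g \<in> carrier G \<Longrightarrow> k \<in> carrier \<Gamma> \<Longrightarrow> f \<in> Arr C \<Longrightarrow> A \<in> Deg D k \<Longrightarrow> Cod C f = M \<Longrightarrow>
    scomp g k M A \<cdot> ((Fa f \<lhd>\<^sub>a g) \<otimes>\<^sub>a Id C A) = Fa ((f \<lhd>\<^sub>a g) \<otimes>\<^sub>a Id C A) \<cdot> scomp g k (Dom C f) A"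
  using scomp_nat[of g k f "Id C A" M A] deg_in_ob[of A k] by simp

lemma scomp_nat_right:
  "g \<in> carrier G \<Longrightarrow> k \<in> carrier \<Gamma> \<Longrightarrow> M \<in> Ob C \<Longrightarrow> j \<in> Arr C \<Longrightarrow> Dom C j \<in> Deg D k \<Longrightarrow> A \<in> Deg D k \<Longrightarrow> Cod C j = A \<Longrightarrow>
    scomp g k M A \<cdot> (Id C (Fo M \<lhd>\<^sub>o g) \<otimes>\<^sub>a j) = Fa (Id C (M \<lhd>\<^sub>o g) \<otimes>\<^sub>a j) \<cdot> scomp g k M (Dom C j)"
  using scomp_nat[of g k "Id C M" j M A] by (simp add: F_simps)

text \<open>Applied below to (g \<bowtie> 1)(h \<bowtie> 1), (g \<bowtie> 1)(e \<bowtie> N) and (e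
  \<bowtie> M)(g \<bowtie> A), each acting on the unit object. The outcomes are the multiplicativity
  of \<open>ev_u\<close>, the relation between \<open>ev_u\<close> and \<open>ev_th\<close>, and the
  module condition for \<open>ev_th\<close>.\<close>

lemma scomp_assoc:
  assumes [simp]: "g \<in> carrier G" "k \<in> carrier \<Gamma>" "h \<in> carrier G" "t \<in> carrier \<Gamma>" "M \<in> Ob C"
    "A \<in> Deg D k" "B \<in> Deg D t"
  shows "scomp (g \<otimes>\<^bsub>G\<^esub> (k \<triangleright> h)) ((k \<triangleleft> h) \<otimes>\<^bsub>\<Gamma>\<^esub> t) M ((A \<lhd>\<^sub>o h) \<otimes>\<^sub>o B) \<cdot> assoc_component (g, k) h (Fo M) A B =
    Fa (assoc_component (g, k) h M A B) \<cdot> scomp h t ((M \<lhd>\<^sub>o g) \<otimes>\<^sub>o A) B \<cdot> ((scomp g k M A \<lhd>\<^sub>a h) \<otimes>\<^sub>a Id C B)"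
proof -
  have I [simp]: "(g, k) \<in> Idx" "(h, t) \<in> Idx" "(g \<otimes>\<^bsub>G\<^esub> (k \<triangleright> h), (k \<triangleleft> h) \<otimes>\<^bsub>\<Gamma>\<^esub> t) \<in> Idx"
    by (simp_all add: mem_Sigma_iff)
  have [simp]: "A \<in> Ob C" "B \<in> Ob C"
    using deg_in_ob[of A k] deg_in_ob[of B t] by simp_all
  note [simp] = F_simps cf_simps(7-10)[OF cfF] inv_arrI[OF id_in id_in]
  have "inv_arr C (assoc_component (g, k) h (Fo M) A B) \<cdot>
        component F (g \<otimes>\<^bsub>G\<^esub> (k \<triangleright> h), (k \<triangleleft> h) \<otimes>\<^bsub>\<Gamma>\<^esub> t) M ((A \<lhd>\<^sub>o h) \<otimes>\<^sub>o B) =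
      ((component F (g, k) M A \<lhd>\<^sub>a h) \<otimes>\<^sub>a Id C B) \<cdot> component F (h, t) ((M \<lhd>\<^sub>o g) \<otimes>\<^sub>o A) B \<cdot>
        Fa (inv_arr C (assoc_component (g, k) h M A B))"
    using coherent_assoc[OF cohF I(1,2), of M A B] by (simp add: idx_mult_def)
  from arg_cong[OF this, of "inv_arr C"] show ?thesis
    by (simp add: scomp_def inv_comp inv_ten inv_act
        functor_inv[OF linear_category_axioms RA.mf_functor[OF mf], symmetric])
qed

text \<open>Identifies the unit object acted on by e \<bowtie> A with \<open>A\<close>.\<close>

definition lam :: "'o \<Rightarrow> 'm" where
  "lam A = LUnit C A \<cdot> (inv_arr C (R0 D \<I>) \<otimes>\<^sub>a Id C A)"

lemma
  assumes "A \<in> Ob C"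
  shows is_iso_lam: "is_iso C (lam A)"
    and arr_lam: "lam A \<in> Arr C"
    and dom_lam: "Dom C (lam A) = (\<I> \<lhd>\<^sub>o \<one>\<^bsub>G\<^esub>) \<otimes>\<^sub>o A"
    and cod_lam: "Cod C (lam A) = A"
  using assms by (simp_all add: lam_def)

lemmas lam_simps = is_iso_lam arr_lam dom_lam cod_lam

section \<open>Evaluation at the unit object\<close>

definition ev_u :: "'g \<Rightarrow> 'm" where
  "ev_u = (\<lambda>g\<in>carrier G. Fa (Eta0 D g \<cdot> RUnit C (\<I> \<lhd>\<^sub>o g)) \<cdot> scomp g \<one>\<^bsub>\<Gamma>\<^esub> \<I> \<I> \<cdot> inv_arr C (RUnit C (Fo \<I> \<lhd>\<^sub>o g)))"

text \<open>The comparison from F(1) \<otimes> A to F(A): the component at (1, k) on the unit, with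
  \<open>R0\<close> and \<open>lam\<close> removing the action of the group unit on the two sides.
  The degree is an index so that \<open>extend\<close> applies.\<close>

definition ev_th :: "'t \<Rightarrow> 'o \<Rightarrow> 'm" where
  "ev_th k A = Fa (lam A) \<cdot> scomp \<one>\<^bsub>G\<^esub> k \<I> A \<cdot> (R0 D (Fo \<I>) \<otimes>\<^sub>a Id C A)"

lemma
  assumes "g \<in> carrier G"
  shows is_iso_ev_u: "is_iso C (ev_u g)"
    and arr_ev_u: "ev_u g \<in> Arr C"
    and dom_ev_u: "Dom C (ev_u g) = Fo \<I> \<lhd>\<^sub>o g"
    and cod_ev_u: "Cod C (ev_u g) = Fo \<I>"
  using assms by (simp_all add: ev_u_def F_simps scomp_simps)

lemmas ev_u_simps = is_iso_ev_u arr_ev_u dom_ev_u cod_ev_u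

lemma
  assumes "k \<in> carrier \<Gamma>" "A \<in> Deg D k"
  shows is_iso_ev_th: "is_iso C (ev_th k A)"
    and arr_ev_th: "ev_th k A \<in> Arr C"
    and dom_ev_th: "Dom C (ev_th k A) = Fo \<I> \<otimes>\<^sub>o A"
    and cod_ev_th: "Cod C (ev_th k A) = Fo A"
  using assms deg_in_ob[of A k] by (simp_all add: ev_th_def F_simps scomp_simps lam_simps)

lemmas ev_th_simps = is_iso_ev_th arr_ev_th dom_ev_th cod_ev_th

lemma ev_u_mult:
  assumes g [simp]: "g \<in> carrier G" and h [simp]: "h \<in> carrier G"
  shows "ev_u (g \<otimes>\<^bsub>G\<^esub> h) \<cdot> R2 D g h (Fo \<I>) = ev_u h \<cdot> (ev_u g \<lhd>\<^sub>a h)"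
proof -
  note [simp] = F_simps scomp_simps ev_u_simps inv_arrI[OF id_in id_in]
  have I [simp]: "(g, \<one>\<^bsub>\<Gamma>\<^esub>) \<in> Idx"
    by (simp add: mem_Sigma_iff)
  define mu where "mu X = assoc_component (g, \<one>\<^bsub>\<Gamma>\<^esub>) h X \<I> \<I>" for X
  define ze where "ze X = ((inv_arr C (RUnit C (X \<lhd>\<^sub>o g)) \<lhd>\<^sub>a h) \<otimes>\<^sub>a Id C \<I>) \<cdot> inv_arr C (RUnit C (X \<lhd>\<^sub>o g \<lhd>\<^sub>o h))" for X
  define de where "de = (inv_arr C (Eta0 D h) \<otimes>\<^sub>a Id C \<I>) \<cdot> inv_arr C (LUnit C \<I>)"
  define x where "x l = Eta0 D l \<cdot> RUnit C (\<I> \<lhd>\<^sub>o l)" for l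
  have mu [simp]: "is_iso C (mu X)" "mu X \<in> Arr C" "Dom C (mu X) = (((X \<lhd>\<^sub>o g) \<otimes>\<^sub>o \<I>) \<lhd>\<^sub>o h) \<otimes>\<^sub>o \<I>"
    "Cod C (mu X) = (X \<lhd>\<^sub>o (g \<otimes>\<^bsub>G\<^esub> h)) \<otimes>\<^sub>o ((\<I> \<lhd>\<^sub>o h) \<otimes>\<^sub>o \<I>)" if "X \<in> Ob C" for X
    using that by (simp_all add: mu_def)
  have ze [simp]: "ze X \<in> Arr C" "Dom C (ze X) = X \<lhd>\<^sub>o g \<lhd>\<^sub>o h" "Cod C (ze X) = (((X \<lhd>\<^sub>o g) \<otimes>\<^sub>o \<I>) \<lhd>\<^sub>o h) \<otimes>\<^sub>o \<I>"
    if "X \<in> Ob C" for X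
    using that by (simp_all add: ze_def)
  have de [simp]: "de \<in> Arr C" "Dom C de = \<I>" "Cod C de = (\<I> \<lhd>\<^sub>o h) \<otimes>\<^sub>o \<I>" "(\<I> \<lhd>\<^sub>o h) \<otimes>\<^sub>o \<I> \<in> Deg D \<one>\<^bsub>\<Gamma>\<^esub>"
    using deg_tensor[of "\<one>\<^bsub>\<Gamma>\<^esub>" "\<one>\<^bsub>\<Gamma>\<^esub>" "\<I> \<lhd>\<^sub>o h" \<I>] deg_act[of \<I> "\<one>\<^bsub>\<Gamma>\<^esub>" h] by (simp_all add: de_def)
  have x [simp]: "x l \<in> Arr C" "Dom C (x l) = (\<I> \<lhd>\<^sub>o l) \<otimes>\<^sub>o \<I>" "Cod C (x l) = \<I>" if "l \<in> carrier G" for l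
    using that by (simp_all add: x_def)
  have rinv: "(f \<otimes>\<^sub>a Id C \<I>) \<cdot> inv_arr C (RUnit C (Dom C f)) = inv_arr C (RUnit C Y) \<cdot> f" if "f \<in> Arr C" "Cod C f = Y" for f Y
    using that cod_in[of f] by (intro inv_slide[symmetric]) (auto simp: runit_nat)
  have mz: "mu X \<cdot> ze X = (Id C (X \<lhd>\<^sub>o (g \<otimes>\<^bsub>G\<^esub> h)) \<otimes>\<^sub>a de) \<cdot> inv_arr C (RUnit C (X \<lhd>\<^sub>o (g \<otimes>\<^bsub>G\<^esub> h))) \<cdot> R2 D g h X"
    if [simp]: "X \<in> Ob C" for X
  proof -
    let ?Z = "X \<lhd>\<^sub>o (g \<otimes>\<^bsub>G\<^esub> h)"
    \<comment> \<open>The right half of (C2), solved for \<eta>.\<close>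
    have e: "Eta D h \<one>\<^bsub>\<Gamma>\<^esub> (X \<lhd>\<^sub>o g) \<I> \<cdot> (inv_arr C (RUnit C (X \<lhd>\<^sub>o g)) \<lhd>\<^sub>a h) =
        (Id C (X \<lhd>\<^sub>o g \<lhd>\<^sub>o h) \<otimes>\<^sub>a inv_arr C (Eta0 D h)) \<cdot> inv_arr C (RUnit C (X \<lhd>\<^sub>o g \<lhd>\<^sub>o h))"
    proof (rule iso_left_cancel[where a = "RUnit C (X \<lhd>\<^sub>o g \<lhd>\<^sub>o h) \<cdot> (Id C (X \<lhd>\<^sub>o g \<lhd>\<^sub>o h) \<otimes>\<^sub>a Eta0 D h)"])
      have "(RUnit C (X \<lhd>\<^sub>o g \<lhd>\<^sub>o h) \<cdot> (Id C (X \<lhd>\<^sub>o g \<lhd>\<^sub>o h) \<otimes>\<^sub>a Eta0 D h)) \<cdot>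
          Eta D h \<one>\<^bsub>\<Gamma>\<^esub> (X \<lhd>\<^sub>o g) \<I> \<cdot> (inv_arr C (RUnit C (X \<lhd>\<^sub>o g)) \<lhd>\<^sub>a h) =
          (RUnit C (X \<lhd>\<^sub>o g) \<lhd>\<^sub>a h) \<cdot> (inv_arr C (RUnit C (X \<lhd>\<^sub>o g)) \<lhd>\<^sub>a h)"
        using pre3[OF C2_right[of h "X \<lhd>\<^sub>o g"]] by simp
      then show "(RUnit C (X \<lhd>\<^sub>o g \<lhd>\<^sub>o h) \<cdot> (Id C (X \<lhd>\<^sub>o g \<lhd>\<^sub>o h) \<otimes>\<^sub>a Eta0 D h)) \<cdot>
          Eta D h \<one>\<^bsub>\<Gamma>\<^esub> (X \<lhd>\<^sub>o g) \<I> \<cdot> (inv_arr C (RUnit C (X \<lhd>\<^sub>o g)) \<lhd>\<^sub>a h) =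
        (RUnit C (X \<lhd>\<^sub>o g \<lhd>\<^sub>o h) \<cdot> (Id C (X \<lhd>\<^sub>o g \<lhd>\<^sub>o h) \<otimes>\<^sub>a Eta0 D h)) \<cdot>
          (Id C (X \<lhd>\<^sub>o g \<lhd>\<^sub>o h) \<otimes>\<^sub>a inv_arr C (Eta0 D h)) \<cdot> inv_arr C (RUnit C (X \<lhd>\<^sub>o g \<lhd>\<^sub>o h))"
        by (simp add: ten_collapse_pre act_expand[symmetric])
    qed simp_all
    \<comment> \<open>The triangle with both unit constraints inverted.\<close>
    have t: "Assoc C ?Z \<I> \<I> \<cdot> (inv_arr C (RUnit C ?Z) \<otimes>\<^sub>a Id C \<I>) = Id C ?Z \<otimes>\<^sub>a inv_arr C (LUnit C \<I>)"
    proof (rule iso_left_cancel[where a = "Id C ?Z \<otimes>\<^sub>a LUnit C \<I>"])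
      show "(Id C ?Z \<otimes>\<^sub>a LUnit C \<I>) \<cdot> Assoc C ?Z \<I> \<I> \<cdot> (inv_arr C (RUnit C ?Z) \<otimes>\<^sub>a Id C \<I>) =
          (Id C ?Z \<otimes>\<^sub>a LUnit C \<I>) \<cdot> (Id C ?Z \<otimes>\<^sub>a inv_arr C (LUnit C \<I>))"
        by (simp add: pre2[OF triangle] ten_collapse)
    qed simp_all
    have inner: "(R2 D g h X \<otimes>\<^sub>a Id C (\<I> \<lhd>\<^sub>o h)) \<cdot> Eta D h \<one>\<^bsub>\<Gamma>\<^esub> (X \<lhd>\<^sub>o g) \<I> \<cdot> (inv_arr C (RUnit C (X \<lhd>\<^sub>o g)) \<lhd>\<^sub>a h) =
        (Id C ?Z \<otimes>\<^sub>a inv_arr C (Eta0 D h)) \<cdot> inv_arr C (RUnit C ?Z) \<cdot> R2 D g h X"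
      using rinv[of "R2 D g h X" ?Z, symmetric] by (simp add: e ten_collapse_pre)
    have "mu X \<cdot> ze X = Assoc C ?Z (\<I> \<lhd>\<^sub>o h) \<I> \<cdot>
        (((R2 D g h X \<otimes>\<^sub>a Id C (\<I> \<lhd>\<^sub>o h)) \<cdot> Eta D h \<one>\<^bsub>\<Gamma>\<^esub> (X \<lhd>\<^sub>o g) \<I> \<cdot> (inv_arr C (RUnit C (X \<lhd>\<^sub>o g)) \<lhd>\<^sub>a h)) \<otimes>\<^sub>a Id C \<I>) \<cdot>
        inv_arr C (RUnit C (X \<lhd>\<^sub>o g \<lhd>\<^sub>o h))"
      by (simp add: mu_def ze_def assoc_component_def ten_collapse_simps)
    also have "\<dots> = Assoc C ?Z (\<I> \<lhd>\<^sub>o h) \<I> \<cdot> (Id C ?Z \<otimes>\<^sub>a inv_arr C (Eta0 D h) \<otimes>\<^sub>a Id C \<I>) \<cdot>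
        (inv_arr C (RUnit C ?Z) \<otimes>\<^sub>a Id C \<I>) \<cdot> (R2 D g h X \<otimes>\<^sub>a Id C \<I>) \<cdot> inv_arr C (RUnit C (X \<lhd>\<^sub>o g \<lhd>\<^sub>o h))"
      unfolding inner by (simp add: ten_collapse_simps)
    also have "\<dots> = (Id C ?Z \<otimes>\<^sub>a (inv_arr C (Eta0 D h) \<otimes>\<^sub>a Id C \<I>)) \<cdot> (Id C ?Z \<otimes>\<^sub>a inv_arr C (LUnit C \<I>)) \<cdot>
        inv_arr C (RUnit C ?Z) \<cdot> R2 D g h X"
      using rinv[of "R2 D g h X" ?Z] by (simp add: assoc_nat_simps pre2[OF t])
    also have "\<dots> = (Id C ?Z \<otimes>\<^sub>a de) \<cdot> inv_arr C (RUnit C ?Z) \<cdot> R2 D g h X"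
      by (simp add: de_def ten_collapse_pre)
    finally show ?thesis .
  qed
  let ?U = "Fo \<I>"
  \<comment> \<open>\<open>Y\<close> acts by g and h in two steps, \<open>S\<close> by the product g
    h in one; \<open>zR\<close> is the arrow inside F that connects their targets.\<close>
  define Y where "Y = scomp h \<one>\<^bsub>\<Gamma>\<^esub> ((\<I> \<lhd>\<^sub>o g) \<otimes>\<^sub>o \<I>) \<I> \<cdot> ((scomp g \<one>\<^bsub>\<Gamma>\<^esub> \<I> \<I> \<lhd>\<^sub>a h) \<otimes>\<^sub>a Id C \<I>) \<cdot> ze ?U"
  define S where "S = scomp (g \<otimes>\<^bsub>G\<^esub> h) \<one>\<^bsub>\<Gamma>\<^esub> \<I> \<I> \<cdot> inv_arr C (RUnit C (?U \<lhd>\<^sub>o (g \<otimes>\<^bsub>G\<^esub> h))) \<cdot> R2 D g h ?U"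
  define zR where "zR = ze \<I> \<cdot> inv_arr C (R2 D g h \<I>) \<cdot> RUnit C (\<I> \<lhd>\<^sub>o (g \<otimes>\<^bsub>G\<^esub> h))"
  have Y [simp]: "Y \<in> Arr C" "Dom C Y = ?U \<lhd>\<^sub>o g \<lhd>\<^sub>o h" "Cod C Y = Fo ((((\<I> \<lhd>\<^sub>o g) \<otimes>\<^sub>o \<I>) \<lhd>\<^sub>o h) \<otimes>\<^sub>o \<I>)"
    by (simp_all add: Y_def)
  have S [simp]: "S \<in> Arr C" "Dom C S = ?U \<lhd>\<^sub>o g \<lhd>\<^sub>o h" "Cod C S = Fo ((\<I> \<lhd>\<^sub>o (g \<otimes>\<^bsub>G\<^esub> h)) \<otimes>\<^sub>o \<I>)"
    by (simp_all add: S_def)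
  have zR [simp]: "zR \<in> Arr C" "Dom C zR = (\<I> \<lhd>\<^sub>o (g \<otimes>\<^bsub>G\<^esub> h)) \<otimes>\<^sub>o \<I>" "Cod C zR = (((\<I> \<lhd>\<^sub>o g) \<otimes>\<^sub>o \<I>) \<lhd>\<^sub>o h) \<otimes>\<^sub>o \<I>"
    by (simp_all add: zR_def)
  have coh: "Fa (mu \<I>) \<cdot> scomp h \<one>\<^bsub>\<Gamma>\<^esub> ((\<I> \<lhd>\<^sub>o g) \<otimes>\<^sub>o \<I>) \<I> \<cdot> ((scomp g \<one>\<^bsub>\<Gamma>\<^esub> \<I> \<I> \<lhd>\<^sub>a h) \<otimes>\<^sub>a Id C \<I>) =
      scomp (g \<otimes>\<^bsub>G\<^esub> h) \<one>\<^bsub>\<Gamma>\<^esub> \<I> ((\<I> \<lhd>\<^sub>o h) \<otimes>\<^sub>o \<I>) \<cdot> mu ?U"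
    using scomp_assoc[of g "\<one>\<^bsub>\<Gamma>\<^esub>" h "\<one>\<^bsub>\<Gamma>\<^esub>" \<I> \<I> \<I>] by (simp add: mu_def)
  \<comment> \<open>Compared after the invertible image of \<open>mu\<close>: coherence exchanges it
    for \<open>mu\<close> at F(1), and \<open>mz\<close> is used at F(1) and at the unit.\<close>
  have YS: "Y = Fa zR \<cdot> S"
  proof (rule iso_left_cancel[where a = "Fa (mu \<I>)"])
    have "Fa (mu \<I>) \<cdot> Y = scomp (g \<otimes>\<^bsub>G\<^esub> h) \<one>\<^bsub>\<Gamma>\<^esub> \<I> ((\<I> \<lhd>\<^sub>o h) \<otimes>\<^sub>o \<I>) \<cdot> mu ?U \<cdot> ze ?U"
      by (simp add: Y_def pre3[OF coh])
    also have "\<dots> = Fa (Id C (\<I> \<lhd>\<^sub>o (g \<otimes>\<^bsub>G\<^esub> h)) \<otimes>\<^sub>a de) \<cdot> S"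
      using deg_in_ob[of "(\<I> \<lhd>\<^sub>o h) \<otimes>\<^sub>o \<I>"] by (simp add: mz S_def pre2[OF scomp_nat_right])
    also have "\<dots> = Fa (mu \<I> \<cdot> zR) \<cdot> S"
      by (simp add: zR_def pre2[OF mz])
    finally show "Fa (mu \<I>) \<cdot> Y = Fa (mu \<I>) \<cdot> Fa zR \<cdot> S"
      by (simp add: F_comp)
  qed simp_all
  \<comment> \<open>Inside F everything concerns the unit object, and the claim becomes the
    multiplicativity (C4) of \<open>Eta0\<close>.\<close>
  have xx: "x h \<cdot> ((x g \<lhd>\<^sub>a h) \<otimes>\<^sub>a Id C \<I>) \<cdot> zR = x (g \<otimes>\<^bsub>G\<^esub> h)"
  proof -
    have "x h \<cdot> ((x g \<lhd>\<^sub>a h) \<otimes>\<^sub>a Id C \<I>) \<cdot> ze \<I> =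
        Eta0 D h \<cdot> RUnit C (\<I> \<lhd>\<^sub>o h) \<cdot> (((Eta0 D g \<cdot> RUnit C (\<I> \<lhd>\<^sub>o g) \<cdot> inv_arr C (RUnit C (\<I> \<lhd>\<^sub>o g))) \<lhd>\<^sub>a h) \<otimes>\<^sub>a Id C \<I>) \<cdot>
          inv_arr C (RUnit C (\<I> \<lhd>\<^sub>o g \<lhd>\<^sub>o h))"
      by (simp only: x_def ze_def) (simp add: ten_collapse_simps act_expand[symmetric])
    also have "\<dots> = Eta0 D h \<cdot> (Eta0 D g \<lhd>\<^sub>a h)"
      by (simp add: runit_nat_simps)
    also have "\<dots> = Eta0 D (g \<otimes>\<^bsub>G\<^esub> h) \<cdot> R2 D g h \<I>"
      by (simp add: C4)
    finally have "x h \<cdot> ((x g \<lhd>\<^sub>a h) \<otimes>\<^sub>a Id C \<I>) \<cdot> ze \<I> = Eta0 D (g \<otimes>\<^bsub>G\<^esub> h) \<cdot> R2 D g h \<I>" .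
    from pre3[OF this] show ?thesis
      by (simp add: zR_def x_def[of "g \<otimes>\<^bsub>G\<^esub> h"])
  qed
  have "ev_u h \<cdot> (ev_u g \<lhd>\<^sub>a h) = Fa (x h) \<cdot> scomp h \<one>\<^bsub>\<Gamma>\<^esub> \<I> \<I> \<cdot> inv_arr C (RUnit C (?U \<lhd>\<^sub>o h)) \<cdot>
      ((Fa (x g) \<cdot> scomp g \<one>\<^bsub>\<Gamma>\<^esub> \<I> \<I> \<cdot> inv_arr C (RUnit C (?U \<lhd>\<^sub>o g))) \<lhd>\<^sub>a h)"
    by (simp add: ev_u_def x_def)
  also have "\<dots> = Fa (x h) \<cdot> scomp h \<one>\<^bsub>\<Gamma>\<^esub> \<I> \<I> \<cdot>
      (((Fa (x g) \<cdot> scomp g \<one>\<^bsub>\<Gamma>\<^esub> \<I> \<I> \<cdot> inv_arr C (RUnit C (?U \<lhd>\<^sub>o g))) \<lhd>\<^sub>a h) \<otimes>\<^sub>a Id C \<I>) \<cdot>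
      inv_arr C (RUnit C (?U \<lhd>\<^sub>o g \<lhd>\<^sub>o h))"
    using rinv[of "(Fa (x g) \<cdot> scomp g \<one>\<^bsub>\<Gamma>\<^esub> \<I> \<I> \<cdot> inv_arr C (RUnit C (?U \<lhd>\<^sub>o g))) \<lhd>\<^sub>a h" "?U \<lhd>\<^sub>o h"] by simp
  also have "\<dots> = Fa (x h) \<cdot> scomp h \<one>\<^bsub>\<Gamma>\<^esub> \<I> \<I> \<cdot> ((Fa (x g) \<lhd>\<^sub>a h) \<otimes>\<^sub>a Id C \<I>) \<cdot>
      ((scomp g \<one>\<^bsub>\<Gamma>\<^esub> \<I> \<I> \<lhd>\<^sub>a h) \<otimes>\<^sub>a Id C \<I>) \<cdot> ze ?U"
    by (simp add: ze_def ten_collapse_simps act_expand)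
  also have "\<dots> = Fa (x h) \<cdot> Fa ((x g \<lhd>\<^sub>a h) \<otimes>\<^sub>a Id C \<I>) \<cdot> Y"
    by (simp add: pre2[OF scomp_nat_left] Y_def)
  also have "\<dots> = Fa (x h \<cdot> ((x g \<lhd>\<^sub>a h) \<otimes>\<^sub>a Id C \<I>) \<cdot> zR) \<cdot> S"
    by (simp add: YS F_comp)
  also have "\<dots> = ev_u (g \<otimes>\<^bsub>G\<^esub> h) \<cdot> R2 D g h ?U"
    unfolding xx by (simp add: ev_u_def S_def x_def)
  finally show ?thesis ..
qed

lemma ev_equivariant: "is_equivariant (Fo \<I>, ev_u)"
  by (rule equivI) (simp_all add: F_simps ev_u_simps ev_u_mult, simp add: ev_u_def)

text \<open>Associativity for (g \<bowtie> 1)(e \<bowtie> N), whose index is (g, k) again. It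
  expresses every component of F on the unit object through \<open>ev_u\<close> and
  \<open>ev_th\<close>.\<close>

lemma ev_th_ev_u:
  assumes g [simp]: "g \<in> carrier G" and k [simp]: "k \<in> carrier \<Gamma>" and N [simp]: "N \<in> Deg D k"
  shows "ev_th k N \<cdot> (ev_u g \<otimes>\<^sub>a Id C N) = Fa (LUnit C N \<cdot> (Eta0 D g \<otimes>\<^sub>a Id C N)) \<cdot> scomp g k \<I> N"
proof -
  have No [simp]: "N \<in> Ob C"
    using deg_in_ob[OF N k] .
  note [simp] = F_simps scomp_simps ev_u_simps lam_simps inv_arrI[OF id_in id_in]
  have I [simp]: "(g, \<one>\<^bsub>\<Gamma>\<^esub>) \<in> Idx"
    by (simp add: mem_Sigma_iff)
  have N' [simp]: "(\<I> \<lhd>\<^sub>o \<one>\<^bsub>G\<^esub>) \<otimes>\<^sub>o N \<in> Deg D k"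
    using deg_tensor[of "\<one>\<^bsub>\<Gamma>\<^esub>" k "\<I> \<lhd>\<^sub>o \<one>\<^bsub>G\<^esub>" N] deg_act[of \<I> "\<one>\<^bsub>\<Gamma>\<^esub>" "\<one>\<^bsub>G\<^esub>"] by simp
  define mu where "mu X = assoc_component (g, \<one>\<^bsub>\<Gamma>\<^esub>) \<one>\<^bsub>G\<^esub> X \<I> N" for X
  define ze where "ze X = (R0 D ((X \<lhd>\<^sub>o g) \<otimes>\<^sub>o \<I>) \<cdot> inv_arr C (RUnit C (X \<lhd>\<^sub>o g))) \<otimes>\<^sub>a Id C N" for X
  define x where "x = Eta0 D g \<cdot> RUnit C (\<I> \<lhd>\<^sub>o g)"
  have mu [simp]: "is_iso C (mu X)" "mu X \<in> Arr C" "Dom C (mu X) = (((X \<lhd>\<^sub>o g) \<otimes>\<^sub>o \<I>) \<lhd>\<^sub>o \<one>\<^bsub>G\<^esub>) \<otimes>\<^sub>o N"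
    "Cod C (mu X) = (X \<lhd>\<^sub>o g) \<otimes>\<^sub>o ((\<I> \<lhd>\<^sub>o \<one>\<^bsub>G\<^esub>) \<otimes>\<^sub>o N)" if "X \<in> Ob C" for X
    using that by (simp_all add: mu_def)
  have ze [simp]: "ze X \<in> Arr C" "Dom C (ze X) = (X \<lhd>\<^sub>o g) \<otimes>\<^sub>o N" "Cod C (ze X) = (((X \<lhd>\<^sub>o g) \<otimes>\<^sub>o \<I>) \<lhd>\<^sub>o \<one>\<^bsub>G\<^esub>) \<otimes>\<^sub>o N"
    if "X \<in> Ob C" for X
    using that by (simp_all add: ze_def)
  have x [simp]: "x \<in> Arr C" "Dom C x = (\<I> \<lhd>\<^sub>o g) \<otimes>\<^sub>o \<I>" "Cod C x = \<I>"
    by (simp_all add: x_def)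
  have laminv: "inv_arr C (lam N) = (R0 D \<I> \<otimes>\<^sub>a Id C N) \<cdot> inv_arr C (LUnit C N)"
    by (simp add: lam_def inv_comp inv_ten)
  have mz: "mu X \<cdot> ze X = Id C (X \<lhd>\<^sub>o g) \<otimes>\<^sub>a inv_arr C (lam N)" if [simp]: "X \<in> Ob C" for X
  proof -
    let ?Z = "X \<lhd>\<^sub>o g"
    have t: "Assoc C ?Z \<I> N \<cdot> (inv_arr C (RUnit C ?Z) \<otimes>\<^sub>a Id C N) = Id C ?Z \<otimes>\<^sub>a inv_arr C (LUnit C N)"
    proof (rule iso_left_cancel[where a = "Id C ?Z \<otimes>\<^sub>a LUnit C N"])
      show "(Id C ?Z \<otimes>\<^sub>a LUnit C N) \<cdot> Assoc C ?Z \<I> N \<cdot> (inv_arr C (RUnit C ?Z) \<otimes>\<^sub>a Id C N) =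
          (Id C ?Z \<otimes>\<^sub>a LUnit C N) \<cdot> (Id C ?Z \<otimes>\<^sub>a inv_arr C (LUnit C N))"
        by (simp add: pre2[OF triangle] ten_collapse)
    qed simp_all
    \<comment> \<open>Here (C5) evaluates \<eta> at the group unit, and the unit law of
      \<open>R2\<close> removes the second action.\<close>
    have "mu X \<cdot> ze X = Assoc C ?Z (\<I> \<lhd>\<^sub>o \<one>\<^bsub>G\<^esub>) N \<cdot> (((Id C ?Z \<otimes>\<^sub>a R0 D \<I>) \<cdot> inv_arr C (RUnit C ?Z)) \<otimes>\<^sub>a Id C N)"
      by (simp add: mu_def ze_def assoc_component_def ten_collapse_simps pre2[OF C5] R2_R0_right)
    also have "\<dots> = Assoc C ?Z (\<I> \<lhd>\<^sub>o \<one>\<^bsub>G\<^esub>) N \<cdot> (Id C ?Z \<otimes>\<^sub>a R0 D \<I> \<otimes>\<^sub>a Id C N) \<cdot> (inv_arr C (RUnit C ?Z) \<otimes>\<^sub>a Id C N)"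
      by (simp add: ten_collapse)
    also have "\<dots> = (Id C ?Z \<otimes>\<^sub>a (R0 D \<I> \<otimes>\<^sub>a Id C N)) \<cdot> (Id C ?Z \<otimes>\<^sub>a inv_arr C (LUnit C N))"
      by (simp add: assoc_nat_simps t)
    also have "\<dots> = Id C ?Z \<otimes>\<^sub>a inv_arr C (lam N)"
      by (simp add: laminv ten_collapse)
    finally show ?thesis .
  qed
  let ?U = "Fo \<I>"
  define Y where "Y = scomp \<one>\<^bsub>G\<^esub> k ((\<I> \<lhd>\<^sub>o g) \<otimes>\<^sub>o \<I>) N \<cdot> ((scomp g \<one>\<^bsub>\<Gamma>\<^esub> \<I> \<I> \<lhd>\<^sub>a \<one>\<^bsub>G\<^esub>) \<otimes>\<^sub>a Id C N) \<cdot> ze ?U"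
  have Y [simp]: "Y \<in> Arr C" "Dom C Y = (?U \<lhd>\<^sub>o g) \<otimes>\<^sub>o N" "Cod C Y = Fo ((((\<I> \<lhd>\<^sub>o g) \<otimes>\<^sub>o \<I>) \<lhd>\<^sub>o \<one>\<^bsub>G\<^esub>) \<otimes>\<^sub>o N)"
    by (simp_all add: Y_def)
  have coh: "Fa (mu \<I>) \<cdot> scomp \<one>\<^bsub>G\<^esub> k ((\<I> \<lhd>\<^sub>o g) \<otimes>\<^sub>o \<I>) N \<cdot> ((scomp g \<one>\<^bsub>\<Gamma>\<^esub> \<I> \<I> \<lhd>\<^sub>a \<one>\<^bsub>G\<^esub>) \<otimes>\<^sub>a Id C N) =
      scomp g k \<I> ((\<I> \<lhd>\<^sub>o \<one>\<^bsub>G\<^esub>) \<otimes>\<^sub>o N) \<cdot> mu ?U"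
    using scomp_assoc[of g "\<one>\<^bsub>\<Gamma>\<^esub>" "\<one>\<^bsub>G\<^esub>" k \<I> \<I> N] by (simp add: mu_def)
  have YS: "Y = Fa (ze \<I>) \<cdot> scomp g k \<I> N"
  proof (rule iso_left_cancel[where a = "Fa (mu \<I>)"])
    have "Fa (mu \<I>) \<cdot> Y = scomp g k \<I> ((\<I> \<lhd>\<^sub>o \<one>\<^bsub>G\<^esub>) \<otimes>\<^sub>o N) \<cdot> mu ?U \<cdot> ze ?U"
      by (simp add: Y_def pre3[OF coh])
    also have "\<dots> = Fa (Id C (\<I> \<lhd>\<^sub>o g) \<otimes>\<^sub>a inv_arr C (lam N)) \<cdot> scomp g k \<I> N"
      by (simp add: mz scomp_nat_right)
    also have "\<dots> = Fa (mu \<I> \<cdot> ze \<I>) \<cdot> scomp g k \<I> N"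
      by (simp add: mz)
    finally show "Fa (mu \<I>) \<cdot> Y = Fa (mu \<I>) \<cdot> Fa (ze \<I>) \<cdot> scomp g k \<I> N"
      by (simp add: F_comp)
  qed simp_all
  have xx: "lam N \<cdot> ((x \<lhd>\<^sub>a \<one>\<^bsub>G\<^esub>) \<otimes>\<^sub>a Id C N) \<cdot> ze \<I> = LUnit C N \<cdot> (Eta0 D g \<otimes>\<^sub>a Id C N)"
  proof -
    have "(x \<lhd>\<^sub>a \<one>\<^bsub>G\<^esub>) \<cdot> R0 D ((\<I> \<lhd>\<^sub>o g) \<otimes>\<^sub>o \<I>) \<cdot> inv_arr C (RUnit C (\<I> \<lhd>\<^sub>o g)) = R0 D \<I> \<cdot> Eta0 D g"
      using pre2[OF R0_nat[of x \<I>], of "inv_arr C (RUnit C (\<I> \<lhd>\<^sub>o g))"] by (simp add: x_def)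
    then show ?thesis
      by (simp add: ze_def lam_def ten_collapse_simps)
  qed
  have "ev_th k N \<cdot> (ev_u g \<otimes>\<^sub>a Id C N) = Fa (lam N) \<cdot> scomp \<one>\<^bsub>G\<^esub> k \<I> N \<cdot> ((R0 D ?U \<cdot> ev_u g) \<otimes>\<^sub>a Id C N)"
    by (simp add: ev_th_def ten_collapse)
  also have "R0 D ?U \<cdot> ev_u g = (Fa x \<lhd>\<^sub>a \<one>\<^bsub>G\<^esub>) \<cdot> (scomp g \<one>\<^bsub>\<Gamma>\<^esub> \<I> \<I> \<lhd>\<^sub>a \<one>\<^bsub>G\<^esub>) \<cdot> R0 D ((?U \<lhd>\<^sub>o g) \<otimes>\<^sub>o \<I>) \<cdot> inv_arr C (RUnit C (?U \<lhd>\<^sub>o g))"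
    by (simp add: ev_u_def x_def[symmetric] R0_nat pre2[OF R0_nat] act_expand)
  also have "Fa (lam N) \<cdot> scomp \<one>\<^bsub>G\<^esub> k \<I> N \<cdot> (((Fa x \<lhd>\<^sub>a \<one>\<^bsub>G\<^esub>) \<cdot> (scomp g \<one>\<^bsub>\<Gamma>\<^esub> \<I> \<I> \<lhd>\<^sub>a \<one>\<^bsub>G\<^esub>) \<cdot>
      R0 D ((?U \<lhd>\<^sub>o g) \<otimes>\<^sub>o \<I>) \<cdot> inv_arr C (RUnit C (?U \<lhd>\<^sub>o g))) \<otimes>\<^sub>a Id C N) =
      Fa (lam N) \<cdot> scomp \<one>\<^bsub>G\<^esub> k \<I> N \<cdot> ((Fa x \<lhd>\<^sub>a \<one>\<^bsub>G\<^esub>) \<otimes>\<^sub>a Id C N) \<cdot> ((scomp g \<one>\<^bsub>\<Gamma>\<^esub> \<I> \<I> \<lhd>\<^sub>a \<one>\<^bsub>G\<^esub>) \<otimes>\<^sub>a Id C N) \<cdot> ze ?U"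
    by (simp add: ze_def ten_collapse_simps)
  also have "\<dots> = Fa (lam N) \<cdot> Fa ((x \<lhd>\<^sub>a \<one>\<^bsub>G\<^esub>) \<otimes>\<^sub>a Id C N) \<cdot> Y"
    by (simp add: pre2[OF scomp_nat_left] Y_def)
  also have "\<dots> = Fa (lam N \<cdot> ((x \<lhd>\<^sub>a \<one>\<^bsub>G\<^esub>) \<otimes>\<^sub>a Id C N) \<cdot> ze \<I>) \<cdot> scomp g k \<I> N"
    by (simp add: YS F_comp)
  finally show ?thesis
    by (simp only: xx)
qed

text \<open>Associativity for (e \<bowtie> M)(g \<bowtie> A), whose index is (k \<triangleright> g,
  (k \<triangleleft> g) t). One side contains the component on \<open>M\<close>; the other only a
  component on the unit, known from \<open>ev_th_ev_u\<close>, and its factor \<open>ev_u\<close> at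
  k \<triangleright> g joins with \<eta> to form gamma.\<close>

lemma ev_th_module:
  assumes g [simp]: "g \<in> carrier G" and k [simp]: "k \<in> carrier \<Gamma>" and t [simp]: "t \<in> carrier \<Gamma>"
    and M [simp]: "M \<in> Deg D k" and A [simp]: "A \<in> Deg D t"
  shows "scomp g t M A \<cdot> ((ev_th k M \<lhd>\<^sub>a g) \<otimes>\<^sub>a Id C A) =
    ev_th ((k \<triangleleft> g) \<otimes>\<^bsub>\<Gamma>\<^esub> t) ((M \<lhd>\<^sub>o g) \<otimes>\<^sub>o A) \<cdot> sig (Fo \<I>) ev_u (g, t) M A"
proof -
  have [simp]: "M \<in> Ob C" "A \<in> Ob C"
    using deg_in_ob[OF M k] deg_in_ob[OF A t] by simp_all
  let ?U = "Fo \<I>" and ?N = "(M \<lhd>\<^sub>o g) \<otimes>\<^sub>o A" and ?r = "(k \<triangleleft> g) \<otimes>\<^bsub>\<Gamma>\<^esub> t" and ?h = "k \<triangleright> g"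
  note eq = ev_equivariant
  have Nd [simp]: "?N \<in> Deg D ?r"
    by simp
  note [simp] = F_simps scomp_simps ev_u_simps ev_th_simps lam_simps equiv_simps[OF eq] gam_simps[OF eq]
  have I [simp]: "(\<one>\<^bsub>G\<^esub>, k) \<in> Idx" "(g, t) \<in> Idx"
    by (simp_all add: mem_Sigma_iff)
  define mu where "mu X = assoc_component (\<one>\<^bsub>G\<^esub>, k) g X M A" for X
  define ze where "ze X = ((R0 D X \<otimes>\<^sub>a Id C M) \<lhd>\<^sub>a g) \<otimes>\<^sub>a Id C A" for X
  define e where "e X = Assoc C (X \<lhd>\<^sub>o ?h) (M \<lhd>\<^sub>o g) A \<cdot> (Eta D g k X M \<otimes>\<^sub>a Id C A)" for X
  have mu [simp]: "is_iso C (mu X)" "mu X \<in> Arr C" "Dom C (mu X) = ((X \<lhd>\<^sub>o \<one>\<^bsub>G\<^esub>) \<otimes>\<^sub>o M) \<lhd>\<^sub>o g \<otimes>\<^sub>o A"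
    "Cod C (mu X) = (X \<lhd>\<^sub>o ?h) \<otimes>\<^sub>o ?N" if "X \<in> Ob C" for X
    using that by (simp_all add: mu_def)
  have ze [simp]: "is_iso C (ze X)" "ze X \<in> Arr C" "Dom C (ze X) = (X \<otimes>\<^sub>o M) \<lhd>\<^sub>o g \<otimes>\<^sub>o A" "Cod C (ze X) = ((X \<lhd>\<^sub>o \<one>\<^bsub>G\<^esub>) \<otimes>\<^sub>o M) \<lhd>\<^sub>o g \<otimes>\<^sub>o A"
    if "X \<in> Ob C" for X
    using that by (simp_all add: ze_def)
  have e [simp]: "e X \<in> Arr C" "Dom C (e X) = (X \<otimes>\<^sub>o M) \<lhd>\<^sub>o g \<otimes>\<^sub>o A" "Cod C (e X) = (X \<lhd>\<^sub>o ?h) \<otimes>\<^sub>o ?N" if "X \<in> Ob C" for X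
    using that by (simp_all add: e_def)
  \<comment> \<open>The unit law \<open>R2_R0_left\<close> cancels the action of the group unit that
    \<open>ze\<close> introduces, leaving \<eta> and an associator.\<close>
  have mz: "mu X \<cdot> ze X = e X" if [simp]: "X \<in> Ob C" for X
    by (simp add: mu_def ze_def e_def assoc_component_def ten_collapse_simps eta_nat pre2[OF R2_R0_left])
      (simp add: R2_R0_left)
  define Y where "Y = scomp g t ((\<I> \<lhd>\<^sub>o \<one>\<^bsub>G\<^esub>) \<otimes>\<^sub>o M) A \<cdot> ((scomp \<one>\<^bsub>G\<^esub> k \<I> M \<lhd>\<^sub>a g) \<otimes>\<^sub>a Id C A) \<cdot> ze ?U"
  have Y [simp]: "Y \<in> Arr C" "Dom C Y = (?U \<otimes>\<^sub>o M) \<lhd>\<^sub>o g \<otimes>\<^sub>o A" "Cod C Y = Fo (((\<I> \<lhd>\<^sub>o \<one>\<^bsub>G\<^esub>) \<otimes>\<^sub>o M) \<lhd>\<^sub>o g \<otimes>\<^sub>o A)"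
    by (simp_all add: Y_def)
  have coh: "Fa (mu \<I>) \<cdot> scomp g t ((\<I> \<lhd>\<^sub>o \<one>\<^bsub>G\<^esub>) \<otimes>\<^sub>o M) A \<cdot> ((scomp \<one>\<^bsub>G\<^esub> k \<I> M \<lhd>\<^sub>a g) \<otimes>\<^sub>a Id C A) =
      scomp ?h ?r \<I> ?N \<cdot> mu ?U"
    using scomp_assoc[of "\<one>\<^bsub>G\<^esub>" k g t \<I> M A] by (simp add: mu_def)
  have FY: "Fa (mu \<I>) \<cdot> Y = scomp ?h ?r \<I> ?N \<cdot> e ?U"
    by (simp add: Y_def pre3[OF coh] mz)
  \<comment> \<open>The left half of (C2), transported through \<open>mu\<close>; \<open>ze\<close>
    is invertible, so it may be tested after composing with it.\<close>
  have lm: "(lam M \<lhd>\<^sub>a g) \<otimes>\<^sub>a Id C A = LUnit C ?N \<cdot> (Eta0 D ?h \<otimes>\<^sub>a Id C ?N) \<cdot> mu \<I>"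
  proof (rule iso_right_cancel[where a = "ze \<I>"])
    have "((lam M \<lhd>\<^sub>a g) \<otimes>\<^sub>a Id C A) \<cdot> ze \<I> = (LUnit C M \<lhd>\<^sub>a g) \<otimes>\<^sub>a Id C A"
      by (simp add: ze_def lam_def ten_collapse act_expand[symmetric])
    also have "\<dots> = LUnit C ?N \<cdot> (Eta0 D ?h \<otimes>\<^sub>a Id C ?N) \<cdot> e \<I>"
      by (simp add: e_def pre2[OF assoc_nat_left_id] pre2[OF lunit_ten] ten_collapse C2_left)
    finally show "((lam M \<lhd>\<^sub>a g) \<otimes>\<^sub>a Id C A) \<cdot> ze \<I> = (LUnit C ?N \<cdot> (Eta0 D ?h \<otimes>\<^sub>a Id C ?N) \<cdot> mu \<I>) \<cdot> ze \<I>"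
      by (simp add: mz)
  qed simp_all
  have "scomp g t M A \<cdot> ((ev_th k M \<lhd>\<^sub>a g) \<otimes>\<^sub>a Id C A) =
      scomp g t M A \<cdot> ((Fa (lam M) \<lhd>\<^sub>a g) \<otimes>\<^sub>a Id C A) \<cdot> ((scomp \<one>\<^bsub>G\<^esub> k \<I> M \<lhd>\<^sub>a g) \<otimes>\<^sub>a Id C A) \<cdot> ze ?U"
    by (simp add: ev_th_def ze_def ten_collapse_simps act_expand)
  also have "\<dots> = Fa ((lam M \<lhd>\<^sub>a g) \<otimes>\<^sub>a Id C A) \<cdot> Y"
    by (simp add: pre2[OF scomp_nat_left] Y_def)
  also have "\<dots> = Fa (LUnit C ?N \<cdot> (Eta0 D ?h \<otimes>\<^sub>a Id C ?N)) \<cdot> scomp ?h ?r \<I> ?N \<cdot> e ?U"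
    by (simp add: lm F_comp FY)
  \<comment> \<open>The component at k \<triangleright> g on the unit is traded for
    \<open>ev_th\<close> and \<open>ev_u\<close>.\<close>
  also have "\<dots> = (ev_th ?r ?N \<cdot> (ev_u ?h \<otimes>\<^sub>a Id C ?N)) \<cdot> e ?U"
    by (subst ev_th_ev_u) simp_all
  also have "\<dots> = ev_th ?r ?N \<cdot> sig ?U ev_u (g, t) M A"
    by (simp add: sig_def gam_homogeneous[OF eq, of _ k] e_def pre2[OF assoc_nat_left_id] ten_collapse)
  finally show ?thesis .
qed

lemma ev_th_natural: "hom_natural (\<lambda>M. Fo \<I> \<otimes>\<^sub>o M) (\<lambda>f. Id C (Fo \<I>) \<otimes>\<^sub>a f) Fo Fa ev_th"
proof -
  note [simp] = F_simps scomp_simps ev_u_simps ev_th_simps lam_simps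
  have "ev_th k B \<cdot> (Id C (Fo \<I>) \<otimes>\<^sub>a f) = Fa f \<cdot> ev_th k A"
    if k [simp]: "k \<in> carrier \<Gamma>" and A [simp]: "A \<in> Deg D k" and B [simp]: "B \<in> Deg D k" and f: "f \<in> Hom C A B" for k A B f
  proof -
    note [simp] = HomD[OF f] Hom_ob[OF f]
    have "lam B \<cdot> (Id C (\<I> \<lhd>\<^sub>o \<one>\<^bsub>G\<^esub>) \<otimes>\<^sub>a f) = LUnit C B \<cdot> (Id C \<I> \<otimes>\<^sub>a f) \<cdot> (inv_arr C (R0 D \<I>) \<otimes>\<^sub>a Id C A)"
      by (simp add: lam_def ten_collapse)
    also have "\<dots> = f \<cdot> lam A"
      by (simp add: lunit_nat_simps lam_def)
    finally have l: "Fa (lam B) \<cdot> Fa (Id C (\<I> \<lhd>\<^sub>o \<one>\<^bsub>G\<^esub>) \<otimes>\<^sub>a f) = Fa f \<cdot> Fa (lam A)"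
      by (simp add: F_comp[symmetric])
    have "ev_th k B \<cdot> (Id C (Fo \<I>) \<otimes>\<^sub>a f) = Fa (lam B) \<cdot> scomp \<one>\<^bsub>G\<^esub> k \<I> B \<cdot> (Id C (Fo \<I> \<lhd>\<^sub>o \<one>\<^bsub>G\<^esub>) \<otimes>\<^sub>a f) \<cdot> (R0 D (Fo \<I>) \<otimes>\<^sub>a Id C A)"
      by (simp add: ev_th_def ten_collapse)
    also have "\<dots> = Fa f \<cdot> ev_th k A"
      by (simp add: pre2[OF scomp_nat_right] pre2[OF l] ev_th_def)
    finally show ?thesis .
  qed
  then show ?thesis
    using ten_linear_functor[of "Fo \<I>"] RA.mf_linear[OF mf] by (auto simp: hom_natural_def intro!: HomI)
qed

definition theta :: "'o \<Rightarrow> 'm" where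
  "theta = extend (\<lambda>M. Fo \<I> \<otimes>\<^sub>o M) (\<lambda>f. Id C (Fo \<I>) \<otimes>\<^sub>a f) Fo Fa ev_th"

lemma
  assumes "M \<in> Ob C"
  shows is_iso_theta: "is_iso C (theta M)"
    and arr_theta: "theta M \<in> Arr C"
    and dom_theta: "Dom C (theta M) = Fo \<I> \<otimes>\<^sub>o M"
    and cod_theta: "Cod C (theta M) = Fo M"
  using extend_in[OF ev_th_natural assms] extend_iso[OF ev_th_natural is_iso_ev_th assms]
  by (simp_all add: theta_def Hom_def)

lemmas theta_simps = is_iso_theta arr_theta dom_theta cod_theta

lemma theta_nat: "f \<in> Arr C \<Longrightarrow> Cod C f = M \<Longrightarrow> theta M \<cdot> (Id C (Fo \<I>) \<otimes>\<^sub>a f) = Fa f \<cdot> theta (Dom C f)"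
  using extend_nat[OF ev_th_natural] by (simp add: theta_def)

lemma theta_homogeneous: "A \<in> Deg D k \<Longrightarrow> k \<in> carrier \<Gamma> \<Longrightarrow> theta A = ev_th k A"
  using extend_homogeneous[OF ev_th_natural] by (simp add: theta_def)

text \<open>Both sides are natural in \<open>M\<close>, so the homogeneous case
  \<open>ev_th_module\<close> on the graded summands of \<open>M\<close> suffices. \<open>A\<close>
  is homogeneous throughout.\<close>

lemma theta_module:
  assumes g [simp]: "g \<in> carrier G" and t [simp]: "t \<in> carrier \<Gamma>" and M [simp]: "M \<in> Ob C" and A [simp]: "A \<in> Deg D t"
  shows "scomp g t M A \<cdot> ((theta M \<lhd>\<^sub>a g) \<otimes>\<^sub>a Id C A) = theta ((M \<lhd>\<^sub>o g) \<otimes>\<^sub>o A) \<cdot> sig (Fo \<I>) ev_u (g, t) M A"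
proof -
  have Ao [simp]: "A \<in> Ob C"
    using deg_in_ob[OF A t] .
  note eq = ev_equivariant
  have I [simp]: "(g, t) \<in> Idx"
    by (simp add: mem_Sigma_iff)
  note [simp] = F_simps scomp_simps ev_u_simps ev_th_simps theta_simps sig_simps[OF eq]
  have U: "Fo \<I> \<in> Ob C"
    by simp
  show ?thesis
  proof (rule linear_functor_epi[OF linear_functor_comp[OF ten_act_linear[OF U g] ten_linear_functor_right[OF Ao]] M])
    fix k assume k [simp]: "k \<in> carrier \<Gamma>"
    let ?M = "comp_ob M k" and ?i = "comp_inj M k"
    have hom: "scomp g t ?M A \<cdot> ((theta ?M \<lhd>\<^sub>a g) \<otimes>\<^sub>a Id C A) = theta ((?M \<lhd>\<^sub>o g) \<otimes>\<^sub>o A) \<cdot> sig (Fo \<I>) ev_u (g, t) ?M A"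
      using ev_th_module[OF g k t comp_deg[OF M k] A] theta_homogeneous[OF comp_deg[OF M k] k]
        theta_homogeneous[of "(?M \<lhd>\<^sub>o g) \<otimes>\<^sub>o A" "(k \<triangleleft> g) \<otimes>\<^bsub>\<Gamma>\<^esub> t"] by simp
    have s: "sig (Fo \<I>) ev_u (g, t) M A \<cdot> (((Id C (Fo \<I>) \<otimes>\<^sub>a ?i) \<lhd>\<^sub>a g) \<otimes>\<^sub>a Id C A) =
        (Id C (Fo \<I>) \<otimes>\<^sub>a ((?i \<lhd>\<^sub>a g) \<otimes>\<^sub>a Id C A)) \<cdot> sig (Fo \<I>) ev_u (g, t) ?M A"
      using sig_nat[OF eq, of "(g, t)" ?i "Id C A"] by simp
    have "(scomp g t M A \<cdot> ((theta M \<lhd>\<^sub>a g) \<otimes>\<^sub>a Id C A)) \<cdot> (((Id C (Fo \<I>) \<otimes>\<^sub>a ?i) \<lhd>\<^sub>a g) \<otimes>\<^sub>a Id C A) =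
        scomp g t M A \<cdot> ((Fa ?i \<lhd>\<^sub>a g) \<otimes>\<^sub>a Id C A) \<cdot> ((theta ?M \<lhd>\<^sub>a g) \<otimes>\<^sub>a Id C A)"
      by (simp add: ten_collapse act_expand[symmetric] theta_nat)
    also have "\<dots> = Fa ((?i \<lhd>\<^sub>a g) \<otimes>\<^sub>a Id C A) \<cdot> theta ((?M \<lhd>\<^sub>o g) \<otimes>\<^sub>o A) \<cdot> sig (Fo \<I>) ev_u (g, t) ?M A"
      by (simp add: pre2[OF scomp_nat_left] hom)
    also have "\<dots> = (theta ((M \<lhd>\<^sub>o g) \<otimes>\<^sub>o A) \<cdot> sig (Fo \<I>) ev_u (g, t) M A) \<cdot> (((Id C (Fo \<I>) \<otimes>\<^sub>a ?i) \<lhd>\<^sub>a g) \<otimes>\<^sub>a Id C A)"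
      by (simp add: s pre2[OF theta_nat])
    finally show "(scomp g t M A \<cdot> ((theta M \<lhd>\<^sub>a g) \<otimes>\<^sub>a Id C A)) \<cdot> (((Id C (Fo \<I>) \<otimes>\<^sub>a ?i) \<lhd>\<^sub>a g) \<otimes>\<^sub>a Id C A) =
        (theta ((M \<lhd>\<^sub>o g) \<otimes>\<^sub>o A) \<cdot> sig (Fo \<I>) ev_u (g, t) M A) \<cdot> (((Id C (Fo \<I>) \<otimes>\<^sub>a ?i) \<lhd>\<^sub>a g) \<otimes>\<^sub>a Id C A)" .
  qed (auto intro!: HomI)
qed

text \<open>The module condition in components is \<open>theta_module\<close> with the two
  constraints inverted.\<close>

lemma Psi_essentially_surjective:
  "RA.is_module_natural (Psi (Fo \<I>, ev_u)) F (\<lambda>M\<in>Ob C. theta M)"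
proof -
  note eq = ev_equivariant
  note [simp] = F_simps scomp_simps ev_u_simps ev_th_simps theta_simps sig_simps[OF eq] cf_simps(7-10)[OF component_family_component[OF mf]]
  have "is_natural C C (fst (Psi (Fo \<I>, ev_u))) (fst (snd (Psi (Fo \<I>, ev_u)))) Fo Fa (\<lambda>M\<in>Ob C. theta M)"
    by (auto simp: is_natural_def Psi_sel Hom_def theta_nat)
  moreover have "component F p M A \<cdot> theta ((M \<lhd>\<^sub>o fst p) \<otimes>\<^sub>o A) =
      ((theta M \<lhd>\<^sub>a fst p) \<otimes>\<^sub>a Id C A) \<cdot> inv_arr C (sig (Fo \<I>) ev_u p M A)"
    if p [simp]: "p \<in> Idx" and M [simp]: "M \<in> Ob C" and A [simp]: "A \<in> Deg D (snd p)" for p M A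
  proof -
    have [simp]: "A \<in> Ob C"
      using deg_in_ob[of A "snd p"] by simp
    have "inv_arr C (component F p M A) \<cdot> ((theta M \<lhd>\<^sub>a fst p) \<otimes>\<^sub>a Id C A) =
        theta ((M \<lhd>\<^sub>o fst p) \<otimes>\<^sub>o A) \<cdot> sig (Fo \<I>) ev_u p M A"
      using theta_module[of "fst p" "snd p" M A] by (simp add: scomp_def)
    then have "inv_arr C (inv_arr C (component F p M A)) \<cdot> theta ((M \<lhd>\<^sub>o fst p) \<otimes>\<^sub>o A) =
        ((theta M \<lhd>\<^sub>a fst p) \<otimes>\<^sub>a Id C A) \<cdot> inv_arr C (sig (Fo \<I>) ev_u p M A)"
      by (rule inv_slide) simp_all
    then show ?thesis
      by simp
  qed
  ultimately show ?thesis
    using deg_in_ob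
    by (subst module_natural_components[OF Psi_endofunctor[OF eq] mf Psi_components[OF eq]
          component_family_component[OF mf] components_of_component[OF mf]]) simp_all
qed

end

end

section \<open>Inverting a fully faithful, essentially surjective monoidal functor\<close>

text \<open>The functor built above runs from the extension to the dual category, and its structure
  maps \<open>K\<close> run out of the image of a product. Both directions are opposite to those in
  the definition of tensor equivalence and are reversed here in the abstract.\<close>

locale tensor_comparison = A: linear_monoidal_category A + E: linear_monoidal_category E
  for A :: "('o, 'm, 'k::field, 'z) moncat_scheme" and E :: "('o2, 'm2, 'k, 'z2) moncat_scheme" +
  fixes Po :: "'o2 \<Rightarrow> 'o" and Pa :: "'m2 \<Rightarrow> 'm" and K :: "'o2 \<Rightarrow> 'o2 \<Rightarrow> 'm" and \<kappa> :: 'm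
  assumes P_linear: "is_linear_functor E A Po Pa"
    and P_faithful: "f \<in> Hom E X Y \<Longrightarrow> g \<in> Hom E X Y \<Longrightarrow> Pa f = Pa g \<Longrightarrow> f = g"
    and P_full: "X \<in> Ob E \<Longrightarrow> Y \<in> Ob E \<Longrightarrow> h \<in> Hom A (Po X) (Po Y) \<Longrightarrow> \<exists>f\<in>Hom E X Y. Pa f = h"
    and P_surj: "F \<in> Ob A \<Longrightarrow> \<exists>X\<in>Ob E. Iso A (Po X) F \<noteq> {}"
    and K_iso: "X \<in> Ob E \<Longrightarrow> Y \<in> Ob E \<Longrightarrow> K X Y \<in> Iso A (Po (X \<otimes>\<^sub>o\<^bsub>E\<^esub> Y)) (Po X \<otimes>\<^sub>o\<^bsub>A\<^esub> Po Y)"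
    and K_nat: "f \<in> Hom E X X' \<Longrightarrow> g \<in> Hom E Y Y' \<Longrightarrow>
      K X' Y' \<cdot>\<^bsub>A\<^esub> Pa (f \<otimes>\<^sub>a\<^bsub>E\<^esub> g) = (Pa f \<otimes>\<^sub>a\<^bsub>A\<^esub> Pa g) \<cdot>\<^bsub>A\<^esub> K X Y"
    and K_assoc: "X \<in> Ob E \<Longrightarrow> Y \<in> Ob E \<Longrightarrow> Z \<in> Ob E \<Longrightarrow>
      (Id A (Po X) \<otimes>\<^sub>a\<^bsub>A\<^esub> K Y Z) \<cdot>\<^bsub>A\<^esub> K X (Y \<otimes>\<^sub>o\<^bsub>E\<^esub> Z) \<cdot>\<^bsub>A\<^esub> Pa (Assoc E X Y Z) =
      Assoc A (Po X) (Po Y) (Po Z) \<cdot>\<^bsub>A\<^esub> (K X Y \<otimes>\<^sub>a\<^bsub>A\<^esub> Id A (Po Z)) \<cdot>\<^bsub>A\<^esub> K (X \<otimes>\<^sub>o\<^bsub>E\<^esub> Y) Z"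
    and \<kappa>_iso: "\<kappa> \<in> Iso A (Po (Unit E)) (Unit A)"
    and K_lunit: "X \<in> Ob E \<Longrightarrow>
      LUnit A (Po X) \<cdot>\<^bsub>A\<^esub> (\<kappa> \<otimes>\<^sub>a\<^bsub>A\<^esub> Id A (Po X)) \<cdot>\<^bsub>A\<^esub> K (Unit E) X = Pa (LUnit E X)"
    and K_runit: "X \<in> Ob E \<Longrightarrow>
      RUnit A (Po X) \<cdot>\<^bsub>A\<^esub> (Id A (Po X) \<otimes>\<^sub>a\<^bsub>A\<^esub> \<kappa>) \<cdot>\<^bsub>A\<^esub> K X (Unit E) = Pa (RUnit E X)"
begin

lemmas P_functor = E.linear_is_functor[OF P_linear]
lemmas P_simps [simp] = E.functor_simps(1-5)[OF P_functor]
lemmas P_comp = E.functor_comp[OF P_functor]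

definition R :: "'o \<Rightarrow> 'o2" where
  "R F = (SOME X. X \<in> Ob E \<and> Iso A (Po X) F \<noteq> {})"

definition eps :: "'o \<Rightarrow> 'm" where
  "eps F = (SOME e. e \<in> Iso A (Po (R F)) F)"

lemma R_spec:
  assumes "F \<in> Ob A"
  shows "R F \<in> Ob E" "eps F \<in> Iso A (Po (R F)) F"
proof -
  have "\<exists>X. X \<in> Ob E \<and> Iso A (Po X) F \<noteq> {}"
    using P_surj[OF assms] by blast
  from someI_ex[OF this] have R: "R F \<in> Ob E \<and> Iso A (Po (R F)) F \<noteq> {}"
    unfolding R_def .
  then show "R F \<in> Ob E" ..
  from R have "\<exists>e. e \<in> Iso A (Po (R F)) F"
    by blast
  from someI_ex[OF this] show "eps F \<in> Iso A (Po (R F)) F"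
    unfolding eps_def .
qed

lemma
  assumes "F \<in> Ob A"
  shows R_ob [simp]: "R F \<in> Ob E"
    and eps_iso [simp]: "is_iso A (eps F)"
    and eps_arr [simp]: "eps F \<in> Arr A"
    and eps_dom [simp]: "Dom A (eps F) = Po (R F)"
    and eps_cod [simp]: "Cod A (eps F) = F"
  using R_spec[OF assms] A.is_iso_arr by (auto simp: A.Iso_iff)

lemma
  assumes "X \<in> Ob E" "Y \<in> Ob E"
  shows K_is_iso [simp]: "is_iso A (K X Y)"
    and K_arr [simp]: "K X Y \<in> Arr A"
    and K_dom [simp]: "Dom A (K X Y) = Po (X \<otimes>\<^sub>o\<^bsub>E\<^esub> Y)"
    and K_cod [simp]: "Cod A (K X Y) = Po X \<otimes>\<^sub>o\<^bsub>A\<^esub> Po Y"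
  using K_iso[OF assms] A.is_iso_arr by (auto simp: A.Iso_iff)

lemma \<kappa>_simps [simp]: "is_iso A \<kappa>" "\<kappa> \<in> Arr A" "Dom A \<kappa> = Po (Unit E)" "Cod A \<kappa> = Unit A"
  using \<kappa>_iso A.is_iso_arr by (auto simp: A.Iso_iff)

lemma K_nat_arr: "f \<in> Arr E \<Longrightarrow> g \<in> Arr E \<Longrightarrow> Cod E f = X \<Longrightarrow> Cod E g = Y \<Longrightarrow>
    K X Y \<cdot>\<^bsub>A\<^esub> Pa (f \<otimes>\<^sub>a\<^bsub>E\<^esub> g) = (Pa f \<otimes>\<^sub>a\<^bsub>A\<^esub> Pa g) \<cdot>\<^bsub>A\<^esub> K (Dom E f) (Dom E g)"
  by (rule K_nat) (auto simp: Hom_def)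

definition lift :: "'o2 \<Rightarrow> 'o2 \<Rightarrow> 'm \<Rightarrow> 'm2" where
  "lift X Y h = (SOME f. f \<in> Hom E X Y \<and> Pa f = h)"

lemma lift_spec:
  assumes "X \<in> Ob E" "Y \<in> Ob E" "h \<in> Hom A (Po X) (Po Y)"
  shows "lift X Y h \<in> Hom E X Y" "Pa (lift X Y h) = h"
proof -
  have "\<exists>f. f \<in> Hom E X Y \<and> Pa f = h"
    using P_full[OF assms] by blast
  from someI_ex[OF this] show "lift X Y h \<in> Hom E X Y" "Pa (lift X Y h) = h"
    unfolding lift_def by auto
qed

lemma lift_iso:
  assumes X: "X \<in> Ob E" "Y \<in> Ob E" and h: "h \<in> Hom A (Po X) (Po Y)" "is_iso A h"
  shows "lift X Y h \<in> Iso E X Y"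
proof -
  have h': "inv_arr A h \<in> Hom A (Po Y) (Po X)"
    using h by (auto simp: Hom_def)
  note l = lift_spec[OF X h(1)] and l' = lift_spec[OF X(2,1) h']
  note [simp] = HomD[OF l(1)] HomD[OF l'(1)] HomD[OF h(1)] X h(2)
  have "is_iso E (lift X Y h)"
  proof (rule E.is_isoI[OF l(1) l'(1)])
    show "lift Y X (inv_arr A h) \<cdot>\<^bsub>E\<^esub> lift X Y h = Id E X"
      by (rule P_faithful[of _ X X]) (simp_all add: Hom_def P_comp l(2) l'(2))
    show "lift X Y h \<cdot>\<^bsub>E\<^esub> lift Y X (inv_arr A h) = Id E Y"
      by (rule P_faithful[of _ Y Y]) (simp_all add: Hom_def P_comp l(2) l'(2))
  qed
  then show ?thesis
    by (simp add: E.Iso_iff)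
qed

section \<open>The quasi-inverse and its structure maps\<close>

definition Ra :: "'m \<Rightarrow> 'm2" where
  "Ra f = lift (R (Dom A f)) (R (Cod A f)) (inv_arr A (eps (Cod A f)) \<cdot>\<^bsub>A\<^esub> f \<cdot>\<^bsub>A\<^esub> eps (Dom A f))"

text \<open>The lift that makes \<open>eps\<close> compatible with the tensor structures, when
  \<open>K\<close> is used on the side of \<open>Po\<close>.\<close>

definition J :: "'o \<Rightarrow> 'o \<Rightarrow> 'm2" where
  "J F H = lift (R F \<otimes>\<^sub>o\<^bsub>E\<^esub> R H) (R (F \<otimes>\<^sub>o\<^bsub>A\<^esub> H))
     (inv_arr A (eps (F \<otimes>\<^sub>o\<^bsub>A\<^esub> H)) \<cdot>\<^bsub>A\<^esub> (eps F \<otimes>\<^sub>a\<^bsub>A\<^esub> eps H) \<cdot>\<^bsub>A\<^esub> K (R F) (R H))"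

definition J0 :: "'m2" where
  "J0 = lift (Unit E) (R (Unit A)) (inv_arr A (eps (Unit A)) \<cdot>\<^bsub>A\<^esub> \<kappa>)"

lemma
  assumes [simp]: "f \<in> Arr A"
  shows Ra_arr [simp]: "Ra f \<in> Arr E"
    and Ra_dom [simp]: "Dom E (Ra f) = R (Dom A f)"
    and Ra_cod [simp]: "Cod E (Ra f) = R (Cod A f)"
    and P_Ra: "Pa (Ra f) = inv_arr A (eps (Cod A f)) \<cdot>\<^bsub>A\<^esub> f \<cdot>\<^bsub>A\<^esub> eps (Dom A f)"
proof -
  have h: "inv_arr A (eps (Cod A f)) \<cdot>\<^bsub>A\<^esub> f \<cdot>\<^bsub>A\<^esub> eps (Dom A f) \<in> Hom A (Po (R (Dom A f))) (Po (R (Cod A f)))"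
    by (simp add: Hom_def)
  show "Ra f \<in> Arr E" "Dom E (Ra f) = R (Dom A f)" "Cod E (Ra f) = R (Cod A f)"
    "Pa (Ra f) = inv_arr A (eps (Cod A f)) \<cdot>\<^bsub>A\<^esub> f \<cdot>\<^bsub>A\<^esub> eps (Dom A f)"
    using lift_spec[OF _ _ h] unfolding Ra_def by (simp_all add: Hom_def)
qed

lemma
  assumes [simp]: "F \<in> Ob A" "H \<in> Ob A"
  shows J_Iso: "J F H \<in> Iso E (R F \<otimes>\<^sub>o\<^bsub>E\<^esub> R H) (R (F \<otimes>\<^sub>o\<^bsub>A\<^esub> H))"
    and J_arr [simp]: "J F H \<in> Arr E"
    and J_dom [simp]: "Dom E (J F H) = R F \<otimes>\<^sub>o\<^bsub>E\<^esub> R H"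
    and J_cod [simp]: "Cod E (J F H) = R (F \<otimes>\<^sub>o\<^bsub>A\<^esub> H)"
    and P_J: "Pa (J F H) = inv_arr A (eps (F \<otimes>\<^sub>o\<^bsub>A\<^esub> H)) \<cdot>\<^bsub>A\<^esub> (eps F \<otimes>\<^sub>a\<^bsub>A\<^esub> eps H) \<cdot>\<^bsub>A\<^esub> K (R F) (R H)"
proof -
  let ?h = "inv_arr A (eps (F \<otimes>\<^sub>o\<^bsub>A\<^esub> H)) \<cdot>\<^bsub>A\<^esub> (eps F \<otimes>\<^sub>a\<^bsub>A\<^esub> eps H) \<cdot>\<^bsub>A\<^esub> K (R F) (R H)"
  have h: "?h \<in> Hom A (Po (R F \<otimes>\<^sub>o\<^bsub>E\<^esub> R H)) (Po (R (F \<otimes>\<^sub>o\<^bsub>A\<^esub> H)))" and i: "is_iso A ?h"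
    by (simp_all add: Hom_def)
  show "J F H \<in> Iso E (R F \<otimes>\<^sub>o\<^bsub>E\<^esub> R H) (R (F \<otimes>\<^sub>o\<^bsub>A\<^esub> H))"
    unfolding J_def by (rule lift_iso[OF _ _ h i]) simp_all
  show "J F H \<in> Arr E" "Dom E (J F H) = R F \<otimes>\<^sub>o\<^bsub>E\<^esub> R H" "Cod E (J F H) = R (F \<otimes>\<^sub>o\<^bsub>A\<^esub> H)" "Pa (J F H) = ?h"
    using lift_spec[OF _ _ h] unfolding J_def by (simp_all add: Hom_def)
qed

lemma
  shows J0_Iso: "J0 \<in> Iso E (Unit E) (R (Unit A))"
    and J0_arr [simp]: "J0 \<in> Arr E" "Dom E J0 = Unit E" "Cod E J0 = R (Unit A)"
    and P_J0: "Pa J0 = inv_arr A (eps (Unit A)) \<cdot>\<^bsub>A\<^esub> \<kappa>"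
proof -
  let ?h = "inv_arr A (eps (Unit A)) \<cdot>\<^bsub>A\<^esub> \<kappa>"
  have h: "?h \<in> Hom A (Po (Unit E)) (Po (R (Unit A)))" and i: "is_iso A ?h"
    by (simp_all add: Hom_def)
  show "J0 \<in> Iso E (Unit E) (R (Unit A))"
    unfolding J0_def by (rule lift_iso[OF _ _ h i]) simp_all
  show "J0 \<in> Arr E" "Dom E J0 = Unit E" "Cod E J0 = R (Unit A)" "Pa J0 = ?h"
    using lift_spec[OF _ _ h] unfolding J0_def by (simp_all add: Hom_def)
qed

text \<open>Faithfulness in the form used for the axioms of the quasi-inverse: equations are pushed
  through \<open>Pa\<close>, where everything is explicit in terms of \<open>eps\<close> and
  \<open>K\<close>.\<close>

lemma P_eqI:
  "f \<in> Arr E \<Longrightarrow> g \<in> Arr E \<Longrightarrow> Dom E f = Dom E g \<Longrightarrow> Cod E f = Cod E g \<Longrightarrow> Pa f = Pa g \<Longrightarrow> f = g"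
  using P_faithful[of f "Dom E f" "Cod E f" g] by (simp add: Hom_def)

lemma R_functor: "is_functor A E R Ra"
  unfolding is_functor_def
proof (intro conjI ballI allI)
  show "Ra (Id A X) = Id E (R X)" if [simp]: "X \<in> Ob A" for X
    by (rule P_eqI) (simp_all add: P_Ra)
  show "Ra (g \<cdot>\<^bsub>A\<^esub> f) = Ra g \<cdot>\<^bsub>E\<^esub> Ra f" if "f \<in> Hom A X Y" "g \<in> Hom A Y Z" for f g X Y Z
  proof -
    note [simp] = HomD[OF that(1)] HomD[OF that(2)] A.Hom_ob[OF that(1)] A.Hom_ob[OF that(2)]
    show ?thesis
      by (rule P_eqI) (simp_all add: P_Ra P_comp)
  qed
qed (auto simp: Hom_def)

lemma R_linear: "is_linear_functor A E R Ra"
  unfolding is_linear_functor_def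
proof (intro conjI ballI allI)
  fix X Y f assume f: "f \<in> Hom A X Y"
  note [simp] = HomD[OF f] A.Hom_ob[OF f]
  have e: "eps X \<in> Hom A (Po (R X)) X" "inv_arr A (eps Y) \<in> Hom A Y (Po (R Y))"
    by (simp_all add: Hom_def)
  have c: "h \<cdot>\<^bsub>A\<^esub> eps X \<in> Hom A (Po (R X)) Y" if "h \<in> Hom A X Y" for h
    using A.comp_in[OF e(1) that] .
  have Rf: "Ra h \<in> Hom E (R X) (R Y)" if "h \<in> Hom A X Y" for h
    using HomD[OF that] by (simp add: Hom_def)
  show "Ra (Plus A f g) = Plus E (Ra f) (Ra g)" if g: "g \<in> Hom A X Y" for g
  proof -
    note [simp] = HomD[OF g] HomD[OF A.plus_in[OF f g]] HomD[OF E.plus_in[OF Rf[OF f] Rf[OF g]]]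
    show ?thesis
      by (rule P_eqI)
        (simp_all add: P_Ra E.linear_functor_plus[OF P_linear Rf[OF f] Rf[OF g]]
          A.comp_plus_left[OF e(1) f g] A.comp_plus_right[OF c[OF f] c[OF g] e(2)])
  qed
  show "Ra (Scale A x f) = Scale E x (Ra f)" for x
  proof -
    have s: "Pa (Scale E x (Ra f)) = Scale A x (Pa (Ra f))"
      using P_linear Rf[OF f] unfolding is_linear_functor_def by blast
    note [simp] = HomD[OF A.scale_in[OF f]] HomD[OF E.scale_in[OF Rf[OF f]]]
    show ?thesis
      by (rule P_eqI) (simp_all add: P_Ra s A.comp_scale_left[OF e(1) f] A.comp_scale_right[OF c[OF f] e(2)])
  qed
qed (rule R_functor)

text \<open>Naturality of \<open>K\<close> takes \<open>J\<close> out of the image of a tensor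
  product, and the adjacent \<open>eps\<close> cancels. With \<open>P_J_right\<close> this reduces
  associativity of \<open>J\<close> to that of \<open>K\<close>.\<close>

lemma P_J_left:
  assumes [simp]: "F \<in> Ob A" "G \<in> Ob A" "H \<in> Ob A"
  shows "(eps (F \<otimes>\<^sub>o\<^bsub>A\<^esub> G) \<otimes>\<^sub>a\<^bsub>A\<^esub> eps H) \<cdot>\<^bsub>A\<^esub> K (R (F \<otimes>\<^sub>o\<^bsub>A\<^esub> G)) (R H) \<cdot>\<^bsub>A\<^esub> Pa (J F G \<otimes>\<^sub>a\<^bsub>E\<^esub> Id E (R H)) =
    (eps F \<otimes>\<^sub>a\<^bsub>A\<^esub> eps G \<otimes>\<^sub>a\<^bsub>A\<^esub> eps H) \<cdot>\<^bsub>A\<^esub> (K (R F) (R G) \<otimes>\<^sub>a\<^bsub>A\<^esub> Id A (Po (R H))) \<cdot>\<^bsub>A\<^esub> K (R F \<otimes>\<^sub>o\<^bsub>E\<^esub> R G) (R H)"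
  by (simp add: K_nat_arr P_J A.ten_collapse_simps)

lemma P_J_right:
  assumes [simp]: "F \<in> Ob A" "G \<in> Ob A" "H \<in> Ob A"
  shows "(eps F \<otimes>\<^sub>a\<^bsub>A\<^esub> eps (G \<otimes>\<^sub>o\<^bsub>A\<^esub> H)) \<cdot>\<^bsub>A\<^esub> K (R F) (R (G \<otimes>\<^sub>o\<^bsub>A\<^esub> H)) \<cdot>\<^bsub>A\<^esub> Pa (Id E (R F) \<otimes>\<^sub>a\<^bsub>E\<^esub> J G H) =
    (eps F \<otimes>\<^sub>a\<^bsub>A\<^esub> (eps G \<otimes>\<^sub>a\<^bsub>A\<^esub> eps H)) \<cdot>\<^bsub>A\<^esub> (Id A (Po (R F)) \<otimes>\<^sub>a\<^bsub>A\<^esub> K (R G) (R H)) \<cdot>\<^bsub>A\<^esub> K (R F) (R G \<otimes>\<^sub>o\<^bsub>E\<^esub> R H)"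
  by (simp add: K_nat_arr P_J A.ten_collapse_simps)

lemma R_monoidal: "is_monoidal_functor A E R Ra J J0"
  unfolding is_monoidal_functor_def
proof (intro conjI ballI allI)
  show "is_functor A E R Ra" "J0 \<in> Iso E (Unit E) (R (Unit A))"
    by (rule R_functor, rule J0_Iso)
  show "J X Y \<in> Iso E (R X \<otimes>\<^sub>o\<^bsub>E\<^esub> R Y) (R (X \<otimes>\<^sub>o\<^bsub>A\<^esub> Y))" if "X \<in> Ob A" "Y \<in> Ob A" for X Y
    using J_Iso[OF that] .
  show "J X' Y' \<cdot>\<^bsub>E\<^esub> (Ra f \<otimes>\<^sub>a\<^bsub>E\<^esub> Ra g) = Ra (f \<otimes>\<^sub>a\<^bsub>A\<^esub> g) \<cdot>\<^bsub>E\<^esub> J X Y"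
    if "f \<in> Hom A X X'" "g \<in> Hom A Y Y'" for X X' Y Y' f g
  proof -
    note [simp] = HomD[OF that(1)] HomD[OF that(2)] A.Hom_ob[OF that(1)] A.Hom_ob[OF that(2)]
    show ?thesis
      by (rule P_eqI) (simp_all add: P_comp P_J P_Ra K_nat_arr A.ten_collapse_simps)
  qed
  show "Ra (Assoc A X Y Z) \<cdot>\<^bsub>E\<^esub> J (X \<otimes>\<^sub>o\<^bsub>A\<^esub> Y) Z \<cdot>\<^bsub>E\<^esub> (J X Y \<otimes>\<^sub>a\<^bsub>E\<^esub> Id E (R Z)) =
        J X (Y \<otimes>\<^sub>o\<^bsub>A\<^esub> Z) \<cdot>\<^bsub>E\<^esub> (Id E (R X) \<otimes>\<^sub>a\<^bsub>E\<^esub> J Y Z) \<cdot>\<^bsub>E\<^esub> Assoc E (R X) (R Y) (R Z)"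
    if [simp]: "X \<in> Ob A" "Y \<in> Ob A" "Z \<in> Ob A" for X Y Z
  proof (rule P_eqI)
    let ?e = "inv_arr A (eps (X \<otimes>\<^sub>o\<^bsub>A\<^esub> (Y \<otimes>\<^sub>o\<^bsub>A\<^esub> Z)))"
    have "Pa (Ra (Assoc A X Y Z) \<cdot>\<^bsub>E\<^esub> J (X \<otimes>\<^sub>o\<^bsub>A\<^esub> Y) Z \<cdot>\<^bsub>E\<^esub> (J X Y \<otimes>\<^sub>a\<^bsub>E\<^esub> Id E (R Z))) =
        ?e \<cdot>\<^bsub>A\<^esub> Assoc A X Y Z \<cdot>\<^bsub>A\<^esub> (eps (X \<otimes>\<^sub>o\<^bsub>A\<^esub> Y) \<otimes>\<^sub>a\<^bsub>A\<^esub> eps Z) \<cdot>\<^bsub>A\<^esub> K (R (X \<otimes>\<^sub>o\<^bsub>A\<^esub> Y)) (R Z) \<cdot>\<^bsub>A\<^esub>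
          Pa (J X Y \<otimes>\<^sub>a\<^bsub>E\<^esub> Id E (R Z))"
      by (simp add: P_comp P_Ra P_J[of "X \<otimes>\<^sub>o\<^bsub>A\<^esub> Y" Z])
    also have "\<dots> = ?e \<cdot>\<^bsub>A\<^esub> (eps X \<otimes>\<^sub>a\<^bsub>A\<^esub> (eps Y \<otimes>\<^sub>a\<^bsub>A\<^esub> eps Z)) \<cdot>\<^bsub>A\<^esub> Assoc A (Po (R X)) (Po (R Y)) (Po (R Z)) \<cdot>\<^bsub>A\<^esub>
        (K (R X) (R Y) \<otimes>\<^sub>a\<^bsub>A\<^esub> Id A (Po (R Z))) \<cdot>\<^bsub>A\<^esub> K (R X \<otimes>\<^sub>o\<^bsub>E\<^esub> R Y) (R Z)"
      by (simp add: P_J_left A.assoc_nat_simps)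
    \<comment> \<open>The three copies of \<open>eps\<close> have been moved past the associator,
      and \<open>K_assoc\<close> applies to what follows them.\<close>
    also have "\<dots> = ?e \<cdot>\<^bsub>A\<^esub> ((eps X \<otimes>\<^sub>a\<^bsub>A\<^esub> (eps Y \<otimes>\<^sub>a\<^bsub>A\<^esub> eps Z)) \<cdot>\<^bsub>A\<^esub>
        (Id A (Po (R X)) \<otimes>\<^sub>a\<^bsub>A\<^esub> K (R Y) (R Z)) \<cdot>\<^bsub>A\<^esub> K (R X) (R Y \<otimes>\<^sub>o\<^bsub>E\<^esub> R Z)) \<cdot>\<^bsub>A\<^esub> Pa (Assoc E (R X) (R Y) (R Z))"
      by (simp add: K_assoc[symmetric])
    also have "\<dots> = Pa (J X (Y \<otimes>\<^sub>o\<^bsub>A\<^esub> Z) \<cdot>\<^bsub>E\<^esub> (Id E (R X) \<otimes>\<^sub>a\<^bsub>E\<^esub> J Y Z) \<cdot>\<^bsub>E\<^esub> Assoc E (R X) (R Y) (R Z))"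
      unfolding P_J_right[OF that, symmetric] by (simp add: P_comp P_J[of X "Y \<otimes>\<^sub>o\<^bsub>A\<^esub> Z"])
    finally show "Pa (Ra (Assoc A X Y Z) \<cdot>\<^bsub>E\<^esub> J (X \<otimes>\<^sub>o\<^bsub>A\<^esub> Y) Z \<cdot>\<^bsub>E\<^esub> (J X Y \<otimes>\<^sub>a\<^bsub>E\<^esub> Id E (R Z))) =
        Pa (J X (Y \<otimes>\<^sub>o\<^bsub>A\<^esub> Z) \<cdot>\<^bsub>E\<^esub> (Id E (R X) \<otimes>\<^sub>a\<^bsub>E\<^esub> J Y Z) \<cdot>\<^bsub>E\<^esub> Assoc E (R X) (R Y) (R Z))" .
  qed simp_all
  show "Ra (LUnit A X) \<cdot>\<^bsub>E\<^esub> J (Unit A) X \<cdot>\<^bsub>E\<^esub> (J0 \<otimes>\<^sub>a\<^bsub>E\<^esub> Id E (R X)) = LUnit E (R X)"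
    if [simp]: "X \<in> Ob A" for X
  proof (rule P_eqI)
    have "Pa (Ra (LUnit A X) \<cdot>\<^bsub>E\<^esub> J (Unit A) X \<cdot>\<^bsub>E\<^esub> (J0 \<otimes>\<^sub>a\<^bsub>E\<^esub> Id E (R X))) =
        inv_arr A (eps X) \<cdot>\<^bsub>A\<^esub> LUnit A X \<cdot>\<^bsub>A\<^esub> (Id A (Unit A) \<otimes>\<^sub>a\<^bsub>A\<^esub> eps X) \<cdot>\<^bsub>A\<^esub> (\<kappa> \<otimes>\<^sub>a\<^bsub>A\<^esub> Id A (Po (R X))) \<cdot>\<^bsub>A\<^esub> K (Unit E) (R X)"
      by (simp add: P_comp P_Ra P_J K_nat_arr P_J0 A.ten_collapse_simps)
    then show "Pa (Ra (LUnit A X) \<cdot>\<^bsub>E\<^esub> J (Unit A) X \<cdot>\<^bsub>E\<^esub> (J0 \<otimes>\<^sub>a\<^bsub>E\<^esub> Id E (R X))) = Pa (LUnit E (R X))"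
      by (simp add: A.lunit_nat_simps K_lunit)
  qed simp_all
  show "Ra (RUnit A X) \<cdot>\<^bsub>E\<^esub> J X (Unit A) \<cdot>\<^bsub>E\<^esub> (Id E (R X) \<otimes>\<^sub>a\<^bsub>E\<^esub> J0) = RUnit E (R X)"
    if [simp]: "X \<in> Ob A" for X
  proof (rule P_eqI)
    have "Pa (Ra (RUnit A X) \<cdot>\<^bsub>E\<^esub> J X (Unit A) \<cdot>\<^bsub>E\<^esub> (Id E (R X) \<otimes>\<^sub>a\<^bsub>E\<^esub> J0)) =
        inv_arr A (eps X) \<cdot>\<^bsub>A\<^esub> RUnit A X \<cdot>\<^bsub>A\<^esub> (eps X \<otimes>\<^sub>a\<^bsub>A\<^esub> Id A (Unit A)) \<cdot>\<^bsub>A\<^esub> (Id A (Po (R X)) \<otimes>\<^sub>a\<^bsub>A\<^esub> \<kappa>) \<cdot>\<^bsub>A\<^esub> K (R X) (Unit E)"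
      by (simp add: P_comp P_Ra P_J K_nat_arr P_J0 A.ten_collapse_simps)
    then show "Pa (Ra (RUnit A X) \<cdot>\<^bsub>E\<^esub> J X (Unit A) \<cdot>\<^bsub>E\<^esub> (Id E (R X) \<otimes>\<^sub>a\<^bsub>E\<^esub> J0)) = Pa (RUnit E (R X))"
      by (simp add: A.runit_nat_simps K_runit)
  qed simp_all
qed

lemma R_equivalence: "is_equivalence A E R Ra"
proof -
  \<comment> \<open>The map \<open>eps\<close> at \<open>Po X\<close> goes between two objects in
    the image of \<open>Po\<close>, so fullness lifts it to an arrow of E.\<close>
  let ?\<tau> = "\<lambda>X. lift (R (Po X)) X (eps (Po X))"
  have t: "?\<tau> X \<in> Hom E (R (Po X)) X" "Pa (?\<tau> X) = eps (Po X)" "?\<tau> X \<in> Iso E (R (Po X)) X" if [simp]: "X \<in> Ob E" for X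
  proof -
    have h: "eps (Po X) \<in> Hom A (Po (R (Po X))) (Po X)" "is_iso A (eps (Po X))"
      by (simp_all add: Hom_def)
    show "?\<tau> X \<in> Hom E (R (Po X)) X" "Pa (?\<tau> X) = eps (Po X)" "?\<tau> X \<in> Iso E (R (Po X)) X"
      using lift_spec[OF _ _ h(1)] lift_iso[OF _ _ h] by simp_all
  qed
  have "is_natural_iso A A id id (Po \<circ> R) (Pa \<circ> Ra) (\<lambda>X. inv_arr A (eps X))"
    by (auto simp: is_natural_iso_def is_natural_def Hom_def P_Ra)
  moreover have "is_natural_iso E E (R \<circ> Po) (Ra \<circ> Pa) id id ?\<tau>"
    unfolding is_natural_iso_def is_natural_def
  proof (intro conjI ballI allI)
    fix X Y f assume f: "f \<in> Hom E X Y"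
    note [simp] = HomD[OF f] E.Hom_ob[OF f] HomD[OF t(1)]
    have "?\<tau> Y \<cdot>\<^bsub>E\<^esub> Ra (Pa f) = f \<cdot>\<^bsub>E\<^esub> ?\<tau> X"
      by (rule P_eqI) (simp_all add: P_comp t(2) P_Ra)
    then show "?\<tau> Y \<cdot>\<^bsub>E\<^esub> (Ra \<circ> Pa) f = id f \<cdot>\<^bsub>E\<^esub> ?\<tau> X"
      by simp
  qed (use t in \<open>auto simp: Iso_def\<close>)
  ultimately show ?thesis
    unfolding is_equivalence_def using R_functor P_functor by blast
qed

lemma tensor_equivalence: "tensor_equivalent A E"
  unfolding tensor_equivalent_def
  using A.linear_monoidal_category_axioms E.linear_monoidal_category_axioms R_linear R_monoidal R_equivalence
  by blast

end

section \<open>The tensor equivalence\<close>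

context finite_crossed_action
begin

section \<open>The comparison functor with its tensor structure\<close>

definition Psi_arr where
  "Psi_arr = (\<lambda>(W, f, W'). (Psi W, \<lambda>M\<in>Ob C. f \<otimes>\<^sub>a Id C M, Psi W'))"

definition Psi_ten where
  "Psi_ten W W' = (Psi (ext_tensor W W'), \<lambda>M\<in>Ob C. Assoc C (fst W) (fst W') M, RA.modfun_comp (Psi W) (Psi W'))"

definition Psi_one where
  "Psi_one = (Psi ext_unit, \<lambda>M\<in>Ob C. LUnit C M, RA.modfun_id)"

lemma Psi_arr_apply [simp]: "Psi_arr (W, f, W') = (Psi W, \<lambda>M\<in>Ob C. f \<otimes>\<^sub>a Id C M, Psi W')"
  by (simp add: Psi_arr_def)

lemma Psi_arr_natural:
  assumes "is_equivariant W" "is_equivariant W'" "is_equivariant_arr W W' f"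
  shows "RA.is_module_natural (Psi W) (Psi W') (\<lambda>M\<in>Ob C. f \<otimes>\<^sub>a Id C M)"
  using assms Psi_natural by (cases W; cases W') blast

lemma Psi_linear: "is_linear_functor crossed_extension RA.dual_category Psi Psi_arr"
proof -
  have "is_functor crossed_extension RA.dual_category Psi Psi_arr"
    unfolding is_functor_def
  proof (intro conjI allI ballI)
    fix W W' W'' p q
    show "W \<in> Ob crossed_extension \<Longrightarrow> Psi W \<in> Ob RA.dual_category"
      by (simp add: Psi_endofunctor)
    show "p \<in> Hom crossed_extension W W' \<Longrightarrow> Psi_arr p \<in> Hom RA.dual_category (Psi W) (Psi W')"
      by (elim ext_HomE) (simp add: RA.dual_Hom Psi_endofunctor Psi_arr_natural)
    show "W \<in> Ob crossed_extension \<Longrightarrow> Psi_arr (Id crossed_extension W) = Id RA.dual_category (Psi W)"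
      by (auto simp: Psi_sel intro!: restrict_cong_on)
    show "p \<in> Hom crossed_extension W W' \<Longrightarrow> q \<in> Hom crossed_extension W' W'' \<Longrightarrow>
        Psi_arr (Comp crossed_extension q p) = Comp RA.dual_category (Psi_arr q) (Psi_arr p)"
      by (elim ext_HomE) (auto simp: Hom_def ten_collapse intro!: restrict_cong_on)
  qed
  moreover have "Psi_arr (Plus crossed_extension p q) = Plus RA.dual_category (Psi_arr p) (Psi_arr q)"
    if "p \<in> Hom crossed_extension W W'" "q \<in> Hom crossed_extension W W'" for W W' p q
    using that by (elim ext_HomE) (auto intro!: restrict_cong_on ten_plus_left id_in)
  moreover have "Psi_arr (Scale crossed_extension x p) = Scale RA.dual_category x (Psi_arr p)"
    if "p \<in> Hom crossed_extension W W'" for W W' p x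
    using that by (elim ext_HomE) (auto intro!: restrict_cong_on ten_scale_left id_in)
  ultimately show ?thesis
    unfolding is_linear_functor_def by blast
qed

text \<open>At each object of C the structure maps are associators and left unit constraints of C,
  so the monoidal identities reduce to the pentagon, to \<open>lunit_ten\<close> and to the
  triangle.\<close>

theorem Psi_tensor_comparison:
  "tensor_comparison RA.dual_category crossed_extension Psi Psi_arr Psi_ten Psi_one"
proof (intro tensor_comparison.intro tensor_comparison_axioms.intro RA.dual_category_monoidal
    crossed_extension_monoidal Psi_linear)
  let ?A = RA.dual_category and ?E = crossed_extension
  note [simp] = Psi_endofunctor RA.modfun_comp_in RA.modfun_id_in ext_unit_equivariant
  show "p = q" if p: "p \<in> Hom ?E W W'" and q: "q \<in> Hom ?E W W'" and e: "Psi_arr p = Psi_arr q" for p q W W'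
  proof -
    obtain f h where f: "p = (W, f, W')" "f \<in> Hom C (fst W) (fst W')"
      and h: "q = (W, h, W')" "h \<in> Hom C (fst W) (fst W')"
      using p q by (elim ext_HomE)
    \<comment> \<open>Evaluation at the unit detects equality, because tensoring with the unit on
      the right is faithful.\<close>
    have "(\<lambda>M\<in>Ob C. f \<otimes>\<^sub>a Id C M) \<I> = (\<lambda>M\<in>Ob C. h \<otimes>\<^sub>a Id C M) \<I>"
      using e by (simp only: f h Psi_arr_apply prod.inject)
    then have "f = h"
      using ten_unit_faithful[OF _ f(2) h(2)] by simp
    then show ?thesis
      by (simp add: f h)
  qed
  show "\<exists>p\<in>Hom ?E W W'. Psi_arr p = t"
    if "W \<in> Ob ?E" "W' \<in> Ob ?E" and t: "t \<in> Hom ?A (Psi W) (Psi W')" for W W' t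
  proof -
    obtain U u V v where W: "W = (U, u)" "W' = (V, v)"
      by (cases W; cases W') auto
    have eq: "is_equivariant (U, u)" "is_equivariant (V, v)"
      using that W by auto
    obtain \<tau> where \<tau>: "t = (Psi W, \<tau>, Psi W')" "RA.is_module_natural (Psi (U, u)) (Psi (V, v)) \<tau>"
      using t by (auto simp: W elim: RA.dual_HomE)
    note full = Psi_full[OF eq \<tau>(2)]
    show ?thesis
      by (rule bexI[of _ "(W, RUnit C V \<cdot> \<tau> \<I> \<cdot> inv_arr C (RUnit C U), W')"])
        (use full eq in \<open>simp_all add: W \<tau>(1) ext_Hom\<close>)
  qed
  show "\<exists>W\<in>Ob ?E. Iso ?A (Psi W) F \<noteq> {}" if "F \<in> Ob ?A" for F
  proof -
    have F: "RA.is_module_endofunctor F"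
      using that by simp
    have "(Psi (fst F \<I>, ev_u F), \<lambda>M\<in>Ob C. theta F M, F) \<in> Iso ?A (Psi (fst F \<I>, ev_u F)) F"
      by (rule RA.dual_IsoI) (simp_all add: F ev_equivariant[OF F] Psi_essentially_surjective[OF F] is_iso_theta[OF F])
    then show ?thesis
      using ev_equivariant[OF F] by auto
  qed
  show "Psi_ten W W' \<in> Iso ?A (Psi (TenO ?E W W')) (TenO ?A (Psi W) (Psi W'))"
    if "W \<in> Ob ?E" "W' \<in> Ob ?E" for W W'
  proof -
    have eq: "is_equivariant W" "is_equivariant W'"
      using that by simp_all
    then have "RA.is_module_natural (Psi (ext_tensor W W')) (RA.modfun_comp (Psi W) (Psi W'))
        (\<lambda>M\<in>Ob C. Assoc C (fst W) (fst W') M)"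
      using Psi_tensor_natural[of "fst W" "snd W" "fst W'" "snd W'"] by simp
    with eq show ?thesis
      unfolding Psi_ten_def ext_sel RA.dual_sel by (intro RA.dual_IsoI) simp_all
  qed
  show "Comp ?A (Psi_ten V V') (Psi_arr (TenA ?E p q)) = Comp ?A (TenA ?A (Psi_arr p) (Psi_arr q)) (Psi_ten W W')"
    if "p \<in> Hom ?E W V" "q \<in> Hom ?E W' V'" for p q W V W' V'
    using that
  proof (elim ext_HomE)
    fix f h assume [simp]: "p = (W, f, V)" "q = (W', h, V')"
      "is_equivariant W" "is_equivariant V" "is_equivariant W'" "is_equivariant V'"
      and fh: "f \<in> Hom C (fst W) (fst V)" "h \<in> Hom C (fst W') (fst V')"
    note [simp] = HomD[OF fh(1)] HomD[OF fh(2)]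
    show ?thesis
      by (auto simp: Psi_ten_def Psi_sel assoc_nat ten_collapse intro!: restrict_cong_on)
  qed
  show "Comp ?A (TenA ?A (Id ?A (Psi W)) (Psi_ten W' W''))
       (Comp ?A (Psi_ten W (TenO ?E W' W'')) (Psi_arr (Assoc ?E W W' W''))) =
     Comp ?A (Assoc ?A (Psi W) (Psi W') (Psi W''))
       (Comp ?A (TenA ?A (Psi_ten W W') (Id ?A (Psi W''))) (Psi_ten (TenO ?E W W') W''))"
    if "W \<in> Ob ?E" "W' \<in> Ob ?E" "W'' \<in> Ob ?E" for W W' W''
  proof -
    have [simp]: "is_equivariant W" "is_equivariant W'" "is_equivariant W''"
      using that by simp_all
    show ?thesis
      by (auto simp: Psi_ten_def Psi_sel RA.modfun_comp_sel pentagon intro!: restrict_cong_on)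
  qed
  show "Psi_one \<in> Iso ?A (Psi (Unit ?E)) (Unit ?A)"
    unfolding Psi_one_def ext_sel RA.dual_sel
    by (rule RA.dual_IsoI) (simp_all add: Psi_unit_natural)
  show "Comp ?A (LUnit ?A (Psi W)) (Comp ?A (TenA ?A Psi_one (Id ?A (Psi W))) (Psi_ten (Unit ?E) W)) =
      Psi_arr (LUnit ?E W)" if "W \<in> Ob ?E" for W
  proof -
    have [simp]: "is_equivariant W"
      using that by simp
    show ?thesis
      by (auto simp: Psi_ten_def Psi_one_def Psi_sel RA.modfun_comp_id_left lunit_ten intro!: restrict_cong_on)
  qed
  show "Comp ?A (RUnit ?A (Psi W)) (Comp ?A (TenA ?A (Id ?A (Psi W)) Psi_one) (Psi_ten W (Unit ?E))) =
      Psi_arr (RUnit ?E W)" if "W \<in> Ob ?E" for W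
  proof -
    have [simp]: "is_equivariant W"
      using that by simp
    show ?thesis
      by (auto simp: Psi_ten_def Psi_one_def Psi_sel RA.modfun_id_sel RA.modfun_comp_id_right triangle intro!: restrict_cong_on)
  qed
qed

end

theorem theorem3p5:
  fixes C :: "('o, 'm, 'k::{alg_closed_field, field_char_0}) moncat"
    and P :: "('g, 't) matched_pair_data"
    and D :: "('g, 't, 'o, 'm) crossed_action_data"
  assumes "matched_pair P"
    and "finite (carrier (grpG P))" and "finite (carrier (grpGam P))"
    and "fusion_category C"
    and "crossed_action C P D"
  shows "tensor_equivalent
     (modcat_data.dual_category C (crossed_data.bicrossed_product C P D)
        (crossed_data.bicrossed_module C P D))
     (crossed_data.crossed_extension C P D)"
proof -
  \<comment> \<open>Finiteness of both groups is what makes the sums over \<Gamma> and over G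
    \<times> \<Gamma> finite.\<close>
  have "finite_crossed_action C P D"
    using assms by (intro finite_crossed_action.intro finite_crossed_action_axioms.intro)
  from tensor_comparison.tensor_equivalence[OF finite_crossed_action.Psi_tensor_comparison[OF this]]
  show ?thesis .
qed

end
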